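(* For each integer $N\ge 1$ let $G_N$ be an $N\times N$ complex Ginibre random matrix. For any fixed $z\in\mathbb{C}$ with $|z|<1$, $$\frac{1}{\frac12\sqrt{\log N}}\left[\log|\det(G_N-z)|-\frac12 N(|z|^2-1)\right]\xrightarrow{\ d\ }N(0,1)\qquad\text{as }N\to\infty,$$ where $N(0,1)$ denotes the standard (real) Gaussian distribution and $\xrightarrow{d}$ denotes convergence in distribution.
   Context: A complex Ginibre random matrix $G_N$ is an $N\times N$ random matrix whose entries are i.i.d. and distributed as $N^{-1/2}Z$, where $Z$ is a standard complex Gaussian (density $\pi^{-1}e^{-|w|^2}$ with respect to Lebesgue measure on $\mathbb{C}$, so $\mathbb{E}|Z|^2=1$). Here $\det(G_N-z)$ means $\det(G_N-zI)$. *)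

theory Defs
  imports "HOL-Probability.Probability" "Jordan_Normal_Form.Determinant"
begin

definition std_complex_gaussian :: "complex measure" where
  "std_complex_gaussian = density lborel (\<lambda>w. ennreal (exp (- (cmod w)\<^sup>2) / pi))"

definition complex_ginibre :: "nat \<Rightarrow> 'a measure \<Rightarrow> ('a \<Rightarrow> complex mat) \<Rightarrow> bool" where
  "complex_ginibre N M G \<longleftrightarrow>
     prob_space M \<and>
     (\<forall>\<omega>\<in>space M. G \<omega> \<in> carrier_mat N N) \<and>
     prob_space.indep_vars M (\<lambda>_. borel) (\<lambda>ij \<omega>. G \<omega> $$ ij) ({..<N} \<times> {..<N}) \<and>
     (\<forall>i<N. \<forall>j<N. distr M borel (\<lambda>\<omega>. G \<omega> $$ (i, j)) =
        distr std_complex_gaussian borel (\<lambda>w. w / complex_of_real (sqrt (real N))))"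

text \<open>
  Since \<^term>\<open>ln 0 = (0::real)\<close>, the next variable is real valued also on the null event
  that the shifted matrix is singular. The value at \<open>N = 1\<close>, where the
  normalisation vanishes, is a junk value that does not affect the limit.
  The name \<open>det\<close> is qualified because HOL-Analysis has a
  determinant for matrices indexed by types.
\<close>
definition normalized_log_det :: "nat \<Rightarrow> complex \<Rightarrow> complex mat \<Rightarrow> real" where
  "normalized_log_det N z A =
     1 / (1 / 2 * sqrt (ln (real N))) *
       (ln (cmod (Determinant.det (A - z \<cdot>\<^sub>m 1\<^sub>m N))) - 1 / 2 * real N * ((cmod z)\<^sup>2 - 1))"

end

theory Submission
  imports Defs "HOL-Real_Asymp.Real_Asymp" "HOL-Complex_Analysis.Complex_Analysis" "HOL-Computational_Algebra.Polynomial"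
begin

text \<open>
  With \<open>G\<close> rescaled to have standard Gaussian entries and \<open>a = N \<bar>z\<bar>\<^sup>2\<close>, the characteristic function of
  \<open>log \<bar>det (G - w)\<bar>\<close> is the moment \<open>J(a) = E \<bar>det (G - w)\<bar>\<^bsup>2s\<^esup>\<close> for imaginary \<open>s\<close>, where \<open>\<bar>w\<bar>\<^sup>2 = a\<close>.
  Unitary rotations of the rows and columns peel off one dimension at a time and give a recursion for these
  moments in which the shift of one diagonal entry is a free variable \<open>y\<close>. The power series in \<open>y\<close> of the
  \<open>n\<close>-dimensional moment, multiplied by \<open>(y - a) ^ (n - 1)\<close>, is a finite combination of Kummer
  functions, so its coefficients are orthogonal to polynomials of low degree with respect to \<open>a ^ l\<close>.
  By Lagrange interpolation this identifies \<open>J(a)\<close> with the expectation of \<open>\<Prod> \<Gamma>(l + 1 + s) / l!\<close> over the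
  Charlier ensemble, that is \<open>N\<close> independent Poisson(\<open>a\<close>) points biased by the square of their Vandermonde
  determinant. Differentiation in \<open>a\<close> gives \<open>J' = s (J - err)\<close>, where \<open>err\<close> is bounded by the probability that no
  point of the ensemble is at \<open>0\<close>; for \<open>\<bar>z\<bar> < 1\<close> this is exponentially small. Hence \<open>J(a)\<close> is asymptotically
  \<open>e\<^bsup>s a\<^esup> J(0)\<close>, and \<open>J(0) = \<Prod> \<Gamma>(k + s) / \<Gamma>(k)\<close> is expanded by means of the Digamma function.
  The theorem follows from Levy's continuity theorem.
\<close>

section \<open>Lagrange interpolation and squared Vandermonde products\<close>

text \<open>Clearing the first column by a rotation of two rows also rotates the shift on the next
  diagonal entry and shrinks it by a ratio that depends on the column. Moments with equal shifts
  therefore do not satisfy a recursion among themselves; this is what forces the free variable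
  \<open>y\<close>. The recursion evaluates the smaller moment at \<open>y = a * b\<close>, where
  \<open>b\<close> is a Beta-type proportion with weight \<open>(1 - b) ^ n\<close>. There
  \<open>(y - a) ^ n\<close> is this weight up to a constant, so the factor that makes the series
  tractable is the one that the next integration supplies. At \<open>y = a\<close> the orthogonality
  relation is what integrates one point out of the ensemble, which is how moments and ensemble come
  to share a recursion. A purely imaginary \<open>s\<close> keeps all powers bounded by one, so
  every integral converges. The probability that none of \<open>N\<close> ensemble points is at
  \<open>0\<close> equals the probability that a Poisson variable of mean \<open>a\<close> is at
  least \<open>N\<close>; with \<open>a = N * \<bar>z\<bar>\<^sup>2\<close> and
  \<open>\<bar>z\<bar> < 1\<close> this is a large deviation. The variance comes from the product of
  Gamma values: the trigamma function summed over \<open>1, ..., N\<close> grows like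
  \<open>ln N\<close>.\<close>

lemma poly_eq_if_agree:
  fixes p q :: "'a::idom poly"
  assumes "finite A" "degree p < card A" "degree q < card A" "\<And>u. u \<in> A \<Longrightarrow> poly p u = poly q u"
  shows "p = q"
proof (rule ccontr)
  assume "p \<noteq> q"
  then have nz: "p - q \<noteq> 0" by simp
  have "A \<subseteq> {u. poly (p - q) u = 0}" using assms(4) by auto
  then have "card A \<le> card {u. poly (p - q) u = 0}"
    using poly_roots_finite[OF nz] by (intro card_mono) auto
  also have "\<dots> \<le> degree (p - q)" by (rule card_poly_roots_bound[OF nz])
  also have "\<dots> < card A" using assms(2,3) by (rule degree_diff_less)
  finally show False by simp
qed

lemma degree_prod_linear:
  fixes c :: "'i \<Rightarrow> 'a::idom"
  assumes "finite I"
  shows "degree (\<Prod>j\<in>I. [:c j, 1:]) = card I" and "coeff (\<Prod>j\<in>I. [:c j, 1:]) (card I) = 1"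
proof -
  show 1: "degree (\<Prod>j\<in>I. [:c j, 1:]) = card I"
    by (subst degree_prod_eq_sum_degree) auto
  have "lead_coeff (\<Prod>j\<in>I. [:c j, 1:]) = 1" by (simp add: lead_coeff_prod)
  then show "coeff (\<Prod>j\<in>I. [:c j, 1:]) (card I) = 1" by (simp add: 1)
qed

lemma coeff_prod_linear_pred:
  fixes c :: "'i \<Rightarrow> 'a::idom"
  assumes "finite I" "I \<noteq> {}"
  shows "coeff (\<Prod>j\<in>I. [:c j, 1:]) (card I - 1) = (\<Sum>j\<in>I. c j)"
  using assms
proof (induction I rule: finite_ne_induct)
  case (insert i I)
  obtain k where k: "card I = Suc k" using insert by (metis card_0_eq not0_implies_Suc)
  have "[:c i, 1:] * q = Polynomial.smult (c i) q + pCons 0 q" for q :: "'a poly" by simp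
  then show ?case using insert k degree_prod_linear(2)[of I c] by simp
qed auto

text \<open>Vieta's formula for the second elementary symmetric polynomial, written through power
  sums so that it can be evaluated for translated nodes. The factor \<open>2\<close> on the left
  avoids a division.\<close>

lemma coeff_prod_linear_pred2:
  fixes c :: "'i \<Rightarrow> 'a::idom"
  assumes "finite I" "card I \<ge> 2"
  shows "2 * coeff (\<Prod>j\<in>I. [:c j, 1:]) (card I - 2) = (\<Sum>j\<in>I. c j)\<^sup>2 - (\<Sum>j\<in>I. (c j)\<^sup>2)"
  using assms
proof (induction I rule: finite_induct)
  case (insert i I)
  have sp: "[:c i, 1:] * q = Polynomial.smult (c i) q + pCons 0 q" for q :: "'a poly" by simp
  obtain k where k: "card I = Suc k" using insert by (cases "card I") auto
  have ne: "I \<noteq> {}" using k by auto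
  have c1: "coeff (\<Prod>j\<in>I. [:c j, 1:]) k = (\<Sum>j\<in>I. c j)"
    using coeff_prod_linear_pred[OF insert(1) ne, of c] k by simp
  show ?case
  proof (cases k)
    case 0
    then obtain j where "I = {j}" using k by (metis One_nat_def card_1_singletonE)
    then show ?thesis using insert by (simp add: power2_eq_square algebra_simps)
  next
    case (Suc k')
    then have "2 * coeff (\<Prod>j\<in>I. [:c j, 1:]) k' = (\<Sum>j\<in>I. c j)\<^sup>2 - (\<Sum>j\<in>I. (c j)\<^sup>2)"
      using insert k by simp
    then show ?thesis using insert k Suc c1
      by (simp add: sp power2_eq_square algebra_simps)
  qed
qed auto

text \<open>Both sides are the top coefficient of the interpolation polynomial through the nodes
  \<open>A\<close>: below degree \<open>card A\<close> it coincides with \<open>p\<close>, and its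
  basis polynomials are monic before normalisation.\<close>

lemma lagrange_sum:
  fixes p :: "'a::field poly"
  assumes fin: "finite A" and deg: "degree p < card A"
  shows "(\<Sum>u\<in>A. poly p u / (\<Prod>v\<in>A - {u}. (u - v))) = coeff p (card A - 1)"
proof -
  define L where "L u = (\<Prod>v\<in>A - {u}. [:- v, 1:])" for u
  have cA: "card A > 0" using deg by simp
  have cu: "card (A - {u}) = card A - 1" if "u \<in> A" for u using that fin by simp
  have dL: "degree (L u) = card A - 1" "coeff (L u) (card A - 1) = 1" if "u \<in> A" for u
    using degree_prod_linear[of "A - {u}" "\<lambda>v. - v"] fin cu[OF that] by (simp_all add: L_def)
  have pL: "poly (L u) w = (\<Prod>v\<in>A - {u}. (w - v))" for u w
    by (simp add: L_def poly_prod)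
  define q where "q = (\<Sum>u\<in>A. Polynomial.smult (poly p u / (\<Prod>v\<in>A - {u}. (u - v))) (L u))"
  have "p = q"
  proof (rule poly_eq_if_agree[OF fin deg])
    have "degree q \<le> card A - 1"
      unfolding q_def using dL(1) by (intro degree_sum_le[OF fin]) (metis degree_smult_le)
    then show "degree q < card A" using cA by simp
    fix w assume w: "w \<in> A"
    have z: "poly (L u) w = 0" if "u \<in> A - {w}" for u
      using that w fin by (auto simp: pL intro!: prod_zero)
    have nz: "(\<Prod>v\<in>A - {w}. (w - v)) \<noteq> 0" using fin by auto
    have "poly q w = (\<Sum>u\<in>A. (poly p u / (\<Prod>v\<in>A - {u}. (u - v))) * poly (L u) w)"
      by (simp add: q_def poly_sum)
    also have "\<dots> = (poly p w / (\<Prod>v\<in>A - {w}. (w - v))) * poly (L w) w"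
      using z by (subst sum.remove[OF fin w]) simp
    also have "\<dots> = poly p w" using nz by (simp add: pL)
    finally show "poly p w = poly q w" by simp
  qed
  then have "coeff p (card A - 1) = coeff q (card A - 1)" by simp
  also have "\<dots> = (\<Sum>u\<in>A. poly p u / (\<Prod>v\<in>A - {u}. (u - v)))"
    using dL(2) by (simp add: q_def coeff_sum)
  finally show ?thesis by simp
qed

text \<open>Subtracting a multiple of the node polynomial, which vanishes on \<open>A\<close>,
  lowers the degree without changing any value. Its subleading coefficient is minus the sum of the
  nodes, whence the correction.\<close>

lemma lagrange_sum_card:
  fixes p :: "'a::field poly"
  assumes fin: "finite A" "A \<noteq> {}" and deg: "degree p \<le> card A"
  shows "(\<Sum>u\<in>A. poly p u / (\<Prod>v\<in>A - {u}. (u - v))) = coeff p (card A - 1) + coeff p (card A) * \<Sum>A"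
proof -
  define P where "P = (\<Prod>v\<in>A. [:- v, 1:])"
  have P: "degree P = card A" "coeff P (card A) = 1" "coeff P (card A - 1) = - \<Sum>A"
    using degree_prod_linear[OF fin(1), of "\<lambda>v. - v"] coeff_prod_linear_pred[OF fin, of "\<lambda>v. - v"]
    by (simp_all add: P_def sum_negf)
  define q where "q = p - Polynomial.smult (coeff p (card A)) P"
  have c0: "card A > 0" using fin by (simp add: card_gt_0_iff)
  have "degree q \<le> card A - 1"
  proof (rule degree_le, intro allI impI)
    fix i assume "card A - 1 < i"
    then consider "i = card A" | "i > card A" by linarith
    then show "coeff q i = 0"
      by cases (use P deg in \<open>auto simp: q_def coeff_eq_0\<close>)
  qed
  then have dq: "degree q < card A" using c0 by simp
  have "poly P u = 0" if "u \<in> A" for u using that fin by (auto simp: P_def poly_prod intro!: prod_zero)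
  then have "(\<Sum>u\<in>A. poly p u / (\<Prod>v\<in>A - {u}. (u - v))) = (\<Sum>u\<in>A. poly q u / (\<Prod>v\<in>A - {u}. (u - v)))"
    by (intro sum.cong) (auto simp: q_def)
  also have "\<dots> = coeff q (card A - 1)" by (rule lagrange_sum[OF fin(1) dq])
  also have "\<dots> = coeff p (card A - 1) + coeff p (card A) * \<Sum>A" by (simp add: q_def P del: One_nat_def)
  finally show ?thesis .
qed

text \<open>In the full product of \<open>u + 1 - v\<close> over all nodes the factor at
  \<open>v = u\<close> is one, so the numerators are values of a single monic polynomial. The sum of
  the nodes cancels between its subleading coefficient and the correction term.\<close>

lemma lagrange_shift_up:
  fixes A :: "'a::field set"
  assumes fin: "finite A" "A \<noteq> {}"
  shows "(\<Sum>u\<in>A. (\<Prod>v\<in>A - {u}. (u + 1 - v)) / (\<Prod>v\<in>A - {u}. (u - v))) = of_nat (card A)"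
proof -
  define p where "p = (\<Prod>v\<in>A. [:1 - v, 1:])"
  have P: "degree p = card A" "coeff p (card A) = 1" "coeff p (card A - 1) = of_nat (card A) - \<Sum>A"
    using degree_prod_linear[OF fin(1), of "\<lambda>v. 1 - v"] coeff_prod_linear_pred[OF fin, of "\<lambda>v. 1 - v"]
    by (simp_all add: p_def sum_subtractf)
  have "poly p u = (\<Prod>v\<in>A - {u}. (u + 1 - v))" if "u \<in> A" for u
    using that fin by (simp add: p_def poly_prod prod.remove[of A u] algebra_simps)
  then have "(\<Sum>u\<in>A. (\<Prod>v\<in>A - {u}. (u + 1 - v)) / (\<Prod>v\<in>A - {u}. (u - v)))
      = (\<Sum>u\<in>A. poly p u / (\<Prod>v\<in>A - {u}. (u - v)))" by simp
  also have "\<dots> = of_nat (card A)" by (subst lagrange_sum_card[OF fin]) (simp_all add: P del: One_nat_def)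
  finally show ?thesis .
qed

text \<open>The denominator \<open>u + 1\<close> is read as the difference to an additional node at
  \<open>- 1\<close>. Over the enlarged node set the sum is the leading coefficient
  \<open>1\<close>, and the new node itself contributes the product on the right.\<close>

lemma lagrange_shift_up_pole:
  fixes A :: "'a::field set"
  assumes fin: "finite A" and m: "- 1 \<notin> A"
  shows "(\<Sum>u\<in>A. (\<Prod>v\<in>A - {u}. (u + 1 - v)) / ((u + 1) * (\<Prod>v\<in>A - {u}. (u - v)))) = 1 - (\<Prod>u\<in>A. u / (u + 1))"
proof -
  define p where "p = (\<Prod>v\<in>A. [:1 - v, 1:])"
  have P: "degree p = card A" "coeff p (card A) = 1"
    using degree_prod_linear[OF fin(1), of "\<lambda>v. 1 - v"] by (simp_all add: p_def)
  let ?B = "insert (- 1) A"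
  have cB: "card ?B = Suc (card A)" using fin m by simp
  have "poly p u = (\<Prod>v\<in>A - {u}. (u + 1 - v))" if "u \<in> A" for u
    using that fin by (simp add: p_def poly_prod prod.remove[of A u] algebra_simps)
  moreover have "(\<Prod>v\<in>?B - {u}. (u - v)) = (u + 1) * (\<Prod>v\<in>A - {u}. (u - v))" if "u \<in> A" for u
  proof -
    have "?B - {u} = insert (- 1) (A - {u})" using m that by auto
    then show ?thesis using fin m by simp
  qed
  ultimately have eq: "(\<Sum>u\<in>A. (\<Prod>v\<in>A - {u}. (u + 1 - v)) / ((u + 1) * (\<Prod>v\<in>A - {u}. (u - v))))
      = (\<Sum>u\<in>A. poly p u / (\<Prod>v\<in>?B - {u}. (u - v)))" by simp
  have BA: "?B - {-1} = A" using m by auto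
  have pm: "poly p (- 1) = (\<Prod>v\<in>A. - v)" by (simp add: p_def poly_prod)
  have "(\<Sum>u\<in>?B. poly p u / (\<Prod>v\<in>?B - {u}. (u - v))) = 1"
    by (subst lagrange_sum) (use fin in \<open>simp_all add: cB P\<close>)
  then have "(\<Prod>v\<in>A. - v) / (\<Prod>v\<in>A. (- 1 - v)) + (\<Sum>u\<in>A. poly p u / (\<Prod>v\<in>?B - {u}. (u - v))) = 1"
    using fin m by (subst (asm) sum.insert) (auto simp: BA pm)
  moreover have "(\<Prod>v\<in>A. - v) / (\<Prod>v\<in>A. (- 1 - v)) = (\<Prod>u\<in>A. u / (u + 1))"
  proof -
    have "- u / (- 1 - u) = u / (u + 1)" for u :: 'a
    proof -
      have "- 1 - u = - (u + 1)" by simp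
      then show ?thesis by (metis minus_divide_divide)
    qed
    then show ?thesis by (simp add: prod_dividef[symmetric])
  qed
  ultimately show ?thesis unfolding eq by (simp add: eq_diff_eq add.commute)
qed

text \<open>At a node the polynomial with roots \<open>A\<close> vanishes, and the one with roots
  \<open>v + 1\<close> carries the factor \<open>- 1\<close> from \<open>v = u\<close>; their
  difference \<open>D\<close> thus takes the values of the shifted products. The extra factor
  \<open>u\<close> brings \<open>D\<close> back to degree \<open>card A\<close>, so two of its
  coefficients enter.\<close>

lemma lagrange_shift_down:
  fixes A :: "'a::field_char_0 set"
  assumes fin: "finite A" "A \<noteq> {}"
  shows "(\<Sum>u\<in>A. u * (\<Prod>v\<in>A - {u}. (u - 1 - v)) / (\<Prod>v\<in>A - {u}. (u - v)))
     = \<Sum>A - of_nat (card A * (card A - 1)) / 2"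
proof -
  let ?n = "card A"
  define p where "p = (\<Prod>v\<in>A. [:- v, 1:])"
  define q where "q = (\<Prod>v\<in>A. [:- 1 - v, 1:])"
  have n0: "?n > 0" using fin by (simp add: card_gt_0_iff)
  have P: "degree p = ?n" "coeff p ?n = 1" "coeff p (?n - 1) = - \<Sum>A"
    using degree_prod_linear[OF fin(1), of "\<lambda>v. - v"] coeff_prod_linear_pred[OF fin, of "\<lambda>v. - v"]
    by (simp_all add: p_def sum_negf)
  have Q: "degree q = ?n" "coeff q ?n = 1" "coeff q (?n - 1) = - of_nat ?n - \<Sum>A"
    using degree_prod_linear[OF fin(1), of "\<lambda>v. - 1 - v"] coeff_prod_linear_pred[OF fin, of "\<lambda>v. -1 - v"]
    by (simp_all add: q_def sum_subtractf)
  define D where "D = p - q"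
  have D1: "coeff D (?n - 1) = of_nat ?n" by (simp add: D_def P Q del: One_nat_def)
  have "degree D \<le> ?n - 1"
  proof (rule degree_le, intro allI impI)
    fix i assume "?n - 1 < i"
    then consider "i = ?n" | "i > ?n" by linarith
    then show "coeff D i = 0"
      by cases (use P Q in \<open>auto simp: D_def coeff_eq_0\<close>)
  qed
  then have dD: "degree (pCons 0 D) \<le> ?n" using n0
    by (metis Suc_le_mono Suc_pred' degree_pCons_le le_trans)
  have D2: "coeff (pCons 0 D) (?n - 1) = - of_nat (?n - 1) * \<Sum>A - of_nat (?n * (?n - 1)) / 2"
  proof (cases "?n \<ge> 2")
    case True
    have "2 * coeff D (?n - 2) = 2 * coeff p (?n - 2) - 2 * coeff q (?n - 2)" by (simp add: D_def algebra_simps)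
    also have "\<dots> = (\<Sum>v\<in>A. - v)\<^sup>2 - (\<Sum>v\<in>A. (- v)\<^sup>2) - ((\<Sum>v\<in>A. - 1 - v)\<^sup>2 - (\<Sum>v\<in>A. (- 1 - v)\<^sup>2))"
      unfolding p_def q_def using coeff_prod_linear_pred2[OF fin(1) True, of "\<lambda>v. - v"]
        coeff_prod_linear_pred2[OF fin(1) True, of "\<lambda>v. - 1 - v"] by simp
    also have "(\<Sum>v\<in>A. - v) = - \<Sum>A" by (simp add: sum_negf)
    also have "(\<Sum>v\<in>A. - 1 - v) = - of_nat ?n - \<Sum>A" by (simp add: sum_subtractf)
    also have "(\<Sum>v\<in>A. (- 1 - v)\<^sup>2) = of_nat ?n + 2 * \<Sum>A + (\<Sum>v\<in>A. v\<^sup>2)"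
      by (simp add: power2_eq_square algebra_simps sum.distrib sum_distrib_left)
    finally have e: "2 * coeff D (?n - 2) = of_nat ?n + 2 * \<Sum>A - of_nat ?n * of_nat ?n - 2 * of_nat ?n * \<Sum>A"
      by (simp add: power2_eq_square algebra_simps)
    obtain k where k: "?n = Suc (Suc k)" using True by (metis Suc_le_D numeral_2_eq_2 Suc_le_mono)
    have "coeff (pCons 0 D) (?n - 1) = coeff D (?n - 2)" using k by simp
    also have "\<dots> = (of_nat ?n + 2 * \<Sum>A - of_nat ?n * of_nat ?n - 2 * of_nat ?n * \<Sum>A) / 2"
      by (subst e[symmetric]) simp
    also have "\<dots> = - of_nat (?n - 1) * \<Sum>A - of_nat (?n * (?n - 1)) / 2"
      using k by (simp add: field_simps)
    finally show ?thesis .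
  next
    case False
    then have "?n = 1" using n0 by simp
    then show ?thesis by simp
  qed
  have D3: "coeff (pCons 0 D) ?n = of_nat ?n" using D1 n0 by (cases ?n) auto
  have "poly D u = (\<Prod>v\<in>A - {u}. (u - 1 - v))" if "u \<in> A" for u
  proof -
    have "poly p u = 0" using that fin by (auto simp: p_def poly_prod intro!: prod_zero)
    then show ?thesis using that fin by (simp add: D_def q_def poly_prod prod.remove[of A u] algebra_simps)
  qed
  then have "(\<Sum>u\<in>A. u * (\<Prod>v\<in>A - {u}. (u - 1 - v)) / (\<Prod>v\<in>A - {u}. (u - v)))
      = (\<Sum>u\<in>A. poly (pCons 0 D) u / (\<Prod>v\<in>A - {u}. (u - v)))" by simp
  also have "\<dots> = - of_nat (?n - 1) * \<Sum>A - of_nat (?n * (?n - 1)) / 2 + of_nat ?n * \<Sum>A"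
    by (subst lagrange_sum_card[OF fin dD]) (simp only: D2 D3)
  also have "\<dots> = \<Sum>A - of_nat (?n * (?n - 1)) / 2"
    using n0 by (cases ?n) (simp_all add: algebra_simps)
  finally show ?thesis .
qed

section \<open>Squared Vandermonde products and their shift identities\<close>

text \<open>The product runs over ordered pairs, so this is the square of the Vandermonde determinant.\<close>
definition vdm :: "'i set \<Rightarrow> ('i \<Rightarrow> nat) \<Rightarrow> real" where
  "vdm I l = (\<Prod>i\<in>I. \<Prod>j\<in>I - {i}. \<bar>real (l i) - real (l j)\<bar>)"

lemma vdm_nonneg: "vdm I l \<ge> 0"
  by (simp add: vdm_def prod_nonneg)

lemma vdm_cong: "(\<And>i. i \<in> I \<Longrightarrow> l i = l' i) \<Longrightarrow> vdm I l = vdm I l'"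
  unfolding vdm_def by (intro prod.cong) auto

text \<open>Every pair containing \<open>i\<close> occurs in both orders, so the factor split off is
  a square and the absolute values disappear.\<close>

lemma vdm_remove:
  assumes "finite I" "i \<in> I"
  shows "vdm I l = vdm (I - {i}) l * (\<Prod>j\<in>I - {i}. (real (l i) - real (l j))\<^sup>2)"
proof -
  have "vdm I l = (\<Prod>j\<in>I - {i}. \<bar>real (l i) - real (l j)\<bar>) * (\<Prod>k\<in>I - {i}. \<Prod>j\<in>I - {k}. \<bar>real (l k) - real (l j)\<bar>)"
    unfolding vdm_def using assms by (subst prod.remove[of I i]) auto
  also have "(\<Prod>k\<in>I - {i}. \<Prod>j\<in>I - {k}. \<bar>real (l k) - real (l j)\<bar>)
    = (\<Prod>k\<in>I - {i}. \<bar>real (l k) - real (l i)\<bar> * (\<Prod>j\<in>I - {i} - {k}. \<bar>real (l k) - real (l j)\<bar>))"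
  proof (intro prod.cong refl)
    fix k assume "k \<in> I - {i}"
    then have "I - {k} - {i} = I - {i} - {k}" "i \<in> I - {k}" using assms by auto
    then show "(\<Prod>j\<in>I - {k}. \<bar>real (l k) - real (l j)\<bar>) = \<bar>real (l k) - real (l i)\<bar> * (\<Prod>j\<in>I - {i} - {k}. \<bar>real (l k) - real (l j)\<bar>)"
      using assms by (subst prod.remove[of "I - {k}" i]) auto
  qed
  also have "\<dots> = (\<Prod>k\<in>I - {i}. \<bar>real (l k) - real (l i)\<bar>) * vdm (I - {i}) l"
    by (simp add: prod.distrib vdm_def)
  also have "(\<Prod>k\<in>I - {i}. \<bar>real (l k) - real (l i)\<bar>) = (\<Prod>k\<in>I - {i}. \<bar>real (l i) - real (l k)\<bar>)"
    by (simp add: abs_minus_commute)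
  finally show ?thesis
    by (simp add: power2_eq_square prod.distrib[symmetric] mult_ac flip: abs_mult)
qed

text \<open>Both sides vanish unless \<open>l\<close> is injective on \<open>I\<close>, so Lagrange identities at the
  nodes \<open>l i\<close> can be multiplied by \<^const>\<open>vdm\<close> without a case distinction.\<close>
lemma vdm_lagrange:
  fixes l :: "'i \<Rightarrow> nat" and h :: "'i \<Rightarrow> complex"
  assumes fin: "finite I"
    and eq: "inj_on l I \<Longrightarrow> (\<Sum>i\<in>I. h i / (\<Prod>j\<in>I - {i}. (of_nat (l i) - of_nat (l j)))) = c"
  shows "(\<Sum>i\<in>I. of_real (vdm (I - {i}) l) * (\<Prod>j\<in>I - {i}. (of_nat (l i) - of_nat (l j))) * h i) = of_real (vdm I l) * c"
proof (cases "inj_on l I")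
  case True
  have "of_real (vdm (I - {i}) l) * (\<Prod>j\<in>I - {i}. (of_nat (l i) - of_nat (l j))) * h i
     = of_real (vdm I l) * (h i / (\<Prod>j\<in>I - {i}. (of_nat (l i) - of_nat (l j))))" if "i \<in> I" for i
  proof -
    have "(\<Prod>j\<in>I - {i}. (of_nat (l i) - of_nat (l j))) \<noteq> (0::complex)"
      using fin that True by (auto simp: inj_on_def)
    moreover have "complex_of_real (vdm I l) = of_real (vdm (I - {i}) l) * (\<Prod>j\<in>I - {i}. (of_nat (l i) - of_nat (l j)))\<^sup>2"
      by (simp add: vdm_remove[OF fin that] prod_power_distrib)
    ultimately show ?thesis
      by (simp add: power2_eq_square)
  qed
  then show ?thesis unfolding eq[OF True, symmetric] by (simp add: sum_distrib_left)
next
  case False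
  then obtain p q where pq: "p \<in> I" "q \<in> I" "p \<noteq> q" "l p = l q" by (auto simp: inj_on_def)
  have v0: "vdm J l = 0" if "p \<in> J" "q \<in> J" "finite J" for J
    unfolding vdm_def using that pq by (intro prod_zero bexI[of _ p] bexI[of _ q]) auto
  have "of_real (vdm (I - {i}) l) * (\<Prod>j\<in>I - {i}. (of_nat (l i) - of_nat (l j))) * h i = 0" if "i \<in> I" for i
  proof (cases "i = p \<or> i = q")
    case True
    then have "(\<Prod>j\<in>I - {i}. (of_nat (l i) - of_nat (l j))) = (0::complex)"
      using pq fin by (intro prod_zero bexI[of _ "if i = p then q else p"]) auto
    then show ?thesis by simp
  next
    case False
    then have "vdm (I - {i}) l = 0" using pq fin by (intro v0) auto
    then show ?thesis by simp
  qed
  then have "(\<Sum>i\<in>I. of_real (vdm (I - {i}) l) * (\<Prod>j\<in>I - {i}. (of_nat (l i) - of_nat (l j))) * h i) = 0"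
    by (intro sum.neutral ballI)
  then show ?thesis using v0[of I] pq fin by simp
qed

text \<open>The interpolation identities live on sets of nodes, the Vandermonde products on index
  sets; an injective configuration translates one into the other. The free \<open>f\<close> serves
  the plain and the shifted differences alike.\<close>

lemma image_nodes:
  fixes l :: "'i \<Rightarrow> nat" and I :: "'i set" and f :: "complex \<Rightarrow> complex \<Rightarrow> complex"
  assumes "inj_on l I" "finite I"
  defines "x \<equiv> \<lambda>i. (of_nat (l i) :: complex)"
  shows "inj_on x I" "i \<in> I \<Longrightarrow> (\<Prod>v\<in>x ` I - {x i}. f (x i) v) = (\<Prod>j\<in>I - {i}. f (x i) (x j))" "card (x ` I) = card I"
proof -
  show inj: "inj_on x I" using assms by (auto simp: inj_on_def)
  show "card (x ` I) = card I" by (rule card_image[OF inj])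
  assume i: "i \<in> I"
  have "x ` I - {x i} = x ` (I - {i})" using inj i by (auto simp: inj_on_def)
  then show "(\<Prod>v\<in>x ` I - {x i}. f (x i) v) = (\<Prod>j\<in>I - {i}. f (x i) (x j))"
    using inj by (simp add: prod.reindex inj_on_diff)
qed

text \<open>This is what lets one point be integrated out of the ensemble: in each summand the
  coordinate \<open>l i\<close> occurs only through \<open>p\<close> and through a monic polynomial
  of degree \<open>card I - 1\<close>, the form to which orthogonality applies.\<close>

lemma vdm_interpolation:
  fixes p :: "complex poly"
  assumes fin: "finite I" and deg: "degree p < card I"
  shows "(\<Sum>i\<in>I. of_real (vdm (I - {i}) l) * (\<Prod>j\<in>I - {i}. (of_nat (l i) - of_nat (l j))) * poly p (of_nat (l i)))
     = of_real (vdm I l) * coeff p (card I - 1)"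
proof (rule vdm_lagrange[OF fin])
  assume inj: "inj_on l I"
  note N = image_nodes[OF inj fin]
  show "(\<Sum>i\<in>I. poly p (of_nat (l i)) / (\<Prod>j\<in>I - {i}. (of_nat (l i) - of_nat (l j)))) = coeff p (card I - 1)"
    using lagrange_sum[of "(\<lambda>i. of_nat (l i)) ` I" p] fin deg N(3)
    by (simp add: sum.reindex[OF N(1)] N(2)[where f = "(-)"])
qed

text \<open>With \<open>V\<close> the Vandermonde determinant, whose square is \<open>vdm\<close>,
  the summand is \<open>V\<close> at \<open>l\<close> times \<open>V\<close> at the configuration
  with \<open>l i\<close> raised by one. The identity expresses the discrete harmonicity of
  \<open>V\<close>: its values at the raised configurations add up to
  \<open>card I * V\<close>.\<close>

lemma vdm_shift_up:
  assumes fin: "finite I"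
  shows "(\<Sum>i\<in>I. of_real (vdm (I - {i}) l) * (\<Prod>j\<in>I - {i}. (of_nat (l i) - of_nat (l j)))
            * (\<Prod>j\<in>I - {i}. (of_nat (l i) + 1 - of_nat (l j)))) = of_real (vdm I l) * (of_nat (card I) :: complex)"
proof (rule vdm_lagrange[OF fin])
  assume inj: "inj_on l I"
  note N = image_nodes[OF inj fin]
  show "(\<Sum>i\<in>I. (\<Prod>j\<in>I - {i}. (of_nat (l i) + 1 - of_nat (l j))) / (\<Prod>j\<in>I - {i}. (of_nat (l i) - of_nat (l j)))) = (of_nat (card I) :: complex)"
  proof (cases "I = {}")
    case False
    then show ?thesis
      using lagrange_shift_up[of "(\<lambda>i. of_nat (l i) :: complex) ` I"] fin N(3)
      by (simp add: sum.reindex[OF N(1)] N(2)[where f = "(-)"] N(2)[where f = "\<lambda>u v. u + 1 - v"])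
  qed auto
qed

text \<open>The harmonic sum with weights \<open>1 / (l i + 1)\<close>. The defect from
  \<open>1\<close> is a product that vanishes as soon as some point is at \<open>0\<close>; this is
  the source of the error term in the final differential equation.\<close>

lemma vdm_shift_up_pole:
  assumes fin: "finite I"
  shows "(\<Sum>i\<in>I. of_real (vdm (I - {i}) l) * (\<Prod>j\<in>I - {i}. (of_nat (l i) - of_nat (l j)))
            * ((\<Prod>j\<in>I - {i}. (of_nat (l i) + 1 - of_nat (l j))) / (of_nat (l i) + 1)))
     = of_real (vdm I l) * (1 - (\<Prod>i\<in>I. of_nat (l i) / (of_nat (l i) + 1)) :: complex)"
proof (rule vdm_lagrange[OF fin])
  assume inj: "inj_on l I"
  note N = image_nodes[OF inj fin]
  have "- 1 \<notin> (\<lambda>i. of_nat (l i) :: complex) ` I"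
  proof
    assume "- 1 \<in> (\<lambda>i. of_nat (l i) :: complex) ` I"
    then obtain i where "- 1 = (of_nat (l i) :: complex)" by auto
    then have "Re (- 1) = Re (of_nat (l i))" by metis
    then show False by simp
  qed
  then show "(\<Sum>i\<in>I. (\<Prod>j\<in>I - {i}. (of_nat (l i) + 1 - of_nat (l j))) / (of_nat (l i) + 1) / (\<Prod>j\<in>I - {i}. (of_nat (l i) - of_nat (l j))))
     = (1 - (\<Prod>i\<in>I. of_nat (l i) / (of_nat (l i) + 1)) :: complex)"
      using lagrange_shift_up_pole[of "(\<lambda>i. of_nat (l i) :: complex) ` I"] fin
      by (simp add: sum.reindex[OF N(1)] prod.reindex[OF N(1)] N(2)[where f = "(-)"] N(2)[where f = "\<lambda>u v. u + 1 - v"])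
qed

text \<open>The counterpart for lowered points, weighted by \<open>l i\<close>. It says that
  \<open>V\<close> is an eigenfunction of the difference operator summing \<open>l i\<close> times
  the decrement in \<open>l i\<close>; the eigenvalue \<open>card I * (card I - 1) / 2\<close> is
  the degree of \<open>V\<close>.\<close>

lemma vdm_shift_down:
  assumes fin: "finite I"
  shows "(\<Sum>i\<in>I. of_real (vdm (I - {i}) l) * (\<Prod>j\<in>I - {i}. (of_nat (l i) - of_nat (l j)))
            * (of_nat (l i) * (\<Prod>j\<in>I - {i}. (of_nat (l i) - 1 - of_nat (l j)))))
     = of_real (vdm I l) * ((\<Sum>i\<in>I. of_nat (l i)) - of_nat (card I * (card I - 1)) / 2 :: complex)"
proof (rule vdm_lagrange[OF fin])
  assume inj: "inj_on l I"
  note N = image_nodes[OF inj fin]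
  show "(\<Sum>i\<in>I. of_nat (l i) * (\<Prod>j\<in>I - {i}. (of_nat (l i) - 1 - of_nat (l j))) / (\<Prod>j\<in>I - {i}. (of_nat (l i) - of_nat (l j))))
      = ((\<Sum>i\<in>I. of_nat (l i)) - of_nat (card I * (card I - 1)) / 2 :: complex)"
  proof (cases "I = {}")
    case False
    then show ?thesis
      using lagrange_shift_down[of "(\<lambda>i. of_nat (l i) :: complex) ` I"] fin N(3)
      by (simp add: sum.reindex[OF N(1)] N(2)[where f = "(-)"] N(2)[where f = "\<lambda>u v. u - 1 - v"])
  qed auto
qed

section \<open>Products of Poisson distributions\<close>

lemma integrable_poisson:
  fixes f :: "nat \<Rightarrow> complex" and a :: real
  assumes a: "a > 0" and b: "\<And>k. norm (f k) \<le> C * K ^ k" and K: "K \<ge> 0"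
  shows "integrable (measure_pmf (poisson_pmf a)) f"
    and "(\<lambda>k. complex_of_real (exp (- a) * a ^ k / fact k) * f k) sums (\<integral>k. f k \<partial>measure_pmf (poisson_pmf a))"
proof -
  have C: "C \<ge> 0" using order_trans[OF norm_ge_zero b[of 0]] by simp
  have s: "summable (\<lambda>k. exp (- a) * C * ((a * K) ^ k /\<^sub>R fact k))"
    by (intro summable_mult summable_exp_generic)
  have sm: "summable (\<lambda>k. norm (pmf (poisson_pmf a) k *\<^sub>R f k))"
  proof (rule summable_comparison_test[OF _ s], intro exI allI impI)
    fix k
    have "norm (pmf (poisson_pmf a) k *\<^sub>R f k) = a ^ k / fact k * exp (- a) * norm (f k)" using a by simp
    also have "\<dots> \<le> a ^ k / fact k * exp (- a) * (C * K ^ k)"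
      using a b[of k] by (intro mult_left_mono) auto
    also have "\<dots> = exp (- a) * C * ((a * K) ^ k /\<^sub>R fact k)"
      by (simp add: power_mult_distrib field_simps)
    finally show "norm (norm (pmf (poisson_pmf a) k *\<^sub>R f k)) \<le> exp (- a) * C * ((a * K) ^ k /\<^sub>R fact k)" by simp
  qed
  have i: "integrable (count_space UNIV) (\<lambda>k. pmf (poisson_pmf a) k *\<^sub>R f k)"
    unfolding integrable_count_space_nat_iff by (rule sm)
  then show "integrable (measure_pmf (poisson_pmf a)) f"
    unfolding measure_pmf_eq_density by (subst integrable_density) (auto simp: pmf_nonneg)
  have "(\<integral>k. f k \<partial>measure_pmf (poisson_pmf a)) = (\<integral>k. pmf (poisson_pmf a) k *\<^sub>R f k \<partial>count_space UNIV)"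
    unfolding measure_pmf_eq_density by (subst integral_density) (auto simp: pmf_nonneg)
  then have "(\<lambda>k. pmf (poisson_pmf a) k *\<^sub>R f k) sums (\<integral>k. f k \<partial>measure_pmf (poisson_pmf a))"
    using sums_integral_count_space_nat[OF i] by simp
  then show "(\<lambda>k. complex_of_real (exp (- a) * a ^ k / fact k) * f k) sums (\<integral>k. f k \<partial>measure_pmf (poisson_pmf a))"
    using a by (simp add: scaleR_conv_of_real mult_ac)
qed

text \<open>Size bias of the Poisson law: the factor \<open>k\<close> cancels against
  \<open>k!\<close>, and reindexing moves it into a shift of the argument and a factor
  \<open>a\<close>.\<close>

lemma poisson_shift:
  fixes f :: "nat \<Rightarrow> complex" and a :: real
  assumes a: "a > 0" and b: "\<And>k. norm (f k) \<le> C * K ^ k" and K: "K \<ge> 0"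
  shows "(\<integral>k. of_nat k * f k \<partial>measure_pmf (poisson_pmf a)) = of_real a * (\<integral>k. f (Suc k) \<partial>measure_pmf (poisson_pmf a))"
proof -
  have C: "C \<ge> 0" using order_trans[OF norm_ge_zero b[of 0]] by simp
  \<comment> \<open>The factor \<open>k \<le> 2 ^ k\<close> is absorbed by doubling the growth
    rate.\<close>
  have 1: "norm (of_nat k * f k) \<le> C * (2 * K) ^ k" for k
  proof -
    have "norm (of_nat k * f k) = real k * norm (f k)" by (simp add: norm_mult)
    also have "\<dots> \<le> 2 ^ k * (C * K ^ k)"
      using b[of k] of_nat_less_two_power[of k, where 'a = real] by (intro mult_mono) auto
    finally show ?thesis by (simp add: power_mult_distrib mult_ac)
  qed
  have 2: "norm (f (Suc k)) \<le> (C * K) * K ^ k" for k using b[of "Suc k"] by (simp add: mult_ac)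
  have "(\<lambda>k. complex_of_real (exp (- a) * a ^ k / fact k) * (of_nat k * f k)) sums (\<integral>k. of_nat k * f k \<partial>measure_pmf (poisson_pmf a))"
    by (rule integrable_poisson(2)[OF a 1]) (use K in simp)
  then have "(\<lambda>k. complex_of_real (exp (- a) * a ^ Suc k / fact (Suc k)) * (of_nat (Suc k) * f (Suc k))) sums (\<integral>k. of_nat k * f k \<partial>measure_pmf (poisson_pmf a))"
    by (subst sums_Suc_iff) simp
  moreover have "of_real (exp (- a) * a ^ Suc k / fact (Suc k)) * (of_nat (Suc k) * f (Suc k)) = a * (of_real (exp (- a) * a ^ k / fact k) * f (Suc k))" for k
    by (simp add: field_simps del: of_nat_Suc)
  ultimately have "(\<lambda>k. of_real a * (of_real (exp (- a) * a ^ k / fact k) * f (Suc k))) sums (\<integral>k. of_nat k * f k \<partial>measure_pmf (poisson_pmf a))"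
    by simp
  moreover have "(\<lambda>k. of_real a * (of_real (exp (- a) * a ^ k / fact k) * f (Suc k))) sums (of_real a * (\<integral>k. f (Suc k) \<partial>measure_pmf (poisson_pmf a)))"
    by (intro sums_mult integrable_poisson(2)[OF a 2 K])
  ultimately show ?thesis by (rule sums_unique2)
qed

text \<open>Moving to rate one turns the dependence of the law on \<open>a\<close> into the explicit
  power \<open>a ^ k\<close>, so that expectations become power series in the rate.\<close>

lemma poisson_change_rate:
  fixes f :: "nat \<Rightarrow> complex" and a :: real
  assumes a: "a > 0" and b: "\<And>k. norm (f k) \<le> C * K ^ k" and K: "K \<ge> 0"
  shows "(\<integral>k. f k \<partial>measure_pmf (poisson_pmf a)) = of_real (exp (1 - a)) * (\<integral>k. of_real a ^ k * f k \<partial>measure_pmf (poisson_pmf 1))"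
proof -
  have 1: "norm (of_real a ^ k * f k) \<le> C * (a * K) ^ k" for k
    using mult_left_mono[OF b[of k], of "a ^ k"] a by (simp add: norm_mult norm_power power_mult_distrib mult_ac)
  have "(\<lambda>k. of_real (exp (1 - a)) * (of_real (exp (- 1) * 1 ^ k / fact k) * (of_real a ^ k * f k))) sums
     (of_real (exp (1 - a)) * (\<integral>k. of_real a ^ k * f k \<partial>measure_pmf (poisson_pmf 1)))"
  proof (intro sums_mult)
    have "0 < (1::real)" "0 \<le> a * K" using a K by auto
    from integrable_poisson(2)[OF this(1) 1 this(2)]
    show "(\<lambda>k. of_real (exp (- 1) * 1 ^ k / fact k) * (of_real a ^ k * f k)) sums (\<integral>k. of_real a ^ k * f k \<partial>measure_pmf (poisson_pmf 1))" .
  qed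
  moreover have "of_real (exp (1 - a)) * (of_real (exp (- 1) * 1 ^ k / fact k) * (of_real a ^ k * f k)) = of_real (exp (- a) * a ^ k / fact k) * f k" for k
  proof -
    have "exp (1 - a) * exp (- 1) = exp (- a)" by (simp add: exp_add[symmetric])
    then have "complex_of_real (exp (1 - a)) * of_real (exp (- 1)) = of_real (exp (- a))"
      by (metis of_real_mult)
    then show ?thesis by (simp add: field_simps)
  qed
  ultimately have "(\<lambda>k. complex_of_real (exp (- a) * a ^ k / fact k) * f k) sums (of_real (exp (1 - a)) * (\<integral>k. of_real a ^ k * f k \<partial>measure_pmf (poisson_pmf 1)))"
    by (simp only:)
  then show ?thesis by (rule sums_unique2[OF integrable_poisson(2)[OF a b K]])
qed

text \<open>One class of integrands, closed under sums, products and shifts of a coordinate, that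
  settles all integrability questions for Poisson products. Requiring \<open>K \<ge> 1\<close> makes
  the bound monotone in the exponent, so growth in one coordinate counts as growth in the
  total.\<close>

definition expgrow :: "'i set \<Rightarrow> (('i \<Rightarrow> nat) \<Rightarrow> complex) \<Rightarrow> bool" where
  "expgrow I F \<longleftrightarrow> (\<exists>C K. C \<ge> 0 \<and> K \<ge> 1 \<and> (\<forall>l. norm (F l) \<le> C * K ^ (\<Sum>i\<in>I. l i)))"

lemma expgrowI:
  assumes "C \<ge> 0" "K \<ge> 1" "\<And>l. norm (F l) \<le> C * K ^ (\<Sum>i\<in>I. l i)"
  shows "expgrow I F"
  using assms unfolding expgrow_def by blast

lemma expgrow_const: "expgrow I (\<lambda>_. c)"
  by (rule expgrowI[of "norm c" 1]) auto

lemma expgrow_mult: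
  assumes "expgrow I F" "expgrow I G"
  shows "expgrow I (\<lambda>l. F l * G l)"
proof -
  obtain C K where 1: "C \<ge> 0" "K \<ge> 1" "\<And>l. norm (F l) \<le> C * K ^ (\<Sum>i\<in>I. l i)"
    using assms(1) unfolding expgrow_def by blast
  obtain D L where 2: "D \<ge> 0" "L \<ge> 1" "\<And>l. norm (G l) \<le> D * L ^ (\<Sum>i\<in>I. l i)"
    using assms(2) unfolding expgrow_def by blast
  show ?thesis
  proof (rule expgrowI[of "C * D" "K * L"])
    fix l
    have "norm (F l * G l) \<le> (C * K ^ (\<Sum>i\<in>I. l i)) * (D * L ^ (\<Sum>i\<in>I. l i))"
      unfolding norm_mult using 1 2 by (intro mult_mono) auto
    then show "norm (F l * G l) \<le> C * D * (K * L) ^ (\<Sum>i\<in>I. l i)"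
      by (simp add: power_mult_distrib mult_ac)
  qed (use 1 2 mult_mono[of 1 K 1 L] in auto)
qed

lemma expgrow_add:
  assumes "expgrow I F" "expgrow I G"
  shows "expgrow I (\<lambda>l. F l + G l)"
proof -
  obtain C K where 1: "C \<ge> 0" "K \<ge> 1" "\<And>l. norm (F l) \<le> C * K ^ (\<Sum>i\<in>I. l i)"
    using assms(1) unfolding expgrow_def by blast
  obtain D L where 2: "D \<ge> 0" "L \<ge> 1" "\<And>l. norm (G l) \<le> D * L ^ (\<Sum>i\<in>I. l i)"
    using assms(2) unfolding expgrow_def by blast
  show ?thesis
  proof (rule expgrowI[of "C + D" "K * L"])
    fix l :: "'a \<Rightarrow> nat"
    let ?S = "\<Sum>i\<in>I. l i"
    have "K ^ ?S \<le> (K * L) ^ ?S" "L ^ ?S \<le> (K * L) ^ ?S"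
      using 1 2 by (intro power_mono; simp add: mult_le_cancel_left1 mult_le_cancel_right1)+
    then have "C * K ^ ?S \<le> C * (K * L) ^ ?S" "D * L ^ ?S \<le> D * (K * L) ^ ?S"
      using 1 2 by (auto intro: mult_left_mono)
    then show "norm (F l + G l) \<le> (C + D) * (K * L) ^ ?S"
      using 1(3)[of l] 2(3)[of l] norm_triangle_ineq[of "F l" "G l"] by (simp add: distrib_right)
  qed (use 1 2 mult_mono[of 1 K 1 L] in auto)
qed

lemma expgrow_diff:
  assumes "expgrow I F" "expgrow I G"
  shows "expgrow I (\<lambda>l. F l - G l)"
  using expgrow_add[OF assms(1) expgrow_mult[OF expgrow_const[of I "-1"] assms(2)]] by simp

lemma expgrow_prod:
  assumes "\<And>x. x \<in> A \<Longrightarrow> expgrow I (F x)"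
  shows "expgrow I (\<lambda>l. \<Prod>x\<in>A. F x l)"
  using assms by (induction A rule: infinite_finite_induct) (simp_all add: expgrow_const expgrow_mult)

lemma expgrow_sum:
  assumes "\<And>x. x \<in> A \<Longrightarrow> expgrow I (F x)"
  shows "expgrow I (\<lambda>l. \<Sum>x\<in>A. F x l)"
  using assms by (induction A rule: infinite_finite_induct) (simp_all add: expgrow_const expgrow_add)

lemma expgrow_coord:
  assumes "finite I" "i \<in> I" "\<And>k. norm (f k) \<le> C * K ^ k" "K \<ge> 1"
  shows "expgrow I (\<lambda>l. f (l i))"
proof (rule expgrowI[of C K])
  show "C \<ge> 0" using order_trans[OF norm_ge_zero assms(3)[of 0]] by simp
  fix l :: "'a \<Rightarrow> nat"
  have "norm (f (l i)) \<le> C * K ^ l i" by (rule assms)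
  also have "\<dots> \<le> C * K ^ (\<Sum>i\<in>I. l i)"
    using assms \<open>C \<ge> 0\<close> by (intro mult_left_mono power_increasing member_le_sum) auto
  finally show "norm (f (l i)) \<le> C * K ^ (\<Sum>i\<in>I. l i)" .
qed (use assms in auto)

lemma expgrow_of_nat:
  assumes "finite I" "i \<in> I"
  shows "expgrow I (\<lambda>l. of_nat (l i))"
proof (rule expgrow_coord[of I i of_nat 1 2, OF assms])
  fix k show "norm (of_nat k :: complex) \<le> 1 * 2 ^ k"
    using of_nat_less_two_power[of k, where 'a = real] by simp
qed auto

lemma expgrow_upd_Suc:
  assumes "expgrow I F" "finite I" "i \<in> I"
  shows "expgrow I (\<lambda>l. F (l(i := Suc (l i))))"
proof -
  obtain C K where 1: "C \<ge> 0" "K \<ge> 1" "\<And>l. norm (F l) \<le> C * K ^ (\<Sum>i\<in>I. l i)"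
    using assms(1) unfolding expgrow_def by blast
  show ?thesis
  proof (rule expgrowI[of "C * K" K])
    fix l :: "'a \<Rightarrow> nat"
    have "(\<Sum>k\<in>I. (l(i := Suc (l i))) k) = Suc (\<Sum>k\<in>I. l k)"
      using assms by (simp add: sum.remove[of I i])
    then show "norm (F (l(i := Suc (l i)))) \<le> C * K * K ^ (\<Sum>i\<in>I. l i)"
      using 1(3)[of "l(i := Suc (l i))"] by (simp add: mult_ac)
  qed (use 1 in auto)
qed

abbreviation poisson_prod :: "'i set \<Rightarrow> real \<Rightarrow> ('i \<Rightarrow> nat) measure" where
  "poisson_prod I a \<equiv> PiM I (\<lambda>_. measure_pmf (poisson_pmf a))"

text \<open>A finite product of countable discrete spaces carries the discrete sigma-algebra, hence
  every function on it is measurable.\<close>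

lemma measurable_poisson_prod:
  fixes F :: "('i \<Rightarrow> nat) \<Rightarrow> 'b::topological_space"
  assumes "finite I"
  shows "F \<in> borel_measurable (poisson_prod I a)"
proof -
  have "sets (poisson_prod I a) = sets (PiM I (\<lambda>_. count_space (UNIV :: nat set)))"
    by (intro sets_PiM_cong) auto
  also have "PiM I (\<lambda>_. count_space (UNIV :: nat set)) = count_space (PiE I (\<lambda>_. UNIV))"
    using assms by (intro count_space_PiM_finite) auto
  finally have s: "sets (poisson_prod I a) = sets (count_space (PiE I (\<lambda>_. UNIV)))" .
  show ?thesis
    by (subst measurable_cong_sets[OF s refl]) simp
qed

lemma product_prob_space_poisson: "product_prob_space (\<lambda>_. measure_pmf (poisson_pmf a))"
  by (intro product_prob_spaceI measure_pmf.prob_space_axioms)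

lemma integrable_poisson_prod:
  assumes fin: "finite I" and a: "a > 0" and g: "expgrow I F"
  shows "integrable (poisson_prod I a) F"
proof -
  interpret P: product_prob_space "\<lambda>_. measure_pmf (poisson_pmf a)" by (rule product_prob_space_poisson)
  obtain C K where 1: "C \<ge> 0" "K \<ge> 1" "\<And>l. norm (F l) \<le> C * K ^ (\<Sum>i\<in>I. l i)"
    using g unfolding expgrow_def by blast
  have "integrable (measure_pmf (poisson_pmf a)) (\<lambda>k. complex_of_real K ^ k)"
    by (rule integrable_poisson(1)[of a _ 1 K]) (use a 1 in \<open>auto simp: norm_power\<close>)
  then have "integrable (poisson_prod I a) (\<lambda>l. of_real C * (\<Prod>i\<in>I. complex_of_real K ^ l i))"
    using fin by (intro integrable_mult_right P.product_integrable_prod) auto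
  then show ?thesis
  proof (rule Bochner_Integration.integrable_bound)
    show "F \<in> borel_measurable (poisson_prod I a)" by (rule measurable_poisson_prod[OF fin])
    show "AE l in poisson_prod I a. norm (F l) \<le> norm (of_real C * (\<Prod>i\<in>I. complex_of_real K ^ l i))"
      using 1 by (intro AE_I2) (simp add: norm_mult norm_power power_sum prod_norm[symmetric])
  qed
qed

lemma poisson_prod_insert:
  assumes fin: "finite I" and i: "i \<notin> I" and a: "a > 0" and g: "expgrow (insert i I) F"
  shows "(\<integral>l. F l \<partial>poisson_prod (insert i I) a) = (\<integral>l. (\<integral>k. F (l(i := k)) \<partial>measure_pmf (poisson_pmf a)) \<partial>poisson_prod I a)"
proof -
  interpret P: product_prob_space "\<lambda>_. measure_pmf (poisson_pmf a)" by (rule product_prob_space_poisson)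
  show ?thesis
    by (rule P.product_integral_insert[OF fin i integrable_poisson_prod]) (use assms in auto)
qed

lemma expgrow_section:
  assumes g: "expgrow (insert i I) F" and fin: "finite I" and i: "i \<notin> I"
  obtains C K where "K \<ge> 1" "C \<ge> 0" "\<And>l k. norm (F (l(i := k))) \<le> C * K ^ (\<Sum>j\<in>I. l j) * K ^ k"
proof -
  obtain C K where 1: "C \<ge> 0" "K \<ge> 1" "\<And>l. norm (F l) \<le> C * K ^ (\<Sum>i\<in>insert i I. l i)"
    using g unfolding expgrow_def by blast
  have "norm (F (l(i := k))) \<le> C * K ^ (\<Sum>j\<in>I. l j) * K ^ k" for l k
  proof -
    have "(\<Sum>j\<in>insert i I. (l(i := k)) j) = k + (\<Sum>j\<in>I. (l(i := k)) j)" using fin i by simp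
    also have "(\<Sum>j\<in>I. (l(i := k)) j) = (\<Sum>j\<in>I. l j)" using i by (intro sum.cong) auto
    finally show ?thesis using 1(3)[of "l(i := k)"] by (simp add: power_add mult_ac)
  qed
  with 1 that show ?thesis by blast
qed

lemma poisson_prod_shift:
  assumes fin: "finite I" and i: "i \<in> I" and a: "a > 0" and g: "expgrow I F"
  shows "(\<integral>l. of_nat (l i) * F l \<partial>poisson_prod I a) = of_real a * (\<integral>l. F (l(i := Suc (l i))) \<partial>poisson_prod I a)"
proof -
  obtain J where J: "I = insert i J" "i \<notin> J" using i by (metis mk_disjoint_insert)
  have finJ: "finite J" using fin J by simp
  obtain C K where K: "K \<ge> 1" "C \<ge> 0" "\<And>l k. norm (F (l(i := k))) \<le> C * K ^ (\<Sum>j\<in>J. l j) * K ^ k"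
    by (rule expgrow_section[OF g[unfolded J(1)] finJ J(2)]) (rule that)
  have "(\<integral>l. of_nat (l i) * F l \<partial>poisson_prod I a)
     = (\<integral>l. (\<integral>k. of_nat k * F (l(i := k)) \<partial>measure_pmf (poisson_pmf a)) \<partial>poisson_prod J a)"
    unfolding J(1) by (subst poisson_prod_insert[OF finJ J(2) a]) (use expgrow_mult[OF expgrow_of_nat g] fin J in auto)
  also have "\<dots> = (\<integral>l. of_real a * (\<integral>k. F (l(i := Suc k)) \<partial>measure_pmf (poisson_pmf a)) \<partial>poisson_prod J a)"
  proof -
    have "(\<integral>k. of_nat k * F (l(i := k)) \<partial>measure_pmf (poisson_pmf a)) = of_real a * (\<integral>k. F (l(i := Suc k)) \<partial>measure_pmf (poisson_pmf a))" for l
      by (rule poisson_shift[OF a K(3)]) (use K in auto)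
    then show ?thesis by simp
  qed
  also have "\<dots> = of_real a * (\<integral>l. (\<integral>k. F (l(i := Suc k)) \<partial>measure_pmf (poisson_pmf a)) \<partial>poisson_prod J a)"
    by simp
  also have "(\<integral>l. (\<integral>k. F (l(i := Suc k)) \<partial>measure_pmf (poisson_pmf a)) \<partial>poisson_prod J a)
     = (\<integral>l. F (l(i := Suc (l i))) \<partial>poisson_prod I a)"
    unfolding J(1) using expgrow_upd_Suc[OF g fin i] J by (subst poisson_prod_insert[OF finJ J(2) a]) auto
  finally show ?thesis .
qed

lemma poisson_prod_change_rate:
  fixes F :: "('i \<Rightarrow> nat) \<Rightarrow> complex" and a :: real
  assumes fin: "finite I" and a: "a > 0" and g: "expgrow I F"
  shows "(\<integral>l. F l \<partial>poisson_prod I a) = of_real (exp ((1 - a) * card I)) * (\<integral>l. of_real a ^ (\<Sum>i\<in>I. l i) * F l \<partial>poisson_prod I 1)"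
  using fin g
proof (induction I arbitrary: F rule: finite_induct)
  case empty
  then show ?case by (simp add: PiM_empty)
next
  case (insert i I)
  obtain C K where K: "K \<ge> 1" "C \<ge> 0" "\<And>l k. norm (F (l(i := k))) \<le> C * K ^ (\<Sum>j\<in>I. l j) * K ^ k"
    by (rule expgrow_section[OF insert(4,1,2)]) (rule that)
  have ga: "expgrow (insert i I) (\<lambda>l. of_real a ^ (\<Sum>i\<in>insert i I. l i) * F l)"
  proof (intro expgrow_mult insert)
    show "expgrow (insert i I) (\<lambda>l. complex_of_real a ^ (\<Sum>i\<in>insert i I. l i))"
      using a by (intro expgrowI[of 1 "max 1 a"]) (auto simp: norm_power intro!: power_mono)
  qed
  have ak: "norm (of_real a ^ k * F (l(i := k))) \<le> C * K ^ (\<Sum>j\<in>I. l j) * (a * K) ^ k" for l k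
    using mult_left_mono[OF K(3)[of l k], of "a ^ k"] a by (simp add: norm_mult norm_power power_mult_distrib mult_ac)
  \<comment> \<open>The induction hypothesis is applied to a partially integrated function, so
    exponential growth has to survive integration over one coordinate; the constant picks up the
    Poisson expectation of \<open>(a * K) ^ k\<close>.\<close>
  have gi: "expgrow I (\<lambda>l. \<integral>k. of_real a ^ k * F (l(i := k)) \<partial>measure_pmf (poisson_pmf 1))"
  proof (rule expgrowI[of "C * (\<integral>k. (a * K) ^ k \<partial>measure_pmf (poisson_pmf 1))" K])
    have ik: "integrable (measure_pmf (poisson_pmf 1)) (\<lambda>k. complex_of_real (a * K) ^ k)"
      by (rule integrable_poisson(1)[of 1 _ 1 "a * K"]) (use a K in \<open>auto simp: norm_power norm_mult\<close>)
    have ikr: "integrable (measure_pmf (poisson_pmf 1)) (\<lambda>k. (a * K) ^ k)"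
      using integrable_norm[OF ik] a K by (simp add: norm_power norm_mult)
    show "0 \<le> C * (\<integral>k. (a * K) ^ k \<partial>measure_pmf (poisson_pmf 1))"
      using a K by (intro mult_nonneg_nonneg integral_nonneg_AE) auto
    fix l :: "'i \<Rightarrow> nat"
    have "norm (\<integral>k. of_real a ^ k * F (l(i := k)) \<partial>measure_pmf (poisson_pmf 1))
       \<le> (\<integral>k. C * K ^ (\<Sum>j\<in>I. l j) * (a * K) ^ k \<partial>measure_pmf (poisson_pmf 1))"
    proof (rule order_trans[OF integral_norm_bound integral_mono])
      show "integrable (measure_pmf (poisson_pmf 1)) (\<lambda>k. norm (of_real a ^ k * F (l(i := k))))"
        by (intro integrable_norm integrable_poisson(1)[OF _ ak]) (use a K in auto)
    qed (use ak ikr in auto)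
    then show "norm (\<integral>k. of_real a ^ k * F (l(i := k)) \<partial>measure_pmf (poisson_pmf 1))
       \<le> C * (\<integral>k. (a * K) ^ k \<partial>measure_pmf (poisson_pmf 1)) * K ^ (\<Sum>j\<in>I. l j)"
      by (simp add: mult_ac)
  qed (use K in auto)
  have gi2: "expgrow I (\<lambda>l. \<integral>k. F (l(i := k)) \<partial>measure_pmf (poisson_pmf a))"
  proof -
    have "(\<integral>k. F (l(i := k)) \<partial>measure_pmf (poisson_pmf a)) = of_real (exp (1 - a)) * (\<integral>k. of_real a ^ k * F (l(i := k)) \<partial>measure_pmf (poisson_pmf 1))" for l
      by (rule poisson_change_rate[OF a K(3)]) (use K in auto)
    then show ?thesis using expgrow_mult[OF expgrow_const gi, of "of_real (exp (1 - a))"] by simp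
  qed
  have sm: "(\<Sum>j\<in>insert i I. (l(i := k)) j) = k + (\<Sum>j\<in>I. l j)" for l k
  proof -
    have "(\<Sum>j\<in>I. (l(i := k)) j) = (\<Sum>j\<in>I. l j)" using insert by (intro sum.cong) auto
    then show ?thesis using insert by simp
  qed
  have "(\<integral>l. F l \<partial>poisson_prod (insert i I) a) = (\<integral>l. (\<integral>k. F (l(i := k)) \<partial>measure_pmf (poisson_pmf a)) \<partial>poisson_prod I a)"
    by (rule poisson_prod_insert) (use insert a in auto)
  also have "\<dots> = of_real (exp ((1 - a) * card I)) * (\<integral>l. of_real a ^ (\<Sum>i\<in>I. l i) * (\<integral>k. F (l(i := k)) \<partial>measure_pmf (poisson_pmf a)) \<partial>poisson_prod I 1)"
    by (rule insert.IH[OF gi2])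
  also have "(\<lambda>l. \<integral>k. F (l(i := k)) \<partial>measure_pmf (poisson_pmf a)) = (\<lambda>l. of_real (exp (1 - a)) * (\<integral>k. of_real a ^ k * F (l(i := k)) \<partial>measure_pmf (poisson_pmf 1)))"
    by (rule ext, rule poisson_change_rate[OF a K(3)]) (use K in auto)
  also have "(\<integral>l. of_real a ^ (\<Sum>i\<in>I. l i) * (of_real (exp (1 - a)) * (\<integral>k. of_real a ^ k * F (l(i := k)) \<partial>measure_pmf (poisson_pmf 1))) \<partial>poisson_prod I 1)
     = of_real (exp (1 - a)) * (\<integral>l. (\<integral>k. of_real a ^ (\<Sum>j\<in>insert i I. (l(i := k)) j) * F (l(i := k)) \<partial>measure_pmf (poisson_pmf 1)) \<partial>poisson_prod I 1)"
    unfolding sm by (simp add: power_add mult_ac flip: integral_mult_right_zero)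
  also have "(\<integral>l. (\<integral>k. of_real a ^ (\<Sum>j\<in>insert i I. (l(i := k)) j) * F (l(i := k)) \<partial>measure_pmf (poisson_pmf 1)) \<partial>poisson_prod I 1)
     = (\<integral>l. of_real a ^ (\<Sum>i\<in>insert i I. l i) * F l \<partial>poisson_prod (insert i I) 1)"
    by (rule poisson_prod_insert[symmetric]) (use insert ga in auto)
  finally show ?case
    using insert by (simp add: exp_add[symmetric] algebra_simps flip: of_real_mult)
qed

section \<open>Power series in the Poisson rate and differentiation in it\<close>

text \<open>The expectation of \<open>F\<close> over the event that the coordinates add up to \<open>m\<close>:
  these are, up to normalisation, the Taylor coefficients in the rate.\<close>
definition level_coeff :: "'i set \<Rightarrow> (('i \<Rightarrow> nat) \<Rightarrow> complex) \<Rightarrow> nat \<Rightarrow> complex" where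
  "level_coeff I F m = (\<integral>l. (if (\<Sum>i\<in>I. l i) = m then F l else 0) \<partial>poisson_prod I 1)"

lemma expgrow_power_sum:
  assumes "finite I"
  shows "expgrow I (\<lambda>l. (z::complex) ^ (\<Sum>i\<in>I. l i))"
  by (rule expgrowI[of 1 "max 1 (norm z)"]) (auto simp: norm_power intro!: power_mono)

text \<open>For fixed \<open>l\<close> exactly one level contributes, so the partial sums of the
  moduli stay below a single integrable function, and sum and integral may be exchanged for every
  complex \<open>z\<close>.\<close>

lemma level_coeff_sums:
  assumes fin: "finite I" and g: "expgrow I F"
  shows "(\<lambda>m. level_coeff I F m * z ^ m) sums (\<integral>l. z ^ (\<Sum>i\<in>I. l i) * F l \<partial>poisson_prod I 1)"
proof -
  let ?S = "\<lambda>l. \<Sum>i\<in>I. l i"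
  let ?f = "\<lambda>m l. if ?S l = m then z ^ m * F l else 0"
  have gz: "expgrow I (\<lambda>l. z ^ ?S l * F l)" by (intro expgrow_mult expgrow_power_sum fin g)
  have int: "integrable (poisson_prod I 1) (\<lambda>l. z ^ ?S l * F l)" by (rule integrable_poisson_prod[OF fin _ gz]) simp
  have intf: "integrable (poisson_prod I 1) (?f m)" for m
    by (rule Bochner_Integration.integrable_bound[OF int measurable_poisson_prod[OF fin]]) auto
  have sf: "(\<lambda>m. ?f m l) sums (z ^ ?S l * F l)" for l
    using sums_single[of "?S l" "\<lambda>m. z ^ m * F l"] by (simp add: eq_commute)
  have nf: "(\<lambda>m. norm (?f m l)) sums norm (z ^ ?S l * F l)" for l
    using sums_single[of "?S l" "\<lambda>m. norm (z ^ m * F l)"] by (simp add: eq_commute if_distrib cong: if_cong)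
  have sumn: "summable (\<lambda>m. \<integral>l. norm (?f m l) \<partial>poisson_prod I 1)"
  proof (rule bounded_imp_summable[of _ "\<integral>l. norm (z ^ ?S l * F l) \<partial>poisson_prod I 1"])
    fix n
    have "(\<Sum>m\<le>n. \<integral>l. norm (?f m l) \<partial>poisson_prod I 1) = (\<integral>l. (\<Sum>m\<le>n. norm (?f m l)) \<partial>poisson_prod I 1)"
      using intf by (subst Bochner_Integration.integral_sum) auto
    also have "\<dots> \<le> (\<integral>l. norm (z ^ ?S l * F l) \<partial>poisson_prod I 1)"
    proof (rule integral_mono)
      show "integrable (poisson_prod I 1) (\<lambda>l. \<Sum>m\<le>n. norm (?f m l))" using intf by auto
      show "integrable (poisson_prod I 1) (\<lambda>l. norm (z ^ ?S l * F l))" using int by auto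
      show "(\<Sum>m\<le>n. norm (?f m l)) \<le> norm (z ^ ?S l * F l)" for l
        using sum_le_suminf[OF sums_summable[OF nf[of l]], of "{..n}"] sums_unique[OF nf[of l]] by auto
    qed
    finally show "(\<Sum>m\<le>n. \<integral>l. norm (?f m l) \<partial>poisson_prod I 1) \<le> (\<integral>l. norm (z ^ ?S l * F l) \<partial>poisson_prod I 1)" .
  qed auto
  have "(\<lambda>m. \<integral>l. ?f m l \<partial>poisson_prod I 1) sums (\<integral>l. (\<Sum>m. ?f m l) \<partial>poisson_prod I 1)"
    by (rule sums_integral[OF intf _ sumn]) (use nf in \<open>auto simp: sums_iff\<close>)
  moreover have "(\<integral>l. ?f m l \<partial>poisson_prod I 1) = level_coeff I F m * z ^ m" for m
  proof -
    have "(\<lambda>l. ?f m l) = (\<lambda>l. z ^ m * (if ?S l = m then F l else 0))" by auto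
    then show ?thesis by (simp add: level_coeff_def mult.commute)
  qed
  moreover have "(\<Sum>m. ?f m l) = z ^ ?S l * F l" for l using sf[of l] by (simp add: sums_iff)
  ultimately show ?thesis by simp
qed

text \<open>After the change of rate the expectation is an exponential times an entire series in
  \<open>a\<close>. Termwise differentiation multiplies the coefficient of level \<open>m\<close> by
  \<open>m\<close>, which on that level is the total of the coordinates; the exponential contributes
  the subtracted term.\<close>

lemma poisson_prod_has_derivative:
  assumes fin: "finite I" and a: "a > 0" and g: "expgrow I F"
  shows "((\<lambda>a. \<integral>l. F l \<partial>poisson_prod I a) has_vector_derivative
     ((1 / of_real a) * (\<integral>l. F l * of_nat (\<Sum>i\<in>I. l i) \<partial>poisson_prod I a) - of_nat (card I) * (\<integral>l. F l \<partial>poisson_prod I a))) (at a)"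
proof -
  let ?S = "\<lambda>l. \<Sum>i\<in>I. l i"
  define c where "c = level_coeff I F"
  define H where "H z = (\<Sum>m. c m * z ^ m)" for z
  have sumc: "summable (\<lambda>m. c m * z ^ m)" for z
    using level_coeff_sums[OF fin g, of z] by (simp add: c_def sums_iff)
  have Heq: "H z = (\<integral>l. z ^ ?S l * F l \<partial>poisson_prod I 1)" for z
    using level_coeff_sums[OF fin g, of z] by (simp add: c_def H_def sums_iff)
  have HD: "(H has_field_derivative (\<Sum>m. diffs c m * z ^ m)) (at z)" for z
    unfolding H_def by (rule termdiffs_strong_converges_everywhere[OF sumc])
  have gS: "expgrow I (\<lambda>l. F l * of_nat (?S l))"
    unfolding of_nat_sum by (intro expgrow_mult expgrow_sum expgrow_of_nat fin g)
  have "level_coeff I (\<lambda>l. F l * of_nat (?S l)) m = of_nat m * c m" for m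
  proof -
    have "(\<lambda>l. if ?S l = m then F l * of_nat (?S l) else 0) = (\<lambda>l. of_nat m * (if ?S l = m then F l else 0))" by auto
    then show ?thesis by (simp add: level_coeff_def c_def del: of_nat_sum)
  qed
  then have zD: "z * (\<Sum>m. diffs c m * z ^ m) = (\<integral>l. z ^ ?S l * (F l * of_nat (?S l)) \<partial>poisson_prod I 1)" for z
  proof -
    have "(\<lambda>m. of_nat m * c m * z ^ m) sums (\<integral>l. z ^ ?S l * (F l * of_nat (?S l)) \<partial>poisson_prod I 1)"
      using level_coeff_sums[OF fin gS, of z] \<open>\<And>m. level_coeff I (\<lambda>l. F l * of_nat (?S l)) m = of_nat m * c m\<close> by simp
    then have "(\<lambda>m. of_nat (Suc m) * c (Suc m) * z ^ Suc m) sums (\<integral>l. z ^ ?S l * (F l * of_nat (?S l)) \<partial>poisson_prod I 1)"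
      by (subst sums_Suc_iff) simp
    moreover have "(\<lambda>m. z * (diffs c m * z ^ m)) sums (z * (\<Sum>m. diffs c m * z ^ m))"
      by (intro sums_mult summable_sums termdiff_converges_all sumc)
    ultimately show ?thesis by (simp add: diffs_def sums_iff mult_ac)
  qed
  have "((\<lambda>x. H (of_real x)) has_vector_derivative (\<Sum>m. diffs c m * of_real a ^ m)) (at a)"
    by (rule has_vector_derivative_real_field[OF HD])
  moreover have "((\<lambda>x. complex_of_real (exp ((1 - x) * card I))) has_vector_derivative of_real (- real (card I) * exp ((1 - a) * card I))) (at a)"
    by (intro has_vector_derivative_of_real) (auto intro!: derivative_eq_intros simp flip: has_real_derivative_iff_has_vector_derivative)
  ultimately have "((\<lambda>x. of_real (exp ((1 - x) * card I)) * H (of_real x)) has_vector_derivative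
     (of_real (exp ((1 - a) * card I)) * (\<Sum>m. diffs c m * of_real a ^ m) + of_real (- real (card I) * exp ((1 - a) * card I)) * H (of_real a))) (at a)"
    by (rule has_vector_derivative_mult[rotated])
  moreover have "of_real (exp ((1 - a) * card I)) * (\<Sum>m. diffs c m * of_real a ^ m)
     = (1 / of_real a) * (\<integral>l. F l * of_nat (?S l) \<partial>poisson_prod I a)"
    using a by (simp add: poisson_prod_change_rate[OF fin a gS] zD[symmetric] del: of_nat_sum)
  moreover have eq: "of_real (exp ((1 - x) * card I)) * H (of_real x) = (\<integral>l. F l \<partial>poisson_prod I x)" if "x > 0" for x :: real
    by (simp add: poisson_prod_change_rate[OF fin that g] Heq)
  moreover have "of_real (- real (card I) * exp ((1 - a) * card I)) * H (of_real a) = - of_nat (card I) * (\<integral>l. F l \<partial>poisson_prod I a)"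
    unfolding eq[OF a, symmetric] by simp
  ultimately have "((\<lambda>x. of_real (exp ((1 - x) * card I)) * H (of_real x)) has_vector_derivative
     ((1 / of_real a) * (\<integral>l. F l * of_nat (\<Sum>i\<in>I. l i) \<partial>poisson_prod I a) - of_nat (card I) * (\<integral>l. F l \<partial>poisson_prod I a))) (at a)"
    by (simp only: mult_minus_left diff_conv_add_uminus)
  \<comment> \<open>The change of rate is available for positive rates, so the derivative is
    transferred along an open half-line.\<close>
  then show ?thesis
    by (rule has_vector_derivative_transform_within_open[of _ _ _ "{0<..}"]) (use a eq in auto)
qed

lemma expgrow_norm_le:
  assumes "expgrow I F" "\<And>l. norm (G l) \<le> norm (F l)"
  shows "expgrow I G"
  using assms unfolding expgrow_def by (meson order_trans)

lemma expgrow_vdm: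
  assumes "finite I" "J \<subseteq> I"
  shows "expgrow I (\<lambda>l. of_real (vdm J l))"
proof (rule expgrow_norm_le)
  show "expgrow I (\<lambda>l. \<Prod>i\<in>J. \<Prod>j\<in>J - {i}. (of_nat (l i) - of_nat (l j)))"
    using assms by (intro expgrow_prod expgrow_diff expgrow_of_nat) auto
  fix l :: "'a \<Rightarrow> nat"
  have "cmod (of_nat (l i) - of_nat (l j)) = \<bar>real (l i) - real (l j)\<bar>" for i j
    by (metis norm_of_real of_real_diff of_real_of_nat_eq)
  then show "norm (complex_of_real (vdm J l)) \<le> norm (\<Prod>i\<in>J. \<Prod>j\<in>J - {i}. (complex_of_nat (l i) - of_nat (l j)))"
    by (simp add: vdm_def prod_norm[symmetric] abs_prod)
qed

lemma of_nat_diff_Suc: "(of_nat (Suc m) :: complex) - 1 - z = of_nat m - z"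
  by simp

text \<open>The two groups of terms come from the shift identities for \<^const>\<open>vdm\<close>: the size bias of a
  Poisson variable turns the shift down by one into a shift up by one.\<close>
lemma vdm_expectation_has_derivative:
  fixes v :: "nat \<Rightarrow> complex" and I :: "'i set"
  assumes fin: "finite I" and a: "a > 0" and v: "\<And>k. norm (v k) \<le> C * K ^ k" and K: "K \<ge> 1"
  shows "((\<lambda>a. \<integral>l. of_real (vdm I l) * (\<Prod>i\<in>I. v (l i)) \<partial>poisson_prod I a) has_vector_derivative
     (of_nat (card I * (card I - 1)) / 2 / of_real a * (\<integral>l. of_real (vdm I l) * (\<Prod>i\<in>I. v (l i)) \<partial>poisson_prod I a)
       + (\<Sum>i\<in>I. \<integral>l. of_real (vdm (I - {i}) l) * (\<Prod>j\<in>I - {i}. (of_nat (l i) - of_nat (l j)))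
            * (\<Prod>j\<in>I - {i}. (of_nat (l i) + 1 - of_nat (l j))) * ((v (Suc (l i)) - v (l i)) * (\<Prod>j\<in>I - {i}. v (l j))) \<partial>poisson_prod I a))) (at a)"
proof -
  let ?E = "\<lambda>F. \<integral>l. F l \<partial>poisson_prod I a"
  let ?M = "of_nat (card I * (card I - 1)) / 2 :: complex"
  define V where "V l = (\<Prod>i\<in>I. v (l i))" for l :: "'i \<Rightarrow> nat"
  define P where "P i l = of_real (vdm (I - {i}) l) * (\<Prod>j\<in>I - {i}. (of_nat (l i) - of_nat (l j)) :: complex)" for i l
  define U where "U i l = P i l * (\<Prod>j\<in>I - {i}. (of_nat (l i) - 1 - of_nat (l j)))" for i l
  define U' where "U' i l = P i l * (\<Prod>j\<in>I - {i}. (of_nat (l i) + 1 - of_nat (l j)))" for i l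
  define F where "F l = of_real (vdm I l) * V l" for l
  define D where "D i l = (v (Suc (l i)) - v (l i)) * (\<Prod>j\<in>I - {i}. v (l j))" for i l
  have gv: "expgrow I (\<lambda>l. v (l i))" if "i \<in> I" for i by (rule expgrow_coord[OF fin that v K])
  have gvS: "expgrow I (\<lambda>l. v (Suc (l i)))" if "i \<in> I" for i
    by (rule expgrow_coord[OF fin that, of _ "C * K" K]) (use v[of "Suc _"] K in \<open>auto simp: mult_ac\<close>)
  have gV: "expgrow I V" unfolding V_def by (intro expgrow_prod gv)
  have gP: "expgrow I (P i)" if "i \<in> I" for i
    unfolding P_def using that by (intro expgrow_mult expgrow_vdm expgrow_prod expgrow_diff expgrow_of_nat fin) auto
  have gU: "expgrow I (U i)" if "i \<in> I" for i
    unfolding U_def using that by (intro expgrow_mult gP expgrow_prod expgrow_diff expgrow_const expgrow_of_nat fin) auto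
  have gU': "expgrow I (U' i)" if "i \<in> I" for i
    unfolding U'_def using that by (intro expgrow_mult gP expgrow_prod expgrow_diff expgrow_add expgrow_const expgrow_of_nat fin) auto
  have gF: "expgrow I F" unfolding F_def by (intro expgrow_mult expgrow_vdm gV fin) auto
  have gD: "expgrow I (D i)" if "i \<in> I" for i
    unfolding D_def using that by (intro expgrow_mult expgrow_diff expgrow_prod gv gvS) auto
  note int = integrable_poisson_prod[OF fin a]
  \<comment> \<open>\<open>vdm_shift_down\<close> replaces the total by its minimal value for
    distinct points, which is \<open>?M\<close>, plus terms carrying a factor \<open>l i\<close>
    ready for size biasing.\<close>
  have "F l * of_nat (\<Sum>i\<in>I. l i) = ?M * F l + (\<Sum>i\<in>I. of_nat (l i) * (U i l * V l))" for l
  proof -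
    have "(\<Sum>i\<in>I. P i l * (of_nat (l i) * (\<Prod>j\<in>I - {i}. (of_nat (l i) - 1 - of_nat (l j)))))
       = of_real (vdm I l) * ((\<Sum>i\<in>I. of_nat (l i)) - ?M)"
      unfolding P_def by (rule vdm_shift_down[OF fin])
    moreover have "(\<Sum>i\<in>I. of_nat (l i) * (U i l * V l)) = V l * (\<Sum>i\<in>I. P i l * (of_nat (l i) * (\<Prod>j\<in>I - {i}. (of_nat (l i) - 1 - of_nat (l j)))))"
      by (simp add: U_def sum_distrib_left mult_ac)
    ultimately show ?thesis by (simp only: F_def of_nat_sum) (simp add: algebra_simps)
  qed
  then have "?E (\<lambda>l. F l * of_nat (\<Sum>i\<in>I. l i)) = ?E (\<lambda>l. ?M * F l + (\<Sum>i\<in>I. of_nat (l i) * (U i l * V l)))"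
    by (simp only:)
  also have "\<dots> = ?M * ?E F + (\<Sum>i\<in>I. ?E (\<lambda>l. of_nat (l i) * (U i l * V l)))"
  proof -
    have g: "expgrow I (\<lambda>l. of_nat (l i) * (U i l * V l))" if "i \<in> I" for i
      by (intro expgrow_mult expgrow_of_nat fin gU gV that)
    have "?E (\<lambda>l. ?M * F l + (\<Sum>i\<in>I. of_nat (l i) * (U i l * V l))) = ?E (\<lambda>l. ?M * F l) + ?E (\<lambda>l. \<Sum>i\<in>I. of_nat (l i) * (U i l * V l))"
      by (rule Bochner_Integration.integral_add) (intro int expgrow_mult expgrow_const gF expgrow_sum g)+
    also have "?E (\<lambda>l. \<Sum>i\<in>I. of_nat (l i) * (U i l * V l)) = (\<Sum>i\<in>I. ?E (\<lambda>l. of_nat (l i) * (U i l * V l)))"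
      by (rule Bochner_Integration.integral_sum) (intro int g)
    finally show ?thesis by simp
  qed
  also have "(\<Sum>i\<in>I. ?E (\<lambda>l. of_nat (l i) * (U i l * V l))) = (\<Sum>i\<in>I. of_real a * (?E (\<lambda>l. U' i l * V l) + ?E (\<lambda>l. U' i l * D i l)))"
  proof (rule sum.cong[OF refl])
    fix i assume i: "i \<in> I"
    have "?E (\<lambda>l. of_nat (l i) * (U i l * V l)) = of_real a * ?E (\<lambda>l. U i (l(i := Suc (l i))) * V (l(i := Suc (l i))))"
      by (rule poisson_prod_shift[OF fin i a expgrow_mult[OF gU[OF i] gV]])
    also have "(\<lambda>l. U i (l(i := Suc (l i))) * V (l(i := Suc (l i)))) = (\<lambda>l. U' i l * V l + U' i l * D i l)"
    proof
      fix l
      have 1: "vdm (I - {i}) (l(i := Suc (l i))) = vdm (I - {i}) l" by (rule vdm_cong) auto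
      have 2: "(\<Prod>j\<in>I - {i}. f (of_nat ((l(i := Suc (l i))) j))) = (\<Prod>j\<in>I - {i}. f (of_nat (l j)))" for f :: "complex \<Rightarrow> complex"
        by (intro prod.cong) auto
      \<comment> \<open>Raising \<open>l i\<close> maps the two difference products of
        \<open>U\<close> onto those of \<open>U'\<close>: the plain product becomes the raised one,
        and the lowered product becomes plain.\<close>
      have 3: "U i (l(i := Suc (l i))) = U' i l"
        unfolding U_def U'_def P_def 1 fun_upd_same 2[of "\<lambda>x. _ - x"] of_nat_diff_Suc by (simp add: mult_ac add_ac)
      have "V (l(i := Suc (l i))) = v (Suc (l i)) * (\<Prod>j\<in>I - {i}. v (l j))"
        unfolding V_def using fin i by (subst prod.remove[of I i]) (auto intro!: prod.cong)
      moreover have "V l = v (l i) * (\<Prod>j\<in>I - {i}. v (l j))"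
        unfolding V_def using fin i by (subst prod.remove[of I i]) auto
      ultimately have 4: "V (l(i := Suc (l i))) = V l + D i l" by (simp add: D_def algebra_simps)
      show "U i (l(i := Suc (l i))) * V (l(i := Suc (l i))) = U' i l * V l + U' i l * D i l"
        unfolding 3 4 by (simp add: algebra_simps)
    qed
    also have "?E (\<lambda>l. U' i l * V l + U' i l * D i l) = ?E (\<lambda>l. U' i l * V l) + ?E (\<lambda>l. U' i l * D i l)"
      using i by (intro Bochner_Integration.integral_add int expgrow_mult gU' gV gD)
    finally show "?E (\<lambda>l. of_nat (l i) * (U i l * V l)) = of_real a * (?E (\<lambda>l. U' i l * V l) + ?E (\<lambda>l. U' i l * D i l))" .
  qed
  also have "\<dots> = of_real a * ((\<Sum>i\<in>I. ?E (\<lambda>l. U' i l * V l)) + (\<Sum>i\<in>I. ?E (\<lambda>l. U' i l * D i l)))"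
    by (simp add: sum_distrib_left sum.distrib distrib_left)
  \<comment> \<open>The part in which \<open>V\<close> keeps its old argument collapses by
    \<open>vdm_shift_up\<close>; its value cancels the term \<open>- card I\<close> in the
    derivative of a Poisson expectation.\<close>
  also have "(\<Sum>i\<in>I. ?E (\<lambda>l. U' i l * V l)) = ?E (\<lambda>l. (\<Sum>i\<in>I. U' i l * V l))"
    by (rule Bochner_Integration.integral_sum[symmetric]) (intro int expgrow_mult gU' gV)
  also have "(\<lambda>l. (\<Sum>i\<in>I. U' i l * V l)) = (\<lambda>l. of_nat (card I) * F l)"
  proof
    fix l
    have "(\<Sum>i\<in>I. U' i l) = of_real (vdm I l) * of_nat (card I)"
      unfolding U'_def P_def by (rule vdm_shift_up[OF fin])
    then show "(\<Sum>i\<in>I. U' i l * V l) = of_nat (card I) * F l" by (simp add: sum_distrib_right[symmetric] F_def)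
  qed
  also have "?E (\<lambda>l. of_nat (card I) * F l) = of_nat (card I) * ?E F" by simp
  finally have main: "?E (\<lambda>l. F l * of_nat (\<Sum>i\<in>I. l i)) = ?M * ?E F + of_real a * (of_nat (card I) * ?E F + (\<Sum>i\<in>I. ?E (\<lambda>l. U' i l * D i l)))" .
  have "((\<lambda>a. \<integral>l. F l \<partial>poisson_prod I a) has_vector_derivative
     ((1 / of_real a) * ?E (\<lambda>l. F l * of_nat (\<Sum>i\<in>I. l i)) - of_nat (card I) * ?E F)) (at a)"
    by (rule poisson_prod_has_derivative[OF fin a gF])
  also have "(1 / of_real a) * ?E (\<lambda>l. F l * of_nat (\<Sum>i\<in>I. l i)) - of_nat (card I) * ?E F
     = ?M / of_real a * ?E F + (\<Sum>i\<in>I. ?E (\<lambda>l. U' i l * D i l))"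
    unfolding main using a by (simp add: field_simps)
  finally show ?thesis by (simp add: F_def V_def U'_def P_def D_def)
qed

lemma expgrow_vdm_prod:
  assumes "finite I" "\<And>k. norm (v k) \<le> C * K ^ k" "K \<ge> 1"
  shows "expgrow I (\<lambda>l. of_real (vdm I l) * (\<Prod>i\<in>I. v (l i)))"
  using assms by (intro expgrow_mult expgrow_vdm expgrow_prod expgrow_coord[OF _ _ assms(2,3)]) auto

text \<open>The step hypothesis is the functional equation of
  \<open>\<Gamma>(k + 1 + s) / k!\<close>. Its increments carry the factor
  \<open>1 / (k + 1)\<close>, the pole of \<open>vdm_shift_up_pole\<close>. The \<open>1\<close> in
  that identity produces the growth rate \<open>s\<close>, and the product produces a term that sees
  only configurations without a point at \<open>0\<close>.\<close>

lemma vdm_expectation_has_derivative_linear: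
  fixes v :: "nat \<Rightarrow> complex" and I :: "'i set"
  assumes fin: "finite I" and a: "a > 0" and v: "\<And>k. norm (v k) \<le> 1"
    and step: "\<And>k. v (Suc k) = v k + v k * (s / (of_nat k + 1))"
  shows "((\<lambda>a. \<integral>l. of_real (vdm I l) * (\<Prod>i\<in>I. v (l i)) \<partial>poisson_prod I a) has_vector_derivative
     (of_nat (card I * (card I - 1)) / 2 / of_real a + s) * (\<integral>l. of_real (vdm I l) * (\<Prod>i\<in>I. v (l i)) \<partial>poisson_prod I a)
      - s * (\<integral>l. of_real (vdm I l) * (\<Prod>i\<in>I. v (l i) * (of_nat (l i) / (of_nat (l i) + 1))) \<partial>poisson_prod I a)) (at a)"
proof -
  let ?E = "\<lambda>F. \<integral>l. F l \<partial>poisson_prod I a"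
  let ?F = "\<lambda>l. of_real (vdm I l) * (\<Prod>i\<in>I. v (l i))"
  let ?G = "\<lambda>l. of_real (vdm I l) * (\<Prod>i\<in>I. v (l i) * (of_nat (l i) / (of_nat (l i) + 1)))"
  define T where "T i l = of_real (vdm (I - {i}) l) * (\<Prod>j\<in>I - {i}. (of_nat (l i) - of_nat (l j)))
            * (\<Prod>j\<in>I - {i}. (of_nat (l i) + 1 - of_nat (l j))) * ((v (Suc (l i)) - v (l i)) * (\<Prod>j\<in>I - {i}. v (l j)))" for i l
  have v': "norm (v k) \<le> 1 * 1 ^ k" for k using v by simp
  have le1: "norm (of_nat k / (of_nat k + 1) :: complex) \<le> 1" for k
  proof -
    have "norm (of_nat k + 1 :: complex) = real k + 1" by (metis norm_of_nat of_nat_Suc add.commute)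
    then show ?thesis by (simp add: norm_divide)
  qed
  have v'': "norm (v k * (of_nat k / (of_nat k + 1))) \<le> 1 * 1 ^ k" for k
    unfolding norm_mult using mult_mono[OF v[of k] le1[of k]] by simp
  have gv: "expgrow I (\<lambda>l. v (l i))" if "i \<in> I" for i by (rule expgrow_coord[OF fin that v']) simp
  have gvS: "expgrow I (\<lambda>l. v (Suc (l i)))" if "i \<in> I" for i
    by (rule expgrow_coord[OF fin that, of _ 1 1]) (use v in auto)
  have gT: "expgrow I (T i)" if "i \<in> I" for i
    unfolding T_def using that by (intro expgrow_mult expgrow_vdm expgrow_prod expgrow_diff expgrow_add expgrow_const expgrow_of_nat fin gv gvS) auto
  have "(\<Sum>i\<in>I. T i l) = s * (?F l - ?G l)" for l
  proof -
    define R where "R i = of_real (vdm (I - {i}) l) * (\<Prod>j\<in>I - {i}. (of_nat (l i) - of_nat (l j)))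
            * ((\<Prod>j\<in>I - {i}. (of_nat (l i) + 1 - of_nat (l j))) / (of_nat (l i) + 1) :: complex)" for i
    have "T i l = s * (\<Prod>i\<in>I. v (l i)) * R i" if "i \<in> I" for i
      using prod.remove[OF fin that, of "\<lambda>i. v (l i)"] by (simp add: T_def step R_def)
    then have "(\<Sum>i\<in>I. T i l) = s * (\<Prod>i\<in>I. v (l i)) * (\<Sum>i\<in>I. R i)"
      by (simp add: sum_distrib_left)
    also have "(\<Sum>i\<in>I. R i) = of_real (vdm I l) * (1 - (\<Prod>i\<in>I. of_nat (l i) / (of_nat (l i) + 1)))"
      unfolding R_def by (rule vdm_shift_up_pole[OF fin])
    finally show ?thesis by (simp only: prod.distrib right_diff_distrib) (simp add: mult_ac)
  qed
  then have "?E (\<lambda>l. \<Sum>i\<in>I. T i l) = s * (?E ?F - ?E ?G)"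
    using integrable_poisson_prod[OF fin a expgrow_vdm_prod[OF fin v']] integrable_poisson_prod[OF fin a expgrow_vdm_prod[OF fin v'']]
    by (simp del: of_nat_sum)
  moreover have "?E (\<lambda>l. \<Sum>i\<in>I. T i l) = (\<Sum>i\<in>I. ?E (T i))"
    by (rule Bochner_Integration.integral_sum) (intro integrable_poisson_prod fin a gT)
  ultimately have T: "(\<Sum>i\<in>I. ?E (T i)) = s * (?E ?F - ?E ?G)" by simp
  have "((\<lambda>a. \<integral>l. ?F l \<partial>poisson_prod I a) has_vector_derivative
     (of_nat (card I * (card I - 1)) / 2 / of_real a * ?E ?F + (\<Sum>i\<in>I. ?E (T i)))) (at a)"
    unfolding T_def by (rule vdm_expectation_has_derivative[OF fin a v']) simp
  then show ?thesis unfolding T by (simp only: distrib_right right_diff_distrib add_diff_eq)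
qed

lemma poisson_prod_shift_all:
  assumes fin: "finite I" and a: "a > 0" and g: "expgrow I F"
  shows "(\<integral>l. (\<Prod>i\<in>I. of_nat (l i)) * F l \<partial>poisson_prod I a) = of_real a ^ card I * (\<integral>l. F (\<lambda>i. if i \<in> I then Suc (l i) else l i) \<partial>poisson_prod I a)"
proof -
  \<comment> \<open>The set \<open>J\<close> of biased coordinates is separated from
    \<open>I\<close>, so that the induction over \<open>J\<close> leaves the measure
    unchanged.\<close>
  have "(\<integral>l. (\<Prod>i\<in>J. of_nat (l i)) * F l \<partial>poisson_prod I a) = of_real a ^ card J * (\<integral>l. F (\<lambda>i. if i \<in> J then Suc (l i) else l i) \<partial>poisson_prod I a)"
    if "finite J" "J \<subseteq> I" "expgrow I F" for J F
    using that
  proof (induction J arbitrary: F rule: finite_induct)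
    case (insert i J)
    have iI: "i \<in> I" using insert by simp
    have gJ: "expgrow I (\<lambda>l. (\<Prod>i\<in>J. of_nat (l i)) * F l)"
      using insert by (intro expgrow_mult expgrow_prod expgrow_of_nat fin) auto
    have "(\<integral>l. (\<Prod>i\<in>insert i J. of_nat (l i)) * F l \<partial>poisson_prod I a) = (\<integral>l. of_nat (l i) * ((\<Prod>i\<in>J. of_nat (l i)) * F l) \<partial>poisson_prod I a)"
      using insert by (simp add: mult_ac)
    also have "\<dots> = of_real a * (\<integral>l. (\<Prod>j\<in>J. of_nat ((l(i := Suc (l i))) j)) * F (l(i := Suc (l i))) \<partial>poisson_prod I a)"
      by (rule poisson_prod_shift[OF fin iI a gJ])
    also have "(\<lambda>l. (\<Prod>j\<in>J. complex_of_nat ((l(i := Suc (l i))) j)) * F (l(i := Suc (l i)))) = (\<lambda>l. (\<Prod>j\<in>J. of_nat (l j)) * F (l(i := Suc (l i))))"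
      using insert by (intro ext arg_cong2[where f = "(*)"] prod.cong) auto
    also have "(\<integral>l. (\<Prod>j\<in>J. of_nat (l j)) * F (l(i := Suc (l i))) \<partial>poisson_prod I a)
      = of_real a ^ card J * (\<integral>l. F ((\<lambda>k. if k \<in> J then Suc (l k) else l k)(i := Suc (if i \<in> J then Suc (l i) else l i))) \<partial>poisson_prod I a)"
      using insert by (intro insert.IH expgrow_upd_Suc fin) auto
    also have "(\<lambda>l. F ((\<lambda>k. if k \<in> J then Suc (l k) else l k)(i := Suc (if i \<in> J then Suc (l i) else l i)))) = (\<lambda>l. F (\<lambda>k. if k \<in> insert i J then Suc (l k) else l k))"
      using insert by (intro ext arg_cong[of _ _ F]) auto
    finally show ?case using insert by simp
  qed simp
  from this[OF fin subset_refl g] show ?thesis .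
qed

text \<open>Differences do not notice a common translation. Together with
  \<open>poisson_prod_shift_all\<close>, a product of all coordinates under the ensemble costs just
  a power of \<open>a\<close>.\<close>

lemma vdm_shift_all: "vdm I (\<lambda>i. if i \<in> I then Suc (l i) else l i) = vdm I l"
  unfolding vdm_def by (intro prod.cong refl) auto

section \<open>Kummer-type power series\<close>

text \<open>Taylor coefficients of \<open>\<Gamma>(1 + c) M(1 + c, 1, z)\<close>. The Gamma value
  stays inside because it is the moment of order \<open>l + c\<close> of the exponential law, the
  form in which these series arise.\<close>

definition kummer_coeff :: "complex \<Rightarrow> nat \<Rightarrow> complex" where
  "kummer_coeff c l = Gamma (of_nat l + 1 + c) / (fact l)\<^sup>2"

definition kummer :: "complex \<Rightarrow> complex \<Rightarrow> complex" where
  "kummer c z = (\<Sum>l. kummer_coeff c l * z ^ l)"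

definition kummer1 :: "complex \<Rightarrow> complex \<Rightarrow> complex" where
  "kummer1 c z = (\<Sum>l. diffs (kummer_coeff c) l * z ^ l)"

lemma not_nonpos_Int: "Re z > 0 \<Longrightarrow> z \<notin> \<int>\<^sub>\<le>\<^sub>0"
  by (auto elim!: nonpos_Ints_cases)

lemma kummer_coeff_Suc:
  assumes "Re c > -1"
  shows "(of_nat l + 1)\<^sup>2 * kummer_coeff c (Suc l) = (of_nat l + 1 + c) * kummer_coeff c l"
proof -
  have "Gamma (of_nat (Suc l) + 1 + c) = Gamma (of_nat l + 1 + c + 1)" by (simp add: add_ac)
  also have "\<dots> = (of_nat l + 1 + c) * Gamma (of_nat l + 1 + c)"
    by (rule Gamma_plus1) (use assms in \<open>auto intro!: not_nonpos_Int\<close>)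
  finally have G: "Gamma (of_nat (Suc l) + 1 + c) = (of_nat l + 1 + c) * Gamma (of_nat l + 1 + c)" .
  have "(fact (Suc l) :: complex) = (of_nat l + 1) * fact l" by (simp add: add_ac)
  moreover have "(of_nat l + 1 :: complex) \<noteq> 0" by (metis of_nat_Suc add.commute of_nat_eq_0_iff nat.simps(3))
  ultimately show ?thesis unfolding kummer_coeff_def G by (simp only: power_mult_distrib) simp
qed

text \<open>Decay faster than every geometric sequence, which amounts to an entire generating
  function. In this form the property passes at once through multiplication by polynomials and
  through shifts.\<close>

definition entire_seq :: "(nat \<Rightarrow> complex) \<Rightarrow> bool" where
  "entire_seq g \<longleftrightarrow> (\<forall>R>0. \<exists>C. \<forall>l. norm (g l) \<le> C * R ^ l)"

lemma entire_seqI: "(\<And>z. summable (\<lambda>l. g l * z ^ l)) \<Longrightarrow> entire_seq g"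
  unfolding entire_seq_def
proof (intro allI impI)
  fix R :: real assume sm: "\<And>z. summable (\<lambda>l. g l * z ^ l)" and R: "R > 0"
  have "Bseq (\<lambda>l. g l * of_real (1 / R) ^ l)"
    using summable_LIMSEQ_zero[OF sm, of "of_real (1 / R)"] by (intro convergent_imp_Bseq) (auto simp: convergent_def)
  then obtain C where C: "\<And>l. norm (g l * of_real (1 / R) ^ l) \<le> C" by (auto simp: Bseq_def)
  have "norm (g l) \<le> C * R ^ l" for l
    using C[of l] R by (simp add: norm_mult norm_power power_divide norm_divide field_simps)
  then show "\<exists>C. \<forall>l. norm (g l) \<le> C * R ^ l" by blast
qed

lemma entire_seq_summable_norm:
  assumes "entire_seq g"
  shows "summable (\<lambda>l. norm (g l) * x ^ l)"
proof -
  define R where "R = 1 / (2 * (\<bar>x\<bar> + 1))"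
  have R: "R > 0" by (simp add: R_def add_nonneg_pos)
  obtain C where C: "\<And>l. norm (g l) \<le> C * R ^ l" using assms R unfolding entire_seq_def by blast
  have Rx: "R * \<bar>x\<bar> < 1" by (simp add: R_def divide_simps)
  show ?thesis
  proof (rule summable_comparison_test)
    show "summable (\<lambda>l. C * (R * \<bar>x\<bar>) ^ l)" using R Rx by (intro summable_mult summable_geometric) simp
    show "\<exists>N. \<forall>l\<ge>N. norm (norm (g l) * x ^ l) \<le> C * (R * \<bar>x\<bar>) ^ l"
      using mult_right_mono[OF C] by (auto simp: norm_mult power_abs power_mult_distrib mult.assoc abs_mult)
  qed
qed

lemma entire_seq_summable:
  assumes "entire_seq g"
  shows "summable (\<lambda>l. g l * z ^ l)"
proof (rule summable_norm_cancel)
  show "summable (\<lambda>l. norm (g l * z ^ l))"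
    using entire_seq_summable_norm[OF assms, of "norm z"] by (simp add: norm_mult norm_power)
qed

lemma entire_seq_poly:
  assumes "entire_seq g"
  shows "entire_seq (\<lambda>l. poly p (of_nat l) * g l)"
  using assms
proof (induction p arbitrary: g)
  case 0
  then show ?case by (auto simp: entire_seq_def intro!: exI[of _ 0])
next
  case (pCons a p)
  have 1: "entire_seq (\<lambda>l. of_nat l * g l)"
    unfolding entire_seq_def
  proof (intro allI impI)
    fix R :: real assume "R > 0"
    \<comment> \<open>The bound is taken at \<open>R / 2\<close>; the spare factor
      \<open>2 ^ l\<close> pays for \<open>l\<close>.\<close>
    then obtain C where C: "\<And>l. norm (g l) \<le> C * (R / 2) ^ l" using pCons(3) unfolding entire_seq_def by (meson half_gt_zero)
    have "norm (of_nat l * g l) \<le> C * R ^ l" for l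
    proof -
      have "norm (of_nat l * g l) \<le> 2 ^ l * (C * (R / 2) ^ l)"
        unfolding norm_mult using C[of l] of_nat_less_two_power[of l, where 'a = real] by (intro mult_mono) auto
      then show ?thesis by (simp add: power_divide)
    qed
    then show "\<exists>C. \<forall>l. norm (of_nat l * g l) \<le> C * R ^ l" by blast
  qed
  show ?case unfolding entire_seq_def
  proof (intro allI impI)
    fix R :: real assume R: "R > 0"
    obtain C where C: "\<And>l. norm (g l) \<le> C * R ^ l" using pCons(3) R unfolding entire_seq_def by blast
    obtain D where D: "\<And>l. norm (poly p (of_nat l) * (of_nat l * g l)) \<le> D * R ^ l" using pCons.IH[OF 1] R unfolding entire_seq_def by blast
    have "norm (poly (pCons a p) (of_nat l) * g l) \<le> (norm a * C + D) * R ^ l" for l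
    proof -
      have "norm (poly (pCons a p) (of_nat l) * g l) = norm (a * g l + poly p (of_nat l) * (of_nat l * g l))"
        by (simp add: algebra_simps)
      also have "\<dots> \<le> norm a * norm (g l) + norm (poly p (of_nat l) * (of_nat l * g l))"
        by (metis norm_mult norm_triangle_ineq)
      also have "\<dots> \<le> norm a * (C * R ^ l) + D * R ^ l" using C D by (intro add_mono mult_left_mono) auto
      finally show ?thesis by (simp add: algebra_simps)
    qed
    then show "\<exists>C. \<forall>l. norm (poly (pCons a p) (of_nat l) * g l) \<le> C * R ^ l" by blast
  qed
qed

text \<open>Ratio test: by \<open>kummer_coeff_Suc\<close> the quotient of consecutive terms is of
  order \<open>1 / l\<close>, whatever \<open>z\<close> is.\<close>

lemma entire_seq_kummer_coeff:
  assumes c: "Re c > -1"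
  shows "entire_seq (kummer_coeff c)"
proof (rule entire_seqI)
  fix z :: complex
  have n1: "norm (of_nat l + 1 :: complex) = real l + 1" for l
    by (metis norm_of_nat of_nat_Suc add.commute)
  have step: "norm (kummer_coeff c (Suc l) * z ^ Suc l) = norm (of_nat l + 1 + c) * norm z / (real l + 1)\<^sup>2 * norm (kummer_coeff c l * z ^ l)" for l
  proof -
    have "(real l + 1)\<^sup>2 * norm (kummer_coeff c (Suc l)) = norm (of_nat l + 1 + c) * norm (kummer_coeff c l)"
      using arg_cong[OF kummer_coeff_Suc[OF c, of l], of norm] unfolding norm_mult norm_power n1 .
    then have "norm (kummer_coeff c (Suc l)) = norm (of_nat l + 1 + c) * norm (kummer_coeff c l) / (real l + 1)\<^sup>2"
      by (simp add: field_simps)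
    then show ?thesis by (simp add: norm_mult norm_power)
  qed
  have "(\<lambda>l. norm (of_nat l + 1 + c) * norm z / (real l + 1)\<^sup>2) \<longlonglongrightarrow> 0"
  proof (rule tendsto_sandwich[OF _ _ tendsto_const])
    show "eventually (\<lambda>l. norm (of_nat l + 1 + c) * norm z / (real l + 1)\<^sup>2 \<le> (real l + 1 + norm c) * norm z / (real l + 1)\<^sup>2) sequentially"
    proof (intro always_eventually allI divide_right_mono mult_right_mono)
      fix l
      show "norm (of_nat l + 1 + c) \<le> real l + 1 + norm c" using norm_triangle_ineq[of "of_nat l + 1" c] n1 by simp
    qed auto
    show "(\<lambda>l. (real l + 1 + norm c) * norm z / (real l + 1)\<^sup>2) \<longlonglongrightarrow> 0" by real_asymp
  qed auto
  then have "eventually (\<lambda>l. norm (of_nat l + 1 + c) * norm z / (real l + 1)\<^sup>2 < 1 / 2) sequentially"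
    by (rule order_tendstoD) simp
  then obtain N where N: "\<And>l. l \<ge> N \<Longrightarrow> norm (of_nat l + 1 + c) * norm z / (real l + 1)\<^sup>2 < 1 / 2"
    by (auto simp: eventually_sequentially)
  show "summable (\<lambda>l. kummer_coeff c l * z ^ l)"
  proof (rule summable_ratio_test[of "1 / 2" N])
    fix l assume "l \<ge> N"
    then show "norm (kummer_coeff c (Suc l) * z ^ Suc l) \<le> 1 / 2 * norm (kummer_coeff c l * z ^ l)"
      unfolding step using less_imp_le[OF N] by (intro mult_right_mono) auto
  qed simp
qed

lemma kummer_has_derivative:
  assumes "Re c > -1"
  shows "(kummer c has_field_derivative kummer1 c z) (at z)"
  unfolding kummer_def[abs_def] kummer1_def
  by (rule termdiffs_strong_converges_everywhere[OF entire_seq_summable[OF entire_seq_kummer_coeff[OF assms]]])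

text \<open>Kummer's equation for \<open>\<Gamma>(1+c) M(1+c, 1, z)\<close>.\<close>
lemma kummer1_has_derivative:
  assumes c: "Re c > -1"
  obtains w2 where "\<And>z. (kummer1 c has_field_derivative w2 z) (at z)"
    and "\<And>z. z * w2 z = (1 + c) * kummer c z - (1 - z) * kummer1 c z"
proof
  let ?w2 = "\<lambda>z. \<Sum>l. diffs (diffs (kummer_coeff c)) l * z ^ l"
  have s0: "summable (\<lambda>l. kummer_coeff c l * z ^ l)" for z by (rule entire_seq_summable[OF entire_seq_kummer_coeff[OF c]])
  have s1: "summable (\<lambda>l. diffs (kummer_coeff c) l * z ^ l)" for z by (rule termdiff_converges_all[OF s0])
  have s2: "summable (\<lambda>l. diffs (diffs (kummer_coeff c)) l * z ^ l)" for z by (rule termdiff_converges_all[OF s1])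
  show "(kummer1 c has_field_derivative ?w2 z) (at z)" for z
    unfolding kummer1_def[abs_def] by (rule termdiffs_strong_converges_everywhere[OF s1])
  fix z :: complex
  have a: "(\<lambda>l. of_nat l * diffs (kummer_coeff c) l * z ^ l) sums (z * ?w2 z)"
  proof -
    have "(\<lambda>l. z * (diffs (diffs (kummer_coeff c)) l * z ^ l)) sums (z * ?w2 z)" by (intro sums_mult summable_sums s2)
    then have "(\<lambda>l. of_nat (Suc l) * diffs (kummer_coeff c) (Suc l) * z ^ Suc l) sums (z * ?w2 z)"
      by (simp add: diffs_def mult_ac)
    then show ?thesis by (subst (asm) sums_Suc_iff) simp
  qed
  have b: "(\<lambda>l. of_nat l * kummer_coeff c l * z ^ l) sums (z * kummer1 c z)"
  proof -
    have "(\<lambda>l. z * (diffs (kummer_coeff c) l * z ^ l)) sums (z * kummer1 c z)" unfolding kummer1_def by (intro sums_mult summable_sums s1)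
    then have "(\<lambda>l. of_nat (Suc l) * kummer_coeff c (Suc l) * z ^ Suc l) sums (z * kummer1 c z)"
      by (simp add: diffs_def mult_ac)
    then show ?thesis by (subst (asm) sums_Suc_iff) simp
  qed
  have d: "(\<lambda>l. diffs (kummer_coeff c) l * z ^ l) sums kummer1 c z" unfolding kummer1_def by (intro summable_sums s1)
  have e: "(\<lambda>l. kummer_coeff c l * z ^ l) sums kummer c z" unfolding kummer_def by (intro summable_sums s0)
  have "(\<lambda>l. (1 + c) * (kummer_coeff c l * z ^ l) + of_nat l * kummer_coeff c l * z ^ l - diffs (kummer_coeff c) l * z ^ l) sums ((1 + c) * kummer c z + z * kummer1 c z - kummer1 c z)"
    by (intro sums_add sums_diff sums_mult b d e)
  moreover have "(1 + c) * (kummer_coeff c l * z ^ l) + of_nat l * kummer_coeff c l * z ^ l - diffs (kummer_coeff c) l * z ^ l = of_nat l * diffs (kummer_coeff c) l * z ^ l" for l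
  proof -
    have "(of_nat l + 1) * diffs (kummer_coeff c) l = (of_nat l + 1 + c) * kummer_coeff c l"
      using kummer_coeff_Suc[OF c, of l] by (simp add: diffs_def power2_eq_square mult_ac add_ac)
    then have "of_nat l * diffs (kummer_coeff c) l = (of_nat l + 1 + c) * kummer_coeff c l - diffs (kummer_coeff c) l" by (simp add: algebra_simps)
    then show ?thesis by (simp only:) (simp add: algebra_simps)
  qed
  ultimately have "(\<lambda>l. of_nat l * diffs (kummer_coeff c) l * z ^ l) sums ((1 + c) * kummer c z + z * kummer1 c z - kummer1 c z)"
    by (simp only:)
  then have "z * ?w2 z = (1 + c) * kummer c z + z * kummer1 c z - kummer1 c z" by (rule sums_unique2[OF a])
  then show "z * ?w2 z = (1 + c) * kummer c z - (1 - z) * kummer1 c z" by (simp add: algebra_simps)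
qed

text \<open>These integrals arise when the Kummer expansion of a smaller moment is inserted into the
  Beta integral over the proportion \<open>b\<close>; the corner shift is \<open>a * b\<close>
  there.\<close>

definition kummer_mom :: "real \<Rightarrow> complex \<Rightarrow> nat \<Rightarrow> complex" where
  "kummer_mom a c p = integral {0..1} (\<lambda>b. of_real b ^ p * (exp (- of_real (a * b)) * kummer c (of_real (a * b))))"

lemma continuous_on_kummer: "Re c > -1 \<Longrightarrow> continuous_on A (kummer c)"
  by (intro continuous_at_imp_continuous_on ballI DERIV_isCont[OF kummer_has_derivative])

lemma kummer_mom_integrable:
  assumes "Re c > -1"
  shows "(\<lambda>b. of_real b ^ p * (exp (- of_real (a * b)) * kummer c (of_real (a * b)))) integrable_on {0..1::real}"
  by (intro integrable_continuous_interval continuous_intros continuous_on_compose2[OF continuous_on_kummer[OF assms, of UNIV]]) auto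

text \<open>The derivative of a suitable combination of \<open>kummer\<close> and
  \<open>kummer1\<close> is integrated over the unit interval; Kummer's equation removes the second
  derivative, and the endpoint \<open>1\<close> gives the boundary terms. At \<open>Q = 0\<close>
  the truncated index \<open>Q - 1\<close> is multiplied by zero.\<close>

lemma kummer_mom_recurrence:
  assumes c: "Re c > -1"
  shows "(of_nat Q)\<^sup>2 * kummer_mom a c (Q - 1) = of_real a * (of_nat Q + 1 + c) * kummer_mom a c Q
     + (of_nat Q * (exp (- of_real a) * kummer c (of_real a)) - of_real a * (exp (- of_real a) * kummer1 c (of_real a)))"
proof -
  obtain w2 where w2: "\<And>z. (kummer1 c has_field_derivative w2 z) (at z)"
    "\<And>z. z * w2 z = (1 + c) * kummer c z - (1 - z) * kummer1 c z"
    using kummer1_has_derivative[OF c] by blast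
  let ?A = "complex_of_real a"
  \<comment> \<open>The combination \<open>Q W - A z W'\<close> is chosen so that in the derivative
    all terms with \<open>W'\<close> cancel and only multiples of \<open>W\<close> remain.\<close>
  define h where "h z = z ^ Q * (exp (- (?A * z)) * (of_nat Q * kummer c (?A * z) - ?A * z * kummer1 c (?A * z)))" for z
  define h' where "h' z = ((of_nat Q)\<^sup>2 * z ^ (Q - 1) - ?A * (of_nat Q + 1 + c) * z ^ Q) * (exp (- (?A * z)) * kummer c (?A * z))" for z
  have kummer_coeff': "((\<lambda>z. kummer c (?A * z)) has_field_derivative kummer1 c (?A * z) * ?A) (at z)" for z
    by (rule DERIV_chain2[OF kummer_has_derivative[OF c]]) (auto intro!: derivative_eq_intros)
  have w1': "((\<lambda>z. kummer1 c (?A * z)) has_field_derivative w2 (?A * z) * ?A) (at z)" for z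
    by (rule DERIV_chain2[OF w2(1)]) (auto intro!: derivative_eq_intros)
  have Qz: "of_nat Q * z ^ (Q - 1) * z = of_nat Q * z ^ Q" for z :: complex by (cases Q) auto
  have hd: "(h has_field_derivative h' z) (at z)" for z
  proof -
    let ?E = "exp (- (?A * z))" and ?W = "kummer c (?A * z)" and ?V = "kummer1 c (?A * z)" and ?U = "w2 (?A * z)"
    have "(h has_field_derivative
      (of_nat Q * z ^ (Q - 1) * (?E * (of_nat Q * ?W - ?A * z * ?V))
       + z ^ Q * (- ?A * ?E * (of_nat Q * ?W - ?A * z * ?V) + ?E * (of_nat Q * (?V * ?A) - (?A * ?V + ?A * z * (?U * ?A)))))) (at z)"
      unfolding h_def[abs_def]
      by (rule derivative_eq_intros refl kummer_coeff' w1' | simp)+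
    moreover have "of_nat Q * z ^ (Q - 1) * (?E * (of_nat Q * ?W - ?A * z * ?V))
       + z ^ Q * (- ?A * ?E * (of_nat Q * ?W - ?A * z * ?V) + ?E * (of_nat Q * (?V * ?A) - (?A * ?V + ?A * z * (?U * ?A)))) = h' z"
    proof -
      have k: "?A * z * (?U * ?A) = ?A * ((1 + c) * ?W - (1 - ?A * z) * ?V)"
        using w2(2)[of "?A * z"] by (simp add: mult_ac)
      have "of_nat Q * z ^ (Q - 1) * (?E * (of_nat Q * ?W - ?A * z * ?V))
        = ?E * ((of_nat Q)\<^sup>2 * z ^ (Q - 1) * ?W - ?A * ?V * (of_nat Q * z ^ (Q - 1) * z))"
        by (simp add: power2_eq_square algebra_simps)
      then show ?thesis unfolding k Qz h'_def by (simp add: algebra_simps power2_eq_square)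
    qed
    ultimately show ?thesis by simp
  qed
  have "((\<lambda>b. h' (of_real b)) has_integral (h (of_real 1) - h (of_real 0))) {0..1}"
    by (rule fundamental_theorem_of_calculus)
       (auto intro!: has_vector_derivative_real_field has_field_derivative_at_within hd)
  then have i1: "integral {0..1} (\<lambda>b. h' (of_real b)) = h 1 - h 0"
    by (simp add: integral_unique)
  have "h 0 = 0" by (cases Q) (simp_all add: h_def)
  have "integral {0..1} (\<lambda>b. h' (of_real b)) = (of_nat Q)\<^sup>2 * kummer_mom a c (Q - 1) - ?A * (of_nat Q + 1 + c) * kummer_mom a c Q"
  proof -
    have "(\<lambda>b. h' (of_real b)) = (\<lambda>b. (of_nat Q)\<^sup>2 * (of_real b ^ (Q - 1) * (exp (- of_real (a * b)) * kummer c (of_real (a * b))))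
        - ?A * (of_nat Q + 1 + c) * (of_real b ^ Q * (exp (- of_real (a * b)) * kummer c (of_real (a * b)))))"
      by (simp add: h'_def fun_eq_iff algebra_simps)
    then show ?thesis unfolding kummer_mom_def
      by (simp only:) (subst Henstock_Kurzweil_Integration.integral_diff;
        (intro integrable_on_mult_right kummer_mom_integrable c)?; simp only: Henstock_Kurzweil_Integration.integral_mult_right)
  qed
  then show ?thesis unfolding i1 \<open>h 0 = 0\<close> by (simp add: h_def algebra_simps)
qed

section \<open>The coefficient operator of multiplication by \<open>y - a\<close>\<close>

text \<open>Multiplication of a power series by \<open>y - a\<close>, in terms of coefficients.\<close>
definition shift_op :: "real \<Rightarrow> (nat \<Rightarrow> complex) \<Rightarrow> nat \<Rightarrow> complex" where
  "shift_op a g q = (if q = 0 then 0 else g (q - 1)) - of_real a * g q"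

lemma entire_seq_shift_op:
  assumes "entire_seq g"
  shows "entire_seq (shift_op a g)"
  unfolding entire_seq_def
proof (intro allI impI)
  fix R :: real assume R: "R > 0"
  obtain C where C: "\<And>l. norm (g l) \<le> C * R ^ l" using assms R unfolding entire_seq_def by blast
  have C0: "C \<ge> 0" using order_trans[OF norm_ge_zero C[of 0]] by simp
  have "norm (shift_op a g l) \<le> (C / R + \<bar>a\<bar> * C) * R ^ l" for l
  proof -
    have "norm (if l = 0 then 0 else g (l - 1)) \<le> C / R * R ^ l"
      using C[of "l - 1"] R C0 by (cases l) auto
    moreover have "norm (of_real a * g l) \<le> \<bar>a\<bar> * (C * R ^ l)"
      using C[of l] by (simp add: norm_mult mult_left_mono)
    ultimately show ?thesis unfolding shift_op_def
      using norm_triangle_ineq4[of "if l = 0 then 0 else g (l - 1)" "of_real a * g l"] by (simp add: algebra_simps)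
  qed
  then show "\<exists>C. \<forall>l. norm (shift_op a g l) \<le> C * R ^ l" by blast
qed

lemma entire_seq_shift_op_power: "entire_seq g \<Longrightarrow> entire_seq ((shift_op a ^^ n) g)"
  by (induction n) (auto intro: entire_seq_shift_op)

text \<open>The adjoint of \<open>shift_op\<close> on test sequences \<open>z ^ l * p l\<close>.
  Constant \<open>p\<close> gives the multiplication rule for generating functions;
  \<open>z = a\<close> turns the adjoint into a forward difference of \<open>p\<close>.\<close>

lemma shift_op_sums_gen:
  assumes "entire_seq g"
  shows "(\<Sum>l. z ^ l * poly p (of_nat l) * shift_op a g l) = (\<Sum>l. z ^ l * (z * poly p (of_nat l + 1) - of_real a * poly p (of_nat l)) * g l)"
proof -
  have e: "summable (\<lambda>l. z ^ l * (poly q (of_nat l) * g l))" for q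
    using entire_seq_summable[OF entire_seq_poly[OF assms], of q z] by (simp add: mult_ac)
  have "summable (\<lambda>l. z ^ l * poly p (of_nat l + 1) * g l)"
    using e[of "pcompose p [:1, 1:]"] by (simp add: poly_pcompose add_ac mult_ac)
  then have "(\<lambda>l. z * (z ^ l * poly p (of_nat l + 1) * g l)) sums (z * (\<Sum>l. z ^ l * poly p (of_nat l + 1) * g l))"
    by (intro sums_mult summable_sums)
  then have "(\<lambda>l. z ^ Suc l * poly p (of_nat (Suc l)) * (if Suc l = 0 then 0 else g (Suc l - 1))) sums (z * (\<Sum>l. z ^ l * poly p (of_nat l + 1) * g l))"
    by (simp add: mult_ac add_ac)
  then have 1: "(\<lambda>l. z ^ l * poly p (of_nat l) * (if l = 0 then 0 else g (l - 1))) sums (z * (\<Sum>l. z ^ l * poly p (of_nat l + 1) * g l))"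
    by (subst (asm) sums_Suc_iff) simp
  have 2: "(\<lambda>l. of_real a * (z ^ l * poly p (of_nat l) * g l)) sums (of_real a * (\<Sum>l. z ^ l * poly p (of_nat l) * g l))"
    using e[of p] by (intro sums_mult summable_sums) (simp add: mult_ac)
  have "(\<lambda>l. z ^ l * poly p (of_nat l) * shift_op a g l) sums (z * (\<Sum>l. z ^ l * poly p (of_nat l + 1) * g l) - of_real a * (\<Sum>l. z ^ l * poly p (of_nat l) * g l))"
    using sums_diff[OF 1 2] by (simp add: shift_op_def algebra_simps)
  moreover have "(\<lambda>l. z ^ l * (z * poly p (of_nat l + 1) - of_real a * poly p (of_nat l)) * g l) sums (z * (\<Sum>l. z ^ l * poly p (of_nat l + 1) * g l) - of_real a * (\<Sum>l. z ^ l * poly p (of_nat l) * g l))"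
  proof -
    have "(\<lambda>l. z * (z ^ l * poly p (of_nat l + 1) * g l) - of_real a * (z ^ l * poly p (of_nat l) * g l)) sums (z * (\<Sum>l. z ^ l * poly p (of_nat l + 1) * g l) - of_real a * (\<Sum>l. z ^ l * poly p (of_nat l) * g l))"
      by (intro sums_diff 2 sums_mult summable_sums) fact
    then show ?thesis by (simp add: algebra_simps)
  qed
  ultimately show ?thesis by (simp add: sums_iff)
qed

lemma shift_op_power_sums:
  assumes "entire_seq g"
  shows "(\<Sum>l. (shift_op a ^^ n) g l * z ^ l) = (z - of_real a) ^ n * (\<Sum>l. g l * z ^ l)"
proof (induction n)
  case (Suc n)
  have "(\<Sum>l. (shift_op a ^^ Suc n) g l * z ^ l) = (\<Sum>l. z ^ l * poly 1 (of_nat l) * shift_op a ((shift_op a ^^ n) g) l)"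
    by (simp add: mult.commute)
  also have "\<dots> = (\<Sum>l. (z - of_real a) * ((shift_op a ^^ n) g l * z ^ l))"
    by (subst shift_op_sums_gen[OF entire_seq_shift_op_power[OF assms]]) (simp add: mult_ac)
  also have "\<dots> = (z - of_real a) * (\<Sum>l. (shift_op a ^^ n) g l * z ^ l)"
    by (rule suminf_mult) (rule entire_seq_summable[OF entire_seq_shift_op_power[OF assms]])
  finally show ?case by (simp add: Suc.IH)
qed simp

text \<open>Prepares the forward difference \<open>p (x + 1) - p x\<close>: the top coefficient
  cancels, and the next one is \<open>n\<close> times the top coefficient of
  \<open>p\<close>.\<close>

lemma coeff_pcompose_shift:
  fixes p :: "complex poly"
  assumes "degree p \<le> n"
  shows "coeff (pcompose p [:1, 1:]) n = coeff p n"
    and "coeff (pcompose p [:1, 1:]) (n - 1) = coeff p (n - 1) + of_nat n * (if n = 0 then 0 else coeff p n)"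
    and "degree (pcompose p [:1, 1:]) \<le> n"
proof -
  have sp: "[:1, 1:] * q = q + pCons 0 q" for q :: "complex poly" by simp
  have D: "degree (pcompose q [:1, 1:]) = degree q" for q :: "complex poly" by (simp add: degree_pcompose)
  show d: "degree (pcompose p [:1, 1:]) \<le> n" using assms by (simp add: D)
  have 1: "degree q \<le> k \<Longrightarrow> coeff (pcompose q [:1, 1:]) k = coeff q k" for q :: "complex poly" and k
  proof (induction q arbitrary: k)
    case (pCons a q)
    show ?case
    proof (cases "q = 0")
      case False
      then obtain k' where k: "k = Suc k'" "degree q \<le> k'" using pCons by (cases k) auto
      have "coeff (pcompose q [:1, 1:]) (Suc k') = 0" using k D[of q] by (intro coeff_eq_0) simp
      then show ?thesis using pCons.IH[OF k(2)] k by (simp add: pcompose_pCons sp)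
    qed (auto simp: pcompose_pCons)
  qed simp
  show "coeff (pcompose p [:1, 1:]) n = coeff p n" by (rule 1[OF assms])
  have "degree q \<le> Suc k \<Longrightarrow> coeff (pcompose q [:1, 1:]) k = coeff q k + of_nat (Suc k) * coeff q (Suc k)" for q :: "complex poly" and k
  proof (induction q arbitrary: k)
    case (pCons a q)
    show ?case
    proof (cases "q = 0")
      case False
      then have dq: "degree q \<le> k" using pCons by auto
      show ?thesis
      proof (cases k)
        case 0
        then have "q = [:coeff q 0:]" using dq by (metis degree_0_id le_zero_eq)
        then obtain b where "q = [:b:]" by blast
        then show ?thesis using 0 by (simp add: pcompose_pCons)
      next
        case (Suc k')
        then have "coeff (pcompose q [:1, 1:]) k' = coeff q k' + of_nat (Suc k') * coeff q (Suc k')" using dq by (intro pCons.IH) simp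
        then show ?thesis using Suc 1[OF dq] by (simp add: pcompose_pCons sp algebra_simps)
      qed
    qed (auto simp: pcompose_pCons coeff_pCons split: nat.split)
  qed simp
  then show "coeff (pcompose p [:1, 1:]) (n - 1) = coeff p (n - 1) + of_nat n * (if n = 0 then 0 else coeff p n)"
    using assms 1[OF assms] by (cases n) auto
qed

text \<open>Summation by parts: against \<open>a ^ l\<close>, each factor \<^const>\<open>shift_op\<close> differentiates the test
  polynomial, so only its coefficient of degree \<open>n\<close> survives.\<close>
lemma shift_op_power_orthogonality:
  assumes "entire_seq g" "degree p \<le> n"
  shows "(\<Sum>l. of_real a ^ l * poly p (of_nat l) * (shift_op a ^^ n) g l) = coeff p n * fact n * of_real a ^ n * (\<Sum>l. of_real a ^ l * g l)"
  using assms(2)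
proof (induction n arbitrary: p)
  case 0
  then obtain b where b: "p = [:b:]" by (metis degree_0_id le_zero_eq)
  have "(\<Sum>l. b * (of_real a ^ l * g l)) = b * (\<Sum>l. of_real a ^ l * g l)"
    by (rule suminf_mult) (use entire_seq_summable[OF assms(1), of "of_real a"] in \<open>simp add: mult.commute\<close>)
  then show ?case by (simp add: b mult_ac)
next
  case (Suc n)
  define q where "q = pcompose p [:1, 1:] - p"
  note c = coeff_pcompose_shift[OF Suc.prems]
  have "degree q \<le> n"
  proof (rule degree_le, intro allI impI)
    fix i assume "n < i"
    then consider "i = Suc n" | "i > Suc n" by linarith
    then show "coeff q i = 0" by cases (use c Suc.prems in \<open>auto simp: q_def coeff_eq_0\<close>)
  qed
  have cq: "coeff q n = of_nat (Suc n) * coeff p (Suc n)" using c(2) by (simp add: q_def)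
  have "(\<Sum>l. of_real a ^ l * poly p (of_nat l) * (shift_op a ^^ Suc n) g l)
     = (\<Sum>l. of_real a ^ l * (of_real a * poly p (of_nat l + 1) - of_real a * poly p (of_nat l)) * (shift_op a ^^ n) g l)"
    unfolding funpow.simps o_apply by (rule shift_op_sums_gen[OF entire_seq_shift_op_power[OF assms(1)]])
  also have "\<dots> = (\<Sum>l. of_real a * (of_real a ^ l * poly q (of_nat l) * (shift_op a ^^ n) g l))"
    by (simp add: q_def poly_pcompose algebra_simps)
  also have "\<dots> = of_real a * (\<Sum>l. of_real a ^ l * poly q (of_nat l) * (shift_op a ^^ n) g l)"
  proof (rule suminf_mult)
    show "summable (\<lambda>l. of_real a ^ l * poly q (of_nat l) * (shift_op a ^^ n) g l)"
      using entire_seq_summable[OF entire_seq_poly[OF entire_seq_shift_op_power[OF assms(1)]], of q n a "of_real a"] by (simp add: mult_ac)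
  qed
  also have "\<dots> = coeff p (Suc n) * fact (Suc n) * of_real a ^ Suc n * (\<Sum>l. of_real a ^ l * g l)"
    unfolding Suc.IH[OF \<open>degree q \<le> n\<close>] cq by (simp add: mult_ac)
  finally show ?case .
qed

lemma shift_op_cmult: "(shift_op a ^^ i) (\<lambda>p. c * g p) = (\<lambda>p. c * (shift_op a ^^ i) g p)"
  by (induction i) (auto simp: shift_op_def fun_eq_iff algebra_simps)

lemma shift_op_sum: "(shift_op a ^^ i) (\<lambda>p. \<Sum>j\<in>A. g j p) = (\<lambda>p. \<Sum>j\<in>A. (shift_op a ^^ i) (g j) p)"
  by (induction i) (auto simp: shift_op_def fun_eq_iff sum_distrib_left sum_subtractf sum_negf)

text \<open>The moment recurrence lets \<open>shift_op\<close> lower the parameter; the factor multiplying the moment picks up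
  \<open>j + 1 + i - n\<close> at step \<open>i\<close>, hence vanishes after \<open>n > j\<close> steps and only a polynomial is left.\<close>
lemma shift_op_kummer_mom_polynomial:
  fixes s :: complex and a :: real
  assumes s: "Re s > -1" and jn: "j < n"
  defines "g \<equiv> \<lambda>p. Gamma (of_nat (n + 1 + p) + s) / (fact p)\<^sup>2 * kummer_mom a (s + of_nat j) p"
  shows "\<exists>S. \<forall>q. (shift_op a ^^ n) g q = Gamma (of_nat q + 1 + s) / (fact q)\<^sup>2 * poly S (of_nat q)"
proof -
  let ?c = "s + of_nat j"
  have c: "Re ?c > -1" using s by simp
  define \<alpha> :: "nat \<Rightarrow> complex" where "\<alpha> i = (\<Prod>k<i. of_real a * (of_nat j + 1 + of_nat k - of_nat n))" for i
  define u where "u = exp (- of_real a) * kummer ?c (of_real a)"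
  define u1 where "u1 = of_real a * (exp (- of_real a) * kummer1 ?c (of_real a))"
  have "i \<le> n \<Longrightarrow> \<exists>S. \<forall>q. (shift_op a ^^ i) g q = Gamma (of_nat (n - i) + 1 + of_nat q + s) / (fact q)\<^sup>2 * (\<alpha> i * kummer_mom a ?c q + poly S (of_nat q))" for i
  proof (induction i)
    case 0
    show ?case by (intro exI[of _ 0]) (simp add: g_def \<alpha>_def add_ac)
  next
    case (Suc i)
    then obtain S where S: "\<And>q. (shift_op a ^^ i) g q = Gamma (of_nat (n - i) + 1 + of_nat q + s) / (fact q)\<^sup>2 * (\<alpha> i * kummer_mom a ?c q + poly S (of_nat q))"
      by auto
    obtain N where N: "n - i = Suc N" using Suc.prems by (metis Suc_diff_Suc Suc_le_lessD)
    then have N': "n - Suc i = N" by simp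
    have nN: "(of_nat n :: complex) = of_nat i + of_nat N + 1"
    proof -
      have "n = i + N + 1" using N by simp
      then show ?thesis by simp
    qed
    \<comment> \<open>The new remainder collects the boundary terms \<open>u\<close> and
      \<open>u1\<close> of the moment recurrence and the image of the old remainder
      \<open>S\<close>. The factor \<open>x\<^sup>2\<close> in front of the translated
      \<open>S\<close> is the quotient of \<open>(fact q)\<^sup>2\<close> and
      \<open>(fact (q - 1))\<^sup>2\<close>.\<close>
    define T where "T = Polynomial.smult (\<alpha> i) [:- u1, u:] + [:0, 0, 1:] * pcompose S [:-1, 1:] - Polynomial.smult (of_real a) ([:of_nat N + 1 + s, 1:] * S)"
    have "(shift_op a ^^ Suc i) g q = Gamma (of_nat N + 1 + of_nat q + s) / (fact q)\<^sup>2 * (\<alpha> (Suc i) * kummer_mom a ?c q + poly T (of_nat q))" for q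
    proof -
      define X where "X q = \<alpha> i * kummer_mom a ?c q + poly S (of_nat q)" for q
      have G: "Gamma (of_nat N + 1 + 1 + of_nat q + s) = (of_nat N + 1 + of_nat q + s) * Gamma (of_nat N + 1 + of_nat q + s)"
      proof -
        have "Gamma ((of_nat N + 1 + of_nat q + s) + 1) = (of_nat N + 1 + of_nat q + s) * Gamma (of_nat N + 1 + of_nat q + s)"
          by (rule Gamma_plus1) (use s in \<open>auto intro!: not_nonpos_Int\<close>)
        then show ?thesis by (simp add: add_ac)
      qed
      have "(shift_op a ^^ Suc i) g q = (if q = 0 then 0 else (shift_op a ^^ i) g (q - 1)) - of_real a * (shift_op a ^^ i) g q"
        by (simp add: shift_op_def)
      also have "(if q = 0 then 0 else (shift_op a ^^ i) g (q - 1)) = Gamma (of_nat N + 1 + of_nat q + s) / (fact q)\<^sup>2 * ((of_nat q)\<^sup>2 * X (q - 1))"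
      proof (cases q)
        case (Suc r)
        have "(of_nat (Suc r) :: complex) \<noteq> 0" by (metis of_nat_eq_0_iff nat.simps(3))
        then show ?thesis
          using Suc by (simp add: S N X_def power_mult_distrib add_ac del: of_nat_Suc) (simp add: add_ac)
      qed simp
      also have "of_real a * (shift_op a ^^ i) g q = Gamma (of_nat N + 1 + of_nat q + s) / (fact q)\<^sup>2 * (of_real a * (of_nat N + 1 + of_nat q + s) * X q)"
        using G by (simp add: S N X_def add_ac)
      finally have "(shift_op a ^^ Suc i) g q = Gamma (of_nat N + 1 + of_nat q + s) / (fact q)\<^sup>2 * ((of_nat q)\<^sup>2 * X (q - 1) - of_real a * (of_nat N + 1 + of_nat q + s) * X q)"
        by (simp add: algebra_simps)
      moreover have "(of_nat q)\<^sup>2 * X (q - 1) - of_real a * (of_nat N + 1 + of_nat q + s) * X q = \<alpha> (Suc i) * kummer_mom a ?c q + poly T (of_nat q)"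
      proof -
        have pT: "poly T (of_nat q) = \<alpha> i * (of_nat q * u - u1) + (of_nat q)\<^sup>2 * poly S (of_nat q - 1) - of_real a * (of_nat N + 1 + s + of_nat q) * poly S (of_nat q)"
          by (simp add: T_def poly_pcompose algebra_simps power2_eq_square)
        have q1: "(of_nat q)\<^sup>2 * poly S (of_nat (q - 1)) = (of_nat q)\<^sup>2 * poly S (of_nat q - 1)"
          by (cases q) auto
        have m: "(of_nat q)\<^sup>2 * kummer_mom a ?c (q - 1) = of_real a * (of_nat q + 1 + ?c) * kummer_mom a ?c q + (of_nat q * u - u1)"
          unfolding u_def u1_def by (rule kummer_mom_recurrence[OF c])
        have "(of_nat q)\<^sup>2 * X (q - 1) = \<alpha> i * ((of_nat q)\<^sup>2 * kummer_mom a ?c (q - 1)) + (of_nat q)\<^sup>2 * poly S (of_nat (q - 1))"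
          by (simp add: X_def algebra_simps)
        then have "(of_nat q)\<^sup>2 * X (q - 1) = \<alpha> i * (of_real a * (of_nat q + 1 + ?c) * kummer_mom a ?c q + (of_nat q * u - u1)) + (of_nat q)\<^sup>2 * poly S (of_nat q - 1)"
          unfolding m q1 .
        moreover have \<alpha>S: "\<alpha> (Suc i) = \<alpha> i * (of_real a * (of_nat j - of_nat N))"
          by (simp add: \<alpha>_def nN)
        ultimately show ?thesis unfolding \<alpha>S pT by (simp add: X_def algebra_simps)
      qed
      ultimately show ?thesis by simp
    qed
    then show ?case unfolding N' by blast
  qed
  from this[OF le_refl] obtain S where S: "\<And>q. (shift_op a ^^ n) g q = Gamma (of_nat (n - n) + 1 + of_nat q + s) / (fact q)\<^sup>2 * (\<alpha> n * kummer_mom a ?c q + poly S (of_nat q))"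
    by blast
  \<comment> \<open>The vanishing factor has index \<open>n - 1 - j\<close>, which lies in the range
    of the product because \<open>j < n\<close>.\<close>
  have "\<alpha> n = 0"
  proof -
    have "of_nat j + 1 + of_nat (n - 1 - j) - (of_nat n :: complex) = 0"
    proof -
      have "n = j + 1 + (n - 1 - j)" using jn by simp
      then have "(of_nat n :: complex) = of_nat j + 1 + of_nat (n - 1 - j)" by (metis of_nat_1 of_nat_add)
      then show ?thesis by simp
    qed
    then show ?thesis unfolding \<alpha>_def using jn by (intro prod_zero bexI[of _ "n - 1 - j"]) auto
  qed
  then show ?thesis using S by (intro exI[of _ S]) (simp add: add_ac)
qed

section \<open>The standard complex Gaussian measure\<close>

lemma lborel_pair_shear:
  fixes f :: "'a::euclidean_space \<Rightarrow> 'a" and h :: "'a \<times> 'a \<Rightarrow> ennreal"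
  assumes [measurable]: "f \<in> borel_measurable borel" "h \<in> borel_measurable (borel \<Otimes>\<^sub>M borel)"
  shows "(\<integral>\<^sup>+z. h (fst z + f (snd z), snd z) \<partial>(lborel \<Otimes>\<^sub>M lborel)) = (\<integral>\<^sup>+z. h z \<partial>(lborel \<Otimes>\<^sub>M lborel))"
    and "(\<integral>\<^sup>+z. h (fst z, snd z + f (fst z)) \<partial>(lborel \<Otimes>\<^sub>M lborel)) = (\<integral>\<^sup>+z. h z \<partial>(lborel \<Otimes>\<^sub>M lborel))"
proof -
  have tr: "(\<integral>\<^sup>+x. g (x + c) \<partial>lborel) = (\<integral>\<^sup>+x. g x \<partial>lborel)" if [measurable]: "g \<in> borel_measurable borel" for g :: "'a \<Rightarrow> ennreal" and c
  proof -
    have "(\<integral>\<^sup>+x. g x \<partial>lborel) = (\<integral>\<^sup>+x. g x \<partial>distr lborel borel ((+) c))" by (simp add: lborel_distr_plus)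
    also have "\<dots> = (\<integral>\<^sup>+x. g (c + x) \<partial>lborel)" by (rule nn_integral_distr) auto
    finally show ?thesis by (simp add: add.commute)
  qed
  show "(\<integral>\<^sup>+z. h (fst z + f (snd z), snd z) \<partial>(lborel \<Otimes>\<^sub>M lborel)) = (\<integral>\<^sup>+z. h z \<partial>(lborel \<Otimes>\<^sub>M lborel))"
  proof -
    have "(\<integral>\<^sup>+x. h (x + f y, y) \<partial>lborel) = (\<integral>\<^sup>+x. h (x, y) \<partial>lborel)" for y
      using tr[of "\<lambda>x. h (x, y)" "f y"] by simp
    then show ?thesis by (simp add: lborel_pair.nn_integral_snd[symmetric])
  qed
  show "(\<integral>\<^sup>+z. h (fst z, snd z + f (fst z)) \<partial>(lborel \<Otimes>\<^sub>M lborel)) = (\<integral>\<^sup>+z. h z \<partial>(lborel \<Otimes>\<^sub>M lborel))"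
  proof -
    have "(\<integral>\<^sup>+y. h (x, y + f x) \<partial>lborel) = (\<integral>\<^sup>+y. h (x, y) \<partial>lborel)" for x
      using tr[of "\<lambda>y. h (x, y)" "f x"] by simp
    then show ?thesis by (simp add: lborel.nn_integral_fst[symmetric])
  qed
qed

text \<open>A matrix of determinant one with nonzero lower left entry is a product of three shears.\<close>
lemma lborel_pair_sl2:
  fixes \<alpha> \<beta> \<gamma> \<delta> :: "'a::{real_normed_field, euclidean_space}" and h :: "'a \<times> 'a \<Rightarrow> ennreal"
  assumes det: "\<alpha> * \<delta> - \<beta> * \<gamma> = 1" and [measurable]: "h \<in> borel_measurable (borel \<Otimes>\<^sub>M borel)"
  shows "(\<integral>\<^sup>+z. h (\<alpha> * fst z + \<beta> * snd z, \<gamma> * fst z + \<delta> * snd z) \<partial>(lborel \<Otimes>\<^sub>M lborel)) = (\<integral>\<^sup>+z. h z \<partial>(lborel \<Otimes>\<^sub>M lborel))"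
proof -
  have nz: "(\<integral>\<^sup>+z. h (\<alpha> * fst z + \<beta> * snd z, \<gamma> * fst z + \<delta> * snd z) \<partial>(lborel \<Otimes>\<^sub>M lborel)) = (\<integral>\<^sup>+z. h z \<partial>(lborel \<Otimes>\<^sub>M lborel))"
    if det: "\<alpha> * \<delta> - \<beta> * \<gamma> = 1" and \<gamma>: "\<gamma> \<noteq> 0" and [measurable]: "h \<in> borel_measurable (borel \<Otimes>\<^sub>M borel)"
    for \<alpha> \<beta> \<gamma> \<delta> :: 'a and h :: "'a \<times> 'a \<Rightarrow> ennreal"
  proof -
    define p q where "p = (\<alpha> - 1) / \<gamma>" and "q = (\<delta> - 1) / \<gamma>"
    have \<beta>: "\<beta> = q + p * \<delta>" using det \<gamma> by (simp add: p_def q_def field_simps)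
    have \<alpha>: "\<alpha> = 1 + p * \<gamma>" and \<delta>: "\<delta> = 1 + q * \<gamma>" using \<gamma> by (simp_all add: p_def q_def)
    have "(\<integral>\<^sup>+z. h z \<partial>(lborel \<Otimes>\<^sub>M lborel)) = (\<integral>\<^sup>+z. h (fst z + p * snd z, snd z) \<partial>(lborel \<Otimes>\<^sub>M lborel))"
      by (rule lborel_pair_shear(1)[symmetric]) auto
    also have "\<dots> = (\<integral>\<^sup>+z. (\<lambda>z. h (fst z + p * snd z, snd z)) (fst z, snd z + \<gamma> * fst z) \<partial>(lborel \<Otimes>\<^sub>M lborel))"
      by (rule lborel_pair_shear(2)[symmetric]) auto
    also have "\<dots> = (\<integral>\<^sup>+z. (\<lambda>z. h (fst z + p * (snd z + \<gamma> * fst z), snd z + \<gamma> * fst z)) (fst z + q * snd z, snd z) \<partial>(lborel \<Otimes>\<^sub>M lborel))"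
      by (subst lborel_pair_shear(1)) auto
    also have "\<dots> = (\<integral>\<^sup>+z. h (\<alpha> * fst z + \<beta> * snd z, \<gamma> * fst z + \<delta> * snd z) \<partial>(lborel \<Otimes>\<^sub>M lborel))"
      by (simp add: \<alpha> \<beta> \<delta> algebra_simps)
    finally show ?thesis by simp
  qed
  show ?thesis
  proof (cases "\<gamma> = 0")
    case False
    then show ?thesis using nz[OF det] by simp
  next
    case True
    \<comment> \<open>With a zero in the lower left corner, \<open>\<alpha> * \<delta> = 1\<close>
      makes \<open>\<alpha>\<close> nonzero. Adding the first row to the second puts
      \<open>\<alpha>\<close> into that corner, and the addition is undone by one more
      shear.\<close>
    then have a0: "\<alpha> \<noteq> 0" using det by auto
    have "(\<integral>\<^sup>+z. h z \<partial>(lborel \<Otimes>\<^sub>M lborel)) = (\<integral>\<^sup>+z. h (fst z, snd z + (- fst z)) \<partial>(lborel \<Otimes>\<^sub>M lborel))"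
      by (rule lborel_pair_shear(2)[symmetric]) auto
    also have "\<dots> = (\<integral>\<^sup>+z. (\<lambda>z. h (fst z, snd z + (- fst z))) (\<alpha> * fst z + \<beta> * snd z, \<alpha> * fst z + (\<beta> + \<delta>) * snd z) \<partial>(lborel \<Otimes>\<^sub>M lborel))"
      by (rule nz[symmetric]) (use a0 det True in \<open>auto simp: algebra_simps\<close>)
    finally show ?thesis using True by (simp add: algebra_simps)
  qed
qed

lemma lborel_complex_eq: "distr (lborel \<Otimes>\<^sub>M lborel) borel (\<lambda>z. Complex (fst z) (snd z)) = lborel"
proof (rule lborel_eqI[symmetric])
  have [measurable]: "(\<lambda>z. Complex (fst z) (snd z)) \<in> borel_measurable (borel \<Otimes>\<^sub>M borel)"
    by (simp add: borel_measurable_complex_iff)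
  fix l u :: complex assume le: "\<And>b. b \<in> Basis \<Longrightarrow> l \<bullet> b \<le> u \<bullet> b"
  then have le': "Re l \<le> Re u" "Im l \<le> Im u" using le[of 1] le[of \<i>] by (auto simp: Basis_complex_def inner_complex_def)
  have "(\<lambda>z. Complex (fst z) (snd z)) -` box l u = {Re l<..<Re u} \<times> {Im l<..<Im u}"
    by (auto simp: box_def Basis_complex_def inner_complex_def)
  then have "emeasure (distr (lborel \<Otimes>\<^sub>M lborel) borel (\<lambda>z. Complex (fst z) (snd z))) (box l u)
     = emeasure (lborel \<Otimes>\<^sub>M lborel) ({Re l<..<Re u} \<times> {Im l<..<Im u})"
    by (subst emeasure_distr) (auto simp: space_pair_measure)
  also have "\<dots> = ennreal (Re u - Re l) * ennreal (Im u - Im l)"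
    using le' by (subst lborel.emeasure_pair_measure_Times) auto
  also have "\<dots> = (\<Prod>b\<in>Basis. (u - l) \<bullet> b)"
    using le' by (simp add: Basis_complex_def inner_complex_def ennreal_mult'')
  finally show "emeasure (distr (lborel \<Otimes>\<^sub>M lborel) borel (\<lambda>z. Complex (fst z) (snd z))) (box l u) = (\<Prod>b\<in>Basis. (u - l) \<bullet> b)" .
qed simp

lemma nn_integral_lborel_rotate:
  fixes h :: "complex \<Rightarrow> ennreal"
  assumes [measurable]: "h \<in> borel_measurable borel" and u: "cmod u = 1"
  shows "(\<integral>\<^sup>+w. h (u * w) \<partial>lborel) = (\<integral>\<^sup>+w. h w \<partial>lborel)"
proof -
  have [measurable]: "(\<lambda>z. Complex (fst z) (snd z)) \<in> borel_measurable (borel \<Otimes>\<^sub>M borel)"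
    by (simp add: borel_measurable_complex_iff)
  have u1: "Re u * Re u - (- Im u) * Im u = 1" using u by (simp add: cmod_def power2_eq_square)
  have c: "(\<integral>\<^sup>+w. g w \<partial>lborel) = (\<integral>\<^sup>+z. g (Complex (fst z) (snd z)) \<partial>(lborel \<Otimes>\<^sub>M lborel))"
    if [measurable]: "g \<in> borel_measurable borel" for g :: "complex \<Rightarrow> ennreal"
    by (subst lborel_complex_eq[symmetric], subst nn_integral_distr) auto
  have "(\<integral>\<^sup>+w. h (u * w) \<partial>lborel) = (\<integral>\<^sup>+z. (\<lambda>z. h (Complex (fst z) (snd z))) (Re u * fst z + (- Im u) * snd z, Im u * fst z + Re u * snd z) \<partial>(lborel \<Otimes>\<^sub>M lborel))"
    by (subst c) (auto simp: complex_eq_iff intro!: nn_integral_cong arg_cong[of _ _ h])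
  also have "\<dots> = (\<integral>\<^sup>+w. h w \<partial>lborel)"
    by (subst lborel_pair_sl2[OF u1]) (auto simp: c)
  finally show ?thesis .
qed

section \<open>Radial part and rotation invariance of the complex Gaussian law\<close>

abbreviation cgauss :: "complex measure" where "cgauss \<equiv> std_complex_gaussian"

lemma sets_cgauss [measurable_cong, simp]: "sets cgauss = sets borel"
  by (simp add: std_complex_gaussian_def)

lemma space_cgauss [simp]: "space cgauss = UNIV"
  by (simp add: std_complex_gaussian_def)

lemma nn_integral_cgauss:
  "f \<in> borel_measurable borel \<Longrightarrow> (\<integral>\<^sup>+w. f w \<partial>cgauss) = (\<integral>\<^sup>+w. ennreal (exp (- (cmod w)\<^sup>2) / pi) * f w \<partial>lborel)"
  unfolding std_complex_gaussian_def by (rule nn_integral_density) auto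

text \<open>The two measures are compared on half-lines: the disc of squared radius \<open>t\<close>
  has area \<open>pi * t\<close>, so the density is constant. This is why the squared modulus of a
  complex Gaussian is exponential.\<close>

lemma distr_lborel_norm_square:
  "distr lborel borel (\<lambda>w::complex. (cmod w)\<^sup>2) = density lborel (\<lambda>t. ennreal pi * indicator {0..} t)"
proof (rule measure_eqI_generator_eq[where E = "range (\<lambda>t::real. {..t})" and \<Omega> = UNIV and A = "\<lambda>n. {..real n}"])
  have E: "emeasure (distr lborel borel (\<lambda>w::complex. (cmod w)\<^sup>2)) {..t} = ennreal (pi * max 0 t)" for t
  proof -
    have "emeasure (distr lborel borel (\<lambda>w::complex. (cmod w)\<^sup>2)) {..t} = emeasure lborel ((\<lambda>w::complex. (cmod w)\<^sup>2) -` {..t})"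
      by (subst emeasure_distr) auto
    also have "(\<lambda>w::complex. (cmod w)\<^sup>2) -` {..t} = (if t < 0 then {} else cball 0 (sqrt t))"
    proof (cases "t < 0")
      case True
      have "\<not> (cmod w)\<^sup>2 \<le> t" for w :: complex using True zero_le_power2[of "cmod w"] by linarith
      then show ?thesis using True by auto
    next
      case False
      have "(cmod w)\<^sup>2 \<le> t \<longleftrightarrow> cmod w \<le> sqrt t" for w :: complex
        using real_sqrt_le_iff[of "(cmod w)\<^sup>2" t] by simp
      then show ?thesis using False by auto
    qed
    also have "emeasure lborel \<dots> = ennreal (pi * max 0 t)"
      by (auto simp: emeasure_cball unit_ball_vol_2)
    finally show ?thesis .
  qed
  fix X assume "X \<in> range (\<lambda>t::real. {..t})"
  then obtain t where X: "X = {..t}" by auto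
  have "emeasure (density lborel (\<lambda>t. ennreal pi * indicator {0..} t)) {..t} = (\<integral>\<^sup>+x. ennreal pi * indicator {0..t} x \<partial>lborel)"
    by (subst emeasure_density) (auto intro!: nn_integral_cong split: split_indicator)
  also have "\<dots> = ennreal (pi * max 0 t)"
    by (cases "0 \<le> t") (auto simp: nn_integral_cmult ennreal_mult)
  finally show "emeasure (distr lborel borel (\<lambda>w::complex. (cmod w)\<^sup>2)) X = emeasure (density lborel (\<lambda>t. ennreal pi * indicator {0..} t)) X"
    by (simp add: E X)
next
  show "emeasure (distr lborel borel (\<lambda>w::complex. (cmod w)\<^sup>2)) {..real i} \<noteq> \<infinity>" for i
  proof -
    have "(\<lambda>w::complex. (cmod w)\<^sup>2) -` {..real i} \<subseteq> cball 0 (sqrt (real i))"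
      using real_le_rsqrt by auto
    then have "emeasure lborel ((\<lambda>w::complex. (cmod w)\<^sup>2) -` {..real i}) \<le> emeasure lborel (cball (0::complex) (sqrt (real i)))"
      by (intro emeasure_mono) auto
    also have "\<dots> < \<infinity>" using emeasure_lborel_cball_finite[of "0::complex" "sqrt (real i)"] by (simp add: top.not_eq_extremum)
    finally show ?thesis by (subst emeasure_distr) auto
  qed
  show "(\<Union>i. {..real i}) = UNIV" using real_arch_simple by auto
  show "Int_stable (range (\<lambda>t::real. {..t}))" by (auto simp: Int_stable_def)
  show "sets (distr lborel borel (\<lambda>w::complex. (cmod w)\<^sup>2)) = sigma_sets UNIV (range (\<lambda>t::real. {..t}))"
    "sets (density lborel (\<lambda>t. ennreal pi * indicator {0..} t)) = sigma_sets UNIV (range (\<lambda>t::real. {..t}))"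
    by (simp_all add: borel_eq_atMost)
qed auto

lemma nn_integral_cgauss_radial:
  assumes [measurable]: "f \<in> borel_measurable borel"
  shows "(\<integral>\<^sup>+w. f ((cmod w)\<^sup>2) \<partial>cgauss) = (\<integral>\<^sup>+t. ennreal (exponential_density 1 t) * f t \<partial>lborel)"
proof -
  have "(\<integral>\<^sup>+w. f ((cmod w)\<^sup>2) \<partial>cgauss) = (\<integral>\<^sup>+w. (\<lambda>t. ennreal (exp (- t) / pi) * f t) ((cmod w)\<^sup>2) \<partial>lborel)"
    by (subst nn_integral_cgauss) auto
  also have "\<dots> = (\<integral>\<^sup>+t. ennreal (exp (- t) / pi) * f t \<partial>distr lborel borel (\<lambda>w::complex. (cmod w)\<^sup>2))"
    by (rule nn_integral_distr[symmetric]) auto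
  also have "\<dots> = (\<integral>\<^sup>+t. (ennreal pi * indicator {0..} t) * (ennreal (exp (- t) / pi) * f t) \<partial>lborel)"
    unfolding distr_lborel_norm_square by (rule nn_integral_density) auto
  also have "\<dots> = (\<integral>\<^sup>+t. ennreal (exponential_density 1 t) * f t \<partial>lborel)"
    by (intro nn_integral_cong)
       (auto simp: exponential_density_def ennreal_mult'[symmetric] mult.assoc[symmetric] split: split_indicator)
  finally show ?thesis .
qed

lemma distributed_cgauss_norm_square: "distributed cgauss lborel (\<lambda>w. (cmod w)\<^sup>2) (exponential_density 1)"
  unfolding distributed_def
proof (intro conjI)
  show "distr cgauss lborel (\<lambda>w. (cmod w)\<^sup>2) = density lborel (exponential_density 1)"
  proof (rule measure_eqI)
    fix A assume "A \<in> sets (distr cgauss lborel (\<lambda>w. (cmod w)\<^sup>2))"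
    then have [measurable]: "A \<in> sets borel" by simp
    have "emeasure (distr cgauss lborel (\<lambda>w. (cmod w)\<^sup>2)) A = (\<integral>\<^sup>+x. indicator A x \<partial>distr cgauss lborel (\<lambda>w. (cmod w)\<^sup>2))"
      by simp
    also have "\<dots> = (\<integral>\<^sup>+w. indicator A ((cmod w)\<^sup>2) \<partial>cgauss)" by (rule nn_integral_distr) auto
    also have "\<dots> = (\<integral>\<^sup>+t. ennreal (exponential_density 1 t) * indicator A t \<partial>lborel)" by (rule nn_integral_cgauss_radial) simp
    finally show "emeasure (distr cgauss lborel (\<lambda>w. (cmod w)\<^sup>2)) A = emeasure (density lborel (exponential_density 1)) A"
      by (simp add: emeasure_density)
  qed simp
qed auto

lemma prob_space_cgauss: "prob_space cgauss"
proof
  have "emeasure cgauss (space cgauss) = (\<integral>\<^sup>+w. (\<lambda>_. 1) ((cmod w)\<^sup>2) \<partial>cgauss)" by simp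
  also have "\<dots> = emeasure (density lborel (exponential_density 1)) (space (density lborel (exponential_density 1)))"
    by (subst nn_integral_cgauss_radial) (auto simp: emeasure_density)
  also have "\<dots> = 1" using prob_space.emeasure_space_1[OF prob_space_exponential_density[of 1]] by simp
  finally show "emeasure cgauss (space cgauss) = 1" .
qed

lemma distr_cgauss_rotate:
  assumes u: "cmod u = 1"
  shows "distr cgauss borel (\<lambda>w. u * w) = cgauss"
proof (rule measure_eqI)
  fix A assume "A \<in> sets (distr cgauss borel (\<lambda>w. u * w))"
  then have [measurable]: "A \<in> sets borel" by simp
  have "emeasure (distr cgauss borel (\<lambda>w. u * w)) A = (\<integral>\<^sup>+x. indicator A x \<partial>distr cgauss borel (\<lambda>w. u * w))"
    by simp
  also have "\<dots> = (\<integral>\<^sup>+w. indicator A (u * w) \<partial>cgauss)" by (rule nn_integral_distr) auto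
  also have "\<dots> = (\<integral>\<^sup>+w. (\<lambda>w. ennreal (exp (- (cmod w)\<^sup>2) / pi) * indicator A w) (u * w) \<partial>lborel)"
    by (subst nn_integral_cgauss) (auto simp: norm_mult u)
  also have "\<dots> = (\<integral>\<^sup>+w. indicator A w \<partial>cgauss)"
    by (subst nn_integral_lborel_rotate[OF _ u]) (auto simp: nn_integral_cgauss[symmetric] simp del: nn_integral_indicator)
  finally show "emeasure (distr cgauss borel (\<lambda>w. u * w)) A = emeasure cgauss A" by simp
qed simp

text \<open>Determinant one gives invariance of Lebesgue measure, and unitarity gives invariance of
  the density. The group SU(2) contains all the Givens rotations that are applied below.\<close>

lemma cgauss_pair_rotate:
  fixes h :: "complex \<times> complex \<Rightarrow> ennreal"
  assumes ab: "(cmod \<alpha>)\<^sup>2 + (cmod \<beta>)\<^sup>2 = 1" and [measurable]: "h \<in> borel_measurable (borel \<Otimes>\<^sub>M borel)"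
  shows "(\<integral>\<^sup>+x. \<integral>\<^sup>+y. h (\<alpha> * x + \<beta> * y, - cnj \<beta> * x + cnj \<alpha> * y) \<partial>cgauss \<partial>cgauss) = (\<integral>\<^sup>+x. \<integral>\<^sup>+y. h (x, y) \<partial>cgauss \<partial>cgauss)"
proof -
  define d where "d z = ennreal (exp (- ((cmod (fst z))\<^sup>2 + (cmod (snd z))\<^sup>2)) / pi / pi)" for z :: "complex \<times> complex"
  have [measurable]: "d \<in> borel_measurable (borel \<Otimes>\<^sub>M borel)" unfolding d_def by measurable
  have E: "(\<integral>\<^sup>+x. \<integral>\<^sup>+y. g (x, y) \<partial>cgauss \<partial>cgauss) = (\<integral>\<^sup>+z. d z * g z \<partial>(lborel \<Otimes>\<^sub>M lborel))"
    if [measurable]: "g \<in> borel_measurable (borel \<Otimes>\<^sub>M borel)" for g :: "complex \<times> complex \<Rightarrow> ennreal"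
  proof -
    have "(\<integral>\<^sup>+x. \<integral>\<^sup>+y. g (x, y) \<partial>cgauss \<partial>cgauss)
      = (\<integral>\<^sup>+x. ennreal (exp (- (cmod x)\<^sup>2) / pi) * (\<integral>\<^sup>+y. ennreal (exp (- (cmod y)\<^sup>2) / pi) * g (x, y) \<partial>lborel) \<partial>lborel)"
      by (simp add: nn_integral_cgauss)
    also have "\<dots> = (\<integral>\<^sup>+x. (\<integral>\<^sup>+y. d (x, y) * g (x, y) \<partial>lborel) \<partial>lborel)"
    proof (intro nn_integral_cong)
      fix x :: complex
      have "d (x, y) = ennreal (exp (- (cmod x)\<^sup>2) / pi) * ennreal (exp (- (cmod y)\<^sup>2) / pi)" for y
        by (simp add: d_def ennreal_mult'[symmetric] exp_add[symmetric] algebra_simps)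
      then show "ennreal (exp (- (cmod x)\<^sup>2) / pi) * (\<integral>\<^sup>+y. ennreal (exp (- (cmod y)\<^sup>2) / pi) * g (x, y) \<partial>lborel) = (\<integral>\<^sup>+y. d (x, y) * g (x, y) \<partial>lborel)"
        by (simp add: mult.assoc nn_integral_cmult)
    qed
    finally show ?thesis using lborel.nn_integral_fst[of "\<lambda>z. d z * g z" lborel] by simp
  qed
  have cc: "cnj z * z = of_real ((cmod z)\<^sup>2)" "z * cnj z = of_real ((cmod z)\<^sup>2)" for z
    using complex_norm_square[of z] by (simp_all add: mult.commute)
  have ab': "of_real ((cmod \<alpha>)\<^sup>2) + of_real ((cmod \<beta>)\<^sup>2) = (1::complex)" using ab by (metis of_real_1 of_real_add)
  have det: "\<alpha> * cnj \<alpha> - \<beta> * (- cnj \<beta>) = 1" using ab' by (simp add: cc)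
  have dinv: "d (\<alpha> * x + \<beta> * y, - cnj \<beta> * x + cnj \<alpha> * y) = d (x, y)" for x y
  proof -
    have "complex_of_real ((cmod (\<alpha> * x + \<beta> * y))\<^sup>2 + (cmod (- cnj \<beta> * x + cnj \<alpha> * y))\<^sup>2)
      = (\<alpha> * cnj \<alpha> + \<beta> * cnj \<beta>) * (x * cnj x + y * cnj y)"
      unfolding of_real_add complex_norm_square by (simp add: algebra_simps)
    also have "\<dots> = of_real ((cmod x)\<^sup>2 + (cmod y)\<^sup>2)" using ab' by (simp add: cc)
    finally have "(cmod (\<alpha> * x + \<beta> * y))\<^sup>2 + (cmod (- cnj \<beta> * x + cnj \<alpha> * y))\<^sup>2 = (cmod x)\<^sup>2 + (cmod y)\<^sup>2"
      using of_real_eq_iff by blast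
    then show ?thesis by (simp add: d_def)
  qed
  have "(\<integral>\<^sup>+x. \<integral>\<^sup>+y. h (\<alpha> * x + \<beta> * y, - cnj \<beta> * x + cnj \<alpha> * y) \<partial>cgauss \<partial>cgauss)
    = (\<integral>\<^sup>+z. d z * h (\<alpha> * fst z + \<beta> * snd z, - cnj \<beta> * fst z + cnj \<alpha> * snd z) \<partial>(lborel \<Otimes>\<^sub>M lborel))"
    using E[of "\<lambda>z. h (\<alpha> * fst z + \<beta> * snd z, - cnj \<beta> * fst z + cnj \<alpha> * snd z)"] by simp
  also have "\<dots> = (\<integral>\<^sup>+z. (\<lambda>z. d z * h z) (\<alpha> * fst z + \<beta> * snd z, - cnj \<beta> * fst z + cnj \<alpha> * snd z) \<partial>(lborel \<Otimes>\<^sub>M lborel))"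
    using dinv by (intro nn_integral_cong) (metis prod.collapse)
  also have "\<dots> = (\<integral>\<^sup>+z. d z * h z \<partial>(lborel \<Otimes>\<^sub>M lborel))"
    by (rule lborel_pair_sl2[OF det]) simp
  finally show ?thesis by (simp add: E)
qed

section \<open>Gaussian matrices\<close>

text \<open>Entries are addressed by absolute indices and the determinant is taken over a window
  starting at \<open>k\<close>. A minor thus keeps the names of its entries, and the Gaussian array
  is never reindexed when a dimension is peeled off.\<close>

definition detf :: "nat \<Rightarrow> nat \<Rightarrow> (nat \<Rightarrow> nat \<Rightarrow> complex) \<Rightarrow> complex" where
  "detf n k f = Determinant.det (mat n n (\<lambda>(i, j). f (k + i) (k + j)))"

lemma detf_cong:
  assumes "\<And>i j. k \<le> i \<Longrightarrow> i < k + n \<Longrightarrow> k \<le> j \<Longrightarrow> j < k + n \<Longrightarrow> f i j = g i j"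
  shows "detf n k f = detf n k g"
  unfolding detf_def using assms by (intro arg_cong[of _ _ Determinant.det] eq_matI) auto

lemma detf_sum:
  "detf n k f = (\<Sum>p | p permutes {0..<n}. signof p * (\<Prod>i = 0..<n. f (k + i) (k + p i)))"
  unfolding detf_def
  by (subst det_def'[of _ n]) (auto intro!: sum.cong prod.cong simp: permutes_in_image)

lemma detf_transpose: "detf n k (\<lambda>i j. f j i) = detf n k f"
proof -
  have "transpose_mat (mat n n (\<lambda>(i, j). f (k + i) (k + j))) = mat n n (\<lambda>(i, j). f (k + j) (k + i))"
    by (intro eq_matI) auto
  then show ?thesis unfolding detf_def
    using det_transpose[of "mat n n (\<lambda>(i, j). f (k + i) (k + j))" n] by simp
qed

text \<open>The factorisation into three shears once more, now as three additions of a multiple of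
  one row to another, each of which preserves the determinant.\<close>

lemma detf_row_sl2:
  assumes det: "\<alpha> * \<delta> - \<beta> * \<gamma> = 1" and \<gamma>: "\<gamma> \<noteq> 0"
    and pq: "p \<noteq> q" "k \<le> p" "p < k + n" "k \<le> q" "q < k + n"
  shows "detf n k (\<lambda>i j. if i = p then \<alpha> * f p j + \<beta> * f q j else if i = q then \<gamma> * f p j + \<delta> * f q j else f i j) = detf n k f"
proof -
  define p' q' where "p' = p - k" and "q' = q - k"
  have pq': "p' < n" "q' < n" "p' \<noteq> q'" "p = k + p'" "q = k + q'" using pq by (auto simp: p'_def q'_def)
  define u v where "u = (\<alpha> - 1) / \<gamma>" and "v = (\<delta> - 1) / \<gamma>"
  have \<beta>: "\<beta> = v + u * \<delta>" using det \<gamma> by (simp add: u_def v_def field_simps)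
  have \<alpha>: "\<alpha> = 1 + u * \<gamma>" and \<delta>: "\<delta> = 1 + v * \<gamma>" using \<gamma> by (simp_all add: u_def v_def)
  let ?A = "mat n n (\<lambda>(i, j). f (k + i) (k + j))"
  let ?B = "addrow u p' q' (addrow \<gamma> q' p' (addrow v p' q' ?A))"
  have "Determinant.det ?B = Determinant.det ?A"
    using pq' by (simp add: det_addrow[of _ n])
  moreover have "?B = mat n n (\<lambda>(i, j). if k + i = p then \<alpha> * f p (k + j) + \<beta> * f q (k + j)
      else if k + i = q then \<gamma> * f p (k + j) + \<delta> * f q (k + j) else f (k + i) (k + j))"
    using pq' by (intro eq_matI) (auto simp: \<alpha> \<beta> \<delta> algebra_simps)
  ultimately show ?thesis unfolding detf_def by simp
qed

lemma detf_col_sl2: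
  assumes det: "\<alpha> * \<delta> - \<beta> * \<gamma> = 1" and \<gamma>: "\<gamma> \<noteq> 0"
    and pq: "p \<noteq> q" "k \<le> p" "p < k + n" "k \<le> q" "q < k + n"
  shows "detf n k (\<lambda>i j. if j = p then \<alpha> * f i p + \<beta> * f i q else if j = q then \<gamma> * f i p + \<delta> * f i q else f i j) = detf n k f"
  using detf_row_sl2[OF det \<gamma> pq, of "\<lambda>i j. f j i"]
  by (subst (asm) (1 2) detf_transpose[symmetric]) simp

lemma detf_first_column:
  assumes "\<And>i. k < i \<Longrightarrow> i \<le> k + n \<Longrightarrow> f i k = 0"
  shows "detf (Suc n) k f = f k k * detf n (Suc k) f"
proof -
  let ?A = "mat (Suc n) (Suc n) (\<lambda>(i, j). f (k + i) (k + j))"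
  have A: "?A \<in> carrier_mat (Suc n) (Suc n)" by simp
  have "Determinant.det ?A = (\<Sum>i<Suc n. ?A $$ (i, 0) * cofactor ?A i 0)"
    by (rule laplace_expansion_column[OF A]) simp
  also have "\<dots> = ?A $$ (0, 0) * cofactor ?A 0 0"
    using assms by (subst sum.remove[of _ 0]) (auto intro!: sum.neutral)
  also have "mat_delete ?A 0 0 = mat n n (\<lambda>(i, j). f (Suc k + i) (Suc k + j))"
    by (intro eq_matI) (auto simp: mat_delete_def)
  then have "cofactor ?A 0 0 = detf n (Suc k) f" by (simp add: cofactor_def detf_def)
  finally show ?thesis by (simp add: detf_def)
qed

lemma measurable_detf:
  assumes [measurable]: "\<And>i j. k \<le> i \<Longrightarrow> i < k + n \<Longrightarrow> k \<le> j \<Longrightarrow> j < k + n \<Longrightarrow> (\<lambda>x. f x i j) \<in> borel_measurable M"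
  shows "(\<lambda>x. detf n k (f x)) \<in> borel_measurable M"
  unfolding detf_sum
  by (intro borel_measurable_sum borel_measurable_times borel_measurable_const borel_measurable_prod assms)
     (auto simp: permutes_in_image)

section \<open>Rotations of Gaussian arrays\<close>

abbreviation gauss_prod :: "'i set \<Rightarrow> ('i \<Rightarrow> complex) measure" where
  "gauss_prod I \<equiv> PiM I (\<lambda>_. cgauss)"

lemma product_prob_space_cgauss: "product_prob_space (\<lambda>_. cgauss)"
  by (intro product_prob_spaceI prob_space_cgauss)

interpretation G: product_prob_space "\<lambda>_::'i. cgauss" for I :: "'i set"
  by (rule product_prob_space_cgauss)

definition pair_rot :: "complex \<Rightarrow> complex \<Rightarrow> 'i \<Rightarrow> 'i \<Rightarrow> ('i \<Rightarrow> complex) \<Rightarrow> 'i \<Rightarrow> complex" where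
  "pair_rot \<alpha> \<beta> p q x = x(p := \<alpha> * x p + \<beta> * x q, q := - cnj \<beta> * x p + cnj \<alpha> * x q)"

lemma measurable_pair_rot:
  assumes "p \<in> I" "q \<in> I"
  shows "pair_rot \<alpha> \<beta> p q \<in> gauss_prod I \<rightarrow>\<^sub>M gauss_prod I"
proof (rule measurable_PiM_single')
  fix i assume i: "i \<in> I"
  have m: "(\<lambda>x. x j) \<in> borel_measurable (gauss_prod I)" if "j \<in> I" for j
    using measurable_component_singleton[OF that, of "\<lambda>_. cgauss"] measurable_cong_sets[OF refl sets_cgauss] by blast
  note [measurable] = m[OF assms(1)] m[OF assms(2)] m[OF i]
  have "(\<lambda>x. pair_rot \<alpha> \<beta> p q x i) \<in> borel_measurable (gauss_prod I)"
  proof (cases "i = q")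
    case True
    then show ?thesis by (simp add: pair_rot_def)
  next
    case False
    then show ?thesis by (cases "i = p") (simp_all add: pair_rot_def)
  qed
  then show "(\<lambda>x. pair_rot \<alpha> \<beta> p q x i) \<in> gauss_prod I \<rightarrow>\<^sub>M cgauss"
    using measurable_cong_sets[OF refl sets_cgauss] by blast
qed (use assms in \<open>auto simp: pair_rot_def PiE_def extensional_def space_PiM\<close>)

lemma gauss_prod_pair_rot:
  assumes fin: "finite I" and pq: "p \<in> I" "q \<in> I" "p \<noteq> q" and ab: "(cmod \<alpha>)\<^sup>2 + (cmod \<beta>)\<^sup>2 = 1"
  shows "distr (gauss_prod I) (gauss_prod I) (pair_rot \<alpha> \<beta> p q) = gauss_prod I"
proof (rule measure_eqI)
  fix A assume "A \<in> sets (distr (gauss_prod I) (gauss_prod I) (pair_rot \<alpha> \<beta> p q))"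
  then have A[measurable]: "A \<in> sets (gauss_prod I)" by simp
  define J where "J = I - {p, q}"
  have I: "I = insert q (insert p J)" "q \<notin> insert p J" "p \<notin> J" "finite J" using pq fin by (auto simp: J_def)
  have E: "(\<integral>\<^sup>+x. F x \<partial>gauss_prod I) = (\<integral>\<^sup>+z. \<integral>\<^sup>+u. \<integral>\<^sup>+v. F (z(p := u, q := v)) \<partial>cgauss \<partial>cgauss \<partial>gauss_prod J)"
    if F: "F \<in> borel_measurable (gauss_prod I)" for F
  proof -
    have m: "(\<lambda>(z, u). F (z(q := u))) \<in> borel_measurable (gauss_prod (insert p J) \<Otimes>\<^sub>M cgauss)"
      using F unfolding I(1) by (simp add: case_prod_beta)
    have "(\<integral>\<^sup>+x. F x \<partial>gauss_prod I) = (\<integral>\<^sup>+z. (\<integral>\<^sup>+u. F (z(q := u)) \<partial>cgauss) \<partial>gauss_prod (insert p J))"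
      unfolding I(1) using F I by (intro G.product_nn_integral_insert) auto
    also have "\<dots> = (\<integral>\<^sup>+z. (\<integral>\<^sup>+u. (\<integral>\<^sup>+v. F (z(p := u, q := v)) \<partial>cgauss) \<partial>cgauss) \<partial>gauss_prod J)"
    proof (rule G.product_nn_integral_insert)
      show "(\<lambda>z. \<integral>\<^sup>+u. F (z(q := u)) \<partial>cgauss) \<in> borel_measurable (gauss_prod (insert p J))"
        using m by (intro sigma_finite_measure.borel_measurable_nn_integral prob_space_imp_sigma_finite prob_space_cgauss)
    qed (use I in auto)
    finally show ?thesis .
  qed
  have "emeasure (distr (gauss_prod I) (gauss_prod I) (pair_rot \<alpha> \<beta> p q)) A = (\<integral>\<^sup>+x. indicator A x \<partial>distr (gauss_prod I) (gauss_prod I) (pair_rot \<alpha> \<beta> p q))"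
    by (rule nn_integral_indicator[symmetric]) simp
  also have "\<dots> = (\<integral>\<^sup>+x. indicator A (pair_rot \<alpha> \<beta> p q x) \<partial>gauss_prod I)"
    by (rule nn_integral_distr) (use pq measurable_pair_rot in auto)
  also have "\<dots> = (\<integral>\<^sup>+z. \<integral>\<^sup>+u. \<integral>\<^sup>+v. indicator A (pair_rot \<alpha> \<beta> p q (z(p := u, q := v))) \<partial>cgauss \<partial>cgauss \<partial>gauss_prod J)"
    by (rule E) (use measurable_pair_rot[OF pq(1,2)] in measurable)
  also have "\<dots> = (\<integral>\<^sup>+z. \<integral>\<^sup>+u. \<integral>\<^sup>+v. indicator A (z(p := u, q := v)) \<partial>cgauss \<partial>cgauss \<partial>gauss_prod J)"
  proof (rule nn_integral_cong)
    fix z assume z: "z \<in> space (gauss_prod J)"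
    define h :: "complex \<times> complex \<Rightarrow> ennreal" where "h w = indicator A (z(p := fst w, q := snd w))" for w
    have [measurable]: "h \<in> borel_measurable (borel \<Otimes>\<^sub>M borel)"
    proof -
      have "(\<lambda>w. z(p := fst w, q := snd w)) \<in> borel \<Otimes>\<^sub>M borel \<rightarrow>\<^sub>M gauss_prod I"
      proof (rule measurable_PiM_single')
        fix i assume "i \<in> I"
        show "(\<lambda>w. (z(p := fst w, q := snd w)) i) \<in> borel \<Otimes>\<^sub>M borel \<rightarrow>\<^sub>M cgauss"
          by (cases "i = p"; cases "i = q") auto
      qed (use z I in \<open>auto simp: PiE_def extensional_def space_PiM\<close>)
      from measurable_compose[OF this borel_measurable_indicator[OF A]] show ?thesis unfolding h_def .
    qed
    have "pair_rot \<alpha> \<beta> p q (z(p := u, q := v)) = z(p := \<alpha> * u + \<beta> * v, q := - cnj \<beta> * u + cnj \<alpha> * v)" for u v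
      using pq by (auto simp: pair_rot_def)
    then show "(\<integral>\<^sup>+u. \<integral>\<^sup>+v. indicator A (pair_rot \<alpha> \<beta> p q (z(p := u, q := v))) \<partial>cgauss \<partial>cgauss) = (\<integral>\<^sup>+u. \<integral>\<^sup>+v. indicator A (z(p := u, q := v)) \<partial>cgauss \<partial>cgauss)"
      using cgauss_pair_rotate[OF ab, of h] by (simp add: h_def)
  qed
  also have "\<dots> = (\<integral>\<^sup>+x. indicator A x \<partial>gauss_prod I)"
    by (rule E[symmetric]) simp
  finally show "emeasure (distr (gauss_prod I) (gauss_prod I) (pair_rot \<alpha> \<beta> p q)) A = emeasure (gauss_prod I) A" by simp
qed simp

text \<open>The set \<open>C\<close> confines the rotation to the random columns, since the first
  column is frozen when it is conditioned on.\<close>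

definition row_rot :: "complex \<Rightarrow> complex \<Rightarrow> nat \<Rightarrow> nat \<Rightarrow> nat set \<Rightarrow> (nat \<times> nat \<Rightarrow> complex) \<Rightarrow> nat \<times> nat \<Rightarrow> complex" where
  "row_rot \<alpha> \<beta> p q C x = (\<lambda>(i, j). if j \<in> C \<and> i = p then \<alpha> * x (p, j) + \<beta> * x (q, j)
     else if j \<in> C \<and> i = q then - cnj \<beta> * x (p, j) + cnj \<alpha> * x (q, j) else x (i, j))"

definition col_rot :: "complex \<Rightarrow> complex \<Rightarrow> nat \<Rightarrow> nat \<Rightarrow> nat set \<Rightarrow> (nat \<times> nat \<Rightarrow> complex) \<Rightarrow> nat \<times> nat \<Rightarrow> complex" where
  "col_rot \<alpha> \<beta> p q R x = (\<lambda>(i, j). if i \<in> R \<and> j = p then \<alpha> * x (i, p) + \<beta> * x (i, q)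
     else if i \<in> R \<and> j = q then - cnj \<beta> * x (i, p) + cnj \<alpha> * x (i, q) else x (i, j))"

lemma distr_funpow_step:
  assumes "f \<in> M \<rightarrow>\<^sub>M M" "distr M M f = M" "g \<in> M \<rightarrow>\<^sub>M M" "distr M M g = M"
  shows "(\<lambda>x. g (f x)) \<in> M \<rightarrow>\<^sub>M M" "distr M M (\<lambda>x. g (f x)) = M"
  using assms distr_distr[of g M M f M] by (auto simp: comp_def)

text \<open>A row rotation acts on each column separately and is therefore a composition of
  rotations of pairs of coordinates; the induction adds one column at a time.\<close>

lemma gauss_prod_row_rot:
  assumes fin: "finite R" "finite C" and pq: "p \<in> R" "q \<in> R" "p \<noteq> q" and ab: "(cmod \<alpha>)\<^sup>2 + (cmod \<beta>)\<^sup>2 = 1"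
  defines "M \<equiv> gauss_prod (R \<times> C)"
  shows "row_rot \<alpha> \<beta> p q C \<in> M \<rightarrow>\<^sub>M M \<and> distr M M (row_rot \<alpha> \<beta> p q C) = M"
proof -
  have "D \<subseteq> C \<Longrightarrow> row_rot \<alpha> \<beta> p q D \<in> M \<rightarrow>\<^sub>M M \<and> distr M M (row_rot \<alpha> \<beta> p q D) = M" if "finite D" for D
    using that
  proof (induction D rule: finite_induct)
    case empty
    have "row_rot \<alpha> \<beta> p q {} = (\<lambda>x. x)" by (auto simp: row_rot_def)
    then show ?case by (simp add: distr_id2)
  next
    case (insert j D)
    have "row_rot \<alpha> \<beta> p q (insert j D) = (\<lambda>x. pair_rot \<alpha> \<beta> (p, j) (q, j) (row_rot \<alpha> \<beta> p q D x))"
      using insert pq by (auto simp: row_rot_def pair_rot_def fun_eq_iff)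
    moreover have "pair_rot \<alpha> \<beta> (p, j) (q, j) \<in> M \<rightarrow>\<^sub>M M" "distr M M (pair_rot \<alpha> \<beta> (p, j) (q, j)) = M"
      unfolding M_def using insert pq fin ab by (auto intro!: measurable_pair_rot gauss_prod_pair_rot)
    ultimately show ?case using insert distr_funpow_step[of "row_rot \<alpha> \<beta> p q D" M "pair_rot \<alpha> \<beta> (p, j) (q, j)"] by simp
  qed
  from this[OF fin(2) subset_refl] show ?thesis .
qed

lemma gauss_prod_col_rot:
  assumes fin: "finite R" "finite C" and pq: "p \<in> C" "q \<in> C" "p \<noteq> q" and ab: "(cmod \<alpha>)\<^sup>2 + (cmod \<beta>)\<^sup>2 = 1"
  defines "M \<equiv> gauss_prod (R \<times> C)"
  shows "col_rot \<alpha> \<beta> p q R \<in> M \<rightarrow>\<^sub>M M \<and> distr M M (col_rot \<alpha> \<beta> p q R) = M"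
proof -
  have "D \<subseteq> R \<Longrightarrow> col_rot \<alpha> \<beta> p q D \<in> M \<rightarrow>\<^sub>M M \<and> distr M M (col_rot \<alpha> \<beta> p q D) = M" if "finite D" for D
    using that
  proof (induction D rule: finite_induct)
    case empty
    have "col_rot \<alpha> \<beta> p q {} = (\<lambda>x. x)" by (auto simp: col_rot_def)
    then show ?case by (simp add: distr_id2)
  next
    case (insert i D)
    have "col_rot \<alpha> \<beta> p q (insert i D) = (\<lambda>x. pair_rot \<alpha> \<beta> (i, p) (i, q) (col_rot \<alpha> \<beta> p q D x))"
      using insert pq by (auto simp: col_rot_def pair_rot_def fun_eq_iff)
    moreover have "pair_rot \<alpha> \<beta> (i, p) (i, q) \<in> M \<rightarrow>\<^sub>M M" "distr M M (pair_rot \<alpha> \<beta> (i, p) (i, q)) = M"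
      unfolding M_def using insert pq fin ab by (auto intro!: measurable_pair_rot gauss_prod_pair_rot)
    ultimately show ?case using insert distr_funpow_step[of "col_rot \<alpha> \<beta> p q D" M "pair_rot \<alpha> \<beta> (i, p) (i, q)"] by simp
  qed
  from this[OF fin(1) subset_refl] show ?thesis .
qed

text \<open>The power \<open>x\<^bsup>s\<^esup>\<close>; the value \<open>0\<close> at \<open>0\<close> makes it multiplicative on \<open>[0, \<infinity>)\<close>.\<close>
definition pw :: "complex \<Rightarrow> real \<Rightarrow> complex" where
  "pw s x = (if x = 0 then 0 else exp (s * of_real (ln x)))"

lemma pw_mult: "x \<ge> 0 \<Longrightarrow> y \<ge> 0 \<Longrightarrow> pw s (x * y) = pw s x * pw s y"
  by (auto simp: pw_def ln_mult exp_add[symmetric] algebra_simps)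

lemma pw_0 [simp]: "pw s 0 = 0"
  by (simp add: pw_def)

lemma norm_pw_le: "Re s = 0 \<Longrightarrow> norm (pw s x) \<le> 1"
  by (auto simp: pw_def norm_exp_eq_Re)

lemma measurable_pw [measurable]: "pw s \<in> borel_measurable borel"
  unfolding pw_def[abs_def] by measurable

definition shiftm :: "nat \<Rightarrow> complex \<Rightarrow> complex \<Rightarrow> nat \<Rightarrow> nat \<Rightarrow> complex" where
  "shiftm k c w i j = (if i = j then (if i = k then c else w) else 0)"

definition cornerdet :: "nat \<Rightarrow> nat \<Rightarrow> complex \<Rightarrow> complex \<Rightarrow> (nat \<times> nat \<Rightarrow> complex) \<Rightarrow> complex" where
  "cornerdet n k c w x = detf n k (\<lambda>i j. x (i, j) - shiftm k c w i j)"

text \<open>Here \<open>a\<close> is the first column after its shift has been subtracted; only the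
  other columns are random. This is the determinant conditioned on the first column.\<close>

definition columndet :: "nat \<Rightarrow> nat \<Rightarrow> complex \<Rightarrow> (nat \<Rightarrow> complex) \<Rightarrow> (nat \<times> nat \<Rightarrow> complex) \<Rightarrow> complex" where
  "columndet n k w a x = detf n k (\<lambda>i j. if j = k then a i else x (i, j) - (if i = j then w else 0))"

lemma measurable_gauss_component: "e \<in> I \<Longrightarrow> (\<lambda>x. x e) \<in> borel_measurable (gauss_prod I)"
  using measurable_component_singleton[of e I "\<lambda>_. cgauss"] measurable_cong_sets[OF refl sets_cgauss] by blast

lemma measurable_cornerdet:
  assumes "{k..<k + n} \<times> {k..<k + n} \<subseteq> I"
  shows "cornerdet n k c w \<in> borel_measurable (gauss_prod I)"
  unfolding cornerdet_def[abs_def] using assms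
  by (intro measurable_detf borel_measurable_diff borel_measurable_const measurable_gauss_component) auto

lemma measurable_columndet:
  assumes "{k..<k + n} \<times> {Suc k..<k + n} \<subseteq> I"
  shows "columndet n k w a \<in> borel_measurable (gauss_prod I)"
  unfolding columndet_def[abs_def]
proof (rule measurable_detf)
  fix i j assume "k \<le> i" "i < k + n" "k \<le> j" "j < k + n"
  then show "(\<lambda>x. if j = k then a i else x (i, j) - (if i = j then w else 0)) \<in> borel_measurable (gauss_prod I)"
    using assms by (cases "j = k") (auto intro!: borel_measurable_diff borel_measurable_const measurable_gauss_component)
qed

lemma cmod_pair_complex:
  assumes "(cmod \<alpha>)\<^sup>2 + (cmod \<beta>)\<^sup>2 = 1"
  shows "\<alpha> * cnj \<alpha> + \<beta> * cnj \<beta> = 1"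
  using assms by (metis complex_norm_square of_real_1 of_real_add)

lemma columndet_conj:
  assumes ab: "(cmod \<alpha>)\<^sup>2 + (cmod \<beta>)\<^sup>2 = 1" and b: "\<beta> \<noteq> 0"
    and pq: "p \<in> {Suc k..<k + n}" "q \<in> {Suc k..<k + n}" "p \<noteq> q"
  shows "columndet n k w (a(p := \<alpha> * a p + \<beta> * a q, q := - cnj \<beta> * a p + cnj \<alpha> * a q))
      (col_rot (cnj \<alpha>) (cnj \<beta>) p q {k..<k + n} (row_rot \<alpha> \<beta> p q {Suc k..<k + n} x)) = columndet n k w a x"
proof -
  note ab' = cmod_pair_complex[OF ab]
  let ?f = "\<lambda>i j. if j = k then a i else x (i, j) - (if i = j then w else 0)"
  let ?g = "\<lambda>i j. if i = p then \<alpha> * ?f p j + \<beta> * ?f q j else if i = q then - cnj \<beta> * ?f p j + cnj \<alpha> * ?f q j else ?f i j"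
  let ?h = "\<lambda>i j. if j = p then cnj \<alpha> * ?g i p + cnj \<beta> * ?g i q else if j = q then - \<beta> * ?g i p + \<alpha> * ?g i q else ?g i j"
  have "detf n k ?g = detf n k ?f"
    using ab' b pq by (intro detf_row_sl2) (auto simp: algebra_simps)
  moreover have "detf n k ?h = detf n k ?g"
    using ab' b pq by (intro detf_col_sl2) (auto simp: algebra_simps)
  moreover have "columndet n k w (a(p := \<alpha> * a p + \<beta> * a q, q := - cnj \<beta> * a p + cnj \<alpha> * a q))
      (col_rot (cnj \<alpha>) (cnj \<beta>) p q {k..<k + n} (row_rot \<alpha> \<beta> p q {Suc k..<k + n} x)) = detf n k ?h"
    unfolding columndet_def
  proof (rule detf_cong)
    fix i j assume ij: "k \<le> i" "i < k + n" "k \<le> j" "j < k + n"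
    \<comment> \<open>On the diagonal the conjugated shift is \<open>w\<close> times a sum of two
      squared moduli, which is one.\<close>
    have w: "w = \<alpha> * cnj \<alpha> * w + \<beta> * cnj \<beta> * w" using ab' by (simp add: distrib_right[symmetric])
    have pk: "p \<noteq> k" "q \<noteq> k" "p \<in> {Suc k..<k + n}" "q \<in> {Suc k..<k + n}" "i \<in> {k..<k + n}" using pq ij by auto
    have jC: "j \<in> {Suc k..<k + n}" if "j \<noteq> k" using that ij by auto
    show "(if j = k then (a(p := \<alpha> * a p + \<beta> * a q, q := - cnj \<beta> * a p + cnj \<alpha> * a q)) i
        else col_rot (cnj \<alpha>) (cnj \<beta>) p q {k..<k + n} (row_rot \<alpha> \<beta> p q {Suc k..<k + n} x) (i, j) - (if i = j then w else 0)) = ?h i j"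
    proof (cases "j = k")
      case True
      then show ?thesis using pk pq(3) by simp
    next
      case False
      note jC = jC[OF False]
      show ?thesis
        using False jC pk pq(3) w
        by (cases "j = p"; cases "j = q"; cases "i = p"; cases "i = q")
           (simp_all add: col_rot_def row_rot_def algebra_simps)
    qed
  qed
  ultimately show ?thesis by (simp add: columndet_def)
qed

section \<open>Expectations conditioned on the first column\<close>

locale imag_power =
  fixes s :: complex
  assumes Re_s: "Re s = 0"
begin

definition colmean :: "nat \<Rightarrow> nat \<Rightarrow> complex \<Rightarrow> (nat \<Rightarrow> complex) \<Rightarrow> complex" where
  "colmean n k w a = (\<integral>x. pw s ((cmod (columndet n k w a x))\<^sup>2) \<partial>gauss_prod ({k..<k + n} \<times> {Suc k..<k + n}))"

lemma colmean_rotate: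
  assumes ab: "(cmod \<alpha>)\<^sup>2 + (cmod \<beta>)\<^sup>2 = 1" and b: "\<beta> \<noteq> 0"
    and pq: "p \<in> {Suc k..<k + n}" "q \<in> {Suc k..<k + n}" "p \<noteq> q"
  shows "colmean n k w (a(p := \<alpha> * a p + \<beta> * a q, q := - cnj \<beta> * a p + cnj \<alpha> * a q)) = colmean n k w a"
proof -
  let ?R = "{k..<k + n}" and ?C = "{Suc k..<k + n}"
  let ?M = "gauss_prod (?R \<times> ?C)" and ?a = "a(p := \<alpha> * a p + \<beta> * a q, q := - cnj \<beta> * a p + cnj \<alpha> * a q)"
  let ?T = "\<lambda>x. col_rot (cnj \<alpha>) (cnj \<beta>) p q ?R (row_rot \<alpha> \<beta> p q ?C x)"
  have T: "?T \<in> ?M \<rightarrow>\<^sub>M ?M" "distr ?M ?M ?T = ?M"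
    using distr_funpow_step[of "row_rot \<alpha> \<beta> p q ?C" ?M "col_rot (cnj \<alpha>) (cnj \<beta>) p q ?R"]
      gauss_prod_row_rot[of ?R ?C p q \<alpha> \<beta>] gauss_prod_col_rot[of ?R ?C p q "cnj \<alpha>" "cnj \<beta>"] pq ab by auto
  have [measurable]: "columndet n k w b \<in> borel_measurable ?M" for b by (rule measurable_columndet) simp
  have "colmean n k w ?a = (\<integral>x. pw s ((cmod (columndet n k w ?a x))\<^sup>2) \<partial>distr ?M ?M ?T)"
    unfolding T(2) colmean_def ..
  also have "\<dots> = (\<integral>x. pw s ((cmod (columndet n k w ?a (?T x)))\<^sup>2) \<partial>?M)"
    by (rule integral_distr[OF T(1)]) measurable
  also have "\<dots> = colmean n k w a"
    unfolding columndet_conj[OF ab b pq] colmean_def ..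
  finally show ?thesis .
qed

lemma givens_coefficients:
  fixes u v :: complex
  assumes v: "v \<noteq> 0"
  defines "t \<equiv> sqrt ((cmod u)\<^sup>2 + (cmod v)\<^sup>2)"
  defines "\<alpha> \<equiv> cnj u / of_real t" and "\<beta> \<equiv> cnj v / of_real t"
  shows "t > 0" "(cmod \<alpha>)\<^sup>2 + (cmod \<beta>)\<^sup>2 = 1" "\<beta> \<noteq> 0" "\<alpha> * u + \<beta> * v = of_real t" "- cnj \<beta> * u + cnj \<alpha> * v = 0"
    "t\<^sup>2 = (cmod u)\<^sup>2 + (cmod v)\<^sup>2" "(cmod \<alpha>)\<^sup>2 = (cmod u)\<^sup>2 / t\<^sup>2"
proof -
  show t: "t > 0" using v by (simp add: t_def add_nonneg_pos)
  show t2: "t\<^sup>2 = (cmod u)\<^sup>2 + (cmod v)\<^sup>2" by (simp add: t_def)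
  show "(cmod \<alpha>)\<^sup>2 = (cmod u)\<^sup>2 / t\<^sup>2" using t by (simp add: \<alpha>_def norm_divide power_divide)
  have "(cmod \<beta>)\<^sup>2 = (cmod v)\<^sup>2 / t\<^sup>2" using t by (simp add: \<beta>_def norm_divide power_divide)
  with \<open>(cmod \<alpha>)\<^sup>2 = (cmod u)\<^sup>2 / t\<^sup>2\<close> show "(cmod \<alpha>)\<^sup>2 + (cmod \<beta>)\<^sup>2 = 1"
    using t2 v by (simp add: add_divide_distrib[symmetric])
  show "\<beta> \<noteq> 0" using t v by (simp add: \<beta>_def)
  have "cnj u * u + cnj v * v = of_real t * of_real t"
    using t2 by (metis complex_norm_square mult.commute of_real_add of_real_mult power2_eq_square)
  then show "\<alpha> * u + \<beta> * v = of_real t"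
    using t by (simp add: \<alpha>_def \<beta>_def add_divide_distrib[symmetric])
  show "- cnj \<beta> * u + cnj \<alpha> * v = 0" using t by (simp add: \<alpha>_def \<beta>_def)
qed

text \<open>Conjugations collect the part of the column below the corner in the single entry
  \<open>Suc k\<close>. A last rotation of rows \<open>k\<close> and \<open>Suc k\<close> clears
  that entry as well and the determinant factors. This rotation is not a conjugation: it multiplies
  the shift at \<open>Suc k\<close> by \<open>cnj \<alpha>\<close>, so the smaller determinant has a
  corner shift of its own, of squared modulus
  \<open>\<bar>w\<bar>\<^sup>2 * \<bar>a k\<bar>\<^sup>2 / S a\<close>.\<close>

lemma colmean_eq:
  assumes n: "n \<ge> 1"
    and H: "\<And>c. (\<integral>x. pw s ((cmod (cornerdet n (Suc k) c w x))\<^sup>2) \<partial>gauss_prod ({Suc k..<Suc k + n} \<times> {Suc k..<Suc k + n})) = J ((cmod c)\<^sup>2)"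
  defines "S \<equiv> \<lambda>a. \<Sum>i\<in>{k..<k + Suc n}. (cmod (a i))\<^sup>2"
  shows "colmean (Suc n) k w a = pw s (S a) * J ((cmod w)\<^sup>2 * (cmod (a k))\<^sup>2 / S a)"
proof -
  let ?R = "{k..<k + Suc n}" and ?C = "{Suc k..<k + Suc n}"
  let ?M = "gauss_prod (?R \<times> ?C)"
  let ?g = "\<lambda>c x. pw s ((cmod (cornerdet n (Suc k) c w x))\<^sup>2)"
  have RC: "?R = insert k ?C" by auto
  have CC: "{Suc k..<Suc k + n} = ?C" by simp
  have [measurable]: "columndet (Suc n) k w b \<in> borel_measurable ?M" for b by (rule measurable_columndet) simp
  have mc: "cornerdet n (Suc k) c w \<in> borel_measurable (gauss_prod (?C \<times> ?C))" for c
    by (rule measurable_cornerdet) auto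
  have [measurable]: "cornerdet n (Suc k) c w \<in> borel_measurable ?M" for c
    by (rule measurable_cornerdet) auto
  \<comment> \<open>The smaller determinant does not look at row \<open>k\<close>, so the larger
    array may be restricted to its marginal.\<close>
  have marg: "(\<integral>x. ?g c x \<partial>?M) = J ((cmod c)\<^sup>2)" for c
  proof -
    have d: "distr ?M (gauss_prod (?C \<times> ?C)) (\<lambda>x. restrict x (?C \<times> ?C)) = gauss_prod (?C \<times> ?C)"
      by (rule G.distr_PiM_restrict_finite) auto
    have "J ((cmod c)\<^sup>2) = (\<integral>x. ?g c x \<partial>distr ?M (gauss_prod (?C \<times> ?C)) (\<lambda>x. restrict x (?C \<times> ?C)))"
      unfolding d using H[of c] unfolding CC by simp
    also have "\<dots> = (\<integral>x. ?g c (restrict x (?C \<times> ?C)) \<partial>?M)"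
      using mc by (intro integral_distr measurable_restrict_subset) auto
    finally have "J ((cmod c)\<^sup>2) = (\<integral>x. ?g c (restrict x (?C \<times> ?C)) \<partial>?M)" .
    moreover have "cornerdet n (Suc k) c w (restrict x (?C \<times> ?C)) = cornerdet n (Suc k) c w x" for x
      unfolding cornerdet_def by (rule detf_cong) auto
    ultimately show ?thesis by simp
  qed
  have S0: "S a \<ge> 0" for a by (simp add: S_def sum_nonneg)
  have base: "colmean (Suc n) k w a = pw s (S a) * J ((cmod w)\<^sup>2 * (cmod (a k))\<^sup>2 / S a)"
    if z: "\<And>i. i \<in> {Suc (Suc k)..<k + Suc n} \<Longrightarrow> a i = 0" for a
  proof -
    have kS: "?R = insert k (insert (Suc k) {Suc (Suc k)..<k + Suc n})" using n by auto
    have Sa: "S a = (cmod (a k))\<^sup>2 + (cmod (a (Suc k)))\<^sup>2"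
      unfolding S_def kS using z by (simp add: sum.neutral)
    show ?thesis
    proof (cases "a (Suc k) = 0")
      case True
      have "columndet (Suc n) k w a x = a k * cornerdet n (Suc k) w w x" for x
      proof -
        have "columndet (Suc n) k w a x = a k * detf n (Suc k) (\<lambda>i j. if j = k then a i else x (i, j) - (if i = j then w else 0))"
          unfolding columndet_def
        proof (subst detf_first_column)
          fix i assume "k < i" "i \<le> k + n"
          then show "(if k = k then a i else x (i, k) - (if i = k then w else 0)) = 0"
            using z[of i] True by (cases "i = Suc k") auto
        qed simp
        also have "detf n (Suc k) (\<lambda>i j. if j = k then a i else x (i, j) - (if i = j then w else 0)) = cornerdet n (Suc k) w w x"
          unfolding cornerdet_def by (rule detf_cong) (auto simp: shiftm_def)
        finally show ?thesis .
      qed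
      then have "colmean (Suc n) k w a = pw s ((cmod (a k))\<^sup>2) * (\<integral>x. ?g w x \<partial>?M)"
        by (simp add: colmean_def norm_mult power_mult_distrib pw_mult)
      then have "colmean (Suc n) k w a = pw s ((cmod (a k))\<^sup>2) * J ((cmod w)\<^sup>2)" by (simp only: marg)
      \<comment> \<open>If the whole column vanishes, both sides are \<open>0\<close> because
        \<open>pw s 0 = 0\<close>; otherwise the quotient of squared moduli is one.\<close>
      then show ?thesis using True by (cases "a k = 0") (simp_all add: Sa)
    next
      case False
      define t where "t = sqrt ((cmod (a k))\<^sup>2 + (cmod (a (Suc k)))\<^sup>2)"
      define \<alpha> \<beta> where "\<alpha> = cnj (a k) / of_real t" and "\<beta> = cnj (a (Suc k)) / of_real t"
      note g = givens_coefficients[OF False, of "a k", folded t_def, folded \<alpha>_def \<beta>_def]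
      have kp: "k \<in> ?R" "Suc k \<in> ?R" "k \<noteq> Suc k" using n by auto
      let ?T = "row_rot \<alpha> \<beta> k (Suc k) ?C"
      have T: "?T \<in> ?M \<rightarrow>\<^sub>M ?M" "distr ?M ?M ?T = ?M"
        using gauss_prod_row_rot[OF _ _ kp g(2), of ?C] by auto
      have "columndet (Suc n) k w a x = of_real t * cornerdet n (Suc k) (w * cnj \<alpha>) w (?T x)" for x
      proof -
        let ?f = "\<lambda>i j. if j = k then a i else x (i, j) - (if i = j then w else 0)"
        let ?h = "\<lambda>i j. if i = k then \<alpha> * ?f k j + \<beta> * ?f (Suc k) j else if i = Suc k then - cnj \<beta> * ?f k j + cnj \<alpha> * ?f (Suc k) j else ?f i j"
        have "columndet (Suc n) k w a x = detf (Suc n) k ?h"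
          unfolding columndet_def using cmod_pair_complex[OF g(2)] g(3) n
          by (intro detf_row_sl2[symmetric]) (auto simp: algebra_simps)
        also have "\<dots> = ?h k k * detf n (Suc k) ?h"
        proof (rule detf_first_column)
          fix i assume i: "k < i" "i \<le> k + n"
          then show "?h i k = 0"
            using z[of i] g(5) by (cases "i = Suc k") auto
        qed
        also have "?h k k = of_real t" using g(4) by simp
        \<comment> \<open>Row \<open>k\<close> has dropped out of the minor. In row
          \<open>Suc k\<close> the diagonal entry retains its shift multiplied by
          \<open>cnj \<alpha>\<close>, while the rotated Gaussian entries are those of
          \<open>?T x\<close>.\<close>
        also have "detf n (Suc k) ?h = cornerdet n (Suc k) (w * cnj \<alpha>) w (?T x)"
          unfolding cornerdet_def
          by (rule detf_cong) (auto simp: shiftm_def row_rot_def algebra_simps)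
        finally show ?thesis .
      qed
      then have "colmean (Suc n) k w a = pw s (t\<^sup>2) * (\<integral>x. ?g (w * cnj \<alpha>) (?T x) \<partial>?M)"
        using g(1) by (simp add: colmean_def norm_mult power_mult_distrib pw_mult)
      also have "(\<integral>x. ?g (w * cnj \<alpha>) (?T x) \<partial>?M) = (\<integral>x. ?g (w * cnj \<alpha>) x \<partial>distr ?M ?M ?T)"
        by (rule integral_distr[symmetric, OF T(1)]) measurable
      also have "\<dots> = J ((cmod w)\<^sup>2 * (cmod \<alpha>)\<^sup>2)"
        unfolding T(2) marg by (simp add: norm_mult power_mult_distrib)
      finally show ?thesis using g(6,7) by (simp add: Sa)
    qed
  qed
  show ?thesis
  \<comment> \<open>Each Givens conjugation moves the entry at \<open>q\<close> into position
    \<open>Suc k\<close> and lowers the number of nonzero entries further down; \<open>base\<close>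
    takes over when none is left.\<close>
  proof (induction "card {i \<in> {Suc (Suc k)..<k + Suc n}. a i \<noteq> 0}" arbitrary: a rule: less_induct)
    case less
    show ?case
    proof (cases "\<exists>q\<in>{Suc (Suc k)..<k + Suc n}. a q \<noteq> 0")
      case False
      then show ?thesis by (intro base) auto
    next
      case True
      then obtain q where q: "q \<in> {Suc (Suc k)..<k + Suc n}" "a q \<noteq> 0" by blast
      define p where "p = Suc k"
      define t where "t = sqrt ((cmod (a p))\<^sup>2 + (cmod (a q))\<^sup>2)"
      define \<alpha> \<beta> where "\<alpha> = cnj (a p) / of_real t" and "\<beta> = cnj (a q) / of_real t"
      note g = givens_coefficients[OF q(2), of "a p", folded t_def, folded \<alpha>_def \<beta>_def]
      have pq: "p \<in> ?C" "q \<in> ?C" "p \<noteq> q" using q n by (auto simp: p_def)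
      define b where "b = a(p := \<alpha> * a p + \<beta> * a q, q := - cnj \<beta> * a p + cnj \<alpha> * a q)"
      have bk: "b p = of_real t" "b q = 0" "\<And>i. i \<noteq> p \<Longrightarrow> i \<noteq> q \<Longrightarrow> b i = a i" "b k = a k"
        using pq g(4,5) q by (auto simp: b_def p_def)
      have "{i \<in> {Suc (Suc k)..<k + Suc n}. b i \<noteq> 0} \<subset> {i \<in> {Suc (Suc k)..<k + Suc n}. a i \<noteq> 0}"
      proof
        show "{i \<in> {Suc (Suc k)..<k + Suc n}. b i \<noteq> 0} \<subseteq> {i \<in> {Suc (Suc k)..<k + Suc n}. a i \<noteq> 0}"
        proof
          fix i assume i: "i \<in> {i \<in> {Suc (Suc k)..<k + Suc n}. b i \<noteq> 0}"
          then have "i \<noteq> p" "i \<noteq> q" using bk by (auto simp: p_def)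
          then show "i \<in> {i \<in> {Suc (Suc k)..<k + Suc n}. a i \<noteq> 0}" using i bk by auto
        qed
        show "{i \<in> {Suc (Suc k)..<k + Suc n}. b i \<noteq> 0} \<noteq> {i \<in> {Suc (Suc k)..<k + Suc n}. a i \<noteq> 0}"
          using q bk(2) by auto
      qed
      then have "card {i \<in> {Suc (Suc k)..<k + Suc n}. b i \<noteq> 0} < card {i \<in> {Suc (Suc k)..<k + Suc n}. a i \<noteq> 0}"
        by (intro psubset_card_mono) auto
      then have "colmean (Suc n) k w b = pw s (S b) * J ((cmod w)\<^sup>2 * (cmod (b k))\<^sup>2 / S b)" by (rule less)
      moreover have "S b = S a"
      proof -
        have R: "?R = insert p (insert q (?R - {p, q}))" using pq by auto
        have "S c = (cmod (c p))\<^sup>2 + (cmod (c q))\<^sup>2 + (\<Sum>i\<in>?R - {p, q}. (cmod (c i))\<^sup>2)" for c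
          unfolding S_def by (subst R) (use pq in simp)
        moreover have "(\<Sum>i\<in>?R - {p, q}. (cmod (b i))\<^sup>2) = (\<Sum>i\<in>?R - {p, q}. (cmod (a i))\<^sup>2)"
          using bk by (intro sum.cong) auto
        ultimately show ?thesis using bk g(6) by simp
      qed
      moreover have "colmean (Suc n) k w b = colmean (Suc n) k w a"
        unfolding b_def by (rule colmean_rotate[OF g(2,3) pq])
      ultimately show ?thesis using bk(4) by simp
    qed
  qed
qed

end

text \<open>Squared moduli of independent standard complex Gaussians are independent exponential
  variables, so their sum is Erlang; the index of \<open>erlang_density\<close> is one less than the
  number of summands.\<close>

lemma integral_cgauss_sum_squares:
  fixes g :: "real \<Rightarrow> complex"
  assumes fin: "finite I" and ne: "I \<noteq> {}" and [measurable]: "g \<in> borel_measurable borel"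
  shows "(\<integral>x. g (\<Sum>e\<in>I. (cmod (x e))\<^sup>2) \<partial>gauss_prod I) = (\<integral>t. erlang_density (card I - 1) 1 t *\<^sub>R g t \<partial>lborel)"
proof -
  have m[measurable]: "(\<lambda>x. x e) \<in> borel_measurable (gauss_prod I)" if "e \<in> I" for e
    using measurable_gauss_component[OF that] .
  have comp: "distr (gauss_prod I) borel (\<lambda>x. x e) = cgauss" if "e \<in> I" for e
    using distr_PiM_component[OF prob_space_cgauss that] by (metis distr_cong sets_cgauss)
  have dist: "distributed (gauss_prod I) lborel (\<lambda>x. (cmod (x e))\<^sup>2) (exponential_density 1)" if "e \<in> I" for e
  proof -
    have "distr (gauss_prod I) lborel (\<lambda>x. (cmod (x e))\<^sup>2) = distr (distr (gauss_prod I) borel (\<lambda>x. x e)) lborel (\<lambda>w. (cmod w)\<^sup>2)"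
      using m[OF that] by (subst distr_distr) (auto simp: comp_def)
    also have "\<dots> = density lborel (exponential_density 1)"
      unfolding comp[OF that] using distributed_cgauss_norm_square by (simp add: distributed_def)
    finally show ?thesis using m[OF that] by (auto simp: distributed_def)
  qed
  have "prob_space.indep_vars (gauss_prod I) (\<lambda>_. borel) (\<lambda>e x. x e) I"
  proof (subst G.P.indep_vars_iff_distr_eq_PiM'[OF ne])
    show "e \<in> I \<Longrightarrow> (\<lambda>x. x e) \<in> borel_measurable (gauss_prod I)" for e by (rule m)
    have "distr (gauss_prod I) (PiM I (\<lambda>_. borel)) (\<lambda>x. \<lambda>i\<in>I. x i) = distr (gauss_prod I) (gauss_prod I) (\<lambda>x. x)"
      by (intro distr_cong) (auto simp: space_PiM PiE_def extensional_def fun_eq_iff restrict_def intro!: sets_PiM_cong)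
    also have "\<dots> = PiM I (\<lambda>i. distr (gauss_prod I) borel (\<lambda>x. x i))"
      by (simp add: distr_id2 comp cong: PiM_cong)
    finally show "distr (gauss_prod I) (PiM I (\<lambda>_. borel)) (\<lambda>x. \<lambda>i\<in>I. x i) = PiM I (\<lambda>i. distr (gauss_prod I) borel (\<lambda>x. x i))" .
  qed
  then have "prob_space.indep_vars (gauss_prod I) (\<lambda>_. borel) (\<lambda>e x. (cmod (x e))\<^sup>2) I"
    by (rule G.P.indep_vars_compose2) auto
  then have D: "distributed (gauss_prod I) lborel (\<lambda>x. \<Sum>e\<in>I. (cmod (x e))\<^sup>2) (erlang_density (card I - 1) 1)"
    using G.P.exponential_distributed_sum[OF fin ne, where X = "\<lambda>e x. (cmod (x e))\<^sup>2" and l = 1] dist by simp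
  have "(\<integral>x. g (\<Sum>e\<in>I. (cmod (x e))\<^sup>2) \<partial>gauss_prod I) = (\<integral>t. g t \<partial>distr (gauss_prod I) lborel (\<lambda>x. \<Sum>e\<in>I. (cmod (x e))\<^sup>2))"
    by (rule integral_distr[symmetric]) (auto intro!: borel_measurable_sum borel_measurable_power borel_measurable_norm m)
  also have "\<dots> = (\<integral>t. g t \<partial>density lborel (erlang_density (card I - 1) 1))"
    using D by (simp add: distributed_def)
  also have "\<dots> = (\<integral>t. erlang_density (card I - 1) 1 t *\<^sub>R g t \<partial>lborel)"
    by (rule integral_density) auto
  finally show ?thesis .
qed

context imag_power
begin

text \<open>After integration over the other columns only two features of the first column remain:
  the shifted corner entry \<open>\<zeta> - c\<close> and the total \<open>\<beta>\<close> of the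
  \<open>n\<close> squared moduli below it. The bound on \<open>J\<close> supplies the integrability
  for Fubini.\<close>

lemma cornerdet_step:
  assumes n: "n \<ge> 1"
    and H: "\<And>c. (\<integral>x. pw s ((cmod (cornerdet n (Suc k) c w x))\<^sup>2) \<partial>gauss_prod ({Suc k..<Suc k + n} \<times> {Suc k..<Suc k + n})) = J ((cmod c)\<^sup>2)"
    and J: "J \<in> borel_measurable borel" "\<And>x. norm (J x) \<le> 1"
  shows "(\<integral>x. pw s ((cmod (cornerdet (Suc n) k c w x))\<^sup>2) \<partial>gauss_prod ({k..<k + Suc n} \<times> {k..<k + Suc n}))
    = (\<integral>\<beta>. erlang_density (n - 1) 1 \<beta> *\<^sub>R (\<integral>\<zeta>. pw s ((cmod (\<zeta> - c))\<^sup>2 + \<beta>) * J ((cmod w)\<^sup>2 * (cmod (\<zeta> - c))\<^sup>2 / ((cmod (\<zeta> - c))\<^sup>2 + \<beta>)) \<partial>cgauss) \<partial>lborel)"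
proof -
  let ?R = "{k..<k + Suc n}" and ?C = "{Suc k..<k + Suc n}"
  let ?f = "\<lambda>x. pw s ((cmod (cornerdet (Suc n) k c w x))\<^sup>2)"
  note [measurable] = J(1)
  have RR: "?R \<times> ?R = (?R \<times> {k}) \<union> (?R \<times> ?C)" by auto
  have [measurable]: "cornerdet (Suc n) k c w \<in> borel_measurable (gauss_prod (?R \<times> ?R))"
    by (rule measurable_cornerdet) auto
  have intf: "integrable (gauss_prod (?R \<times> ?R)) ?f"
  proof (rule G.P.integrable_const_bound[where B = 1])
    show "?f \<in> borel_measurable (gauss_prod (?R \<times> ?R))" by measurable
  qed (auto intro!: norm_pw_le Re_s)
  define a where "a y i = y (i, k) - (if i = k then c else 0)" for y :: "nat \<times> nat \<Rightarrow> complex" and i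
  have "(\<integral>x. ?f x \<partial>gauss_prod (?R \<times> ?R)) = (\<integral>y. (\<integral>z. ?f (merge (?R \<times> {k}) (?R \<times> ?C) (y, z)) \<partial>gauss_prod (?R \<times> ?C)) \<partial>gauss_prod (?R \<times> {k}))"
    using intf unfolding RR by (intro G.product_integral_fold) auto
  also have "\<dots> = (\<integral>y. colmean (Suc n) k w (a y) \<partial>gauss_prod (?R \<times> {k}))"
  proof -
    have "cornerdet (Suc n) k c w (merge (?R \<times> {k}) (?R \<times> ?C) (y, z)) = columndet (Suc n) k w (a y) z" for y z
      unfolding cornerdet_def columndet_def
      by (rule detf_cong) (auto simp: merge_def shiftm_def a_def)
    then show ?thesis by (simp add: colmean_def)
  qed
  also have "\<dots> = (\<integral>y. pw s (\<Sum>i\<in>?R. (cmod (a y i))\<^sup>2) * J ((cmod w)\<^sup>2 * (cmod (a y k))\<^sup>2 / (\<Sum>i\<in>?R. (cmod (a y i))\<^sup>2)) \<partial>gauss_prod (?R \<times> {k}))"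
    using colmean_eq[OF n H] by simp
  also have "\<dots> = (\<integral>y. (\<lambda>u v. pw s ((cmod (u - c))\<^sup>2 + v) * J ((cmod w)\<^sup>2 * (cmod (u - c))\<^sup>2 / ((cmod (u - c))\<^sup>2 + v))) (y (k, k)) (\<Sum>e\<in>?C \<times> {k}. (cmod (y e))\<^sup>2) \<partial>gauss_prod (?R \<times> {k}))"
  proof -
    have "(\<Sum>i\<in>?R. (cmod (a y i))\<^sup>2) = (cmod (y (k, k) - c))\<^sup>2 + (\<Sum>e\<in>?C \<times> {k}. (cmod (y e))\<^sup>2)" for y
    proof -
      have R: "?R = insert k ?C" by auto
      have "(\<Sum>e\<in>?C \<times> {k}. (cmod (y e))\<^sup>2) = (\<Sum>i\<in>?C. (cmod (y (i, k)))\<^sup>2)"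
      proof -
        have "?C \<times> {k} = (\<lambda>i. (i, k)) ` ?C" by auto
        then show ?thesis by (simp add: sum.reindex inj_on_def)
      qed
      also have "\<dots> = (\<Sum>i\<in>?C. (cmod (a y i))\<^sup>2)" by (intro sum.cong) (auto simp: a_def)
      finally show ?thesis by (subst R) (simp add: a_def)
    qed
    then show ?thesis by (simp add: a_def)
  qed
  also have "?R \<times> {k} = insert (k, k) (?C \<times> {k})" by auto
  also have "(\<integral>y. (\<lambda>u v. pw s ((cmod (u - c))\<^sup>2 + v) * J ((cmod w)\<^sup>2 * (cmod (u - c))\<^sup>2 / ((cmod (u - c))\<^sup>2 + v))) (y (k, k)) (\<Sum>e\<in>?C \<times> {k}. (cmod (y e))\<^sup>2) \<partial>gauss_prod (insert (k, k) (?C \<times> {k})))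
    = (\<integral>y. (\<integral>\<zeta>. pw s ((cmod (\<zeta> - c))\<^sup>2 + (\<Sum>e\<in>?C \<times> {k}. (cmod (y e))\<^sup>2)) * J ((cmod w)\<^sup>2 * (cmod (\<zeta> - c))\<^sup>2 / ((cmod (\<zeta> - c))\<^sup>2 + (\<Sum>e\<in>?C \<times> {k}. (cmod (y e))\<^sup>2))) \<partial>cgauss) \<partial>gauss_prod (?C \<times> {k}))"
  proof (subst G.product_integral_insert)
    have [measurable]: "(\<lambda>y. y e) \<in> borel_measurable (gauss_prod (insert (k, k) (?C \<times> {k})))" if "e \<in> insert (k, k) (?C \<times> {k})" for e
      by (rule measurable_gauss_component[OF that])
    show "integrable (gauss_prod (insert (k, k) (?C \<times> {k}))) (\<lambda>y. pw s ((cmod (y (k, k) - c))\<^sup>2 + (\<Sum>e\<in>?C \<times> {k}. (cmod (y e))\<^sup>2)) * J ((cmod w)\<^sup>2 * (cmod (y (k, k) - c))\<^sup>2 / ((cmod (y (k, k) - c))\<^sup>2 + (\<Sum>e\<in>?C \<times> {k}. (cmod (y e))\<^sup>2))))"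
    proof (rule G.P.integrable_const_bound[where B = 1])
      show "AE y in gauss_prod (insert (k, k) (?C \<times> {k})). norm (pw s ((cmod (y (k, k) - c))\<^sup>2 + (\<Sum>e\<in>?C \<times> {k}. (cmod (y e))\<^sup>2)) * J ((cmod w)\<^sup>2 * (cmod (y (k, k) - c))\<^sup>2 / ((cmod (y (k, k) - c))\<^sup>2 + (\<Sum>e\<in>?C \<times> {k}. (cmod (y e))\<^sup>2)))) \<le> 1"
        using mult_mono[OF norm_pw_le[OF Re_s] J(2)] by (intro AE_I2) (simp add: norm_mult)
      have m1: "(\<lambda>y. (cmod (y (k, k) - c))\<^sup>2) \<in> borel_measurable (gauss_prod (insert (k, k) (?C \<times> {k})))" by measurable
      have m2: "(\<lambda>y. (\<Sum>e\<in>?C \<times> {k}. (cmod (y e))\<^sup>2)) \<in> borel_measurable (gauss_prod (insert (k, k) (?C \<times> {k})))"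
      proof (rule borel_measurable_sum)
        fix e assume "e \<in> ?C \<times> {k}"
        then have [measurable]: "(\<lambda>y. y e) \<in> borel_measurable (gauss_prod (insert (k, k) (?C \<times> {k})))"
          by (intro measurable_gauss_component) simp
        show "(\<lambda>y. (cmod (y e))\<^sup>2) \<in> borel_measurable (gauss_prod (insert (k, k) (?C \<times> {k})))" by measurable
      qed
      note [measurable] = m1 m2
      show "(\<lambda>y. pw s ((cmod (y (k, k) - c))\<^sup>2 + (\<Sum>e\<in>?C \<times> {k}. (cmod (y e))\<^sup>2)) * J ((cmod w)\<^sup>2 * (cmod (y (k, k) - c))\<^sup>2 / ((cmod (y (k, k) - c))\<^sup>2 + (\<Sum>e\<in>?C \<times> {k}. (cmod (y e))\<^sup>2)))) \<in> borel_measurable (gauss_prod (insert (k, k) (?C \<times> {k})))"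
        by measurable
    qed
  next
    have "(\<Sum>e\<in>?C \<times> {k}. (cmod ((y((k, k) := u)) e))\<^sup>2) = (\<Sum>e\<in>?C \<times> {k}. (cmod (y e))\<^sup>2)" for y :: "nat \<times> nat \<Rightarrow> complex" and u
      by (intro sum.cong) auto
    then show "(\<integral>y. (\<integral>\<zeta>. pw s ((cmod ((y((k, k) := \<zeta>)) (k, k) - c))\<^sup>2 + (\<Sum>e\<in>?C \<times> {k}. (cmod ((y((k, k) := \<zeta>)) e))\<^sup>2)) * J ((cmod w)\<^sup>2 * (cmod ((y((k, k) := \<zeta>)) (k, k) - c))\<^sup>2 / ((cmod ((y((k, k) := \<zeta>)) (k, k) - c))\<^sup>2 + (\<Sum>e\<in>?C \<times> {k}. (cmod ((y((k, k) := \<zeta>)) e))\<^sup>2))) \<partial>cgauss) \<partial>gauss_prod (?C \<times> {k}))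
      = (\<integral>y. (\<integral>\<zeta>. pw s ((cmod (\<zeta> - c))\<^sup>2 + (\<Sum>e\<in>?C \<times> {k}. (cmod (y e))\<^sup>2)) * J ((cmod w)\<^sup>2 * (cmod (\<zeta> - c))\<^sup>2 / ((cmod (\<zeta> - c))\<^sup>2 + (\<Sum>e\<in>?C \<times> {k}. (cmod (y e))\<^sup>2))) \<partial>cgauss) \<partial>gauss_prod (?C \<times> {k}))"
      by simp
  qed auto
  also have "\<dots> = (\<integral>\<beta>. erlang_density (card (?C \<times> {k}) - 1) 1 \<beta> *\<^sub>R (\<integral>\<zeta>. pw s ((cmod (\<zeta> - c))\<^sup>2 + \<beta>) * J ((cmod w)\<^sup>2 * (cmod (\<zeta> - c))\<^sup>2 / ((cmod (\<zeta> - c))\<^sup>2 + \<beta>)) \<partial>cgauss) \<partial>lborel)"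
  proof (rule integral_cgauss_sum_squares)
    have "(\<lambda>(\<beta>, \<zeta>). pw s ((cmod (\<zeta> - c))\<^sup>2 + \<beta>) * J ((cmod w)\<^sup>2 * (cmod (\<zeta> - c))\<^sup>2 / ((cmod (\<zeta> - c))\<^sup>2 + \<beta>))) \<in> borel_measurable (borel \<Otimes>\<^sub>M cgauss)"
      by measurable
    then show "(\<lambda>\<beta>. \<integral>\<zeta>. pw s ((cmod (\<zeta> - c))\<^sup>2 + \<beta>) * J ((cmod w)\<^sup>2 * (cmod (\<zeta> - c))\<^sup>2 / ((cmod (\<zeta> - c))\<^sup>2 + \<beta>)) \<partial>cgauss) \<in> borel_measurable borel"
      by (intro sigma_finite_measure.borel_measurable_lebesgue_integral prob_space_imp_sigma_finite prob_space_cgauss)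
  qed (use n in auto)
  finally show ?thesis by simp
qed

lemma cornerdet_one:
  "(\<integral>x. pw s ((cmod (cornerdet 1 k c w x))\<^sup>2) \<partial>gauss_prod ({k..<k + 1} \<times> {k..<k + 1})) = (\<integral>\<zeta>. pw s ((cmod (\<zeta> - c))\<^sup>2) \<partial>cgauss)"
proof -
  have K: "{k..<k + 1} \<times> {k..<k + 1} = {(k, k)}" by auto
  have "cornerdet 1 k c w x = x (k, k) - c" for x
    using detf_first_column[of k 0 "\<lambda>i j. x (i, j) - shiftm k c w i j"]
    by (simp add: cornerdet_def shiftm_def detf_def det_dim_zero)
  then show ?thesis unfolding K
    using G.product_integral_singleton[of "\<lambda>\<zeta>. pw s ((cmod (\<zeta> - c))\<^sup>2)" "(k, k)"] by simp
qed

end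

section \<open>The recursion for the moments of the determinant\<close>

lemma measurable_cnj [measurable]: "cnj \<in> borel_measurable borel"
  by (intro borel_measurable_continuous_onI continuous_intros)

lemma power_div_fact_le_exp:
  fixes x :: real
  assumes "x \<ge> 0"
  shows "x ^ n / fact n \<le> exp x"
proof -
  have s: "(\<lambda>n. x ^ n / fact n) sums exp x" using exp_converges[of x] by (simp add: divide_inverse mult.commute)
  have "(\<Sum>k\<in>{n}. x ^ k / fact k) \<le> (\<Sum>k. x ^ k / fact k)"
    using assms by (intro sum_le_suminf sums_summable[OF s]) auto
  then show ?thesis using sums_unique[OF s] by simp
qed

lemma integral_cgauss_radial:
  fixes f :: "real \<Rightarrow> complex"
  assumes [measurable]: "f \<in> borel_measurable borel"
  shows "(\<integral>w. f ((cmod w)\<^sup>2) \<partial>cgauss) = (\<integral>t. exponential_density 1 t *\<^sub>R f t \<partial>lborel)"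
proof -
  have "(\<integral>w. f ((cmod w)\<^sup>2) \<partial>cgauss) = (\<integral>t. f t \<partial>distr cgauss lborel (\<lambda>w. (cmod w)\<^sup>2))"
    by (rule integral_distr[symmetric]) auto
  also have "\<dots> = (\<integral>t. f t \<partial>density lborel (exponential_density 1))"
    using distributed_cgauss_norm_square by (simp add: distributed_def)
  also have "\<dots> = (\<integral>t. exponential_density 1 t *\<^sub>R f t \<partial>lborel)"
    by (rule integral_density) (auto simp: exponential_density_def)
  finally show ?thesis .
qed

lemma integrable_cgauss_exp:
  assumes "b < 1"
  shows "integrable cgauss (\<lambda>w. exp (b * (cmod w)\<^sup>2))"
proof (rule integrableI_bounded)
  have "(\<integral>\<^sup>+w. ennreal (norm (exp (b * (cmod w)\<^sup>2))) \<partial>cgauss) = (\<integral>\<^sup>+w. (\<lambda>t. ennreal (exp (b * t))) ((cmod w)\<^sup>2) \<partial>cgauss)"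
    by simp
  also have "\<dots> = (\<integral>\<^sup>+t. ennreal (exponential_density 1 t) * ennreal (exp (b * t)) \<partial>lborel)"
    by (rule nn_integral_cgauss_radial) simp
  also have "\<dots> = (\<integral>\<^sup>+t. ennreal (1 / (1 - b)) * ennreal (exponential_density (1 - b) t) \<partial>lborel)"
  proof (intro nn_integral_cong)
    fix t :: real
    show "ennreal (exponential_density 1 t) * ennreal (exp (b * t)) = ennreal (1 / (1 - b)) * ennreal (exponential_density (1 - b) t)"
    proof (cases "t < 0")
      case False
      have "exp (- t) * exp (b * t) = (1 / (1 - b)) * ((1 - b) * exp (- t * (1 - b)))"
        using assms by (simp add: exp_add[symmetric] algebra_simps add_divide_distrib[symmetric] diff_divide_distrib[symmetric])
           (simp add: field_simps)
      then show ?thesis using False assms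
        by (simp add: exponential_density_def ennreal_mult'[symmetric])
    qed (simp add: exponential_density_def)
  qed
  also have "\<dots> = ennreal (1 / (1 - b)) * 1"
  proof -
    have "(\<integral>\<^sup>+t. ennreal (exponential_density (1 - b) t) \<partial>lborel) = emeasure (density lborel (exponential_density (1 - b))) (space (density lborel (exponential_density (1 - b))))"
      by (subst emeasure_density) auto
    also have "\<dots> = 1" using prob_space.emeasure_space_1[OF prob_space_exponential_density[of "1 - b"]] assms by simp
    finally show ?thesis by (subst nn_integral_cmult) auto
  qed
  finally show "(\<integral>\<^sup>+w. ennreal (norm (exp (b * (cmod w)\<^sup>2))) \<partial>cgauss) < \<infinity>" by simp
qed simp

lemma integral_cgauss_monomial:
  fixes \<phi> :: "real \<Rightarrow> complex"
  assumes [measurable]: "\<phi> \<in> borel_measurable borel"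
  shows "(\<integral>u. \<phi> ((cmod u)\<^sup>2) * (u ^ k * cnj u ^ l) \<partial>cgauss) = (if k = l then (\<integral>u. \<phi> ((cmod u)\<^sup>2) * of_real ((cmod u)\<^sup>2) ^ k \<partial>cgauss) else 0)"
proof (cases "k = l")
  case True
  have "u ^ k * cnj u ^ k = complex_of_real ((cmod u)\<^sup>2) ^ k" for u
    by (metis complex_norm_square power_mult_distrib)
  then show ?thesis using True by simp
next
  case False
  \<comment> \<open>A rotation by this angle multiplies the monomial by
    \<open>exp (\<i> * pi) = - 1\<close>, so the integral equals its own negative.\<close>
  define \<theta> where "\<theta> = pi / (real k - real l)"
  define e where "e = cis \<theta>"
  have kl: "real k - real l \<noteq> 0" using False by simp
  have ee: "e ^ k * cnj e ^ l = - 1"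
  proof -
    have "e ^ k * cnj e ^ l = cis (real k * \<theta>) * cis (real l * (- \<theta>))"
      unfolding e_def cis_cnj Complex.DeMoivre ..
    also have "\<dots> = cis ((real k - real l) * \<theta>)" by (simp add: cis_mult algebra_simps)
    also have "(real k - real l) * \<theta> = pi" using kl by (simp add: \<theta>_def)
    finally show ?thesis by simp
  qed
  let ?I = "\<integral>u. \<phi> ((cmod u)\<^sup>2) * (u ^ k * cnj u ^ l) \<partial>cgauss"
  have "?I = (\<integral>u. \<phi> ((cmod u)\<^sup>2) * (u ^ k * cnj u ^ l) \<partial>distr cgauss borel (\<lambda>w. e * w))"
    by (subst distr_cgauss_rotate) (simp_all add: e_def)
  also have "\<dots> = (\<integral>u. \<phi> ((cmod (e * u))\<^sup>2) * ((e * u) ^ k * cnj (e * u) ^ l) \<partial>cgauss)"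
    by (rule integral_distr) auto
  also have "(\<lambda>u. \<phi> ((cmod (e * u))\<^sup>2) * ((e * u) ^ k * cnj (e * u) ^ l)) = (\<lambda>u. (e ^ k * cnj e ^ l) * (\<phi> ((cmod u)\<^sup>2) * (u ^ k * cnj u ^ l)))"
    by (simp add: norm_mult e_def power_mult_distrib mult_ac)
  also have "(\<integral>u. (e ^ k * cnj e ^ l) * (\<phi> ((cmod u)\<^sup>2) * (u ^ k * cnj u ^ l)) \<partial>cgauss) = - ?I"
    by (simp add: ee)
  finally have "?I = 0" by simp
  then show ?thesis using False by simp
qed

text \<open>The Cameron-Martin density of a real translation. Complex translations are reduced to
  real ones by rotation invariance.\<close>

lemma integral_cgauss_translate:
  fixes f :: "complex \<Rightarrow> complex"
  assumes [measurable]: "f \<in> borel_measurable borel"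
  shows "(\<integral>u. f (u - of_real m) \<partial>cgauss) = exp (- of_real (m\<^sup>2)) * (\<integral>u. f u * exp (- of_real (m * (2 * Re u))) \<partial>cgauss)"
proof -
  have d: "(\<integral>u. g u \<partial>cgauss) = (\<integral>u. (exp (- (cmod u)\<^sup>2) / pi) *\<^sub>R g u \<partial>lborel)" if "g \<in> borel_measurable borel" for g :: "complex \<Rightarrow> complex"
    unfolding std_complex_gaussian_def using that by (intro integral_density) auto
  have "(\<integral>u. f (u - of_real m) \<partial>cgauss) = (\<integral>u. (exp (- (cmod u)\<^sup>2) / pi) *\<^sub>R f (u - of_real m) \<partial>distr lborel borel ((+) (of_real m)))"
    by (simp add: d lborel_distr_plus)
  also have "\<dots> = (\<integral>u. (exp (- (cmod (of_real m + u))\<^sup>2) / pi) *\<^sub>R f (of_real m + u - of_real m) \<partial>lborel)"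
    by (rule integral_distr) auto
  also have "\<dots> = (\<integral>u. exp (- of_real (m\<^sup>2)) * ((exp (- (cmod u)\<^sup>2) / pi) *\<^sub>R (f u * exp (- of_real (m * (2 * Re u))))) \<partial>lborel)"
  proof (intro Bochner_Integration.integral_cong refl)
    fix u :: complex
    have "(cmod (of_real m + u))\<^sup>2 = (cmod u)\<^sup>2 + m\<^sup>2 + m * (2 * Re u)"
      unfolding cmod_power2 by (simp add: power2_eq_square algebra_simps)
    then have E: "exp (- (cmod (of_real m + u))\<^sup>2) = exp (- (m\<^sup>2)) * exp (- (cmod u)\<^sup>2) * exp (- (m * (2 * Re u)))"
      by (simp add: exp_add[symmetric])
    show "(exp (- (cmod (of_real m + u))\<^sup>2) / pi) *\<^sub>R f (of_real m + u - of_real m) = exp (- of_real (m\<^sup>2)) * ((exp (- (cmod u)\<^sup>2) / pi) *\<^sub>R (f u * exp (- of_real (m * (2 * Re u)))))"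
    proof -
      have e: "exp (- complex_of_real x) = of_real (exp (- x))" for x by (metis exp_of_real of_real_minus)
      show ?thesis unfolding scaleR_conv_of_real e E by simp
    qed
  qed
  also have "\<dots> = exp (- of_real (m\<^sup>2)) * (\<integral>u. (exp (- (cmod u)\<^sup>2) / pi) *\<^sub>R (f u * exp (- of_real (m * (2 * Re u)))) \<partial>lborel)"
    by (rule integral_mult_right_zero)
  also have "(\<integral>u. (exp (- (cmod u)\<^sup>2) / pi) *\<^sub>R (f u * exp (- of_real (m * (2 * Re u)))) \<partial>lborel) = (\<integral>u. f u * exp (- of_real (m * (2 * Re u))) \<partial>cgauss)"
    by (rule d[symmetric]) simp
  finally show ?thesis .
qed

text \<open>The noncentral law of \<open>\<bar>u - m\<bar>\<^sup>2\<close> as a Poisson mixture: by rotation invariance only the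
  balanced monomials of \<open>exp (- m u) exp (- m cnj u)\<close> contribute.\<close>
lemma noncentral_radial_sums:
  fixes \<phi> :: "real \<Rightarrow> complex"
  assumes [measurable]: "\<phi> \<in> borel_measurable borel" and m: "m \<ge> 0"
    and bd: "\<And>t. t \<ge> 0 \<Longrightarrow> norm (\<phi> t) \<le> C * exp (t / 4)"
  shows "(\<lambda>p. of_real ((m\<^sup>2) ^ p / (fact p)\<^sup>2) * (\<integral>t. exponential_density 1 t *\<^sub>R (\<phi> t * of_real t ^ p) \<partial>lborel))
     sums (exp (of_real (m\<^sup>2)) * (\<integral>u. \<phi> ((cmod (u - of_real m))\<^sup>2) \<partial>cgauss))"
proof -
  \<comment> \<open>The Taylor terms of the translation density
    \<open>exp (- m * (u + cnj u))\<close>, multiplied by the radial function.\<close>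
  define f where "f q u = \<phi> ((cmod u)\<^sup>2) * (of_real ((- m * (2 * Re u)) ^ q / fact q))" for q and u :: complex
  define g where "g u = norm (\<phi> ((cmod u)\<^sup>2)) * exp (2 * m * cmod u)" for u
  have [measurable]: "f q \<in> borel_measurable borel" "g \<in> borel_measurable borel" for q
    unfolding f_def g_def by measurable
  have C0: "C \<ge> 0" using order_trans[OF norm_ge_zero bd[of 0]] by simp
  \<comment> \<open>The quarter in the growth hypothesis and the half from completing the square add
    up to \<open>3 / 4\<close>, below the threshold one for integrability against the
    Gaussian.\<close>
  have gb: "g u \<le> C * exp (2 * m\<^sup>2) * exp (3 / 4 * (cmod u)\<^sup>2)" for u
  proof -
    have "0 \<le> (2 * m - cmod u)\<^sup>2" by simp
    then have "2 * m * cmod u \<le> 2 * m\<^sup>2 + (cmod u)\<^sup>2 / 2" by (simp add: power2_eq_square algebra_simps)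
    then have "g u \<le> (C * exp ((cmod u)\<^sup>2 / 4)) * exp (2 * m\<^sup>2 + (cmod u)\<^sup>2 / 2)"
      unfolding g_def using C0 by (intro mult_mono bd) auto
    also have "\<dots> = C * exp (2 * m\<^sup>2) * exp (3 / 4 * (cmod u)\<^sup>2)"
      by (simp add: exp_add[symmetric] algebra_simps)
    finally show ?thesis .
  qed
  have g0: "g u \<ge> 0" for u by (simp add: g_def)
  have ig: "integrable cgauss g"
    by (rule Bochner_Integration.integrable_bound[OF integrable_mult_right[OF integrable_cgauss_exp[of "3 / 4"], of "C * exp (2 * m\<^sup>2)"]])
       (use g0 gb C0 in \<open>auto intro!: AE_I2\<close>)
  have nf: "norm (f q u) \<le> norm (\<phi> ((cmod u)\<^sup>2)) * ((2 * m * cmod u) ^ q / fact q)" for q u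
  proof -
    have "\<bar>- m * (2 * Re u)\<bar> \<le> 2 * m * cmod u" using m abs_Re_le_cmod[of u] by (simp add: abs_mult mult_left_mono)
    then have "\<bar>- m * (2 * Re u)\<bar> ^ q / fact q \<le> (2 * m * cmod u) ^ q / fact q"
      by (intro divide_right_mono power_mono) auto
    then show ?thesis unfolding f_def norm_mult norm_of_real abs_divide power_abs by (intro mult_left_mono) auto
  qed
  have ge: "(\<lambda>q. norm (\<phi> ((cmod u)\<^sup>2)) * ((2 * m * cmod u) ^ q / fact q)) sums g u" for u
    unfolding g_def using exp_converges[of "2 * m * cmod u"] by (intro sums_mult) (simp add: divide_inverse mult.commute)
  have nfs: "summable (\<lambda>q. norm (f q u))" for u
    by (rule summable_comparison_test'[OF sums_summable[OF ge[of u]], of 0]) (use nf in simp)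
  have part: "(\<Sum>q<n. norm (f q u)) \<le> g u" for n u
  proof -
    have "(\<Sum>q<n. norm (f q u)) \<le> (\<Sum>q<n. norm (\<phi> ((cmod u)\<^sup>2)) * ((2 * m * cmod u) ^ q / fact q))" by (intro sum_mono nf)
    also have "\<dots> \<le> g u"
      using sum_le_suminf[OF sums_summable[OF ge[of u]], of "{..<n}"] sums_unique[OF ge[of u]] m by simp
    finally show ?thesis .
  qed
  have int: "integrable cgauss (f q)" for q
  proof (rule Bochner_Integration.integrable_bound[OF ig])
    have "norm (f q u) \<le> g u" for u
      using part[where n = "Suc q" and u = u] sum_nonneg[of "{..<q}" "\<lambda>q. norm (f q u)"] by simp
    then show "AE u in cgauss. norm (f q u) \<le> norm (g u)" using g0 by (intro AE_I2) simp
  qed measurable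
  have "summable (\<lambda>q. \<integral>u. norm (f q u) \<partial>cgauss)"
  proof (rule bounded_imp_summable[of _ "\<integral>u. g u \<partial>cgauss"])
    fix n
    have "(\<Sum>q\<le>n. \<integral>u. norm (f q u) \<partial>cgauss) = (\<integral>u. (\<Sum>q\<le>n. norm (f q u)) \<partial>cgauss)"
      using int by (subst Bochner_Integration.integral_sum) auto
    also have "\<dots> \<le> (\<integral>u. g u \<partial>cgauss)"
      using part[where n = "Suc n"] by (intro integral_mono ig Bochner_Integration.integrable_sum integrable_norm int) (simp add: lessThan_Suc_atMost)
    finally show "(\<Sum>q\<le>n. \<integral>u. norm (f q u) \<partial>cgauss) \<le> (\<integral>u. g u \<partial>cgauss)" .
  qed auto
  then have S0: "(\<lambda>q. \<integral>u. f q u \<partial>cgauss) sums (\<integral>u. (\<Sum>q. f q u) \<partial>cgauss)"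
    by (intro sums_integral int AE_I2 nfs)
  have fs: "(\<Sum>q. f q u) = \<phi> ((cmod u)\<^sup>2) * exp (- of_real (m * (2 * Re u)))" for u
  proof -
    have "(\<lambda>q. complex_of_real ((- m * (2 * Re u)) ^ q / fact q)) sums of_real (exp (- m * (2 * Re u)))"
      using exp_converges[of "- m * (2 * Re u)"] by (intro sums_of_real) (simp add: divide_inverse mult.commute)
    then have "(\<lambda>q. f q u) sums (\<phi> ((cmod u)\<^sup>2) * of_real (exp (- m * (2 * Re u))))"
      unfolding f_def by (rule sums_mult)
    then show ?thesis by (simp add: sums_iff exp_of_real[symmetric])
  qed
  have "(\<integral>u. \<phi> ((cmod u)\<^sup>2) * exp (- of_real (m * (2 * Re u))) \<partial>cgauss) = exp (of_real (m\<^sup>2)) * (\<integral>u. \<phi> ((cmod (u - of_real m))\<^sup>2) \<partial>cgauss)"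
    using integral_cgauss_translate[of "\<lambda>u. \<phi> ((cmod u)\<^sup>2)" m] by (simp add: exp_minus)
  then have S: "(\<lambda>q. \<integral>u. f q u \<partial>cgauss) sums (exp (of_real (m\<^sup>2)) * (\<integral>u. \<phi> ((cmod (u - of_real m))\<^sup>2) \<partial>cgauss))"
    using S0 by (simp only: fs)
  define R where "R p = (\<integral>u. \<phi> ((cmod u)\<^sup>2) * of_real ((cmod u)\<^sup>2) ^ p \<partial>cgauss)" for p
  \<comment> \<open>Expanding \<open>(u + cnj u) ^ q\<close>, only the balanced term with
    \<open>2 * k = q\<close> survives. The central binomial coefficient cancels
    \<open>fact (2 * p)\<close> and leaves the square of \<open>fact p\<close> in the
    denominator.\<close>
  have fq: "(\<integral>u. f q u \<partial>cgauss) = (if even q then of_real ((m\<^sup>2) ^ (q div 2) / (fact (q div 2))\<^sup>2) * R (q div 2) else 0)" for q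
  proof -
    have e: "f q u = (\<Sum>k\<le>q. of_real ((- m) ^ q / fact q) * of_nat (q choose k) * (\<phi> ((cmod u)\<^sup>2) * (u ^ k * cnj u ^ (q - k))))" for u
    proof -
      have "u + cnj u = complex_of_real (2 * Re u)" by (simp add: complex_add_cnj)
      moreover have "(- m * (2 * Re u)) ^ q = (- m) ^ q * (2 * Re u) ^ q" by (rule power_mult_distrib)
      ultimately have "complex_of_real ((- m * (2 * Re u)) ^ q / fact q) = of_real ((- m) ^ q / fact q) * (u + cnj u) ^ q"
        by (metis (no_types, lifting) of_real_mult of_real_power times_divide_eq_left)
      then show ?thesis unfolding f_def by (simp add: binomial_ring sum_distrib_left mult_ac)
    qed
    have im: "integrable cgauss (\<lambda>u. \<phi> ((cmod u)\<^sup>2) * (u ^ k * cnj u ^ l))" for k l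
    proof -
      have "integrable cgauss (\<lambda>u. fact (k + l) * (norm (\<phi> ((cmod u)\<^sup>2)) * exp (cmod u)))"
      proof (intro integrable_mult_right)
        have "norm (\<phi> ((cmod u)\<^sup>2)) * exp (cmod u) \<le> C * exp 1 * exp (3 / 4 * (cmod u)\<^sup>2)" for u
        proof -
          have "0 \<le> (1 - cmod u / 2)\<^sup>2" by simp
          then have "cmod u \<le> 1 + (cmod u)\<^sup>2 / 4" by (simp add: power2_eq_square algebra_simps)
          moreover have "0 \<le> (cmod u)\<^sup>2" by simp
          ultimately have "cmod u \<le> 1 + (cmod u)\<^sup>2 / 2" by linarith
          then have "norm (\<phi> ((cmod u)\<^sup>2)) * exp (cmod u) \<le> (C * exp ((cmod u)\<^sup>2 / 4)) * exp (1 + (cmod u)\<^sup>2 / 2)"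
            using C0 by (intro mult_mono bd) auto
          also have "\<dots> = C * exp 1 * exp (3 / 4 * (cmod u)\<^sup>2)" by (simp add: exp_add[symmetric] algebra_simps)
          finally show ?thesis .
        qed
        then show "integrable cgauss (\<lambda>u. norm (\<phi> ((cmod u)\<^sup>2)) * exp (cmod u))"
          by (intro Bochner_Integration.integrable_bound[OF integrable_mult_right[OF integrable_cgauss_exp[of "3 / 4"], of "C * exp 1"]])
             (use C0 in \<open>auto intro!: AE_I2\<close>)
      qed
      then show ?thesis
      proof (rule Bochner_Integration.integrable_bound)
        have "norm (\<phi> ((cmod u)\<^sup>2) * (u ^ k * cnj u ^ l)) \<le> fact (k + l) * (norm (\<phi> ((cmod u)\<^sup>2)) * exp (cmod u))" for u
        proof -
          have "cmod u ^ (k + l) / fact (k + l) \<le> exp (cmod u)" by (rule power_div_fact_le_exp) simp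
          then have "cmod u ^ (k + l) \<le> fact (k + l) * exp (cmod u)" by (simp add: divide_le_eq mult.commute)
          then have "norm (\<phi> ((cmod u)\<^sup>2)) * cmod u ^ (k + l) \<le> norm (\<phi> ((cmod u)\<^sup>2)) * (fact (k + l) * exp (cmod u))"
            by (intro mult_left_mono) auto
          then show ?thesis by (simp add: norm_mult norm_power power_add mult_ac)
        qed
        then show "AE u in cgauss. norm (\<phi> ((cmod u)\<^sup>2) * (u ^ k * cnj u ^ l)) \<le> norm (fact (k + l) * (norm (\<phi> ((cmod u)\<^sup>2)) * exp (cmod u)))"
          by (intro AE_I2) simp
      qed measurable
    qed
    have "(\<integral>u. f q u \<partial>cgauss) = (\<Sum>k\<le>q. of_real ((- m) ^ q / fact q) * of_nat (q choose k) * (\<integral>u. \<phi> ((cmod u)\<^sup>2) * (u ^ k * cnj u ^ (q - k)) \<partial>cgauss))"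
      unfolding e using im by (subst Bochner_Integration.integral_sum) auto
    also have "\<dots> = (\<Sum>k\<le>q. if 2 * k = q then of_real ((- m) ^ q / fact q) * of_nat (q choose k) * R k else 0)"
      by (intro sum.cong refl, subst integral_cgauss_monomial) (auto simp: R_def)
    also have "\<dots> = (if even q then of_real ((m\<^sup>2) ^ (q div 2) / (fact (q div 2))\<^sup>2) * R (q div 2) else 0)"
    proof (cases "even q")
      case False
      then show ?thesis by (auto intro!: sum.neutral)
    next
      case True
      then obtain p where q: "q = 2 * p" by (elim evenE)
      have "(\<Sum>k\<le>q. if 2 * k = q then of_real ((- m) ^ q / fact q) * of_nat (q choose k) * R k else 0) = of_real ((- m) ^ q / fact q) * of_nat (q choose p) * R p"
        using sum.delta[of "{..q}" p "\<lambda>k. complex_of_real ((- m) ^ q / fact q) * of_nat (q choose k) * R k"] by (simp add: q eq_commute)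
      moreover have "((- m) ^ q / fact q) * real (q choose p) = (m\<^sup>2) ^ p / (fact p)\<^sup>2"
        by (simp add: q power_mult binomial_fact power2_eq_square)
      then have "complex_of_real ((- m) ^ q / fact q) * of_nat (q choose p) = of_real ((m\<^sup>2) ^ p / (fact p)\<^sup>2)"
        by (metis of_real_mult of_real_of_nat_eq)
      ultimately show ?thesis by (simp add: q)
    qed
    finally show ?thesis .
  qed
  have "(\<lambda>p. \<integral>u. f (2 * p) u \<partial>cgauss) sums (exp (of_real (m\<^sup>2)) * (\<integral>u. \<phi> ((cmod (u - of_real m))\<^sup>2) \<partial>cgauss))"
  proof (subst sums_mono_reindex[of "\<lambda>p. 2 * p"])
    show "strict_mono (\<lambda>p::nat. 2 * p)" by (simp add: strict_mono_def)
    fix n assume "n \<notin> range (\<lambda>p::nat. 2 * p)"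
    then have "odd n" by (metis evenE rangeI)
    then show "(\<integral>u. f n u \<partial>cgauss) = 0" by (simp add: fq)
  qed (rule S)
  moreover have "R p = (\<integral>t. exponential_density 1 t *\<^sub>R (\<phi> t * of_real t ^ p) \<partial>lborel)" for p
    unfolding R_def using integral_cgauss_radial[of "\<lambda>t. \<phi> t * of_real t ^ p"] by simp
  ultimately show ?thesis by (simp add: fq)
qed

lemma erlang_density_1: "erlang_density n 1 t = (if t < 0 then 0 else t ^ n * exp (- t) / fact n)"
  by (simp add: erlang_density_def)

lemma integrable_erlang: "integrable lborel (erlang_density n 1)"
proof (rule integrableI_nonneg)
  have "(\<integral>\<^sup>+t. ennreal (erlang_density n 1 t) \<partial>lborel) = emeasure (density lborel (erlang_density n 1)) (space (density lborel (erlang_density n 1)))"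
    by (subst emeasure_density) auto
  also have "\<dots> = 1" using prob_space.emeasure_space_1[OF prob_space_erlang_density[of 1 n]] by simp
  finally show "(\<integral>\<^sup>+t. ennreal (erlang_density n 1 t) \<partial>lborel) < \<infinity>" by simp
qed auto

lemma integral_erlang: "(\<integral>t. erlang_density n 1 t \<partial>lborel) = 1"
proof -
  have "(\<integral>\<^sup>+t. ennreal (erlang_density n 1 t) \<partial>lborel) = emeasure (density lborel (erlang_density n 1)) (space (density lborel (erlang_density n 1)))"
    by (subst emeasure_density) auto
  also have "\<dots> = 1" using prob_space.emeasure_space_1[OF prob_space_erlang_density[of 1 n]] by simp
  finally show ?thesis by (simp add: integral_eq_nn_integral)
qed

lemma integrable_erlang_scale:
  fixes g :: "real \<Rightarrow> complex"
  assumes [measurable]: "g \<in> borel_measurable borel" and "\<And>t. norm (g t) \<le> B"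
  shows "integrable lborel (\<lambda>t. erlang_density n 1 t *\<^sub>R g t)"
proof (rule Bochner_Integration.integrable_bound[OF integrable_mult_right[OF integrable_erlang[of n], of B]])
  show "AE t in lborel. norm (erlang_density n 1 t *\<^sub>R g t) \<le> norm (B * erlang_density n 1 t)"
  proof (intro AE_I2)
    fix t
    have "B \<ge> 0" using order_trans[OF norm_ge_zero assms(2)] .
    then show "norm (erlang_density n 1 t *\<^sub>R g t) \<le> norm (B * erlang_density n 1 t)"
      using mult_right_mono[OF assms(2)[of t], of "erlang_density n 1 t"] by (simp add: abs_mult mult.commute)
  qed
qed measurable

lemma lborel_integral_translate:
  fixes f :: "real \<Rightarrow> complex"
  shows "(\<integral>x. f (x - c) \<partial>lborel) = (\<integral>x. f x \<partial>lborel)"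
  using lborel_integral_real_affine[of 1 f "- c"] by simp

section \<open>Gamma integrals and Beta-Gamma algebra\<close>

context imag_power
begin

lemma pw_power_Gamma:
  assumes n: "n + 1 > 0"
  shows "(\<integral>t. (if t < 0 then 0 else exp (- of_real t) * of_real t ^ n * pw s t) \<partial>lborel) = Gamma (of_nat n + 1 + s)"
    and "integrable lborel (\<lambda>t. if t < 0 then 0 else exp (- of_real t) * of_real t ^ n * pw s t)"
proof -
  let ?f = "\<lambda>t::real. if t < 0 then 0 else exp (- of_real t) * of_real t ^ n * pw s t"
  have [measurable]: "?f \<in> borel_measurable borel" by measurable
  show int: "integrable lborel ?f"
  proof (rule Bochner_Integration.integrable_bound[OF integrable_mult_right[OF integrable_erlang[of n], of "fact n"]])
    have "norm (?f t) \<le> norm (fact n * erlang_density n 1 t)" for t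
      using mult_left_mono[OF norm_pw_le[OF Re_s, of t], of "exp (- t) * t ^ n"]
      by (auto simp: erlang_density_1 norm_mult norm_power norm_exp_eq_Re mult_ac)
    then show "AE t in lborel. norm (?f t) \<le> norm (fact n * erlang_density n 1 t)" by simp
  qed measurable
  have hi: "(?f has_integral (\<integral>t. ?f t \<partial>lborel)) UNIV"
    by (rule has_integral_integral_lborel[OF int])
  have "((\<lambda>t. of_real t powr (of_nat n + 1 + s - 1) / of_real (exp t)) has_integral Gamma (of_nat n + 1 + s)) {0..}"
    by (rule Gamma_integral_complex) (simp add: Re_s)
  then have "((\<lambda>t. if t \<in> {0..} then of_real t powr (of_nat n + 1 + s - 1) / of_real (exp t) else 0) has_integral Gamma (of_nat n + 1 + s)) UNIV"
    by (simp only: has_integral_restrict_UNIV)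
  then have "(?f has_integral Gamma (of_nat n + 1 + s)) UNIV"
  proof (rule has_integral_spike[of "{0}", rotated 2])
    fix t :: real assume t: "t \<in> UNIV - {0}"
    show "?f t = (if t \<in> {0..} then of_real t powr (of_nat n + 1 + s - 1) / of_real (exp t) else 0)"
    proof (cases "t < 0")
      case False
      then have t0: "t > 0" using t by auto
      have "complex_of_real t powr (of_nat n + 1 + s - 1) = of_real t ^ n * pw s t"
        using t0 by (simp add: pw_def powr_def Ln_of_real distrib_right exp_add exp_of_nat_mult exp_of_real)
      then show ?thesis using t0 by (simp add: exp_minus exp_of_real field_simps)
    qed auto
  qed simp
  from has_integral_unique[OF hi this]
  show "(\<integral>t. ?f t \<partial>lborel) = Gamma (of_nat n + 1 + s)" .
qed

text \<open>Beta-Gamma algebra: substitute the total mass \<open>u = t + \<beta>\<close> and the proportion \<open>b = t / u\<close>.\<close>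
lemma gamma_beta_split:
  fixes J :: "real \<Rightarrow> complex"
  assumes J[measurable]: "J \<in> borel_measurable borel" "\<And>x. norm (J x) \<le> 1"
  shows "(\<integral>t. (if t < 0 then 0 else of_real (t ^ p * exp (- t)) * (\<integral>\<beta>. erlang_density n 1 \<beta> *\<^sub>R (pw s (t + \<beta>) * J (a * t / (t + \<beta>))) \<partial>lborel)) \<partial>lborel)
     = Gamma (of_nat (n + 2 + p) + s) / fact n * (\<integral>b. (if b \<in> {0..1} then of_real b ^ p * (1 - of_real b) ^ n * J (a * b) else 0) \<partial>lborel)"
proof -
  \<comment> \<open>The joint integrand in the variables \<open>u = t + \<beta>\<close> and
    \<open>t\<close>, with the constant of the Erlang density kept inside. For fixed
    \<open>u\<close> the variable \<open>t\<close> ranges over \<open>[0, u]\<close>.\<close>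
  define F where "F u t = (if 0 \<le> t \<and> t \<le> u then of_real (t ^ p * (u - t) ^ n * exp (- u) / fact n) * (pw s u * J (a * t / u)) else 0)" for u t :: real
  have [measurable]: "(\<lambda>(u, t). F u t) \<in> borel_measurable (lborel \<Otimes>\<^sub>M lborel)" "F u \<in> borel_measurable borel" for u
    unfolding F_def by measurable
  define BB where "BB = (\<integral>b. (if b \<in> {0..1} then of_real b ^ p * (1 - of_real b) ^ n * J (a * b) else 0) \<partial>lborel)"
  have nF: "norm (F u t) \<le> (if 0 \<le> t \<and> t \<le> u then u ^ (p + n) * exp (- u) / fact n else 0)" for u t
  proof (cases "0 \<le> t \<and> t \<le> u")
    case True
    have "norm (F u t) = t ^ p * (u - t) ^ n * exp (- u) / fact n * (norm (pw s u) * norm (J (a * t / u)))"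
      using True unfolding F_def by (simp add: norm_mult del: of_real_mult of_real_divide of_real_power)
    also have "\<dots> \<le> u ^ p * u ^ n * exp (- u) / fact n * (1 * 1)"
      using True by (intro mult_mono norm_pw_le Re_s J divide_right_mono mult_right_mono power_mono) auto
    finally show ?thesis using True by (simp add: power_add)
  qed (auto simp: F_def)
  have i1: "integrable lborel (F u)" for u
  proof (rule Bochner_Integration.integrable_bound)
    show "integrable lborel (\<lambda>t. indicator {0..u} t *\<^sub>R (u ^ (p + n) * exp (- u) / fact n))"
      by (intro integrable_scaleR_left) (simp add: integrable_real_indicator emeasure_lborel_Icc_eq)
    have "norm (F u t) \<le> norm (indicator {0..u} t *\<^sub>R (u ^ (p + n) * exp (- u) / fact n))" for t
      using nF[of u t] by (auto split: split_indicator simp: abs_mult)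
    then show "AE t in lborel. norm (F u t) \<le> norm (indicator {0..u} t *\<^sub>R (u ^ (p + n) * exp (- u) / fact n))" by simp
  qed measurable
  have ifull: "integrable (lborel \<Otimes>\<^sub>M lborel) (\<lambda>(u, t). F u t)"
  proof (rule lborel_pair.Fubini_integrable)
    show "integrable lborel (\<lambda>u. \<integral>t. norm ((\<lambda>(u, t). F u t) (u, t)) \<partial>lborel)"
    proof (rule Bochner_Integration.integrable_bound[OF integrable_mult_right[OF integrable_erlang[of "p + n + 1"], of "fact (p + n + 1) / fact n"]])
      have "(\<integral>t. norm (F u t) \<partial>lborel) \<le> norm (fact (p + n + 1) / fact n * erlang_density (p + n + 1) 1 u)" for u
      proof (cases "u < 0")
        case True
        then have "F u t = 0" for t by (auto simp: F_def)
        then show ?thesis by simp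
      next
        case False
        have "(\<integral>t. norm (F u t) \<partial>lborel) \<le> (\<integral>t. indicator {0..u} t *\<^sub>R (u ^ (p + n) * exp (- u) / fact n) \<partial>lborel)"
        proof (rule integral_mono)
          show "integrable lborel (\<lambda>t. norm (F u t))" using i1 by simp
          show "integrable lborel (\<lambda>t. indicator {0..u} t *\<^sub>R (u ^ (p + n) * exp (- u) / fact n))"
            by (intro integrable_scaleR_left) (simp add: integrable_real_indicator emeasure_lborel_Icc_eq)
          show "norm (F u t) \<le> indicator {0..u} t *\<^sub>R (u ^ (p + n) * exp (- u) / fact n)" for t
            using nF[of u t] by (auto split: split_indicator)
        qed
        also have "\<dots> = u * (u ^ (p + n) * exp (- u) / fact n)" using False by simp
        finally show ?thesis using False by (simp add: erlang_density_1 mult_ac)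
      qed
      then show "AE u in lborel. norm (\<integral>t. norm ((\<lambda>(u, t). F u t) (u, t)) \<partial>lborel) \<le> norm (fact (p + n + 1) / fact n * erlang_density (p + n + 1) 1 u)"
        by (intro AE_I2) (simp add: integral_nonneg_AE)
    qed measurable
    show "AE u in lborel. integrable lborel (\<lambda>t. (\<lambda>(u, t). F u t) (u, t))" using i1 by simp
  qed measurable
  have "(\<integral>t. (if t < 0 then 0 else of_real (t ^ p * exp (- t)) * (\<integral>\<beta>. erlang_density n 1 \<beta> *\<^sub>R (pw s (t + \<beta>) * J (a * t / (t + \<beta>))) \<partial>lborel)) \<partial>lborel)
     = (\<integral>t. (\<integral>u. F u t \<partial>lborel) \<partial>lborel)"
  proof (intro Bochner_Integration.integral_cong refl)
    fix t :: real
    show "(if t < 0 then 0 else of_real (t ^ p * exp (- t)) * (\<integral>\<beta>. erlang_density n 1 \<beta> *\<^sub>R (pw s (t + \<beta>) * J (a * t / (t + \<beta>))) \<partial>lborel)) = (\<integral>u. F u t \<partial>lborel)"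
    proof (cases "t < 0")
      case True
      then have "F u t = 0" for u by (simp add: F_def)
      then show ?thesis using True by simp
    next
      case False
      have "(\<integral>\<beta>. erlang_density n 1 \<beta> *\<^sub>R (pw s (t + \<beta>) * J (a * t / (t + \<beta>))) \<partial>lborel)
         = (\<integral>u. erlang_density n 1 (u - t) *\<^sub>R (pw s (t + (u - t)) * J (a * t / (t + (u - t)))) \<partial>lborel)"
        by (rule lborel_integral_translate[symmetric])
      also have "\<dots> = (\<integral>u. erlang_density n 1 (u - t) *\<^sub>R (pw s u * J (a * t / u)) \<partial>lborel)" by simp
      finally have "of_real (t ^ p * exp (- t)) * (\<integral>\<beta>. erlang_density n 1 \<beta> *\<^sub>R (pw s (t + \<beta>) * J (a * t / (t + \<beta>))) \<partial>lborel)
         = (\<integral>u. of_real (t ^ p * exp (- t)) * (erlang_density n 1 (u - t) *\<^sub>R (pw s u * J (a * t / u))) \<partial>lborel)"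
        by (simp only: integral_mult_right_zero)
      also have "\<dots> = (\<integral>u. F u t \<partial>lborel)"
      proof (intro Bochner_Integration.integral_cong refl)
        fix u
        have "exp (- u) = exp (- t) * exp (- (u - t))" by (simp add: exp_add[symmetric])
        then show "of_real (t ^ p * exp (- t)) * (erlang_density n 1 (u - t) *\<^sub>R (pw s u * J (a * t / u))) = F u t"
          using False by (auto simp: F_def erlang_density_1 scaleR_conv_of_real)
      qed
      finally show ?thesis using False by simp
    qed
  qed
  also have "\<dots> = (\<integral>u. (\<integral>t. F u t \<partial>lborel) \<partial>lborel)"
    using lborel_pair.Fubini_integral[OF ifull] .
  also have "\<dots> = (\<integral>u. (if u < 0 then 0 else exp (- of_real u) * of_real u ^ (p + n + 1) * pw s u) * (BB / fact n) \<partial>lborel)"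
  proof (intro Bochner_Integration.integral_cong refl)
    fix u :: real
    show "(\<integral>t. F u t \<partial>lborel) = (if u < 0 then 0 else exp (- of_real u) * of_real u ^ (p + n + 1) * pw s u) * (BB / fact n)"
    proof (cases "u \<le> 0")
      case True
      \<comment> \<open>At \<open>u = 0\<close> the convention \<open>pw s 0 = 0\<close> makes the
        integrand vanish.\<close>
      then have "F u t = 0" for t by (cases "u = 0") (auto simp: F_def)
      then show ?thesis using True by auto
    next
      case False
      have "(\<integral>t. F u t \<partial>lborel) = \<bar>u\<bar> *\<^sub>R (\<integral>b. F u (0 + u * b) \<partial>lborel)"
        using False by (intro lborel_integral_real_affine) simp
      also have "(\<integral>b. F u (0 + u * b) \<partial>lborel) = (\<integral>b. of_real (u ^ (p + n) * exp (- u) / fact n) * pw s u * (if b \<in> {0..1} then of_real b ^ p * (1 - of_real b) ^ n * J (a * b) else 0) \<partial>lborel)"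
      proof (intro Bochner_Integration.integral_cong refl)
        fix b
        have iff: "0 \<le> u * b \<and> u * b \<le> u \<longleftrightarrow> b \<in> {0..1}" using False by (auto simp: zero_le_mult_iff mult_le_cancel_left2)
        have "(u - u * b) ^ n = u ^ n * (1 - b) ^ n" by (metis power_mult_distrib mult.right_neutral right_diff_distrib)
        then show "F u (0 + u * b) = of_real (u ^ (p + n) * exp (- u) / fact n) * pw s u * (if b \<in> {0..1} then of_real b ^ p * (1 - of_real b) ^ n * J (a * b) else 0)"
          using False iff by (auto simp: F_def power_mult_distrib power_add mult_ac)
      qed
      also have "\<dots> = of_real (u ^ (p + n) * exp (- u) / fact n) * pw s u * BB"
        unfolding BB_def by (rule integral_mult_right_zero)
      also have "\<bar>u\<bar> *\<^sub>R \<dots> = exp (- of_real u) * of_real u ^ (p + n + 1) * pw s u * (BB / fact n)"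
      proof -
        have "exp (- complex_of_real u) = of_real (exp (- u))" by (metis exp_of_real of_real_minus)
        then show ?thesis using False by (simp add: scaleR_conv_of_real mult_ac)
      qed
      finally show ?thesis using False by simp
    qed
  qed
  also have "\<dots> = Gamma (of_nat (p + n + 1) + 1 + s) * (BB / fact n)"
    by (subst integral_mult_left_zero, subst pw_power_Gamma(1)) auto
  finally show ?thesis by (simp add: BB_def add_ac)
qed

end

text \<open>Rotating the Gaussian variable aligns \<open>c\<close> with the positive real axis,
  where the Poisson mixture for a real translation applies.\<close>

lemma cgauss_integral_modulus:
  fixes f :: "real \<Rightarrow> complex"
  assumes [measurable]: "f \<in> borel_measurable borel"
  shows "(\<integral>\<zeta>. f ((cmod (\<zeta> - c))\<^sup>2) \<partial>cgauss) = (\<integral>\<zeta>. f ((cmod (\<zeta> - of_real (cmod c)))\<^sup>2) \<partial>cgauss)"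
proof -
  obtain u where u: "cmod u = 1" "c = u * of_real (cmod c)"
  proof (cases "c = 0")
    case True
    then show ?thesis using that[of 1] by simp
  next
    case False
    then show ?thesis using that[of "c / of_real (cmod c)"] by (simp add: norm_divide)
  qed
  have "(\<integral>\<zeta>. f ((cmod (\<zeta> - c))\<^sup>2) \<partial>cgauss) = (\<integral>\<zeta>. f ((cmod (\<zeta> - c))\<^sup>2) \<partial>distr cgauss borel (\<lambda>w. u * w))"
    by (simp add: distr_cgauss_rotate[OF u(1)])
  also have "\<dots> = (\<integral>\<zeta>. f ((cmod (u * \<zeta> - c))\<^sup>2) \<partial>cgauss)"
    by (rule integral_distr) auto
  also have "(\<lambda>\<zeta>. f ((cmod (u * \<zeta> - c))\<^sup>2)) = (\<lambda>\<zeta>. f ((cmod (\<zeta> - of_real (cmod c)))\<^sup>2))"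
  proof
    fix \<zeta>
    have "u * \<zeta> - c = u * (\<zeta> - of_real (cmod c))" using u(2) by (simp add: right_diff_distrib)
    then have "cmod (u * \<zeta> - c) = cmod (\<zeta> - of_real (cmod c))" using u(1) by (metis mult_1 norm_mult)
    then show "f ((cmod (u * \<zeta> - c))\<^sup>2) = f ((cmod (\<zeta> - of_real (cmod c)))\<^sup>2)" by simp
  qed
  finally show ?thesis .
qed

lemma measurable_cgauss1: "measurable cgauss M = measurable borel M"
  by (rule measurable_cong_sets) auto

lemma AE_cgauss_neq: "AE \<zeta> in cgauss. \<zeta> \<noteq> c"
proof -
  have "AE \<zeta> in lborel. \<zeta> \<noteq> c" by (rule AE_lborel_singleton)
  then show ?thesis unfolding std_complex_gaussian_def by (subst AE_density) auto
qed

lemma integral_cgauss_const: "(\<integral>\<zeta>. c \<partial>cgauss) = (c :: complex)"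
  using prob_space.prob_space[OF prob_space_cgauss] by simp

lemma integrable_cgauss_bounded:
  fixes f :: "complex \<Rightarrow> complex"
  assumes "f \<in> borel_measurable borel" "\<And>x. norm (f x) \<le> B"
  shows "integrable cgauss f"
  by (rule finite_measure.integrable_const_bound[OF prob_space.finite_measure[OF prob_space_cgauss], where B = B])
     (use assms in auto)

lemma norm_integral_cgauss_le:
  fixes f :: "complex \<Rightarrow> complex"
  assumes [measurable]: "f \<in> borel_measurable borel" and "\<And>x. norm (f x) \<le> B"
  shows "norm (\<integral>x. f x \<partial>cgauss) \<le> B"
proof -
  have "norm (\<integral>x. f x \<partial>cgauss) \<le> (\<integral>x. norm (f x) \<partial>cgauss)" by (rule integral_norm_bound)
  also have "\<dots> \<le> (\<integral>x. B \<partial>cgauss)"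
    by (intro integral_mono integrable_norm integrable_cgauss_bounded[of _ B] assms) 
       (use prob_space.finite_measure[OF prob_space_cgauss] in \<open>auto simp: finite_measure.integrable_const\<close>)
  also have "\<dots> = B" using prob_space.prob_space[OF prob_space_cgauss] by simp
  finally show ?thesis .
qed

lemma norm_integral_erlang_le:
  fixes f :: "real \<Rightarrow> complex"
  assumes [measurable]: "f \<in> borel_measurable borel" and b: "\<And>x. norm (f x) \<le> B"
  shows "norm (\<integral>x. erlang_density n 1 x *\<^sub>R f x \<partial>lborel) \<le> B"
proof -
  have "norm (\<integral>x. erlang_density n 1 x *\<^sub>R f x \<partial>lborel) \<le> (\<integral>x. norm (erlang_density n 1 x *\<^sub>R f x) \<partial>lborel)" by (rule integral_norm_bound)
  also have "\<dots> \<le> (\<integral>x. erlang_density n 1 x * B \<partial>lborel)"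
    by (intro integral_mono integrable_norm integrable_erlang_scale[of _ B] b assms integrable_mult_left integrable_erlang)
       (simp add: mult_left_mono b)
  also have "\<dots> = B" by (simp add: integral_erlang)
  finally show ?thesis .
qed

section \<open>The moment recursion, its continuity and its power series in the corner shift\<close>

context imag_power
begin

text \<open>The argument \<open>n\<close> belongs to matrices of size \<open>n + 1\<close>: peeling a column off a matrix of size \<open>n + 2\<close> leaves
  \<open>n + 1\<close> Gaussian entries below the diagonal, and \<open>\<beta>\<close> is the sum of their squared moduli.\<close>
primrec det_mom :: "real \<Rightarrow> nat \<Rightarrow> real \<Rightarrow> complex" where
  "det_mom a 0 y = (\<integral>\<zeta>. pw s ((cmod (\<zeta> - of_real (sqrt y)))\<^sup>2) \<partial>cgauss)"
| "det_mom a (Suc n) y = (\<integral>\<beta>. erlang_density n 1 \<beta> *\<^sub>R (\<integral>\<zeta>. pw s ((cmod (\<zeta> - of_real (sqrt y)))\<^sup>2 + \<beta>)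
     * det_mom a n (a * (cmod (\<zeta> - of_real (sqrt y)))\<^sup>2 / ((cmod (\<zeta> - of_real (sqrt y)))\<^sup>2 + \<beta>)) \<partial>cgauss) \<partial>lborel)"

lemma sigma_finite_cgauss: "sigma_finite_measure cgauss"
  by (rule prob_space_imp_sigma_finite[OF prob_space_cgauss])

lemma measurable_integral_cgauss:
  fixes f :: "'b \<Rightarrow> complex \<Rightarrow> complex"
  assumes "(\<lambda>(x, y). f x y) \<in> borel_measurable (M \<Otimes>\<^sub>M borel)"
  shows "(\<lambda>x. \<integral>y. f x y \<partial>cgauss) \<in> borel_measurable M"
proof -
  have "(\<lambda>(x, y). f x y) \<in> borel_measurable (M \<Otimes>\<^sub>M cgauss)"
    using assms measurable_cong_sets[OF sets_pair_measure_cong[OF refl sets_cgauss] refl, of M borel] by simp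
  then show ?thesis by (rule sigma_finite_measure.borel_measurable_lebesgue_integral[OF sigma_finite_cgauss])
qed

lemma det_mom_measurable_bound: "det_mom a n \<in> borel_measurable borel \<and> (\<forall>y. norm (det_mom a n y) \<le> 1)"
proof (induction n)
  case 0
  have m: "(\<lambda>y. \<integral>\<zeta>. pw s ((cmod (\<zeta> - of_real (sqrt y)))\<^sup>2) \<partial>cgauss) \<in> borel_measurable borel"
    by (rule measurable_integral_cgauss) measurable
  have "norm (\<integral>\<zeta>. pw s ((cmod (\<zeta> - of_real (sqrt y)))\<^sup>2) \<partial>cgauss) \<le> 1" for y
    by (rule norm_integral_cgauss_le) (auto intro: norm_pw_le Re_s)
  then show ?case using m by (auto simp: fun_eq_iff[symmetric] cong: measurable_cong)
next
  case (Suc n)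
  then have [measurable]: "det_mom a n \<in> borel_measurable borel" and b: "\<And>y. norm (det_mom a n y) \<le> 1" by auto
  have b2: "norm (pw s x * det_mom a n y) \<le> 1" for x y
    using mult_mono[OF norm_pw_le[OF Re_s] b] by (simp add: norm_mult)
  have m1: "(\<lambda>(y, \<beta>). \<integral>\<zeta>. pw s ((cmod (\<zeta> - of_real (sqrt y)))\<^sup>2 + \<beta>)
     * det_mom a n (a * (cmod (\<zeta> - of_real (sqrt y)))\<^sup>2 / ((cmod (\<zeta> - of_real (sqrt y)))\<^sup>2 + \<beta>)) \<partial>cgauss) \<in> borel_measurable (borel \<Otimes>\<^sub>M borel)"
    unfolding case_prod_beta by (rule measurable_integral_cgauss) measurable
  have m2: "(\<lambda>y. det_mom a (Suc n) y) \<in> borel_measurable borel"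
    using m1 by (simp add: case_prod_beta)
  have n1: "norm (\<integral>\<zeta>. pw s ((cmod (\<zeta> - of_real (sqrt y)))\<^sup>2 + \<beta>)
     * det_mom a n (a * (cmod (\<zeta> - of_real (sqrt y)))\<^sup>2 / ((cmod (\<zeta> - of_real (sqrt y)))\<^sup>2 + \<beta>)) \<partial>cgauss) \<le> 1" for y \<beta>
    by (rule norm_integral_cgauss_le) (auto intro: b2)
  have "norm (det_mom a (Suc n) y) \<le> 1" for y
    unfolding det_mom.simps
  proof (rule norm_integral_erlang_le[OF _ n1])
    show "(\<lambda>\<beta>. \<integral>\<zeta>. pw s ((cmod (\<zeta> - of_real (sqrt y)))\<^sup>2 + \<beta>)
     * det_mom a n (a * (cmod (\<zeta> - of_real (sqrt y)))\<^sup>2 / ((cmod (\<zeta> - of_real (sqrt y)))\<^sup>2 + \<beta>)) \<partial>cgauss) \<in> borel_measurable borel"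
      by (rule measurable_integral_cgauss) measurable
  qed
  then show ?case using m2 by simp
qed

lemma det_mom_measurable [measurable]: "det_mom a n \<in> borel_measurable borel" using det_mom_measurable_bound by blast
lemma norm_det_mom_le: "norm (det_mom a n y) \<le> 1" using det_mom_measurable_bound by blast

text \<open>The offset \<open>k\<close> and the corner shift \<open>c\<close> are universally
  quantified in the induction, because peeling a column leaves a window that starts at
  \<open>Suc k\<close> and has a different corner. Only moduli of the shifts matter, which justifies
  the parameters \<open>a\<close> and \<open>y\<close>.\<close>

theorem cornerdet_expectation:
  "(\<integral>x. pw s ((cmod (cornerdet (Suc n) k c w x))\<^sup>2) \<partial>gauss_prod ({k..<k + Suc n} \<times> {k..<k + Suc n})) = det_mom ((cmod w)\<^sup>2) n ((cmod c)\<^sup>2)"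
proof (induction n arbitrary: k c)
  case 0
  show ?case using cornerdet_one[of k c w] cgauss_integral_modulus[OF measurable_pw, of s c] by simp
next
  case (Suc n)
  have "(\<integral>x. pw s ((cmod (cornerdet (Suc (Suc n)) k c w x))\<^sup>2) \<partial>gauss_prod ({k..<k + Suc (Suc n)} \<times> {k..<k + Suc (Suc n)}))
    = (\<integral>\<beta>. erlang_density (Suc n - 1) 1 \<beta> *\<^sub>R (\<integral>\<zeta>. pw s ((cmod (\<zeta> - c))\<^sup>2 + \<beta>) * det_mom ((cmod w)\<^sup>2) n ((cmod w)\<^sup>2 * (cmod (\<zeta> - c))\<^sup>2 / ((cmod (\<zeta> - c))\<^sup>2 + \<beta>)) \<partial>cgauss) \<partial>lborel)"
    by (rule cornerdet_step) (use Suc.IH[of "Suc k"] norm_det_mom_le in auto)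
  also have "\<dots> = det_mom ((cmod w)\<^sup>2) (Suc n) ((cmod c)\<^sup>2)"
    unfolding det_mom.simps
  proof (rule Bochner_Integration.integral_cong[OF refl])
    fix \<beta> :: real
    have "(\<integral>\<zeta>. pw s ((cmod (\<zeta> - c))\<^sup>2 + \<beta>) * det_mom ((cmod w)\<^sup>2) n ((cmod w)\<^sup>2 * (cmod (\<zeta> - c))\<^sup>2 / ((cmod (\<zeta> - c))\<^sup>2 + \<beta>)) \<partial>cgauss)
      = (\<integral>\<zeta>. pw s ((cmod (\<zeta> - of_real (sqrt ((cmod c)\<^sup>2))))\<^sup>2 + \<beta>) * det_mom ((cmod w)\<^sup>2) n ((cmod w)\<^sup>2 * (cmod (\<zeta> - of_real (sqrt ((cmod c)\<^sup>2))))\<^sup>2 / ((cmod (\<zeta> - of_real (sqrt ((cmod c)\<^sup>2))))\<^sup>2 + \<beta>)) \<partial>cgauss)"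
    proof -
      have m: "(\<lambda>t. pw s (t + \<beta>) * det_mom ((cmod w)\<^sup>2) n ((cmod w)\<^sup>2 * t / (t + \<beta>))) \<in> borel_measurable borel" by measurable
      have e: "sqrt ((cmod c)\<^sup>2) = cmod c" by simp
      show ?thesis unfolding e by (rule cgauss_integral_modulus[OF m])
    qed
    then show "erlang_density (Suc n - 1) 1 \<beta> *\<^sub>R (\<integral>\<zeta>. pw s ((cmod (\<zeta> - c))\<^sup>2 + \<beta>) * det_mom ((cmod w)\<^sup>2) n ((cmod w)\<^sup>2 * (cmod (\<zeta> - c))\<^sup>2 / ((cmod (\<zeta> - c))\<^sup>2 + \<beta>)) \<partial>cgauss)
      = erlang_density n 1 \<beta> *\<^sub>R (\<integral>\<zeta>. pw s ((cmod (\<zeta> - of_real (sqrt ((cmod c)\<^sup>2))))\<^sup>2 + \<beta>) * det_mom ((cmod w)\<^sup>2) n ((cmod w)\<^sup>2 * (cmod (\<zeta> - of_real (sqrt ((cmod c)\<^sup>2))))\<^sup>2 / ((cmod (\<zeta> - of_real (sqrt ((cmod c)\<^sup>2))))\<^sup>2 + \<beta>)) \<partial>cgauss)"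
      unfolding diff_Suc_1 by (rule arg_cong)
  qed
  finally show ?case .
qed

lemma tendsto_pw:
  assumes "(f \<longlongrightarrow> x) F" "x > 0"
  shows "((\<lambda>k. pw s (f k)) \<longlongrightarrow> pw s x) F"
proof -
  have "((\<lambda>k. exp (s * of_real (ln (f k)))) \<longlongrightarrow> exp (s * of_real (ln x))) F"
    by (intro tendsto_exp tendsto_mult tendsto_const tendsto_of_real tendsto_ln assms(1)) (use assms(2) in simp)
  moreover have "eventually (\<lambda>k. exp (s * of_real (ln (f k))) = pw s (f k)) F"
    using order_tendstoD(1)[OF assms] by eventually_elim (simp add: pw_def)
  ultimately have "((\<lambda>k. pw s (f k)) \<longlongrightarrow> exp (s * of_real (ln x))) F" by (rule Lim_transform_eventually)
  then show ?thesis using assms(2) by (simp add: pw_def[of s x])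
qed


text \<open>Dominated convergence with moduli at most one. Since \<open>pw s\<close> jumps at
  \<open>0\<close>, the base case discards the null event that the shifted Gaussian vanishes, and
  the step case uses that \<open>\<beta> > 0\<close> almost everywhere under the Erlang density.
  Joint continuity is needed on the diagonal \<open>y = a\<close> and at
  \<open>a = 0\<close>.\<close>

lemma det_mom_tendsto:
  assumes "A \<longlonglongrightarrow> a" "Y \<longlonglongrightarrow> y" "\<And>k. A k \<ge> 0" "\<And>k. Y k \<ge> 0"
  shows "(\<lambda>k. det_mom (A k) n (Y k)) \<longlonglongrightarrow> det_mom a n y"
  using assms(2,4)
proof (induction n arbitrary: Y y)
  case 0
  show ?case unfolding det_mom.simps
  proof (rule integral_dominated_convergence[where w = "\<lambda>_. 1"])
    show "AE \<zeta> in cgauss. (\<lambda>k. pw s ((cmod (\<zeta> - of_real (sqrt (Y k))))\<^sup>2)) \<longlonglongrightarrow> pw s ((cmod (\<zeta> - of_real (sqrt y)))\<^sup>2)"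
      using AE_cgauss_neq[of "of_real (sqrt y)"]
    proof eventually_elim
      case (elim \<zeta>)
      show ?case by (rule tendsto_pw) (use elim 0 in \<open>auto intro!: tendsto_intros\<close>)
    qed
    show "integrable cgauss (\<lambda>_. 1 :: real)"
      by (rule finite_measure.integrable_const[OF prob_space.finite_measure[OF prob_space_cgauss]])
    show "(\<lambda>\<zeta>. pw s ((cmod (\<zeta> - of_real (sqrt y)))\<^sup>2)) \<in> borel_measurable cgauss"
      "\<And>k. (\<lambda>\<zeta>. pw s ((cmod (\<zeta> - of_real (sqrt (Y k))))\<^sup>2)) \<in> borel_measurable cgauss"
      unfolding measurable_cgauss1 by measurable
    show "AE \<zeta> in cgauss. norm (pw s ((cmod (\<zeta> - of_real (sqrt (Y k))))\<^sup>2)) \<le> 1" for k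
      by (rule AE_I2) (rule norm_pw_le[OF Re_s])
  qed
next
  case (Suc n)
  have b2: "norm (pw s x * det_mom b n z) \<le> 1" for x b z
    using mult_mono[OF norm_pw_le[OF Re_s] norm_det_mom_le] by (simp add: norm_mult)
  let ?I = "\<lambda>a y \<beta>. \<integral>\<zeta>. pw s ((cmod (\<zeta> - of_real (sqrt y)))\<^sup>2 + \<beta>)
     * det_mom a n (a * (cmod (\<zeta> - of_real (sqrt y)))\<^sup>2 / ((cmod (\<zeta> - of_real (sqrt y)))\<^sup>2 + \<beta>)) \<partial>cgauss"
  have mI: "?I a y \<in> borel_measurable borel" for a y by (rule measurable_integral_cgauss) measurable
  have bI: "norm (?I a y \<beta>) \<le> 1" for a y \<beta> by (rule norm_integral_cgauss_le) (auto intro: b2)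
  have lim: "(\<lambda>k. ?I (A k) (Y k) \<beta>) \<longlonglongrightarrow> ?I a y \<beta>" if \<beta>: "\<beta> > 0" for \<beta>
  proof (rule integral_dominated_convergence[where w = "\<lambda>_. 1"])
    show "AE \<zeta> in cgauss. (\<lambda>k. pw s ((cmod (\<zeta> - of_real (sqrt (Y k))))\<^sup>2 + \<beta>)
     * det_mom (A k) n (A k * (cmod (\<zeta> - of_real (sqrt (Y k))))\<^sup>2 / ((cmod (\<zeta> - of_real (sqrt (Y k))))\<^sup>2 + \<beta>)))
      \<longlonglongrightarrow> pw s ((cmod (\<zeta> - of_real (sqrt y)))\<^sup>2 + \<beta>)
     * det_mom a n (a * (cmod (\<zeta> - of_real (sqrt y)))\<^sup>2 / ((cmod (\<zeta> - of_real (sqrt y)))\<^sup>2 + \<beta>))"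
    proof (intro AE_I2 tendsto_mult)
      fix \<zeta>
      have t: "(\<lambda>k. (cmod (\<zeta> - of_real (sqrt (Y k))))\<^sup>2) \<longlonglongrightarrow> (cmod (\<zeta> - of_real (sqrt y)))\<^sup>2"
        using Suc.prems by (intro tendsto_intros)
      have p: "(cmod (\<zeta> - of_real (sqrt y)))\<^sup>2 + \<beta> > 0" for y using \<beta> by (simp add: add_nonneg_pos)
      show "(\<lambda>k. pw s ((cmod (\<zeta> - of_real (sqrt (Y k))))\<^sup>2 + \<beta>)) \<longlonglongrightarrow> pw s ((cmod (\<zeta> - of_real (sqrt y)))\<^sup>2 + \<beta>)"
        by (rule tendsto_pw) (use p t in \<open>auto intro!: tendsto_intros\<close>)
      show "(\<lambda>k. det_mom (A k) n (A k * (cmod (\<zeta> - of_real (sqrt (Y k))))\<^sup>2 / ((cmod (\<zeta> - of_real (sqrt (Y k))))\<^sup>2 + \<beta>)))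
        \<longlonglongrightarrow> det_mom a n (a * (cmod (\<zeta> - of_real (sqrt y)))\<^sup>2 / ((cmod (\<zeta> - of_real (sqrt y)))\<^sup>2 + \<beta>))"
      proof (rule Suc.IH)
        show "(\<lambda>k. A k * (cmod (\<zeta> - of_real (sqrt (Y k))))\<^sup>2 / ((cmod (\<zeta> - of_real (sqrt (Y k))))\<^sup>2 + \<beta>)) \<longlonglongrightarrow> a * (cmod (\<zeta> - of_real (sqrt y)))\<^sup>2 / ((cmod (\<zeta> - of_real (sqrt y)))\<^sup>2 + \<beta>)"
          using p[of y] Suc.prems(1) assms(1) by (intro tendsto_intros) auto
        show "A k * (cmod (\<zeta> - of_real (sqrt (Y k))))\<^sup>2 / ((cmod (\<zeta> - of_real (sqrt (Y k))))\<^sup>2 + \<beta>) \<ge> 0" for k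
          using assms(3) \<beta> by auto
      qed
    qed
    show "integrable cgauss (\<lambda>_. 1 :: real)"
      by (rule finite_measure.integrable_const[OF prob_space.finite_measure[OF prob_space_cgauss]])
    have m: "(\<lambda>\<zeta>. pw s ((cmod (\<zeta> - of_real (sqrt y)))\<^sup>2 + \<beta>)
     * det_mom a n (a * (cmod (\<zeta> - of_real (sqrt y)))\<^sup>2 / ((cmod (\<zeta> - of_real (sqrt y)))\<^sup>2 + \<beta>))) \<in> borel_measurable cgauss" for a y
      unfolding measurable_cgauss1 by measurable
    show "(\<lambda>\<zeta>. pw s ((cmod (\<zeta> - of_real (sqrt y)))\<^sup>2 + \<beta>)
     * det_mom a n (a * (cmod (\<zeta> - of_real (sqrt y)))\<^sup>2 / ((cmod (\<zeta> - of_real (sqrt y)))\<^sup>2 + \<beta>))) \<in> borel_measurable cgauss" 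
      by (rule m)
    show "(\<lambda>\<zeta>. pw s ((cmod (\<zeta> - of_real (sqrt (Y k))))\<^sup>2 + \<beta>)
     * det_mom (A k) n (A k * (cmod (\<zeta> - of_real (sqrt (Y k))))\<^sup>2 / ((cmod (\<zeta> - of_real (sqrt (Y k))))\<^sup>2 + \<beta>))) \<in> borel_measurable cgauss" for k
      by (rule m)
    show "AE \<zeta> in cgauss. norm (pw s ((cmod (\<zeta> - of_real (sqrt (Y k))))\<^sup>2 + \<beta>)
     * det_mom (A k) n (A k * (cmod (\<zeta> - of_real (sqrt (Y k))))\<^sup>2 / ((cmod (\<zeta> - of_real (sqrt (Y k))))\<^sup>2 + \<beta>))) \<le> 1" for k
      by (rule AE_I2) (rule b2)
  qed
  show ?case unfolding det_mom.simps
  proof (rule integral_dominated_convergence[where w = "erlang_density n 1"])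
    have "AE \<beta> in lborel. \<beta> \<noteq> (0::real)" by (rule AE_lborel_singleton)
    then show "AE \<beta> in lborel. (\<lambda>k. erlang_density n 1 \<beta> *\<^sub>R ?I (A k) (Y k) \<beta>) \<longlonglongrightarrow> erlang_density n 1 \<beta> *\<^sub>R ?I a y \<beta>"
    proof eventually_elim
      case (elim \<beta>)
      then consider "\<beta> < 0" | "\<beta> > 0" by linarith
      then show ?case
      proof cases
        case 2
        then show ?thesis by (intro tendsto_scaleR tendsto_const lim)
      next
        case 1
        then show ?thesis by (simp add: erlang_density_1)
      qed
    qed
    show "AE \<beta> in lborel. norm (erlang_density n 1 \<beta> *\<^sub>R ?I (A k) (Y k) \<beta>) \<le> erlang_density n 1 \<beta>" for k
      using mult_left_mono[OF bI, of "erlang_density n 1 _"] by (intro AE_I2) simp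
    show "integrable lborel (erlang_density n 1)" by (rule integrable_erlang)
    have [measurable]: "?I a y \<in> borel_measurable borel" "\<And>k. ?I (A k) (Y k) \<in> borel_measurable borel" by (rule mI)+
    show "(\<lambda>\<beta>. erlang_density n 1 \<beta> *\<^sub>R ?I a y \<beta>) \<in> borel_measurable lborel"
      "\<And>k. (\<lambda>\<beta>. erlang_density n 1 \<beta> *\<^sub>R ?I (A k) (Y k) \<beta>) \<in> borel_measurable lborel"
      unfolding measurable_lborel1 by measurable
  qed
qed


text \<open>The moment conditioned on the squared modulus \<open>t\<close> of the shifted corner
  entry. Interchanging the two integrals of the recursion confines the dependence on
  \<open>y\<close> to the noncentral law of that modulus.\<close>

primrec phi :: "real \<Rightarrow> nat \<Rightarrow> real \<Rightarrow> complex" where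
  "phi a 0 t = pw s t"
| "phi a (Suc n) t = (\<integral>\<beta>. erlang_density n 1 \<beta> *\<^sub>R (pw s (t + \<beta>) * det_mom a n (a * t / (t + \<beta>))) \<partial>lborel)"

lemma norm_pw_det_mom_le: "norm (pw s x * det_mom b n z) \<le> 1"
  using mult_mono[OF norm_pw_le[OF Re_s] norm_det_mom_le] by (simp add: norm_mult)

lemma phi_measurable [measurable]: "phi a n \<in> borel_measurable borel"
proof (cases n)
  case 0
  have "phi a 0 = pw s" by (rule ext) simp
  then show ?thesis using 0 by simp
next
  case (Suc m)
  have "(\<lambda>t. \<integral>\<beta>. erlang_density m 1 \<beta> *\<^sub>R (pw s (t + \<beta>) * det_mom a m (a * t / (t + \<beta>))) \<partial>lborel) \<in> borel_measurable borel"
    by measurable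
  moreover have "phi a (Suc m) = (\<lambda>t. \<integral>\<beta>. erlang_density m 1 \<beta> *\<^sub>R (pw s (t + \<beta>) * det_mom a m (a * t / (t + \<beta>))) \<partial>lborel)"
    by (rule ext) simp
  ultimately show ?thesis using Suc by simp
qed

lemma norm_phi_le: "norm (phi a n t) \<le> 1"
proof (cases n)
  case 0
  then show ?thesis using norm_pw_le[OF Re_s] by simp
next
  case (Suc m)
  have "norm (\<integral>\<beta>. erlang_density m 1 \<beta> *\<^sub>R (pw s (t + \<beta>) * det_mom a m (a * t / (t + \<beta>))) \<partial>lborel) \<le> 1"
  proof (rule norm_integral_erlang_le)
    show "(\<lambda>\<beta>. pw s (t + \<beta>) * det_mom a m (a * t / (t + \<beta>))) \<in> borel_measurable borel" by measurable
  qed (rule norm_pw_det_mom_le)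
  then show ?thesis using Suc by simp
qed

lemma det_mom_eq_phi: "det_mom a n y = (\<integral>\<zeta>. phi a n ((cmod (\<zeta> - of_real (sqrt y)))\<^sup>2) \<partial>cgauss)"
proof (cases n)
  case 0
  then show ?thesis by simp
next
  case (Suc m)
  interpret P: prob_space cgauss by (rule prob_space_cgauss)
  interpret L: pair_sigma_finite cgauss "lborel :: real measure" by standard
  let ?F = "\<lambda>\<zeta> \<beta>. pw s ((cmod (\<zeta> - of_real (sqrt y)))\<^sup>2 + \<beta>) * det_mom a m (a * (cmod (\<zeta> - of_real (sqrt y)))\<^sup>2 / ((cmod (\<zeta> - of_real (sqrt y)))\<^sup>2 + \<beta>))"
  have meas0: "(\<lambda>(\<zeta>, \<beta>). erlang_density m 1 \<beta> *\<^sub>R ?F \<zeta> \<beta>) \<in> borel_measurable (borel \<Otimes>\<^sub>M borel)"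
    unfolding case_prod_beta by measurable
  have se: "sets (cgauss \<Otimes>\<^sub>M lborel) = sets (borel \<Otimes>\<^sub>M (borel :: real measure))"
    by (rule sets_pair_measure_cong) auto
  have meas: "(\<lambda>(\<zeta>, \<beta>). erlang_density m 1 \<beta> *\<^sub>R ?F \<zeta> \<beta>) \<in> borel_measurable (cgauss \<Otimes>\<^sub>M lborel)"
    using meas0 measurable_cong_sets[OF se refl] by blast
  have mF: "(\<lambda>\<beta>. ?F \<zeta> \<beta>) \<in> borel_measurable borel" for \<zeta> by measurable
  have intb: "integrable (cgauss \<Otimes>\<^sub>M lborel) (\<lambda>(\<zeta>, \<beta>). erlang_density m 1 \<beta> *\<^sub>R ?F \<zeta> \<beta>)"
  proof (rule L.Fubini_integrable[OF meas])
    have b: "norm (norm (\<integral>\<beta>. norm (erlang_density m 1 \<beta> *\<^sub>R ?F \<zeta> \<beta>) \<partial>lborel)) \<le> 1" for \<zeta>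
    proof -
      have "(\<integral>\<beta>. norm (erlang_density m 1 \<beta> *\<^sub>R ?F \<zeta> \<beta>) \<partial>lborel) \<le> (\<integral>\<beta>. erlang_density m 1 \<beta> \<partial>lborel)"
      proof (rule integral_mono)
        show "integrable lborel (\<lambda>\<beta>. norm (erlang_density m 1 \<beta> *\<^sub>R ?F \<zeta> \<beta>))"
          by (intro integrable_norm integrable_erlang_scale[OF mF norm_pw_det_mom_le])
        show "norm (erlang_density m 1 \<beta> *\<^sub>R ?F \<zeta> \<beta>) \<le> erlang_density m 1 \<beta>" for \<beta>
          using mult_left_mono[OF norm_pw_det_mom_le, of "erlang_density m 1 \<beta>"] by simp
      qed (rule integrable_erlang)
      moreover have "0 \<le> (\<integral>\<beta>. norm (erlang_density m 1 \<beta> *\<^sub>R ?F \<zeta> \<beta>) \<partial>lborel)" by simp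
      ultimately show ?thesis unfolding integral_erlang by simp
    qed
    have "(\<lambda>(\<zeta>, \<beta>). norm (erlang_density m 1 \<beta> *\<^sub>R ?F \<zeta> \<beta>)) \<in> borel_measurable (cgauss \<Otimes>\<^sub>M lborel)"
      using measurable_compose[OF meas borel_measurable_norm] unfolding case_prod_beta .
    then have mm: "(\<lambda>\<zeta>. \<integral>\<beta>. norm (erlang_density m 1 \<beta> *\<^sub>R ?F \<zeta> \<beta>) \<partial>lborel) \<in> borel_measurable cgauss"
      by (rule lborel.borel_measurable_lebesgue_integral)
    show "integrable cgauss (\<lambda>\<zeta>. \<integral>\<beta>. norm (case (\<zeta>, \<beta>) of (\<zeta>, \<beta>) \<Rightarrow> erlang_density m 1 \<beta> *\<^sub>R ?F \<zeta> \<beta>) \<partial>lborel)"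
      unfolding prod.case by (rule finite_measure.integrable_const_bound[OF prob_space.finite_measure[OF prob_space_cgauss], where B = 1]) (use b mm in auto)
    show "AE \<zeta> in cgauss. integrable lborel (\<lambda>\<beta>. case (\<zeta>, \<beta>) of (\<zeta>, \<beta>) \<Rightarrow> erlang_density m 1 \<beta> *\<^sub>R ?F \<zeta> \<beta>)"
      unfolding prod.case by (rule AE_I2) (rule integrable_erlang_scale[OF mF norm_pw_det_mom_le])
  qed
  have "(\<integral>\<beta>. (\<integral>\<zeta>. erlang_density m 1 \<beta> *\<^sub>R ?F \<zeta> \<beta> \<partial>cgauss) \<partial>lborel) = (\<integral>\<zeta>. (\<integral>\<beta>. erlang_density m 1 \<beta> *\<^sub>R ?F \<zeta> \<beta> \<partial>lborel) \<partial>cgauss)"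
    by (rule L.Fubini_integral[OF intb])
  then show ?thesis using Suc by simp
qed

text \<open>Taylor coefficients in \<open>y\<close> of \<open>exp y * det_mom a n y\<close>. One
  factorial belongs to the Poisson weight of the mixture, the other normalises the Gamma density of
  index \<open>p\<close>.\<close>

definition mom_coeff :: "real \<Rightarrow> nat \<Rightarrow> nat \<Rightarrow> complex" where
  "mom_coeff a n p = (\<integral>t. exponential_density 1 t *\<^sub>R (phi a n t * of_real t ^ p) \<partial>lborel) / (fact p)\<^sup>2"

lemma mom_coeff_sums:
  assumes "y \<ge> 0"
  shows "(\<lambda>p. mom_coeff a n p * of_real y ^ p) sums (exp (of_real y) * det_mom a n y)"
proof -
  have "norm (phi a n t) \<le> 1 * exp (t / 4)" if "t \<ge> 0" for t
    using norm_phi_le[of a n t] that by (smt (verit) one_le_exp_iff divide_nonneg_nonneg)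
  from noncentral_radial_sums[OF phi_measurable real_sqrt_ge_zero[OF assms] this]
  have "(\<lambda>p. of_real (((sqrt y)\<^sup>2) ^ p / (fact p)\<^sup>2) * (\<integral>t. exponential_density 1 t *\<^sub>R (phi a n t * of_real t ^ p) \<partial>lborel))
     sums (exp (of_real ((sqrt y)\<^sup>2)) * (\<integral>u. phi a n ((cmod (u - of_real (sqrt y)))\<^sup>2) \<partial>cgauss))" .
  then show ?thesis using assms by (simp add: mom_coeff_def det_mom_eq_phi[of a n y] mult_ac of_real_power)
qed

lemma exponential_power_eq_erlang: "exponential_density 1 t * t ^ p = fact p * erlang_density p 1 t"
  by (simp add: erlang_density_1 exponential_density_def)

lemma norm_mom_coeff_le: "norm (mom_coeff a n p) \<le> 1 / fact p"
proof -
  have "(\<integral>t. exponential_density 1 t *\<^sub>R (phi a n t * of_real t ^ p) \<partial>lborel) = (\<integral>t. fact p * (erlang_density p 1 t *\<^sub>R phi a n t) \<partial>lborel)"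
  proof (rule Bochner_Integration.integral_cong[OF refl])
    fix t
    have "exponential_density 1 t *\<^sub>R (phi a n t * of_real t ^ p) = of_real (exponential_density 1 t * t ^ p) * phi a n t"
      by (simp add: scaleR_conv_of_real mult_ac)
    then show "exponential_density 1 t *\<^sub>R (phi a n t * of_real t ^ p) = fact p * (erlang_density p 1 t *\<^sub>R phi a n t)"
      unfolding exponential_power_eq_erlang by (simp add: scaleR_conv_of_real)
  qed
  also have "\<dots> = fact p * (\<integral>t. erlang_density p 1 t *\<^sub>R phi a n t \<partial>lborel)" by (rule integral_mult_right_zero)
  finally have "norm (mom_coeff a n p) = norm (\<integral>t. erlang_density p 1 t *\<^sub>R phi a n t \<partial>lborel) / fact p"
    by (simp add: mom_coeff_def norm_mult norm_divide norm_power power2_eq_square)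
  also have "\<dots> \<le> 1 / fact p"
    by (intro divide_right_mono norm_integral_erlang_le[OF phi_measurable norm_phi_le]) simp
  finally show ?thesis .
qed

lemma entire_seq_mom_coeff: "entire_seq (mom_coeff a n)"
proof (rule entire_seqI)
  fix z :: complex
  have "summable (\<lambda>p. norm z ^ p /\<^sub>R fact p)" by (rule summable_exp_generic)
  then show "summable (\<lambda>p. mom_coeff a n p * z ^ p)"
  proof (rule summable_comparison_test'[where N = 0])
    fix p :: nat
    show "norm (mom_coeff a n p * z ^ p) \<le> norm z ^ p /\<^sub>R fact p"
      using mult_right_mono[OF norm_mom_coeff_le, of "norm z ^ p" a n p] by (simp add: norm_mult norm_power divide_inverse)
  qed
qed

lemma mom_coeff_0: "mom_coeff a 0 = kummer_coeff s"
proof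
  fix p
  have "(\<integral>t. exponential_density 1 t *\<^sub>R (pw s t * of_real t ^ p) \<partial>lborel) = (\<integral>t. (if t < 0 then 0 else exp (- of_real t) * of_real t ^ p * pw s t) \<partial>lborel)"
    by (intro Bochner_Integration.integral_cong refl) (simp add: exponential_density_def scaleR_conv_of_real mult_ac exp_of_real[symmetric])
  also have "\<dots> = Gamma (of_nat p + 1 + s)" by (rule pw_power_Gamma) simp
  finally show "mom_coeff a 0 p = kummer_coeff s p" by (simp add: mom_coeff_def kummer_coeff_def)
qed

text \<open>Total mass and proportion decouple: the total gives the Gamma value, and the smaller
  moment is averaged over its corner shift \<open>a * b\<close> with a Beta weight in
  \<open>b\<close>.\<close>

lemma mom_coeff_Suc: "mom_coeff a (Suc n) p = Gamma (of_nat (n + 2 + p) + s) / ((fact p)\<^sup>2 * fact n)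
    * (\<integral>b. (if b \<in> {0..1} then of_real b ^ p * (1 - of_real b) ^ n * det_mom a n (a * b) else 0) \<partial>lborel)"
proof -
  have "(\<integral>t. exponential_density 1 t *\<^sub>R (phi a (Suc n) t * of_real t ^ p) \<partial>lborel)
    = (\<integral>t. (if t < 0 then 0 else of_real (t ^ p * exp (- t)) * (\<integral>\<beta>. erlang_density n 1 \<beta> *\<^sub>R (pw s (t + \<beta>) * det_mom a n (a * t / (t + \<beta>))) \<partial>lborel)) \<partial>lborel)"
    by (intro Bochner_Integration.integral_cong refl) (simp add: exponential_density_def scaleR_conv_of_real mult_ac)
  then show ?thesis using gamma_beta_split[OF det_mom_measurable norm_det_mom_le, of p n a n a] by (simp add: mom_coeff_def field_simps)
qed

text \<open>Without shifts the squared determinant is distributed like a product of independent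
  Gamma variables with shapes \<open>1, ..., n + 1\<close>. Here this appears as the constant
  coefficient of the series, because the smaller moment no longer depends on
  \<open>b\<close>.\<close>

lemma det_mom_0_0: "det_mom 0 n 0 = (\<Prod>k\<le>n. Gamma (of_nat (Suc k) + s) / fact k)"
proof (induction n)
  case 0
  have "(\<lambda>p. mom_coeff 0 0 p * of_real 0 ^ p) sums (mom_coeff 0 0 0)" using powser_sums_zero[of "mom_coeff 0 0"] by simp
  then show ?case using mom_coeff_sums[of 0 0 0] sums_unique2 by (fastforce simp: mom_coeff_0 kummer_coeff_def)
next
  case (Suc n)
  have "(\<lambda>p. mom_coeff 0 (Suc n) p * of_real 0 ^ p) sums (mom_coeff 0 (Suc n) 0)" using powser_sums_zero[of "mom_coeff 0 (Suc n)"] by simp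
  then have "det_mom 0 (Suc n) 0 = mom_coeff 0 (Suc n) 0" using mom_coeff_sums[of 0 0 "Suc n"] sums_unique2 by fastforce
  also have "\<dots> = Gamma (of_nat (n + 2) + s) / fact n * ((\<integral>b. (if b \<in> {0..1} then (1 - of_real b) ^ n else 0) \<partial>lborel) * det_mom 0 n 0)"
  proof -
    have "(\<integral>b. (if b \<in> {0..1} then of_real b ^ 0 * (1 - of_real b) ^ n * det_mom 0 n (0 * b) else 0) \<partial>lborel)
      = (\<integral>b. (if b \<in> {0..1} then (1 - of_real b) ^ n else 0) * det_mom 0 n 0 \<partial>lborel)"
      by (intro Bochner_Integration.integral_cong refl) simp
    then show ?thesis unfolding mom_coeff_Suc integral_mult_left_zero by simp
  qed
  \<comment> \<open>This Beta integral completes \<open>fact n\<close> to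
    \<open>fact (Suc n)\<close> in the new factor.\<close>
  also have "(\<integral>b. (if b \<in> {0..1} then (1 - of_real b) ^ n else 0) \<partial>lborel) = (1 / of_nat (Suc n) :: complex)"
  proof -
    have "((\<lambda>b::real. (1 - b) ^ n) has_integral - ((1 - 1) ^ Suc n / Suc n) - (- ((1 - 0) ^ Suc n / Suc n))) {0..1}"
      by (rule fundamental_theorem_of_calculus)
         (auto intro!: derivative_eq_intros simp: has_real_derivative_iff_has_vector_derivative[symmetric] simp del: power_Suc)
    moreover have "set_integrable lborel {0..1} (\<lambda>b::real. (1 - b) ^ n)" 
      by (rule borel_integrable_atLeastAtMost') (intro continuous_intros)
    ultimately have "(LINT b:{0..1}|lborel. (1 - b) ^ n) = 1 / real (Suc n)"
      by (subst set_borel_integral_eq_integral(2)) (auto simp: integral_unique)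
    then have "complex_of_real (LINT b:{0..1}|lborel. (1 - b) ^ n) = 1 / of_nat (Suc n)" by simp
    also have "complex_of_real (LINT b:{0..1}|lborel. (1 - b) ^ n) = (\<integral>b. (if b \<in> {0..1} then (1 - of_real b) ^ n else 0) \<partial>lborel)"
      unfolding set_lebesgue_integral_def integral_complex_of_real[symmetric]
      by (intro Bochner_Integration.integral_cong refl) (auto simp: indicator_def)
    finally show ?thesis by simp
  qed
  finally show ?case using Suc by (simp add: field_simps)
qed

lemma det_mom_0_0_nonzero: "det_mom 0 n 0 \<noteq> 0"
  unfolding det_mom_0_0
proof (simp, intro ballI notI)
  fix k assume "Gamma (1 + of_nat k + s) = 0"
  then have "1 + of_nat k + s \<in> \<int>\<^sub>\<le>\<^sub>0" using Gamma_eq_zero_iff by blast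
  moreover have "1 + of_nat k + s \<notin> \<int>\<^sub>\<le>\<^sub>0" by (rule not_nonpos_Int) (simp add: Re_s)
  ultimately show False by simp
qed

end

section \<open>Growth for a large corner shift\<close>

lemma cmod_square_bound: "((cmod (\<zeta> - of_real r))\<^sup>2 / r\<^sup>2) \<le> 2 * (cmod \<zeta>)\<^sup>2 + 2" if "r \<ge> 1"
proof -
  have "cmod (\<zeta> - of_real r) \<le> cmod \<zeta> + r" using norm_triangle_ineq4[of \<zeta> "of_real r"] that by simp
  then have "(cmod (\<zeta> - of_real r))\<^sup>2 \<le> (cmod \<zeta> + r)\<^sup>2" by (intro power_mono) auto
  also have "\<dots> \<le> 2 * (cmod \<zeta>)\<^sup>2 + 2 * r\<^sup>2" using sum_squares_bound[of "cmod \<zeta>" r] by (simp add: power2_sum)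
  also have "\<dots> \<le> (2 * (cmod \<zeta>)\<^sup>2 + 2) * r\<^sup>2"
    using that mult_left_mono[of 1 "r\<^sup>2" "2 * (cmod \<zeta>)\<^sup>2"] by (simp add: distrib_right)
  finally show ?thesis using that by (simp add: field_simps)
qed

lemma tendsto_cmod_square_ratio:
  "(\<lambda>k. (cmod (\<zeta> - of_real (sqrt (real k))))\<^sup>2 / real k) \<longlonglongrightarrow> 1"
proof -
  have i: "(\<lambda>k. inverse (sqrt (real k))) \<longlonglongrightarrow> 0"
    by real_asymp
  have "(\<lambda>k. (cmod (\<zeta> * of_real (inverse (sqrt (real k))) - 1))\<^sup>2) \<longlonglongrightarrow> (cmod (\<zeta> * of_real 0 - 1))\<^sup>2"
    by (intro tendsto_power tendsto_norm tendsto_diff tendsto_mult tendsto_const tendsto_of_real i)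
  then have "(\<lambda>k. (cmod (\<zeta> * of_real (inverse (sqrt (real k))) - 1))\<^sup>2) \<longlonglongrightarrow> 1" by simp
  moreover have "\<forall>\<^sub>F k in sequentially. (cmod (\<zeta> * of_real (inverse (sqrt (real k))) - 1))\<^sup>2 = (cmod (\<zeta> - of_real (sqrt (real k))))\<^sup>2 / real k"
  proof (rule eventually_sequentiallyI[of 1])
    fix k :: nat assume "k \<ge> 1"
    then have p: "sqrt (real k) > 0" by simp
    have "\<zeta> * of_real (inverse (sqrt (real k))) - 1 = (\<zeta> - of_real (sqrt (real k))) * of_real (inverse (sqrt (real k)))"
      using p by (simp add: left_diff_distrib of_real_mult[symmetric] del: of_real_mult)
    then show "(cmod (\<zeta> * of_real (inverse (sqrt (real k))) - 1))\<^sup>2 = (cmod (\<zeta> - of_real (sqrt (real k))))\<^sup>2 / real k"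
      using p by (simp add: norm_mult power_mult_distrib divide_inverse power_inverse del: of_real_inverse)
  qed
  ultimately show ?thesis by (rule Lim_transform_eventually)
qed

context imag_power
begin

lemma pw_ratio: "x \<ge> 0 \<Longrightarrow> y > 0 \<Longrightarrow> pw s x = pw s (x / y) * pw s y"
  using pw_mult[of "x / y" y s] by simp

lemma pw_nonzero: "y > 0 \<Longrightarrow> pw s y \<noteq> 0" by (simp add: pw_def)

lemma pw_1: "pw s 1 = 1" by (simp add: pw_def)

text \<open>The Kummer function is a noncentral moment of order \<open>s + j\<close>. Its growth can
  therefore be found by dominated convergence of Gaussian integrals.\<close>

lemma kummer_shift_integral:
  assumes "y \<ge> 0"
  shows "kummer (s + of_nat j) (of_real y) = exp (of_real y) * (\<integral>\<zeta>. pw s ((cmod (\<zeta> - of_real (sqrt y)))\<^sup>2) * of_real ((cmod (\<zeta> - of_real (sqrt y)))\<^sup>2) ^ j \<partial>cgauss)"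
proof -
  define \<phi> where "\<phi> t = pw s t * of_real t ^ j" for t
  have m: "\<phi> \<in> borel_measurable borel" unfolding \<phi>_def by measurable
  have b: "norm (\<phi> t) \<le> (4 ^ j * fact j) * exp (t / 4)" if "t \<ge> 0" for t
  proof -
    have "norm (\<phi> t) \<le> 1 * t ^ j" unfolding \<phi>_def norm_mult norm_power
      using that by (intro mult_mono norm_pw_le Re_s) auto
    also have "\<dots> = (4 ^ j * fact j) * ((t / 4) ^ j / fact j)" by (simp add: power_divide)
    also have "\<dots> \<le> (4 ^ j * fact j) * exp (t / 4)" by (intro mult_left_mono power_div_fact_le_exp) (use that in auto)
    finally show ?thesis .
  qed
  have c: "(\<integral>t. exponential_density 1 t *\<^sub>R (\<phi> t * of_real t ^ p) \<partial>lborel) = Gamma (of_nat (p + j) + 1 + s)" for p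
  proof -
    have "(\<integral>t. exponential_density 1 t *\<^sub>R (\<phi> t * of_real t ^ p) \<partial>lborel) = (\<integral>t. (if t < 0 then 0 else exp (- of_real t) * of_real t ^ (p + j) * pw s t) \<partial>lborel)"
      by (intro Bochner_Integration.integral_cong refl) (simp add: \<phi>_def power_add exponential_density_def scaleR_conv_of_real mult_ac exp_of_real[symmetric])
    also have "\<dots> = Gamma (of_nat (p + j) + 1 + s)" by (rule pw_power_Gamma) simp
    finally show ?thesis .
  qed
  have "(\<lambda>p. of_real (((sqrt y)\<^sup>2) ^ p / (fact p)\<^sup>2) * (\<integral>t. exponential_density 1 t *\<^sub>R (\<phi> t * of_real t ^ p) \<partial>lborel))
     sums (exp (of_real ((sqrt y)\<^sup>2)) * (\<integral>u. \<phi> ((cmod (u - of_real (sqrt y)))\<^sup>2) \<partial>cgauss))"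
    by (rule noncentral_radial_sums[OF m real_sqrt_ge_zero[OF assms] b])
  moreover have "of_real (((sqrt y)\<^sup>2) ^ p / (fact p)\<^sup>2) * (\<integral>t. exponential_density 1 t *\<^sub>R (\<phi> t * of_real t ^ p) \<partial>lborel)
    = kummer_coeff (s + of_nat j) p * of_real y ^ p" for p
    unfolding c kummer_coeff_def using assms by (simp add: add_ac)
  ultimately have "(\<lambda>p. kummer_coeff (s + of_nat j) p * of_real y ^ p) sums (exp (of_real y) * (\<integral>u. \<phi> ((cmod (u - of_real (sqrt y)))\<^sup>2) \<partial>cgauss))"
    using assms by simp
  then show ?thesis unfolding kummer_def \<phi>_def by (rule sums_unique[symmetric])
qed

lemma integrable_cgauss_polynomial: "integrable cgauss (\<lambda>\<zeta>. (2 * (cmod \<zeta>)\<^sup>2 + 2) ^ j)"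
proof (rule Bochner_Integration.integrable_bound)
  show "integrable cgauss (\<lambda>\<zeta>. 8 ^ j * fact j * exp (1 / 4) * exp (1 / 4 * (cmod \<zeta>)\<^sup>2))"
    by (intro integrable_mult_right integrable_cgauss_exp) simp
  show "(\<lambda>\<zeta>. (2 * (cmod \<zeta>)\<^sup>2 + 2) ^ j) \<in> borel_measurable cgauss"
    unfolding measurable_cgauss1 by measurable
  show "AE \<zeta> in cgauss. norm ((2 * (cmod \<zeta>)\<^sup>2 + 2) ^ j) \<le> norm (8 ^ j * fact j * exp (1 / 4) * exp (1 / 4 * (cmod \<zeta>)\<^sup>2))"
  proof (rule AE_I2)
    fix \<zeta> :: complex
    have "2 * (cmod \<zeta>)\<^sup>2 + 2 = 8 * (((cmod \<zeta>)\<^sup>2 + 1) / 4)" by simp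
    then have "(2 * (cmod \<zeta>)\<^sup>2 + 2) ^ j = (8 * (((cmod \<zeta>)\<^sup>2 + 1) / 4)) ^ j" by (rule arg_cong)
    also have "\<dots> = 8 ^ j * fact j * ((((cmod \<zeta>)\<^sup>2 + 1) / 4) ^ j / fact j)" by (subst power_mult_distrib) simp
    also have "\<dots> \<le> 8 ^ j * fact j * exp (((cmod \<zeta>)\<^sup>2 + 1) / 4)" by (intro mult_left_mono power_div_fact_le_exp) auto
    also have "\<dots> = 8 ^ j * fact j * exp (1 / 4) * exp (1 / 4 * (cmod \<zeta>)\<^sup>2)" by (simp add: exp_add[symmetric] add_divide_distrib)
    finally show "norm ((2 * (cmod \<zeta>)\<^sup>2 + 2) ^ j) \<le> norm (8 ^ j * fact j * exp (1 / 4) * exp (1 / 4 * (cmod \<zeta>)\<^sup>2))"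
      by (simp add: abs_mult)
  qed
qed

text \<open>For \<open>y\<close> tending to infinity
  \<open>\<bar>\<zeta> - sqrt y\<bar>\<^sup>2 / y\<close> tends to one, so the moment behaves like
  \<open>y ^ j * pw s y\<close>. Integers \<open>y = k\<close> suffice for the comparison of leading
  terms later on.\<close>

lemma kummer_growth:
  "(\<lambda>k. exp (- of_real (real k)) * kummer (s + of_nat j) (of_real (real k)) / (of_real (real k) ^ j * pw s (real k))) \<longlonglongrightarrow> 1"
proof -
  let ?\<rho> = "\<lambda>k \<zeta>. (cmod (\<zeta> - of_real (sqrt (real k))))\<^sup>2 / real k"
  \<comment> \<open>The last factor switches off \<open>k = 0\<close>, where the ratio has a default
    value and is not covered by \<open>cmod_square_bound\<close>.\<close>
  have l: "(\<lambda>k. \<integral>\<zeta>. pw s (?\<rho> k \<zeta>) * of_real (?\<rho> k \<zeta>) ^ j * (if k = 0 then 0 else 1) \<partial>cgauss) \<longlonglongrightarrow> (\<integral>\<zeta>. 1 \<partial>cgauss)"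
  proof (rule integral_dominated_convergence[where w = "\<lambda>\<zeta>. (2 * (cmod \<zeta>)\<^sup>2 + 2) ^ j"])
    show "(\<lambda>\<zeta>. 1) \<in> borel_measurable cgauss" by simp
    show "(\<lambda>\<zeta>. pw s (?\<rho> k \<zeta>) * of_real (?\<rho> k \<zeta>) ^ j * (if k = 0 then 0 else 1)) \<in> borel_measurable cgauss" for k
      unfolding measurable_cgauss1 by measurable
    show "integrable cgauss (\<lambda>\<zeta>. (2 * (cmod \<zeta>)\<^sup>2 + 2) ^ j)" by (rule integrable_cgauss_polynomial)
    show "AE \<zeta> in cgauss. (\<lambda>k. pw s (?\<rho> k \<zeta>) * of_real (?\<rho> k \<zeta>) ^ j * (if k = 0 then 0 else 1)) \<longlonglongrightarrow> (1 :: complex)"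
    proof (rule AE_I2)
      fix \<zeta>
      have "(\<lambda>k. pw s (?\<rho> k \<zeta>) * of_real (?\<rho> k \<zeta>) ^ j) \<longlonglongrightarrow> pw s 1 * of_real 1 ^ j"
        by (intro tendsto_mult tendsto_power tendsto_of_real tendsto_cmod_square_ratio tendsto_pw) simp
      moreover have "\<forall>\<^sub>F k in sequentially. pw s (?\<rho> k \<zeta>) * of_real (?\<rho> k \<zeta>) ^ j = pw s (?\<rho> k \<zeta>) * of_real (?\<rho> k \<zeta>) ^ j * (if k = 0 then 0 else 1)"
        by (rule eventually_sequentiallyI[of 1]) simp
      ultimately show "(\<lambda>k. pw s (?\<rho> k \<zeta>) * of_real (?\<rho> k \<zeta>) ^ j * (if k = 0 then 0 else 1)) \<longlonglongrightarrow> 1"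
        unfolding pw_1 by (simp add: Lim_transform_eventually)
    qed
    show "AE \<zeta> in cgauss. norm (pw s (?\<rho> k \<zeta>) * of_real (?\<rho> k \<zeta>) ^ j * (if k = 0 then 0 else 1)) \<le> (2 * (cmod \<zeta>)\<^sup>2 + 2) ^ j" for k
    proof (rule AE_I2)
      fix \<zeta>
      show "norm (pw s (?\<rho> k \<zeta>) * of_real (?\<rho> k \<zeta>) ^ j * (if k = 0 then 0 else 1)) \<le> (2 * (cmod \<zeta>)\<^sup>2 + 2) ^ j"
      proof (cases "k = 0")
        case False
        then have "?\<rho> k \<zeta> \<le> 2 * (cmod \<zeta>)\<^sup>2 + 2" using cmod_square_bound[of "sqrt (real k)" \<zeta>] by simp
        then have "(?\<rho> k \<zeta>) ^ j \<le> (2 * (cmod \<zeta>)\<^sup>2 + 2) ^ j" by (intro power_mono) auto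
        moreover have "norm (pw s (?\<rho> k \<zeta>)) * (?\<rho> k \<zeta>) ^ j \<le> 1 * (?\<rho> k \<zeta>) ^ j"
          by (intro mult_right_mono norm_pw_le Re_s) simp
        moreover have "norm (pw s (?\<rho> k \<zeta>) * of_real (?\<rho> k \<zeta>) ^ j * (if k = 0 then 0 else 1)) = norm (pw s (?\<rho> k \<zeta>)) * (?\<rho> k \<zeta>) ^ j"
          using False unfolding norm_mult norm_power norm_of_real by simp
        ultimately show ?thesis by linarith
      qed simp
    qed
  qed
  have "\<forall>\<^sub>F k in sequentially. (\<integral>\<zeta>. pw s (?\<rho> k \<zeta>) * of_real (?\<rho> k \<zeta>) ^ j * (if k = 0 then 0 else 1) \<partial>cgauss)
    = exp (- of_real (real k)) * kummer (s + of_nat j) (of_real (real k)) / (of_real (real k) ^ j * pw s (real k))"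
  proof (rule eventually_sequentiallyI[of 1])
    fix k :: nat assume k: "k \<ge> 1"
    have "(\<integral>\<zeta>. pw s ((cmod (\<zeta> - of_real (sqrt (real k))))\<^sup>2) * of_real ((cmod (\<zeta> - of_real (sqrt (real k))))\<^sup>2) ^ j \<partial>cgauss)
      = (\<integral>\<zeta>. (of_real (real k) ^ j * pw s (real k)) * (pw s (?\<rho> k \<zeta>) * of_real (?\<rho> k \<zeta>) ^ j * (if k = 0 then 0 else 1)) \<partial>cgauss)"
    proof (rule Bochner_Integration.integral_cong[OF refl])
      fix \<zeta>
      show "pw s ((cmod (\<zeta> - of_real (sqrt (real k))))\<^sup>2) * of_real ((cmod (\<zeta> - of_real (sqrt (real k))))\<^sup>2) ^ j
        = (of_real (real k) ^ j * pw s (real k)) * (pw s (?\<rho> k \<zeta>) * of_real (?\<rho> k \<zeta>) ^ j * (if k = 0 then 0 else 1))"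
        using k pw_ratio[of "(cmod (\<zeta> - of_real (sqrt (real k))))\<^sup>2" "real k"] by (simp add: power_divide)
    qed
    also have "\<dots> = (of_real (real k) ^ j * pw s (real k)) * (\<integral>\<zeta>. pw s (?\<rho> k \<zeta>) * of_real (?\<rho> k \<zeta>) ^ j * (if k = 0 then 0 else 1) \<partial>cgauss)"
      by (rule integral_mult_right_zero)
    finally have e: "kummer (s + of_nat j) (of_real (real k)) = exp (of_real (real k)) * ((of_real (real k) ^ j * pw s (real k)) * (\<integral>\<zeta>. pw s (?\<rho> k \<zeta>) * of_real (?\<rho> k \<zeta>) ^ j * (if k = 0 then 0 else 1) \<partial>cgauss))"
      using kummer_shift_integral[of "real k" j] by simp
    have nz: "of_real (real k) ^ j * pw s (real k) \<noteq> 0" using k pw_nonzero[of "real k"] by simp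
    show "(\<integral>\<zeta>. pw s (?\<rho> k \<zeta>) * of_real (?\<rho> k \<zeta>) ^ j * (if k = 0 then 0 else 1) \<partial>cgauss)
    = exp (- of_real (real k)) * kummer (s + of_nat j) (of_real (real k)) / (of_real (real k) ^ j * pw s (real k))"
      unfolding e using nz by (simp add: exp_minus)
  qed
  with l show ?thesis unfolding integral_cgauss_const by (rule Lim_transform_eventually)
qed

text \<open>With a large corner shift the first column is dominated by its corner entry: the total
  grows like \<open>y\<close>, the proportion tends to one, and the smaller moment is evaluated at
  corner shift \<open>a\<close>. This is how the diagonal moment of the smaller matrix
  enters.\<close>

lemma det_mom_growth: "(\<lambda>k. det_mom a (Suc n) (real k) / pw s (real k)) \<longlonglongrightarrow> det_mom a n a" if a: "a \<ge> 0"
proof -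
  let ?\<rho> = "\<lambda>k \<zeta>. (cmod (\<zeta> - of_real (sqrt (real k))))\<^sup>2"
  let ?I = "\<lambda>k \<beta>. \<integral>\<zeta>. pw s ((?\<rho> k \<zeta> + \<beta>) / real k) * det_mom a n (a * ?\<rho> k \<zeta> / (?\<rho> k \<zeta> + \<beta>)) \<partial>cgauss"
  have mI: "?I k \<in> borel_measurable borel" for k by (rule measurable_integral_cgauss) measurable
  have mi: "(\<lambda>\<zeta>. pw s ((?\<rho> k \<zeta> + \<beta>) / real k) * det_mom a n (a * ?\<rho> k \<zeta> / (?\<rho> k \<zeta> + \<beta>))) \<in> borel_measurable borel" for k \<beta>
    by measurable
  have bI: "norm (?I k \<beta>) \<le> 1" for k \<beta> by (rule norm_integral_cgauss_le[OF mi norm_pw_det_mom_le])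
  have lim: "(\<lambda>k. ?I k \<beta>) \<longlonglongrightarrow> (\<integral>\<zeta>. det_mom a n a \<partial>cgauss)" if \<beta>: "\<beta> > 0" for \<beta>
  proof (rule integral_dominated_convergence[where w = "\<lambda>_. 1"])
    show "integrable cgauss (\<lambda>_. 1 :: real)"
      by (rule finite_measure.integrable_const[OF prob_space.finite_measure[OF prob_space_cgauss]])
    show "(\<lambda>\<zeta>. pw s ((?\<rho> k \<zeta> + \<beta>) / real k) * det_mom a n (a * ?\<rho> k \<zeta> / (?\<rho> k \<zeta> + \<beta>))) \<in> borel_measurable cgauss" for k
      unfolding measurable_cgauss1 by (rule mi)
    show "AE \<zeta> in cgauss. norm (pw s ((?\<rho> k \<zeta> + \<beta>) / real k) * det_mom a n (a * ?\<rho> k \<zeta> / (?\<rho> k \<zeta> + \<beta>))) \<le> 1" for k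
      by (rule AE_I2) (rule norm_pw_det_mom_le)
    show "AE \<zeta> in cgauss. (\<lambda>k. pw s ((?\<rho> k \<zeta> + \<beta>) / real k) * det_mom a n (a * ?\<rho> k \<zeta> / (?\<rho> k \<zeta> + \<beta>))) \<longlonglongrightarrow> det_mom a n a"
    proof (rule AE_I2)
      fix \<zeta>
      have b: "(\<lambda>k. \<beta> / real k) \<longlonglongrightarrow> 0" by real_asymp
      have 1: "(\<lambda>k. ?\<rho> k \<zeta> / real k + \<beta> / real k) \<longlonglongrightarrow> 1 + 0" by (intro tendsto_add tendsto_cmod_square_ratio b)
      then have l1: "(\<lambda>k. (?\<rho> k \<zeta> + \<beta>) / real k) \<longlonglongrightarrow> 1" by (simp add: add_divide_distrib)
      have "(\<lambda>k. a * (?\<rho> k \<zeta> / real k) / (?\<rho> k \<zeta> / real k + \<beta> / real k)) \<longlonglongrightarrow> a * 1 / (1 + 0)"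
        by (intro tendsto_divide tendsto_mult tendsto_const tendsto_cmod_square_ratio 1) simp
      moreover have "\<forall>\<^sub>F k in sequentially. a * (?\<rho> k \<zeta> / real k) / (?\<rho> k \<zeta> / real k + \<beta> / real k) = a * ?\<rho> k \<zeta> / (?\<rho> k \<zeta> + \<beta>)"
        by (rule eventually_sequentiallyI[of 1]) (simp add: add_divide_distrib[symmetric])
      ultimately have l2: "(\<lambda>k. a * ?\<rho> k \<zeta> / (?\<rho> k \<zeta> + \<beta>)) \<longlonglongrightarrow> a"
        by (simp add: Lim_transform_eventually)
      have "(\<lambda>k. det_mom a n (a * ?\<rho> k \<zeta> / (?\<rho> k \<zeta> + \<beta>))) \<longlonglongrightarrow> det_mom a n a"
        by (rule det_mom_tendsto[OF tendsto_const l2]) (use a \<beta> in auto)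
      then have "(\<lambda>k. pw s ((?\<rho> k \<zeta> + \<beta>) / real k) * det_mom a n (a * ?\<rho> k \<zeta> / (?\<rho> k \<zeta> + \<beta>))) \<longlonglongrightarrow> pw s 1 * det_mom a n a"
        by (intro tendsto_mult tendsto_pw l1) auto
      then show "(\<lambda>k. pw s ((?\<rho> k \<zeta> + \<beta>) / real k) * det_mom a n (a * ?\<rho> k \<zeta> / (?\<rho> k \<zeta> + \<beta>))) \<longlonglongrightarrow> det_mom a n a" by (simp add: pw_1)
    qed
  qed simp
  have l: "(\<lambda>k. \<integral>\<beta>. erlang_density n 1 \<beta> *\<^sub>R ?I k \<beta> \<partial>lborel) \<longlonglongrightarrow> (\<integral>\<beta>. erlang_density n 1 \<beta> *\<^sub>R det_mom a n a \<partial>lborel)"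
  proof (rule integral_dominated_convergence[where w = "erlang_density n 1"])
    have "AE \<beta> in lborel. \<beta> \<noteq> (0::real)" by (rule AE_lborel_singleton)
    then show "AE \<beta> in lborel. (\<lambda>k. erlang_density n 1 \<beta> *\<^sub>R ?I k \<beta>) \<longlonglongrightarrow> erlang_density n 1 \<beta> *\<^sub>R det_mom a n a"
    proof eventually_elim
      case (elim \<beta>)
      then consider "\<beta> < 0" | "\<beta> > 0" by linarith
      then show ?case
      proof cases
        case 2
        then show ?thesis using lim[OF 2] unfolding integral_cgauss_const by (intro tendsto_scaleR tendsto_const)
      next
        case 1
        then show ?thesis by (simp add: erlang_density_1)
      qed
    qed
    show "AE \<beta> in lborel. norm (erlang_density n 1 \<beta> *\<^sub>R ?I k \<beta>) \<le> erlang_density n 1 \<beta>" for k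
      using mult_left_mono[OF bI, of "erlang_density n 1 _"] by (intro AE_I2) simp
    show "integrable lborel (erlang_density n 1)" by (rule integrable_erlang)
    have [measurable]: "\<And>k. ?I k \<in> borel_measurable borel" by (rule mI)+
    show "(\<lambda>\<beta>. erlang_density n 1 \<beta> *\<^sub>R det_mom a n a) \<in> borel_measurable lborel"
      "\<And>k. (\<lambda>\<beta>. erlang_density n 1 \<beta> *\<^sub>R ?I k \<beta>) \<in> borel_measurable lborel"
      unfolding measurable_lborel1 by measurable
  qed
  have r: "(\<integral>\<beta>. erlang_density n 1 \<beta> *\<^sub>R det_mom a n a \<partial>lborel) = det_mom a n a"
    by (subst integral_scaleR_left) (simp_all add: integral_erlang integrable_erlang)
  have "\<forall>\<^sub>F k in sequentially. (\<integral>\<beta>. erlang_density n 1 \<beta> *\<^sub>R ?I k \<beta> \<partial>lborel) = det_mom a (Suc n) (real k) / pw s (real k)"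
  proof (rule eventually_sequentiallyI[of 1])
    fix k :: nat assume k: "k \<ge> 1"
    have "det_mom a (Suc n) (real k) = (\<integral>\<beta>. erlang_density n 1 \<beta> *\<^sub>R ?I k \<beta> * pw s (real k) \<partial>lborel)"
      unfolding det_mom.simps
    proof (rule Bochner_Integration.integral_cong[OF refl])
      fix \<beta> :: real
      show "erlang_density n 1 \<beta> *\<^sub>R (\<integral>\<zeta>. pw s (?\<rho> k \<zeta> + \<beta>) * det_mom a n (a * ?\<rho> k \<zeta> / (?\<rho> k \<zeta> + \<beta>)) \<partial>cgauss) = erlang_density n 1 \<beta> *\<^sub>R ?I k \<beta> * pw s (real k)"
      proof (cases "\<beta> \<ge> 0")
        case True
        have "(\<integral>\<zeta>. pw s (?\<rho> k \<zeta> + \<beta>) * det_mom a n (a * ?\<rho> k \<zeta> / (?\<rho> k \<zeta> + \<beta>)) \<partial>cgauss)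
          = (\<integral>\<zeta>. pw s ((?\<rho> k \<zeta> + \<beta>) / real k) * det_mom a n (a * ?\<rho> k \<zeta> / (?\<rho> k \<zeta> + \<beta>)) * pw s (real k) \<partial>cgauss)"
          by (rule Bochner_Integration.integral_cong[OF refl]) (use pw_ratio[of "?\<rho> k _ + \<beta>" "real k"] k True in simp)
        then show ?thesis by simp
      qed (simp add: erlang_density_1)
    qed
    also have "\<dots> = (\<integral>\<beta>. erlang_density n 1 \<beta> *\<^sub>R ?I k \<beta> \<partial>lborel) * pw s (real k)" by (rule integral_mult_left_zero)
    finally show "(\<integral>\<beta>. erlang_density n 1 \<beta> *\<^sub>R ?I k \<beta> \<partial>lborel) = det_mom a (Suc n) (real k) / pw s (real k)"
      using pw_nonzero[of "real k"] k by simp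
  qed
  with l show ?thesis unfolding r by (rule Lim_transform_eventually)
qed

end

section \<open>Structure of the moment series\<close>

text \<open>Rising factorials form the basis adapted to Kummer coefficients: multiplication by one
  of them raises the parameter, so a polynomial multiple of \<open>kummer_coeff\<close> becomes a
  finite combination of Kummer coefficients.\<close>

lemma poly_pochhammer_decomposition:
  fixes S :: "complex poly"
  assumes "degree S \<le> d"
  shows "\<exists>\<kappa>. (\<forall>x. poly S x = (\<Sum>j\<le>d. \<kappa> j * pochhammer (x + c) j)) \<and> \<kappa> d = coeff S d"
  using assms
proof (induction d arbitrary: S)
  case 0
  then obtain b where "S = [:b:]" by (metis degree_0_id le_zero_eq)
  then show ?case by (intro exI[of _ "\<lambda>_. b"]) simp
next
  case (Suc d)
  define P :: "complex poly" where "P = pochhammer [:c, 1:] (Suc d)"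
  have shift: "([:c, 1:] :: complex poly) + of_nat j = [:c + of_nat j, 1:]" for j
    by (simp add: of_nat_poly)
  have monic: "degree (pochhammer ([:c, 1:] :: complex poly) j) = j \<and> lead_coeff (pochhammer ([:c, 1:] :: complex poly) j) = 1" for j
  proof (induction j)
    case (Suc j)
    have nz: "pochhammer ([:c, 1:] :: complex poly) j \<noteq> 0" using Suc by auto
    show ?case unfolding pochhammer_Suc shift
    proof -
      have "degree (pochhammer ([:c, 1:] :: complex poly) j * [:c + of_nat j, 1:]) = Suc j"
        by (subst degree_mult_eq) (use Suc nz in auto)
      moreover have "lead_coeff (pochhammer ([:c, 1:] :: complex poly) j * [:c + of_nat j, 1:]) = 1"
        by (subst lead_coeff_mult) (use conjunct1[OF Suc] conjunct2[OF Suc] in simp)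
      ultimately show "degree (pochhammer ([:c, 1:] :: complex poly) j * [:c + of_nat j, 1:]) = Suc j
        \<and> lead_coeff (pochhammer ([:c, 1:] :: complex poly) j * [:c + of_nat j, 1:]) = 1" by blast
    qed
  qed simp
  have ev: "poly (pochhammer ([:c, 1:] :: complex poly) j) x = pochhammer (x + c) j" for j x
    by (induction j) (simp_all add: pochhammer_Suc algebra_simps)
  define S' where "S' = S - Polynomial.smult (coeff S (Suc d)) P"
  have P: "degree P = Suc d" "coeff P (Suc d) = 1" using monic[of "Suc d"] by (auto simp: P_def)
  have "degree S' \<le> Suc d" unfolding S'_def using Suc.prems P(1) by (intro degree_diff_le) (auto intro: order_trans[OF degree_smult_le])
  moreover have "coeff S' (Suc d) = 0" using P by (simp add: S'_def)
  ultimately have "degree S' \<le> d"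
    by (metis Suc_leI eq_zero_or_degree_less le_less_Suc_eq less_Suc_eq_le not_le degree_0 zero_le leading_coeff_0_iff)
  from Suc.IH[OF this] obtain \<kappa> where \<kappa>: "\<And>x. poly S' x = (\<Sum>j\<le>d. \<kappa> j * pochhammer (x + c) j)" by blast
  have "poly S x = (\<Sum>j\<le>Suc d. (\<kappa>(Suc d := coeff S (Suc d))) j * pochhammer (x + c) j)" for x
  proof -
    have "poly S x = poly S' x + coeff S (Suc d) * poly P x" by (simp add: S'_def)
    also have "poly P x = pochhammer (x + c) (Suc d)" unfolding P_def by (rule ev)
    also have "poly S' x = (\<Sum>j\<le>d. (\<kappa>(Suc d := coeff S (Suc d))) j * pochhammer (x + c) j)"
      unfolding \<kappa> by (rule sum.cong) auto
    finally show ?thesis by simp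
  qed
  then show ?case by (intro exI[of _ "\<kappa>(Suc d := coeff S (Suc d))"]) simp
qed

lemma kummer_coeff_pochhammer:
  assumes "Re c > -1"
  shows "kummer_coeff c q * pochhammer (of_nat q + (1 + c)) j = kummer_coeff (c + of_nat j) q"
proof -
  have n: "of_nat q + (1 + c) \<notin> \<int>\<^sub>\<le>\<^sub>0" by (rule not_nonpos_Int) (use assms in simp)
  then have "Gamma (of_nat q + (1 + c)) \<noteq> 0" using Gamma_eq_zero_iff by blast
  then show ?thesis using pochhammer_Gamma[OF n, of j] by (simp add: kummer_coeff_def field_simps add_ac)
qed

context imag_power
begin

lemma det_mom_kummer_expansion:
  assumes S: "\<And>q. (shift_op a ^^ n) (mom_coeff a m) q = kummer_coeff s q * poly S (of_nat q)"
    and \<kappa>: "\<And>x. poly S x = (\<Sum>j\<le>d. \<kappa> j * pochhammer (x + (1 + s)) j)"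
    and y: "y \<ge> 0"
  shows "(of_real y - of_real a) ^ n * det_mom a m y = (\<Sum>j\<le>d. \<kappa> j * (exp (- of_real y) * kummer (s + of_nat j) (of_real y)))"
proof -
  have s1: "Re (s + of_nat j) > -1" for j by (simp add: Re_s)
  have q: "(shift_op a ^^ n) (mom_coeff a m) q * of_real y ^ q = (\<Sum>j\<le>d. \<kappa> j * (kummer_coeff (s + of_nat j) q * of_real y ^ q))" for q
    unfolding S \<kappa> sum_distrib_left sum_distrib_right
    by (intro sum.cong refl) (use s1[of 0] in \<open>simp add: kummer_coeff_pochhammer[symmetric] mult_ac\<close>)
  have "(of_real y - of_real a) ^ n * (exp (of_real y) * det_mom a m y) = (of_real y - of_real a) ^ n * (\<Sum>l. mom_coeff a m l * of_real y ^ l)"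
    using sums_unique[OF mom_coeff_sums[OF y]] by simp
  also have "\<dots> = (\<Sum>l. (shift_op a ^^ n) (mom_coeff a m) l * of_real y ^ l)" by (rule shift_op_power_sums[OF entire_seq_mom_coeff, symmetric])
  also have "\<dots> = (\<Sum>l. \<Sum>j\<le>d. \<kappa> j * (kummer_coeff (s + of_nat j) l * of_real y ^ l))" unfolding q ..
  also have "\<dots> = (\<Sum>j\<le>d. \<Sum>l. \<kappa> j * (kummer_coeff (s + of_nat j) l * of_real y ^ l))"
    by (rule suminf_sum) (intro summable_mult entire_seq_summable entire_seq_kummer_coeff s1)
  also have "\<dots> = (\<Sum>j\<le>d. \<kappa> j * kummer (s + of_nat j) (of_real y))"
    unfolding kummer_def by (intro sum.cong refl suminf_mult entire_seq_summable entire_seq_kummer_coeff s1)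
  finally have "exp (- of_real y) * ((of_real y - of_real a) ^ n * (exp (of_real y) * det_mom a m y)) = exp (- of_real y) * (\<Sum>j\<le>d. \<kappa> j * kummer (s + of_nat j) (of_real y))"
    by (rule arg_cong)
  moreover have "exp (- of_real y) * ((of_real y - of_real a) ^ n * (exp (of_real y) * det_mom a m y)) = (of_real y - of_real a) ^ n * det_mom a m y"
    by (simp add: exp_minus)
  ultimately show ?thesis by (simp add: sum_distrib_left mult_ac)
qed

lemma lborel_integral_unit_interval:
  fixes f :: "real \<Rightarrow> complex"
  assumes "continuous_on {0..1} f"
  shows "(\<integral>b. (if b \<in> {0..1} then f b else 0) \<partial>lborel) = integral {0..1} f"
proof -
  have "set_integrable lborel {0..1} f" by (rule borel_integrable_atLeastAtMost'[OF assms])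
  then have "(LINT b:{0..1}|lborel. f b) = integral {0..1} f" by (rule set_borel_integral_eq_integral(2))
  moreover have "(LINT b:{0..1}|lborel. f b) = (\<integral>b. (if b \<in> {0..1} then f b else 0) \<partial>lborel)"
    unfolding set_lebesgue_integral_def by (intro Bochner_Integration.integral_cong refl) (auto simp: indicator_def)
  ultimately show ?thesis by simp
qed

text \<open>At \<open>y = a * b\<close> the Beta weight \<open>(1 - b) ^ n\<close> is
  \<open>(y - a) ^ n\<close> divided by \<open>(- a) ^ n\<close>. The expansion of the smaller
  moment thus enters the integral without a denominator in \<open>b\<close>.\<close>

lemma mom_coeff_Suc_kummer_mom:
  assumes a: "a > 0"
    and e: "\<And>y. y \<ge> 0 \<Longrightarrow> (of_real y - of_real a) ^ n * det_mom a n y = (\<Sum>j\<le>n. \<kappa> j * (exp (- of_real y) * kummer (s + of_nat j) (of_real y)))"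
  shows "mom_coeff a (Suc n) p = (\<Sum>j\<le>n. (\<kappa> j / (fact n * (- of_real a) ^ n)) * (Gamma (of_nat (Suc n + 1 + p) + s) / (fact p)\<^sup>2 * kummer_mom a (s + of_nat j) p))"
proof -
  have s1: "Re (s + of_nat j) > -1" for j by (simp add: Re_s)
  let ?A = "(- of_real a :: complex) ^ n"
  have A: "?A \<noteq> 0" using a by simp
  let ?f = "\<lambda>j b. of_real b ^ p * (exp (- of_real (a * b)) * kummer (s + of_nat j) (of_real (a * b)))"
  have pt: "?A * (of_real b ^ p * (1 - of_real b) ^ n * det_mom a n (a * b)) = (\<Sum>j\<le>n. \<kappa> j * ?f j b)" if "b \<in> {0..1}" for b
  proof -
    have "?A * (1 - of_real b) ^ n = (of_real (a * b) - of_real a) ^ n"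
      unfolding power_mult_distrib[symmetric] by (simp add: algebra_simps)
    then have "?A * (of_real b ^ p * (1 - of_real b) ^ n * det_mom a n (a * b)) = of_real b ^ p * ((of_real (a * b) - of_real a) ^ n * det_mom a n (a * b))"
      by (metis (no_types, opaque_lifting) mult.assoc mult.left_commute)
    also have "\<dots> = (\<Sum>j\<le>n. \<kappa> j * ?f j b)" using that a by (subst e) (simp_all add: sum_distrib_left mult_ac)
    finally show ?thesis .
  qed
  have cont: "continuous_on {0..1} (?f j)" for j
    by (intro continuous_intros continuous_on_compose2[OF continuous_on_kummer[OF s1, of UNIV]]) auto
  have "?A * (\<integral>b. (if b \<in> {0..1} then of_real b ^ p * (1 - of_real b) ^ n * det_mom a n (a * b) else 0) \<partial>lborel)
    = (\<integral>b. (if b \<in> {0..1} then (\<Sum>j\<le>n. \<kappa> j * ?f j b) else 0) \<partial>lborel)"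
    unfolding integral_mult_right_zero[symmetric]
    by (rule Bochner_Integration.integral_cong[OF refl]) (use pt in auto)
  also have "\<dots> = integral {0..1} (\<lambda>b. \<Sum>j\<le>n. \<kappa> j * ?f j b)"
    by (rule lborel_integral_unit_interval) (intro continuous_on_sum continuous_on_mult_left cont)
  also have "\<dots> = (\<Sum>j\<le>n. integral {0..1} (\<lambda>b. \<kappa> j * ?f j b))"
    by (rule Henstock_Kurzweil_Integration.integral_sum) (simp, rule integrable_continuous_real[OF continuous_on_mult_left[OF cont]])
  also have "\<dots> = (\<Sum>j\<le>n. \<kappa> j * kummer_mom a (s + of_nat j) p)" unfolding kummer_mom_def by simp
  finally have "(\<integral>b. (if b \<in> {0..1} then of_real b ^ p * (1 - of_real b) ^ n * det_mom a n (a * b) else 0) \<partial>lborel) = (\<Sum>j\<le>n. \<kappa> j * kummer_mom a (s + of_nat j) p) / ?A"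
    using A by (simp add: field_simps)
  then have "mom_coeff a (Suc n) p = Gamma (of_nat (n + 2 + p) + s) / ((fact p)\<^sup>2 * fact n) * ((\<Sum>j\<le>n. \<kappa> j * kummer_mom a (s + of_nat j) p) / ?A)"
    unfolding mom_coeff_Suc by simp
  also have "\<dots> = (\<Sum>j\<le>n. (\<kappa> j / (fact n * ?A)) * (Gamma (of_nat (Suc n + 1 + p) + s) / (fact p)\<^sup>2 * kummer_mom a (s + of_nat j) p))"
    unfolding sum_divide_distrib sum_distrib_left by (intro sum.cong refl) (simp add: mult_ac)
  finally show ?thesis .
qed

text \<open>Letting \<open>y\<close> tend to infinity in the expansion forces the degree bound and identifies the top coefficient.\<close>
lemma structure_degree:
  assumes a: "a \<ge> 0"
    and S: "\<And>q. (shift_op a ^^ Suc n) (mom_coeff a (Suc n)) q = kummer_coeff s q * poly S (of_nat q)"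
  shows "degree S \<le> Suc n \<and> coeff S (Suc n) = det_mom a n a"
proof -
  \<comment> \<open>The degree of \<open>S\<close> is still unknown. Dividing by the larger of the
    actual and the expected power makes the limit show the coefficient of \<open>S\<close> at
    \<open>m\<close> in either case.\<close>
  define m where "m = max (degree S) (Suc n)"
  obtain \<kappa> where \<kappa>: "\<And>x. poly S x = (\<Sum>j\<le>m. \<kappa> j * pochhammer (x + (1 + s)) j)" "\<kappa> m = coeff S m"
    using poly_pochhammer_decomposition[of S m "1 + s"] by (auto simp: m_def)
  let ?E = "\<lambda>j k. exp (- of_real (real k)) * kummer (s + of_nat j) (of_real (real k)) / (of_real (real k) ^ j * pw s (real k))"
  have r0: "(\<lambda>k. of_real (real k) ^ j / of_real (real k) ^ m :: complex) \<longlonglongrightarrow> (if j = m then 1 else 0)" if "j \<le> m" for j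
  proof (cases "j = m")
    case True
    have "\<forall>\<^sub>F k in sequentially. 1 = (of_real (real k) ^ j / of_real (real k) ^ m :: complex)"
      by (rule eventually_sequentiallyI[of 1]) (simp add: True)
    then have "(\<lambda>k. of_real (real k) ^ j / of_real (real k) ^ m :: complex) \<longlonglongrightarrow> 1"
      by (rule Lim_transform_eventually[OF tendsto_const])
    then show ?thesis by (simp only: True simp_thms if_True)
  next
    case False
    then have "j < m" using that by simp
    then have "(\<lambda>k. inverse (real k) ^ (m - j)) \<longlonglongrightarrow> 0 ^ (m - j)" by (intro tendsto_power lim_inverse_n)
    then have "(\<lambda>k. complex_of_real (inverse (real k) ^ (m - j))) \<longlonglongrightarrow> of_real (0 ^ (m - j))" by (rule tendsto_of_real)
    moreover have "complex_of_real (0 ^ (m - j)) = 0" using \<open>j < m\<close> by simp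
    ultimately have "(\<lambda>k. complex_of_real (inverse (real k) ^ (m - j))) \<longlonglongrightarrow> 0" by (simp only:)
    moreover have "\<forall>\<^sub>F k in sequentially. complex_of_real (inverse (real k) ^ (m - j)) = (of_real (real k) ^ j / of_real (real k) ^ m :: complex)"
    proof (rule eventually_sequentiallyI[of 1])
      fix k :: nat assume "k \<ge> 1"
      then have "(of_real (real k) :: complex) ^ m = of_real (real k) ^ j * of_real (real k) ^ (m - j)" "(of_real (real k) :: complex) \<noteq> 0"
        using \<open>j < m\<close> by (simp_all add: power_add[symmetric])
      then show "complex_of_real (inverse (real k) ^ (m - j)) = (of_real (real k) ^ j / of_real (real k) ^ m :: complex)"
        by (simp add: power_inverse divide_inverse)
    qed
    ultimately show ?thesis using False by (simp add: Lim_transform_eventually)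
  qed
  have R: "(\<lambda>k. \<Sum>j\<le>m. \<kappa> j * (of_real (real k) ^ j / of_real (real k) ^ m * ?E j k)) \<longlonglongrightarrow> (\<Sum>j\<le>m. \<kappa> j * ((if j = m then 1 else 0) * 1))"
    by (intro tendsto_sum tendsto_mult tendsto_const kummer_growth r0) auto
  have "(\<lambda>k. 1 - of_real a * inverse (complex_of_real (real k))) \<longlonglongrightarrow> 1 - of_real a * 0"
    using lim_inverse_n[where 'a = complex] by (intro tendsto_intros) simp
  then have "(\<lambda>k. (of_real (real k) ^ Suc n / of_real (real k) ^ m) * (1 - of_real a * inverse (complex_of_real (real k))) ^ Suc n * (det_mom a (Suc n) (real k) / pw s (real k)))
     \<longlonglongrightarrow> (if Suc n = m then 1 else 0) * (1 - of_real a * 0) ^ Suc n * det_mom a n a"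
    by (intro tendsto_mult tendsto_power det_mom_growth[OF a] r0) (simp_all add: m_def)
  moreover have "\<forall>\<^sub>F k in sequentially. (of_real (real k) ^ Suc n / of_real (real k) ^ m) * (1 - of_real a * inverse (complex_of_real (real k))) ^ Suc n * (det_mom a (Suc n) (real k) / pw s (real k))
    = (\<Sum>j\<le>m. \<kappa> j * (of_real (real k) ^ j / of_real (real k) ^ m * ?E j k))"
  proof (rule eventually_sequentiallyI[of 1])
    fix k :: nat assume k: "k \<ge> 1"
    let ?k = "complex_of_real (real k)"
    have kz: "?k \<noteq> 0" "pw s (real k) \<noteq> 0" using k pw_nonzero[of "real k"] by simp_all
    have "(?k ^ Suc n / ?k ^ m) * (1 - of_real a * inverse ?k) ^ Suc n * (det_mom a (Suc n) (real k) / pw s (real k))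
      = (?k * (1 - of_real a * inverse ?k)) ^ Suc n * det_mom a (Suc n) (real k) / (?k ^ m * pw s (real k))"
      unfolding power_mult_distrib by simp
    also have "?k * (1 - of_real a * inverse ?k) = ?k - of_real a" using kz by (simp add: field_simps)
    also have "(?k - of_real a) ^ Suc n * det_mom a (Suc n) (real k) = (\<Sum>j\<le>m. \<kappa> j * (exp (- ?k) * kummer (s + of_nat j) ?k))"
      by (rule det_mom_kummer_expansion[OF S \<kappa>(1)]) simp
    also have "(\<Sum>j\<le>m. \<kappa> j * (exp (- ?k) * kummer (s + of_nat j) ?k)) / (?k ^ m * pw s (real k)) = (\<Sum>j\<le>m. \<kappa> j * (?k ^ j / ?k ^ m * ?E j k))"
      unfolding sum_divide_distrib by (intro sum.cong refl) (use kz in \<open>simp add: field_simps\<close>)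
    finally show "(?k ^ Suc n / ?k ^ m) * (1 - of_real a * inverse ?k) ^ Suc n * (det_mom a (Suc n) (real k) / pw s (real k))
      = (\<Sum>j\<le>m. \<kappa> j * (?k ^ j / ?k ^ m * ?E j k))" .
  qed
  ultimately have "(\<lambda>k. \<Sum>j\<le>m. \<kappa> j * (of_real (real k) ^ j / of_real (real k) ^ m * ?E j k)) \<longlonglongrightarrow> (if Suc n = m then 1 else 0) * (1 - of_real a * 0) ^ Suc n * det_mom a n a"
    by (rule Lim_transform_eventually)
  \<comment> \<open>If \<open>degree S\<close> exceeded \<open>Suc n\<close>, then \<open>m\<close>
    would be this degree and the limit \<open>0\<close> would be the leading coefficient, which is
    impossible. Otherwise \<open>m = Suc n\<close> and the limit is the diagonal moment.\<close>
  from LIMSEQ_unique[OF this R] have "(if Suc n = m then det_mom a n a else 0) = coeff S m"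
    using \<kappa>(2) by (simp add: if_distrib[of "\<lambda>x. _ * x"] cong: if_cong split: if_splits)
  then show ?thesis
    unfolding m_def by (cases "degree S \<le> Suc n") (auto simp: max_def split: if_splits)
qed

text \<open>The polynomial for \<open>n\<close> yields the Kummer expansion of the moment, and its
  Beta integral writes the next coefficient sequence through \<open>kummer_mom\<close> with
  parameters \<open>s + j\<close>, \<open>j \<le> n\<close>. Since \<open>j < Suc n\<close>, the
  operator \<open>shift_op\<close> applied \<open>Suc n\<close> times leaves only polynomials; the
  growth comparison then recovers the degree bound, which this construction loses.\<close>

theorem mom_coeff_structure:
  assumes a: "a > 0"
  shows "\<exists>S. degree S \<le> n \<and> coeff S n = (case n of 0 \<Rightarrow> 1 | Suc m \<Rightarrow> det_mom a m a) \<and> (\<forall>q. (shift_op a ^^ n) (mom_coeff a n) q = kummer_coeff s q * poly S (of_nat q))"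
proof (induction n)
  case 0
  then show ?case by (intro exI[of _ 1]) (simp add: mom_coeff_0)
next
  case (Suc n)
  then obtain S where S: "degree S \<le> n" "\<And>q. (shift_op a ^^ n) (mom_coeff a n) q = kummer_coeff s q * poly S (of_nat q)" by blast
  obtain \<kappa> where \<kappa>: "\<And>x. poly S x = (\<Sum>j\<le>n. \<kappa> j * pochhammer (x + (1 + s)) j)"
    using poly_pochhammer_decomposition[OF S(1), of "1 + s"] by blast
  define \<mu> where "\<mu> j = \<kappa> j / (fact n * (- of_real a) ^ n)" for j
  define g where "g j p = Gamma (of_nat (Suc n + 1 + p) + s) / (fact p)\<^sup>2 * kummer_mom a (s + of_nat j) p" for j p
  have mom_coeff: "mom_coeff a (Suc n) = (\<lambda>p. \<Sum>j\<le>n. \<mu> j * g j p)"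
    unfolding \<mu>_def g_def by (rule ext, rule mom_coeff_Suc_kummer_mom[OF a]) (rule det_mom_kummer_expansion[OF S(2) \<kappa>])
  have "\<forall>j\<in>{..n}. \<exists>S. \<forall>q. (shift_op a ^^ Suc n) (g j) q = kummer_coeff s q * poly S (of_nat q)"
  proof
    fix j assume "j \<in> {..n}"
    then have "j < Suc n" by simp
    from shift_op_kummer_mom_polynomial[OF _ this, of s a] obtain T where "\<forall>q. (shift_op a ^^ Suc n) (g j) q = Gamma (of_nat q + 1 + s) / (fact q)\<^sup>2 * poly T (of_nat q)"
      unfolding g_def using Re_s by auto
    then show "\<exists>S. \<forall>q. (shift_op a ^^ Suc n) (g j) q = kummer_coeff s q * poly S (of_nat q)" unfolding kummer_coeff_def by blast
  qed
  then obtain T where T: "\<And>j q. j \<le> n \<Longrightarrow> (shift_op a ^^ Suc n) (g j) q = kummer_coeff s q * poly (T j) (of_nat q)" by (metis atMost_iff)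
  define S' where "S' = (\<Sum>j\<le>n. Polynomial.smult (\<mu> j) (T j))"
  have S': "(shift_op a ^^ Suc n) (mom_coeff a (Suc n)) q = kummer_coeff s q * poly S' (of_nat q)" for q
  proof -
    have "(shift_op a ^^ Suc n) (mom_coeff a (Suc n)) q = (\<Sum>j\<le>n. \<mu> j * (shift_op a ^^ Suc n) (g j) q)"
      unfolding mom_coeff shift_op_sum shift_op_cmult ..
    also have "\<dots> = (\<Sum>j\<le>n. kummer_coeff s q * (\<mu> j * poly (T j) (of_nat q)))" by (intro sum.cong refl) (simp add: T del: funpow.simps)
    also have "\<dots> = kummer_coeff s q * poly S' (of_nat q)" by (simp add: S'_def poly_sum sum_distrib_left)
    finally show ?thesis .
  qed
  show ?case using structure_degree[OF less_imp_le[OF a] S'] S' by (intro exI[of _ S']) simp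
qed

end

section \<open>The Poisson orthogonal polynomial ensemble\<close>

lemma poly_growth:
  fixes p :: "complex poly"
  shows "\<exists>C K. C \<ge> 0 \<and> K \<ge> 1 \<and> (\<forall>k. norm (poly p (of_nat k)) \<le> C * K ^ k)"
proof (induction p)
  case 0
  then show ?case by (intro exI[of _ 0] exI[of _ 1]) simp
next
  case (pCons b p)
  then obtain C K where CK: "C \<ge> 0" "K \<ge> 1" "\<And>k. norm (poly p (of_nat k)) \<le> C * K ^ k" by blast
  have "norm (poly (pCons b p) (of_nat k)) \<le> (norm b + C) * (2 * K) ^ k" for k
  proof -
    have k2: "real k \<le> 2 ^ k" by (metis less_imp_le of_nat_less_two_power)
    have "norm (poly (pCons b p) (of_nat k)) \<le> norm b + real k * norm (poly p (of_nat k))"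
      using norm_triangle_ineq[of b "of_nat k * poly p (of_nat k)"] by (simp add: norm_mult)
    also have "\<dots> \<le> norm b * (2 * K) ^ k + 2 ^ k * (C * K ^ k)"
      using CK k2 one_le_power[of "2 * K" k] by (intro add_mono mult_mono) (auto simp: mult_le_cancel_left1)
    also have "\<dots> = (norm b + C) * (2 * K) ^ k" by (simp add: power_mult_distrib algebra_simps)
    finally show ?thesis .
  qed
  then show ?case using CK by (intro exI[of _ "norm b + C"] exI[of _ "2 * K"]) simp
qed

lemma expgrow_poly: "finite I \<Longrightarrow> i \<in> I \<Longrightarrow> expgrow I (\<lambda>l. poly p (of_nat (l i)))"
  using poly_growth[of p] by (elim exE conjE) (rule expgrow_coord, auto)

context imag_power
begin

definition gamma_quot :: "nat \<Rightarrow> complex" where "gamma_quot l = Gamma (of_nat l + 1 + s) / fact l"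

text \<open>The quotient is the expectation of \<open>pw s\<close> under a Gamma law, hence an
  average of numbers of modulus at most one.\<close>

lemma norm_gamma_quot_le: "norm (gamma_quot l) \<le> 1"
proof -
  have "Gamma (of_nat l + 1 + s) = (\<integral>t. (if t < 0 then 0 else exp (- of_real t) * of_real t ^ l * pw s t) \<partial>lborel)"
    by (rule pw_power_Gamma(1)[symmetric]) simp
  also have "\<dots> = (\<integral>t. fact l * (erlang_density l 1 t *\<^sub>R pw s t) \<partial>lborel)"
    by (intro Bochner_Integration.integral_cong refl) (simp add: erlang_density_1 scaleR_conv_of_real exp_of_real[symmetric])
  also have "\<dots> = fact l * (\<integral>t. (erlang_density l 1 t *\<^sub>R pw s t) \<partial>lborel)" by (rule integral_mult_right_zero)
  finally have "gamma_quot l = (\<integral>t. (erlang_density l 1 t *\<^sub>R pw s t) \<partial>lborel)" by (simp add: gamma_quot_def)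
  then show ?thesis using norm_integral_erlang_le[OF measurable_pw norm_pw_le[OF Re_s], of l] by simp
qed

lemma gamma_quot_Suc: "gamma_quot (Suc k) = gamma_quot k + gamma_quot k * (s / (of_nat k + 1))"
proof -
  have "of_nat k + 1 + s \<notin> \<int>\<^sub>\<le>\<^sub>0" by (rule not_nonpos_Int) (simp add: Re_s)
  then have "Gamma (of_nat k + 1 + s + 1) = (of_nat k + 1 + s) * Gamma (of_nat k + 1 + s)" by (intro Gamma_plus1) auto
  moreover define x where "x = (of_nat k + 1 :: complex)"
  moreover have x: "x \<noteq> 0" unfolding x_def by (metis of_nat_Suc of_nat_eq_0_iff nat.distinct(1) add.commute)
  ultimately have "gamma_quot (Suc k) = (x + s) * Gamma (x + s) / (x * fact k)" "gamma_quot k = Gamma (x + s) / fact k"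
    by (simp_all add: gamma_quot_def add_ac)
  then have "gamma_quot (Suc k) = (x + s) / x * gamma_quot k" using x by simp
  then show ?thesis unfolding x_def[symmetric] using x by (simp add: field_simps)
qed

lemma kummer_coeff_gamma_quot: "kummer_coeff s l = gamma_quot l / fact l" by (simp add: kummer_coeff_def gamma_quot_def power2_eq_square)

text \<open>The unnormalised expectation over the ensemble. The index set is arbitrary, so removing
  a point is simply removing an index.\<close>

definition Z :: "'i set \<Rightarrow> real \<Rightarrow> complex" where
  "Z I a = (\<integral>l. of_real (vdm I l) * (\<Prod>i\<in>I. gamma_quot (l i)) \<partial>poisson_prod I a)"

text \<open>The moment of the \<open>n\<close>-dimensional matrix with all shifts equal; the empty
  matrix has determinant one. This undoes the offset in the index of \<open>det_mom\<close>.\<close>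

definition diag_mom :: "real \<Rightarrow> nat \<Rightarrow> complex" where "diag_mom a n = (case n of 0 \<Rightarrow> 1 | Suc m \<Rightarrow> det_mom a m a)"

lemma norm_gamma_quot_le': "norm (gamma_quot l) \<le> 1 * 1 ^ l" using norm_gamma_quot_le by simp

lemma expgrow_Z: "finite I \<Longrightarrow> expgrow I (\<lambda>l. of_real (vdm I l) * (\<Prod>i\<in>I. gamma_quot (l i)))"
  by (rule expgrow_vdm_prod[OF _ norm_gamma_quot_le']) auto

text \<open>Since \<open>kummer_coeff s l\<close> is \<open>gamma_quot l / l!\<close>, the Poisson
  weight times \<open>S * gamma_quot\<close> equals \<open>exp (- a) * a ^ l\<close> times the
  sequence after \<open>n\<close> applications of \<open>shift_op\<close>. So \<open>S\<close> is
  orthogonal to all lower degrees for the weight \<open>gamma_quot\<close> under the Poisson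
  law.\<close>

lemma poisson_orthogonality:
  assumes a: "a > 0" and \<pi>: "degree \<pi> \<le> n"
    and S: "\<And>q. (shift_op a ^^ n) (mom_coeff a n) q = kummer_coeff s q * poly S (of_nat q)"
  shows "(\<integral>k. poly \<pi> (of_nat k) * poly S (of_nat k) * gamma_quot k \<partial>measure_pmf (poisson_pmf a)) = coeff \<pi> n * fact n * of_real a ^ n * det_mom a n a"
proof -
  obtain C K where CK: "C \<ge> 0" "K \<ge> 1" "\<And>k. norm (poly (\<pi> * S) (of_nat k)) \<le> C * K ^ k" using poly_growth by blast
  have "norm (poly \<pi> (of_nat k) * poly S (of_nat k) * gamma_quot k) \<le> C * K ^ k" for k
    using mult_mono[OF CK(3)[of k] norm_gamma_quot_le[of k]] CK by (simp add: norm_mult)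
  from integrable_poisson(2)[OF a this] CK
  have "(\<lambda>k. of_real (exp (- a) * a ^ k / fact k) * (poly \<pi> (of_nat k) * poly S (of_nat k) * gamma_quot k)) sums
    (\<integral>k. poly \<pi> (of_nat k) * poly S (of_nat k) * gamma_quot k \<partial>measure_pmf (poisson_pmf a))" by simp
  moreover have "of_real (exp (- a) * a ^ k / fact k) * (poly \<pi> (of_nat k) * poly S (of_nat k) * gamma_quot k)
    = exp (- of_real a) * (of_real a ^ k * poly \<pi> (of_nat k) * (shift_op a ^^ n) (mom_coeff a n) k)" for k
    unfolding S kummer_coeff_gamma_quot by (simp add: exp_of_real[symmetric])
  ultimately have s1: "(\<lambda>k. exp (- of_real a) * (of_real a ^ k * poly \<pi> (of_nat k) * (shift_op a ^^ n) (mom_coeff a n) k)) sums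
    (\<integral>k. poly \<pi> (of_nat k) * poly S (of_nat k) * gamma_quot k \<partial>measure_pmf (poisson_pmf a))" by simp
  have sm: "summable (\<lambda>k. of_real a ^ k * poly \<pi> (of_nat k) * (shift_op a ^^ n) (mom_coeff a n) k)"
    using entire_seq_summable[OF entire_seq_poly[OF entire_seq_shift_op_power[OF entire_seq_mom_coeff]], of \<pi> n a a n "of_real a"] by (simp add: mult_ac)
  have "(\<integral>k. poly \<pi> (of_nat k) * poly S (of_nat k) * gamma_quot k \<partial>measure_pmf (poisson_pmf a)) = (\<Sum>k. exp (- of_real a) * (of_real a ^ k * poly \<pi> (of_nat k) * (shift_op a ^^ n) (mom_coeff a n) k))"
    by (rule sums_unique[OF s1])
  also have "\<dots> = exp (- of_real a) * (\<Sum>k. of_real a ^ k * poly \<pi> (of_nat k) * (shift_op a ^^ n) (mom_coeff a n) k)"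
    by (rule suminf_mult[OF sm])
  also have "\<dots> = exp (- of_real a) * (coeff \<pi> n * fact n * of_real a ^ n * (\<Sum>l. of_real a ^ l * mom_coeff a n l))"
    unfolding shift_op_power_orthogonality[OF entire_seq_mom_coeff \<pi>] ..
  also have "(\<Sum>l. of_real a ^ l * mom_coeff a n l) = exp (of_real a) * det_mom a n a"
    using sums_unique[OF mom_coeff_sums[of a a n]] a by (simp add: mult_ac)
  finally show ?thesis by (simp add: exp_minus field_simps)
qed

text \<open>\<open>vdm_interpolation\<close> applied to \<open>S\<close> singles out one coordinate
  at a time. That coordinate then occurs through a monic polynomial of degree \<open>n\<close>,
  through \<open>S\<close> and through \<open>gamma_quot\<close>, so its integral is a constant and
  the ensemble loses one point.\<close>

lemma Z_recursion:
  assumes fin: "finite I" and card: "card I = Suc n" and a: "a > 0"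
  shows "diag_mom a n * Z I a = (\<Sum>i\<in>I. fact n * of_real a ^ n * det_mom a n a * Z (I - {i}) a)"
proof -
  obtain S where S: "degree S \<le> n" "coeff S n = diag_mom a n" "\<And>q. (shift_op a ^^ n) (mom_coeff a n) q = kummer_coeff s q * poly S (of_nat q)"
    using mom_coeff_structure[OF a, of n] unfolding diag_mom_def by blast
  define F where "F i l = of_real (vdm (I - {i}) l) * (\<Prod>j\<in>I - {i}. (of_nat (l i) - of_nat (l j))) * poly S (of_nat (l i)) * (\<Prod>j\<in>I. gamma_quot (l j))" for i l
  have gr: "expgrow I (F i)" if "i \<in> I" for i
    unfolding F_def using fin that
    by (intro expgrow_mult expgrow_prod expgrow_diff expgrow_vdm expgrow_of_nat expgrow_poly expgrow_coord[OF _ _ norm_gamma_quot_le']) auto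
  have "diag_mom a n * Z I a = (\<integral>l. diag_mom a n * (of_real (vdm I l) * (\<Prod>i\<in>I. gamma_quot (l i))) \<partial>poisson_prod I a)"
    unfolding Z_def by simp
  also have "\<dots> = (\<integral>l. (\<Sum>i\<in>I. F i l) \<partial>poisson_prod I a)"
  proof (rule Bochner_Integration.integral_cong[OF refl])
    fix l
    have "(\<Sum>i\<in>I. F i l) = of_real (vdm I l) * coeff S (card I - 1) * (\<Prod>j\<in>I. gamma_quot (l j))"
      unfolding F_def sum_distrib_right[symmetric] using S(1) card by (subst vdm_interpolation[OF fin]) auto
    then show "diag_mom a n * (of_real (vdm I l) * (\<Prod>i\<in>I. gamma_quot (l i))) = (\<Sum>i\<in>I. F i l)" using S(2) card by simp
  qed
  also have "\<dots> = (\<Sum>i\<in>I. \<integral>l. F i l \<partial>poisson_prod I a)"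
    by (rule Bochner_Integration.integral_sum) (rule integrable_poisson_prod[OF fin a gr])
  also have "\<dots> = (\<Sum>i\<in>I. fact n * of_real a ^ n * det_mom a n a * Z (I - {i}) a)"
  proof (rule sum.cong[OF refl])
    fix i assume i: "i \<in> I"
    define I' where "I' = I - {i}"
    have I': "finite I'" "i \<notin> I'" "I = insert i I'" "card I' = n" using fin i card by (auto simp: I'_def)
    define \<pi> where "\<pi> l = (\<Prod>j\<in>I'. [:- of_nat (l j), 1:] :: complex poly)" for l :: "'a \<Rightarrow> nat"
    have d\<pi>: "degree (\<pi> l) = n" "coeff (\<pi> l) n = 1" for l
    proof -
      show d: "degree (\<pi> l) = n" unfolding \<pi>_def by (subst degree_prod_eq_sum_degree) (auto simp: I')
      have "lead_coeff (\<pi> l) = 1" unfolding \<pi>_def by (simp add: lead_coeff_prod)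
      then show "coeff (\<pi> l) n = 1" using d by simp
    qed
    have "(\<integral>l. F i l \<partial>poisson_prod I a) = (\<integral>l. (\<integral>k. F i (l(i := k)) \<partial>measure_pmf (poisson_pmf a)) \<partial>poisson_prod I' a)"
      using poisson_prod_insert[OF I'(1,2) a] gr[OF i] I'(3) by simp
    also have "\<dots> = (\<integral>l. (fact n * of_real a ^ n * det_mom a n a) * (of_real (vdm I' l) * (\<Prod>j\<in>I'. gamma_quot (l j))) \<partial>poisson_prod I' a)"
    proof (rule Bochner_Integration.integral_cong[OF refl])
      fix l :: "'a \<Rightarrow> nat"
      have ne: "j \<noteq> i" if "j \<in> I'" for j using that I'(2) by auto
      have "F i (l(i := k)) = (of_real (vdm I' l) * (\<Prod>j\<in>I'. gamma_quot (l j))) * (poly (\<pi> l) (of_nat k) * poly S (of_nat k) * gamma_quot k)" for k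
      proof -
        have v: "vdm I' (l(i := k)) = vdm I' l" by (rule vdm_cong) (use ne in auto)
        have p1: "(\<Prod>j\<in>I'. gamma_quot ((l(i := k)) j)) = (\<Prod>j\<in>I'. gamma_quot (l j))" by (rule prod.cong) (use ne in auto)
        have p2: "(\<Prod>j\<in>I'. (of_nat ((l(i := k)) i) - of_nat ((l(i := k)) j))) = poly (\<pi> l) (of_nat k)"
          unfolding \<pi>_def poly_prod by (rule prod.cong) (use ne in auto)
        show ?thesis unfolding F_def I'_def[symmetric] v p2
          using I' p1 by (simp add: mult_ac)
      qed
      then have "(\<integral>k. F i (l(i := k)) \<partial>measure_pmf (poisson_pmf a)) = (of_real (vdm I' l) * (\<Prod>j\<in>I'. gamma_quot (l j))) * (\<integral>k. poly (\<pi> l) (of_nat k) * poly S (of_nat k) * gamma_quot k \<partial>measure_pmf (poisson_pmf a))"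
        by simp
      also have "(\<integral>k. poly (\<pi> l) (of_nat k) * poly S (of_nat k) * gamma_quot k \<partial>measure_pmf (poisson_pmf a)) = fact n * of_real a ^ n * det_mom a n a"
        by (subst poisson_orthogonality[OF a _ S(3)]) (simp_all add: d\<pi>)
      finally show "(\<integral>k. F i (l(i := k)) \<partial>measure_pmf (poisson_pmf a)) = (fact n * of_real a ^ n * det_mom a n a) * (of_real (vdm I' l) * (\<Prod>j\<in>I'. gamma_quot (l j)))"
        by (simp only: mult_ac)
    qed
    also have "\<dots> = fact n * of_real a ^ n * det_mom a n a * Z I' a" unfolding Z_def by simp
    finally show "(\<integral>l. F i l \<partial>poisson_prod I a) = fact n * of_real a ^ n * det_mom a n a * Z (I - {i}) a" unfolding I'_def .
  qed
  finally show ?thesis .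
qed

lemma Z_empty: "Z ({} :: 'i set) a = 1"
proof -
  interpret PP: product_prob_space "\<lambda>_. measure_pmf (poisson_pmf a)" "{} :: 'i set" by (rule product_prob_space_poisson)
  have "prob_space (poisson_prod ({} :: 'i set) a)" by (rule PP.P.prob_space_axioms)
  then have "measure (poisson_prod ({} :: 'i set) a) (space (poisson_prod {} a)) = 1" by (rule prob_space.prob_space)
  then have "measure (poisson_prod ({} :: 'i set) a) (space (poisson_prod {} a)) *\<^sub>R (1::complex) = 1" by simp
  then show ?thesis unfolding Z_def vdm_def prod.empty by (simp only: lebesgue_integral_const of_real_1 mult_1)
qed

lemma continuous_Z: "finite I \<Longrightarrow> a > 0 \<Longrightarrow> isCont (Z I) a"
  unfolding Z_def[abs_def]
  by (rule has_vector_derivative_continuous[OF poisson_prod_has_derivative[OF _ _ expgrow_Z]])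

text \<open>At \<open>a = 0\<close> the moment is a nonzero product of Gamma values, and continuity
  carries this to small positive \<open>a\<close>. One such point is what the isolation of zeros
  requires.\<close>

lemma diag_mom_nonzero_somewhere: "\<exists>b>0. diag_mom b n \<noteq> 0"
proof (cases n)
  case 0
  then show ?thesis by (intro exI[of _ 1]) (simp add: diag_mom_def)
next
  case (Suc m)
  have "(\<lambda>k. det_mom (inverse (real (Suc k))) m (inverse (real (Suc k)))) \<longlonglongrightarrow> det_mom 0 m 0"
    by (rule det_mom_tendsto) (use LIMSEQ_inverse_real_of_nat in auto)
  from eventually_happens'[OF sequentially_bot tendsto_imp_eventually_ne[OF this det_mom_0_0_nonzero]]
  obtain k where "det_mom (inverse (real (Suc k))) m (inverse (real (Suc k))) \<noteq> 0"
    by blast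
  then show ?thesis using Suc by (intro exI[of _ "inverse (real (Suc k))"]) (simp add: diag_mom_def)
qed

text \<open>The recursion can only be divided by \<open>diag_mom\<close> where it does not vanish; its zeros are isolated, being those of an
  entire function, so the general case follows by continuity.\<close>
theorem Z_eq:
  assumes "finite I" "card I = n" "a > 0"
  shows "Z I a = diag_mom a n * (\<Prod>k<n. fact (Suc k) * of_real a ^ k)"
  using assms
proof (induction n arbitrary: I a)
  case 0
  then show ?case by (simp add: Z_empty diag_mom_def)
next
  case (Suc n)
  let ?C = "\<lambda>n b. \<Prod>k<n. fact (Suc k) * complex_of_real b ^ k"
  \<comment> \<open>The induction hypothesis for \<open>I - {i}\<close> puts the factor
    \<open>diag_mom b n\<close> on both sides of the recursion, where it can be cancelled.\<close>
  have generic: "Z I b = det_mom b n b * ?C (Suc n) b" if b: "b > 0" "diag_mom b n \<noteq> 0" for b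
  proof -
    have "diag_mom b n * Z I b = (\<Sum>i\<in>I. fact n * of_real b ^ n * det_mom b n b * (diag_mom b n * ?C n b))"
      unfolding Z_recursion[OF Suc.prems(1,2) b(1)] using Suc.prems b by (intro sum.cong refl) (simp add: Suc.IH)
    also have "\<dots> = diag_mom b n * (det_mom b n b * ?C (Suc n) b)" using Suc.prems(2) by (simp add: algebra_simps)
    finally show ?thesis using b(2) by simp
  qed
  obtain i where i: "i \<in> I" using Suc.prems by fastforce
  define I' where "I' = I - {i}"
  have I': "finite I'" "card I' = n" using Suc.prems i by (auto simp: I'_def)
  \<comment> \<open>By the induction hypothesis \<open>diag_mom\<close> has the same positive zeros
    as the ensemble expectation with one point fewer, which after the change of rate is a positive
    factor times this entire function.\<close>
  define g where "g z = (\<Sum>m. level_coeff I' (\<lambda>l. of_real (vdm I' l) * (\<Prod>i\<in>I'. gamma_quot (l i))) m * z ^ m)" for z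
  have g: "g (of_real b) \<noteq> 0 \<longleftrightarrow> diag_mom b n \<noteq> 0" if "b > 0" for b
  proof -
    have zg: "Z I' b = of_real (exp ((1 - b) * card I')) * g (of_real b)"
      unfolding Z_def g_def poisson_prod_change_rate[OF I'(1) that expgrow_Z[OF I'(1)]]
      using sums_unique[OF level_coeff_sums[OF I'(1) expgrow_Z[OF I'(1)], of "of_real b"]] by simp
    have zj: "Z I' b = diag_mom b n * ?C n b" by (rule Suc.IH[OF I' that])
    have nz: "?C n b \<noteq> 0"
    proof -
      have "fact (Suc k) * complex_of_real b ^ k \<noteq> 0" for k using that fact_nonzero[of "Suc k"] by (simp del: fact_Suc)
      then show ?thesis by (simp only: prod_zero_iff finite_lessThan) blast
    qed
    have iff: "c * x = y * d \<Longrightarrow> c \<noteq> 0 \<Longrightarrow> d \<noteq> 0 \<Longrightarrow> x \<noteq> 0 \<longleftrightarrow> y \<noteq> 0" for c d x y :: complex by auto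
    have "complex_of_real (exp ((1 - b) * card I')) \<noteq> 0" by simp
    from iff[OF trans[OF zg[symmetric] zj] this nz] show ?thesis .
  qed
  have "g holomorphic_on UNIV"
  proof -
    have "g holomorphic_on ball 0 R" for R
    proof (rule power_series_holomorphic[where a = "level_coeff I' (\<lambda>l. of_real (vdm I' l) * (\<Prod>i\<in>I'. gamma_quot (l i)))"])
      fix z
      show "(\<lambda>m. level_coeff I' (\<lambda>l. of_real (vdm I' l) * (\<Prod>i\<in>I'. gamma_quot (l i))) m * (z - 0) ^ m) sums g z"
        unfolding g_def diff_0_right by (rule summable_sums[OF sums_summable[OF level_coeff_sums[OF I'(1) expgrow_Z[OF I'(1)]]]])
    qed
    note hb = holomorphic_on_imp_differentiable_at[OF this open_ball]
    have "g field_differentiable at z" for z by (rule hb[of _ "norm z + 1"]) simp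
    then show ?thesis by (simp add: holomorphic_on_def field_differentiable_at_within)
  qed
  note hol = this
  have dense: "\<exists>A. A \<longlonglongrightarrow> a \<and> (\<forall>k. A k > 0 \<and> diag_mom (A k) n \<noteq> 0)"
  proof (cases "diag_mom a n = 0")
    case False
    then show ?thesis using Suc.prems(3) by (intro exI[of _ "\<lambda>_. a"]) auto
  next
    case True
    obtain b where b: "b > 0" "diag_mom b n \<noteq> 0" using diag_mom_nonzero_somewhere by blast
    obtain r where r: "r > 0" "\<And>z. z \<in> ball (of_real a) r - {of_real a} \<Longrightarrow> g z \<noteq> 0"
    proof (rule isolated_zeros[OF hol open_UNIV connected_UNIV, of "of_real a" "of_real b"])
      show "g (of_real a) = 0" using g[OF Suc.prems(3)] True by simp
      show "g (of_real b) \<noteq> 0" using g[OF b(1)] b(2) by simp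
    qed auto
    \<comment> \<open>All these points lie in the punctured disc without zeros, because
      \<open>r / (k + 2) < r\<close>, and they tend to \<open>a\<close>.\<close>
    define A where "A k = a + r / (real k + 2)" for k
    have "A \<longlonglongrightarrow> a" unfolding A_def by real_asymp
    moreover have "A k > 0 \<and> diag_mom (A k) n \<noteq> 0" for k
    proof -
      have p: "0 < r / (real k + 2)" "r / (real k + 2) < r"
        using r(1) divide_strict_left_mono[of 1 "real k + 2" r] by simp_all
      then have Ak: "A k > 0" using Suc.prems(3) by (simp add: A_def)
      have "dist (complex_of_real a) (of_real (A k)) = r / (real k + 2)"
        unfolding dist_of_real using p by (simp add: A_def dist_real_def)
      then have "g (of_real (A k)) \<noteq> 0" using p by (intro r(2)) (auto simp: A_def)
      then show ?thesis using g[OF Ak] Ak by blast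
    qed
    ultimately show ?thesis by blast
  qed
  then obtain A where A: "A \<longlonglongrightarrow> a" "\<And>k. A k > 0" "\<And>k. diag_mom (A k) n \<noteq> 0" by blast
  have "(\<lambda>k. Z I (A k)) \<longlonglongrightarrow> Z I a"
    using continuous_Z[OF Suc.prems(1,3)] A(1) by (rule isCont_tendsto_compose)
  moreover have "(\<lambda>k. det_mom (A k) n (A k) * ?C (Suc n) (A k)) \<longlonglongrightarrow> det_mom a n a * ?C (Suc n) a"
    by (intro tendsto_mult tendsto_prod tendsto_power tendsto_of_real tendsto_const A(1) det_mom_tendsto less_imp_le[OF A(2)])
  ultimately have "Z I a = det_mom a n a * ?C (Suc n) a"
    unfolding generic[OF A(2,3)] by (rule LIMSEQ_unique)
  then show ?case by (simp add: diag_mom_def)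
qed

end

section \<open>Normalisation, void probability and the differential equation in the rate\<close>

lemma norm_mvt:
  fixes f :: "real \<Rightarrow> complex"
  assumes "a < b" "\<And>x. x \<in> {a..b} \<Longrightarrow> (f has_vector_derivative f' x) (at x)" "\<And>x. x \<in> {a..b} \<Longrightarrow> norm (f' x) \<le> B"
  shows "norm (f b - f a) \<le> B * (b - a)"
proof -
  have "continuous_on {a..b} f"
    by (intro continuous_at_imp_continuous_on ballI has_vector_derivative_continuous[OF assms(2)])
  then obtain x where x: "x \<in> {a<..<b}" "norm (f b - f a) \<le> norm ((b - a) *\<^sub>R f' x)"
    using mvt_general[OF assms(1), of f "\<lambda>x h. h *\<^sub>R f' x"] assms(2)[unfolded has_vector_derivative_def] by force
  have "norm ((b - a) *\<^sub>R f' x) \<le> (b - a) * B" using assms(1) assms(3)[of x] x(1) by (simp add: mult_left_mono)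
  then show ?thesis using x(2) by (simp add: mult.commute)
qed

lemma norm_integral_le_norm_integral:
  fixes F G :: "'b \<Rightarrow> complex"
  assumes "integrable M G" "\<And>x. G x = of_real (g x)" "\<And>x. norm (F x) \<le> g x"
  shows "norm (\<integral>x. F x \<partial>M) \<le> norm (\<integral>x. G x \<partial>M)"
proof -
  have g: "integrable M g" using integrable_Re[OF assms(1)] by (simp add: assms(2))
  have "norm (\<integral>x. F x \<partial>M) \<le> (\<integral>x. g x \<partial>M)"
  proof (cases "integrable M F")
    case True
    have "norm (\<integral>x. F x \<partial>M) \<le> (\<integral>x. norm (F x) \<partial>M)" by (rule integral_norm_bound)
    also have "\<dots> \<le> (\<integral>x. g x \<partial>M)" by (rule integral_mono[OF integrable_norm[OF True] g assms(3)])
    finally show ?thesis .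
  next
    case False
    moreover have "0 \<le> (\<integral>x. g x \<partial>M)" by (rule integral_nonneg_AE) (rule AE_I2, rule order_trans[OF norm_ge_zero assms(3)])
    ultimately show ?thesis by (simp add: not_integrable_integral_eq)
  qed
  also have "\<dots> \<le> \<bar>\<integral>x. g x \<partial>M\<bar>" by simp
  also have "\<dots> = norm (\<integral>x. G x \<partial>M)" unfolding assms(2) integral_complex_of_real by simp
  finally show ?thesis .
qed

lemma imag_power_0: "imag_power 0" by unfold_locales simp

lemma gamma_quot_zero: "imag_power.gamma_quot 0 l = 1"
  unfolding imag_power.gamma_quot_def[OF imag_power_0] using Gamma_fact[of l, where 'a = complex] by (simp add: add.commute)

text \<open>At exponent zero the moment is a total mass, as the bases vanish with probability zero.
  This yields the normalisation of the ensemble and, since \<open>pw 0\<close> is the indicator of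
  nonzero numbers, the almost sure invertibility of the shifted matrix.\<close>

lemma det_mom_zero: "imag_power.det_mom 0 a n y = 1"
proof -
  interpret imag_power 0 by (rule imag_power_0)
  have 1: "(\<integral>\<zeta>. pw 0 ((cmod (\<zeta> - of_real (sqrt y)))\<^sup>2 + \<beta>) \<partial>cgauss) = 1" if "\<beta> \<ge> 0" for y \<beta>
  proof -
    have "(\<integral>\<zeta>. pw 0 ((cmod (\<zeta> - of_real (sqrt y)))\<^sup>2 + \<beta>) \<partial>cgauss) = (\<integral>\<zeta>. 1 \<partial>cgauss)"
    proof (rule integral_cong_AE)
      show "(\<lambda>\<zeta>. pw 0 ((cmod (\<zeta> - of_real (sqrt y)))\<^sup>2 + \<beta>)) \<in> borel_measurable cgauss" unfolding measurable_cgauss1 by measurable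
      show "AE \<zeta> in cgauss. pw 0 ((cmod (\<zeta> - of_real (sqrt y)))\<^sup>2 + \<beta>) = 1"
        using AE_cgauss_neq[of "of_real (sqrt y)"]
      proof eventually_elim
        case (elim \<zeta>)
        then have "(cmod (\<zeta> - of_real (sqrt y)))\<^sup>2 + \<beta> > 0" using that by (intro add_pos_nonneg) auto
        then show ?case by (simp add: pw_def)
      qed
    qed simp
    then show ?thesis unfolding integral_cgauss_const .
  qed
  show ?thesis
  proof (cases n)
    case 0
    then show ?thesis using 1[of 0 y] by simp
  next
    case (Suc m)
    have "det_mom a n y = 1" for y
      unfolding Suc
    proof (induction m arbitrary: y)
      case 0
      have J0: "det_mom a 0 y = 1" for y using 1[of 0 y] by simp
      have "det_mom a (Suc 0) y = (\<integral>\<beta>. erlang_density 0 1 \<beta> *\<^sub>R 1 \<partial>lborel)"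
        unfolding det_mom.simps(2) J0
        by (intro Bochner_Integration.integral_cong refl) (use 1 in \<open>simp add: exponential_density_def\<close>)
      also have "\<dots> = 1" by (subst integral_scaleR_left) (simp_all add: integral_erlang integrable_erlang)
      finally show ?case .
    next
      case (Suc m)
      have "det_mom a (Suc (Suc m)) y = (\<integral>\<beta>. erlang_density (Suc m) 1 \<beta> *\<^sub>R 1 \<partial>lborel)"
        unfolding det_mom.simps(2)[of a "Suc m"] Suc
        by (intro Bochner_Integration.integral_cong refl) (use 1 in \<open>simp add: erlang_density_1\<close>)
      also have "\<dots> = 1" by (subst integral_scaleR_left) (simp_all add: integral_erlang integrable_erlang)
      finally show ?case .
    qed
    then show ?thesis .
  qed
qed

definition vconst :: "nat \<Rightarrow> real \<Rightarrow> complex" where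
  "vconst n a = (\<Prod>k<n. fact (Suc k) * of_real a ^ k)"

text \<open>The case \<open>s = 0\<close> of \<open>Z_eq\<close>: the moments are one, so the
  recursion computes the partition function of the Charlier ensemble.\<close>

lemma vdm_total:
  assumes "finite I" "a > 0"
  shows "(\<integral>l. of_real (vdm I l) \<partial>poisson_prod I a) = vconst (card I) a"
proof -
  interpret imag_power 0 by (rule imag_power_0)
  have "diag_mom a (card I) = 1" by (simp add: diag_mom_def det_mom_zero split: nat.split)
  then show ?thesis using Z_eq[OF assms(1) refl assms(2)] by (simp add: Z_def gamma_quot_zero vconst_def)
qed

lemma vconst_Suc: "vconst (Suc n) a = vconst n a * (fact (Suc n) * of_real a ^ n)"
  by (simp add: vconst_def)

lemma vconst_nonzero: "a > 0 \<Longrightarrow> vconst n a \<noteq> 0"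
  by (induction n) (simp_all add: vconst_Suc vconst_def[of 0] del: fact_Suc)

text \<open>As a function of the rate, \<open>vconst n\<close> is a constant times the power with
  exponent \<open>n * (n - 1) / 2\<close>.\<close>

lemma inverse_vconst_derivative:
  assumes "a > 0"
  shows "((\<lambda>a. inverse (vconst n a)) has_vector_derivative - (of_nat (n * (n - 1)) / 2 / of_real a) * inverse (vconst n a)) (at a)"
proof -
  have "((\<lambda>a. \<Prod>k<n. fact (Suc k) * a ^ k) has_real_derivative (real (n * (n - 1)) / 2 / a) * (\<Prod>k<n. fact (Suc k) * a ^ k)) (at a)"
  proof (induction n)
    case (Suc n)
    have p: "((\<lambda>a. fact (Suc n) * a ^ n) has_real_derivative (real n / a) * (fact (Suc n) * a ^ n)) (at a)"
    proof -
      have "fact (Suc n) * (real n * a ^ (n - Suc 0)) = (real n / a) * (fact (Suc n) * a ^ n)"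
        using assms by (cases n) (simp_all del: fact_Suc)
      then show ?thesis using DERIV_cmult[OF DERIV_pow[of n a], of "fact (Suc n)"] by (simp only:)
    qed
    have c: "real (Suc n * (Suc n - 1)) / 2 = real (n * (n - 1)) / 2 + real n" by (cases n) (auto simp: field_simps)
    show ?case unfolding prod.lessThan_Suc c
      by (rule DERIV_cong[OF DERIV_mult[OF Suc p]]) (simp add: algebra_simps add_divide_distrib del: fact_Suc)
  qed simp
  from DERIV_inverse'[OF this] have d: "((\<lambda>a. inverse (\<Prod>k<n. fact (Suc k) * a ^ k)) has_real_derivative - (real (n * (n - 1)) / 2 / a) * inverse (\<Prod>k<n. fact (Suc k) * a ^ k)) (at a)"
    using assms by (simp add: mult_ac del: fact_Suc)
  have e: "inverse (vconst n a) = of_real (inverse (\<Prod>k<n. fact (Suc k) * a ^ k))" for a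
    by (simp add: vconst_def)
  show ?thesis unfolding e
    using has_vector_derivative_of_real[OF d, where 'a = complex] by simp
qed

text \<open>Normalisation removes exactly the term of \<open>vdm_expectation_has_derivative\<close>
  that stems from the degree of the Vandermonde determinant.\<close>

lemma vconst_quotient_derivative:
  assumes a: "a > 0" and X: "(X has_vector_derivative of_nat (n * (n - 1)) / 2 / of_real a * X a + Y) (at a)"
  shows "((\<lambda>a. X a / vconst n a) has_vector_derivative Y / vconst n a) (at a)"
proof -
  have "((\<lambda>a. X a * inverse (vconst n a)) has_vector_derivative
     X a * (- (of_nat (n * (n - 1)) / 2 / of_real a) * inverse (vconst n a)) + (of_nat (n * (n - 1)) / 2 / of_real a * X a + Y) * inverse (vconst n a)) (at a)"
    by (rule has_vector_derivative_mult[OF X inverse_vconst_derivative[OF a]])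
  moreover have "X a * (- (of_nat (n * (n - 1)) / 2 / of_real a) * inverse (vconst n a)) + (of_nat (n * (n - 1)) / 2 / of_real a * X a + Y) * inverse (vconst n a) = Y * inverse (vconst n a)"
  proof -
    have "x * (- c * i) + (c * x + y) * i = y * i" for x c i y :: complex by (simp add: algebra_simps)
    then show ?thesis .
  qed
  ultimately show ?thesis by (simp only: divide_inverse)
qed

definition nonzero_ind :: "nat \<Rightarrow> complex" where "nonzero_ind k = (if k = 0 then 0 else 1)"

text \<open>Divided by \<open>vconst\<close>, this is the probability that the ensemble has no point
  at \<open>0\<close>. It is complex valued so that the differentiation lemma for ensemble
  expectations applies to it.\<close>

definition void_mass :: "'i set \<Rightarrow> real \<Rightarrow> complex" where
  "void_mass I a = (\<integral>l. of_real (vdm I l) * (\<Prod>i\<in>I. nonzero_ind (l i)) \<partial>poisson_prod I a)"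

lemma norm_nonzero_ind: "norm (nonzero_ind k) \<le> 1 * 1 ^ k" by (simp add: nonzero_ind_def)

lemma expgrow_void_mass: "finite I \<Longrightarrow> expgrow I (\<lambda>l. of_real (vdm I l) * (\<Prod>i\<in>I. nonzero_ind (l i)))"
  by (rule expgrow_vdm_prod[OF _ norm_nonzero_ind]) auto

text \<open>The indicator of nonzero coordinates is at most their product. Size bias and translation
  invariance evaluate the product to a power of \<open>a\<close>, so the void probability tends to
  \<open>0\<close> with the rate; this fixes its initial value.\<close>

lemma norm_void_mass_le:
  assumes "finite I" "a > 0"
  shows "norm (void_mass I a) \<le> a ^ card I * norm (vconst (card I) a)"
proof -
  have "norm (void_mass I a) \<le> norm (\<integral>l. (\<Prod>i\<in>I. of_nat (l i)) * complex_of_real (vdm I l) \<partial>poisson_prod I a)"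
    unfolding void_mass_def
  proof (rule norm_integral_le_norm_integral)
    show "integrable (poisson_prod I a) (\<lambda>l. (\<Prod>i\<in>I. of_nat (l i)) * of_real (vdm I l) :: complex)"
      using assms by (intro integrable_poisson_prod expgrow_mult expgrow_prod expgrow_of_nat expgrow_vdm) auto
    show "(\<Prod>i\<in>I. of_nat (l i)) * complex_of_real (vdm I l) = of_real ((\<Prod>i\<in>I. real (l i)) * vdm I l)" for l by simp
    show "norm (complex_of_real (vdm I l) * (\<Prod>i\<in>I. nonzero_ind (l i))) \<le> (\<Prod>i\<in>I. real (l i)) * vdm I l" for l
    proof -
      have "norm (\<Prod>i\<in>I. nonzero_ind (l i)) \<le> (\<Prod>i\<in>I. real (l i))"
        unfolding prod_norm[symmetric] by (rule prod_mono) (auto simp: nonzero_ind_def)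
      then show ?thesis using vdm_nonneg[of I l] by (simp add: norm_mult mult.commute mult_left_mono)
    qed
  qed
  also have "(\<integral>l. (\<Prod>i\<in>I. of_nat (l i)) * of_real (vdm I l) \<partial>poisson_prod I a) = of_real a ^ card I * vconst (card I) a"
    by (subst poisson_prod_shift_all[OF assms expgrow_vdm[OF assms(1) order_refl]]) (simp only: vdm_shift_all vdm_total[OF assms])
  finally show ?thesis using assms by (simp add: norm_mult norm_power)
qed

text \<open>The increments of \<open>nonzero_ind\<close> are concentrated at \<open>0\<close>, so
  differentiation pins one point there. The other points receive the weight
  \<open>l j * (l j - 1)\<close>; two size biases turn it into powers of \<open>a\<close> and leave
  the total mass for \<open>m\<close> points. The result is the derivative of the probability that a
  Poisson variable of mean \<open>a\<close> exceeds \<open>m\<close>.\<close>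

lemma void_mass_derivative:
  assumes fin: "finite I" and card: "card I = Suc m" and a: "a > 0"
  shows "((\<lambda>a. void_mass I a / vconst (Suc m) a) has_vector_derivative of_real (exp (- a) * a ^ m / fact m)) (at a)"
proof -
  define T where "T i = (\<integral>l. of_real (vdm (I - {i}) l) * (\<Prod>j\<in>I - {i}. (of_nat (l i) - of_nat (l j)))
            * (\<Prod>j\<in>I - {i}. (of_nat (l i) + 1 - of_nat (l j))) * ((nonzero_ind (Suc (l i)) - nonzero_ind (l i)) * (\<Prod>j\<in>I - {i}. nonzero_ind (l j))) \<partial>poisson_prod I a)" for i
  have T: "T i = exp (- of_real a) * (of_real a ^ m * (of_real a ^ m * vconst m a))" if i: "i \<in> I" for i
  proof -
    define I' where "I' = I - {i}"
    have I': "finite I'" "i \<notin> I'" "I = insert i I'" "card I' = m" using fin i card by (auto simp: I'_def)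
    have ne: "j \<noteq> i" if "j \<in> I'" for j using that I'(2) by auto
    define F where "F l = of_real (vdm I' l) * (\<Prod>j\<in>I'. (of_nat (l i) - of_nat (l j)))
            * (\<Prod>j\<in>I'. (of_nat (l i) + 1 - of_nat (l j))) * ((nonzero_ind (Suc (l i)) - nonzero_ind (l i)) * (\<Prod>j\<in>I'. nonzero_ind (l j)))" for l
    have np: "norm (nonzero_ind (Suc k)) \<le> 1 * 1 ^ k" for k by (simp add: nonzero_ind_def)
    have gF: "expgrow I F" unfolding F_def using fin i I'
      by (intro expgrow_mult expgrow_prod expgrow_diff expgrow_add expgrow_const expgrow_vdm expgrow_of_nat expgrow_coord[OF _ _ norm_nonzero_ind] expgrow_coord[OF _ _ np]) auto
    have "T i = (\<integral>l. F l \<partial>poisson_prod (insert i I') a)" unfolding T_def F_def using I'(3) by (simp add: I'_def)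
    also have "\<dots> = (\<integral>l. (\<integral>k. F (l(i := k)) \<partial>measure_pmf (poisson_pmf a)) \<partial>poisson_prod I' a)"
      using poisson_prod_insert[OF I'(1,2) a] gF I'(3) by simp
    also have "\<dots> = (\<integral>l. exp (- of_real a) * ((\<Prod>j\<in>I'. of_nat (l j)) * (of_real (vdm I' l) * (\<Prod>j\<in>I'. (of_nat (l j) - 1)))) \<partial>poisson_prod I' a)"
    proof (rule Bochner_Integration.integral_cong[OF refl])
      fix l :: "'a \<Rightarrow> nat"
      let ?c = "(\<Prod>j\<in>I'. of_nat (l j)) * (of_real (vdm I' l) * (\<Prod>j\<in>I'. (of_nat (l j) - 1 :: complex)))"
      have "F (l(i := k)) = (if k = 0 then ?c else 0)" for k
      proof -
        have v: "vdm I' (l(i := k)) = vdm I' l" by (rule vdm_cong) (use ne in auto)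
        \<comment> \<open>For the pinned point \<open>k = 0\<close> the differences are
          \<open>- l j\<close> and \<open>1 - l j\<close>; the two signs cancel, and the factor
          \<open>l j\<close> already enforces the indicator.\<close>
        have "(\<Prod>j\<in>I'. (- of_nat (l j)) :: complex) * (\<Prod>j\<in>I'. (1 - of_nat (l j))) * (\<Prod>j\<in>I'. nonzero_ind (l j)) = (\<Prod>j\<in>I'. of_nat (l j)) * (\<Prod>j\<in>I'. (of_nat (l j) - 1))"
          unfolding prod.distrib[symmetric] by (rule prod.cong[OF refl]) (auto simp: nonzero_ind_def algebra_simps)
        moreover have "F (l(i := k)) = of_real (vdm I' l) * (\<Prod>j\<in>I'. (of_nat k - of_nat (l j)))
            * (\<Prod>j\<in>I'. (of_nat k + 1 - of_nat (l j))) * ((nonzero_ind (Suc k) - nonzero_ind k) * (\<Prod>j\<in>I'. nonzero_ind (l j)))"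
          unfolding F_def v using ne by (intro arg_cong2[where f = "(*)"] prod.cong refl) auto
        ultimately show ?thesis by (simp add: nonzero_ind_def[of k] nonzero_ind_def[of "Suc k"] mult_ac)
      qed
      then have "(\<integral>k. F (l(i := k)) \<partial>measure_pmf (poisson_pmf a)) = (\<integral>k. (if k = 0 then ?c else 0) \<partial>measure_pmf (poisson_pmf a))" by simp
      also have "\<dots> = (\<Sum>k\<in>{0}. pmf (poisson_pmf a) k *\<^sub>R (if k = 0 then ?c else 0))"
        by (rule integral_measure_pmf) (auto split: if_splits)
      also have "\<dots> = exp (- of_real a) * ?c" using a by (simp add: scaleR_conv_of_real exp_of_real[symmetric])
      finally show "(\<integral>k. F (l(i := k)) \<partial>measure_pmf (poisson_pmf a)) = exp (- of_real a) * ?c" .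
    qed
    also have "\<dots> = exp (- of_real a) * (\<integral>l. (\<Prod>j\<in>I'. of_nat (l j)) * (of_real (vdm I' l) * (\<Prod>j\<in>I'. (of_nat (l j) - 1))) \<partial>poisson_prod I' a)"
      by simp
    also have "(\<integral>l. (\<Prod>j\<in>I'. of_nat (l j)) * (of_real (vdm I' l) * (\<Prod>j\<in>I'. (of_nat (l j) - 1 :: complex))) \<partial>poisson_prod I' a)
      = of_real a ^ m * (\<integral>l. (\<Prod>j\<in>I'. of_nat (l j)) * of_real (vdm I' l) \<partial>poisson_prod I' a)"
    proof (subst poisson_prod_shift_all[OF I'(1) a])
      show "expgrow I' (\<lambda>l. of_real (vdm I' l) * (\<Prod>j\<in>I'. (of_nat (l j) - 1)))"
        using I'(1) by (intro expgrow_mult expgrow_prod expgrow_diff expgrow_const expgrow_vdm expgrow_of_nat) auto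
      have "(\<Prod>j\<in>I'. (of_nat (if j \<in> I' then Suc (l j) else l j) - 1 :: complex)) = (\<Prod>j\<in>I'. of_nat (l j))" for l
        by (rule prod.cong) auto
      then show "complex_of_real a ^ card I' * (\<integral>l. of_real (vdm I' (\<lambda>i. if i \<in> I' then Suc (l i) else l i)) * (\<Prod>j\<in>I'. (of_nat (if j \<in> I' then Suc (l j) else l j) - 1)) \<partial>poisson_prod I' a)
        = of_real a ^ m * (\<integral>l. (\<Prod>j\<in>I'. of_nat (l j)) * of_real (vdm I' l) \<partial>poisson_prod I' a)"
        using I'(4) by (simp only: vdm_shift_all mult.commute)
    qed
    also have "(\<integral>l. (\<Prod>j\<in>I'. of_nat (l j)) * of_real (vdm I' l) \<partial>poisson_prod I' a) = of_real a ^ m * vconst m a"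
      by (subst poisson_prod_shift_all[OF I'(1) a expgrow_vdm[OF I'(1) order_refl]]) (simp only: vdm_shift_all vdm_total[OF I'(1) a] I'(4))
    finally show ?thesis .
  qed
  have "((\<lambda>a. void_mass I a) has_vector_derivative (of_nat (Suc m * (Suc m - 1)) / 2 / of_real a * void_mass I a + (\<Sum>i\<in>I. T i))) (at a)"
    using vdm_expectation_has_derivative[OF fin a norm_nonzero_ind] unfolding void_mass_def T_def card by simp
  from vconst_quotient_derivative[OF a this]
  have "((\<lambda>a. void_mass I a / vconst (Suc m) a) has_vector_derivative (\<Sum>i\<in>I. T i) / vconst (Suc m) a) (at a)" .
  moreover have "(\<Sum>i\<in>I. T i) / vconst (Suc m) a = of_real (exp (- a) * a ^ m / fact m)"
  proof -
    have "(\<Sum>i\<in>I. T i) = of_nat (Suc m) * (exp (- of_real a) * (of_real a ^ m * (of_real a ^ m * vconst m a)))"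
      using T card by simp
    then show ?thesis using vconst_nonzero[OF a, of m] a
      by (simp add: vconst_Suc field_simps exp_of_real[symmetric] del: of_nat_Suc)
  qed
  ultimately show ?thesis by simp
qed

lemma void_mass_bound:
  assumes fin: "finite I" and card: "card I = Suc m" and b: "0 < b" "b \<le> a" and a: "a \<le> real m"
  shows "norm (void_mass I b / vconst (Suc m) b) \<le> a ^ Suc m * exp (- a) / fact m"
proof -
  let ?B = "exp (- a) * a ^ m / fact m"
  \<comment> \<open>The Poisson weight of \<open>m\<close> increases in the rate up to
    \<open>m\<close>. This follows from \<open>x / a \<le> exp (x / a - 1)\<close> and
    \<open>a \<le> m\<close>.\<close>
  have mono: "exp (- x) * x ^ m \<le> exp (- a) * a ^ m" if "0 < x" "x \<le> a" for x
  proof -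
    have "(x / a) ^ m \<le> exp (x / a - 1) ^ m" using that exp_ge_add_one_self[of "x / a - 1"] by (intro power_mono) auto
    also have "\<dots> = exp (real m * (x / a - 1))" by (simp add: exp_of_nat_mult[symmetric])
    also have "\<dots> \<le> exp (x - a)"
    proof -
      have "(real m / a) * (x - a) \<le> 1 * (x - a)" using that a by (intro mult_right_mono_neg) auto
      then show ?thesis using that by (simp add: field_simps)
    qed
    finally have "x ^ m \<le> exp (x - a) * a ^ m" using that by (simp add: power_divide field_simps)
    then have "exp (- x) * x ^ m \<le> exp (- x) * (exp (x - a) * a ^ m)" by (rule mult_left_mono) simp
    also have "\<dots> = exp (- a) * a ^ m" by (simp add: mult.assoc[symmetric] exp_add[symmetric])
    finally show ?thesis .
  qed
  have small: "norm (void_mass I e / vconst (Suc m) e) \<le> e ^ Suc m" if "e > 0" for e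
    using norm_void_mass_le[OF fin that] vconst_nonzero[OF that, of "Suc m"] card by (simp add: norm_divide divide_simps)
  \<comment> \<open>The derivative is known for positive rates, so the mean value bound starts at a
    small \<open>e\<close>; the contribution of the starting point vanishes as \<open>e\<close>
    tends to \<open>0\<close>.\<close>
  have le: "norm (void_mass I b / vconst (Suc m) b) \<le> ?B * b + e ^ Suc m" if e: "0 < e" "e < b" for e
  proof -
    have "norm (void_mass I b / vconst (Suc m) b - void_mass I e / vconst (Suc m) e) \<le> ?B * (b - e)"
    proof (rule norm_mvt[OF e(2)])
      show "((\<lambda>a. void_mass I a / vconst (Suc m) a) has_vector_derivative of_real (exp (- x) * x ^ m / fact m)) (at x)" if "x \<in> {e..b}" for x
        by (rule void_mass_derivative[OF fin card]) (use that e in auto)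
      show "norm (complex_of_real (exp (- x) * x ^ m / fact m)) \<le> ?B" if "x \<in> {e..b}" for x
        unfolding norm_of_real using mono[of x] that e b by (simp add: divide_right_mono)
    qed
    moreover have "?B * (b - e) \<le> ?B * b" using e b by (intro mult_left_mono) auto
    ultimately show ?thesis using small[OF e(1)] norm_triangle_ineq2[of "void_mass I b / vconst (Suc m) b" "void_mass I e / vconst (Suc m) e"] by linarith
  qed
  have "norm (void_mass I b / vconst (Suc m) b) \<le> ?B * b + 0 ^ Suc m"
  proof (rule tendsto_lowerbound[where F = "at_right 0"])
    show "((\<lambda>e. ?B * b + e ^ Suc m) \<longlongrightarrow> ?B * b + 0 ^ Suc m) (at_right 0)" by (intro tendsto_intros)
    show "\<forall>\<^sub>F e in at_right 0. norm (void_mass I b / vconst (Suc m) b) \<le> ?B * b + e ^ Suc m"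
      using eventually_at_right_less[of 0] eventually_at_rightI[of 0 b "\<lambda>e. e < b"] b(1) le
      by (smt (verit, ccfv_SIG) eventually_at_right_field)
  qed simp
  also have "\<dots> \<le> ?B * a" unfolding power_Suc mult_zero_left add_0_right by (rule mult_left_mono) (use b in auto)
  finally show ?thesis by (simp add: mult_ac)
qed

context imag_power
begin

text \<open>The integrating factor has modulus one and removes the term \<open>s * J\<close> from
  the differential equation. What remains is an expectation over configurations without a point at
  \<open>0\<close>, because each \<open>l i / (l i + 1)\<close> vanishes at \<open>0\<close> and is
  at most one elsewhere.\<close>

lemma det_mom_exp_derivative:
  assumes a: "a > 0"
  shows "\<exists>D. ((\<lambda>a. exp (- (s * of_real a)) * det_mom a m a) has_vector_derivative D) (at a)
    \<and> norm D \<le> norm s * norm (void_mass {..<Suc m} a / vconst (Suc m) a)"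
proof -
  let ?I = "{..<Suc m}"
  define E where "E = (\<integral>l. of_real (vdm ?I l) * (\<Prod>i\<in>?I. gamma_quot (l i) * (of_nat (l i) / (of_nat (l i) + 1))) \<partial>poisson_prod ?I a)"
  have eq: "Z ?I b / vconst (Suc m) b = det_mom b m b" if "b > 0" for b
    using Z_eq[of ?I "Suc m", OF _ _ that] vconst_nonzero[OF that, of "Suc m"] by (simp add: diag_mom_def vconst_def)
  have "((\<lambda>a. Z ?I a) has_vector_derivative (of_nat (Suc m * (Suc m - 1)) / 2 / of_real a * Z ?I a + (s * Z ?I a - s * E))) (at a)"
    using vdm_expectation_has_derivative_linear[OF finite_lessThan[of "Suc m"] a norm_gamma_quot_le gamma_quot_Suc] unfolding Z_def E_def card_lessThan
    by (simp add: distrib_right add_diff_eq)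
  from vconst_quotient_derivative[OF a this]
  have d1: "((\<lambda>a. Z ?I a / vconst (Suc m) a) has_vector_derivative (s * Z ?I a - s * E) / vconst (Suc m) a) (at a)" .
  have ex: "((\<lambda>a. exp (- (s * of_real a))) has_vector_derivative (- s * exp (- (s * of_real a)))) (at a)"
    by (auto intro!: derivative_eq_intros has_vector_derivative_real_field)
  have d2: "((\<lambda>a. exp (- (s * of_real a)) * (Z ?I a / vconst (Suc m) a)) has_vector_derivative
      (exp (- (s * of_real a)) * ((s * Z ?I a - s * E) / vconst (Suc m) a) + (- s * exp (- (s * of_real a))) * (Z ?I a / vconst (Suc m) a))) (at a)"
    by (rule has_vector_derivative_mult[OF ex d1])
  have d3: "((\<lambda>a. exp (- (s * of_real a)) * det_mom a m a) has_vector_derivative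
      (exp (- (s * of_real a)) * ((s * Z ?I a - s * E) / vconst (Suc m) a) + (- s * exp (- (s * of_real a))) * (Z ?I a / vconst (Suc m) a))) (at a)"
    by (rule has_vector_derivative_transform_within_open[OF d2, of "{0<..}"]) (use a eq in auto)
  have D: "exp (- (s * of_real a)) * ((s * Z ?I a - s * E) / vconst (Suc m) a) + (- s * exp (- (s * of_real a))) * (Z ?I a / vconst (Suc m) a)
    = - s * (exp (- (s * of_real a)) * (E / vconst (Suc m) a))"
    by (simp add: diff_divide_distrib algebra_simps)
  have "norm E \<le> norm (void_mass ?I a)"
    unfolding E_def void_mass_def
  proof (rule norm_integral_le_norm_integral)
    show "integrable (poisson_prod ?I a) (\<lambda>l. of_real (vdm ?I l) * (\<Prod>i\<in>?I. nonzero_ind (l i)))"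
      by (rule integrable_poisson_prod[OF _ a expgrow_void_mass]) auto
    show "of_real (vdm ?I l) * (\<Prod>i\<in>?I. nonzero_ind (l i)) = of_real (vdm ?I l * (\<Prod>i\<in>?I. (if l i = 0 then 0 else 1)))" for l
      by (simp add: nonzero_ind_def if_distrib cong: if_cong)
    show "norm (of_real (vdm ?I l) * (\<Prod>i\<in>?I. gamma_quot (l i) * (of_nat (l i) / (of_nat (l i) + 1)))) \<le> vdm ?I l * (\<Prod>i\<in>?I. (if l i = 0 then 0 else 1))" for l
    proof -
      have "norm (gamma_quot k * (of_nat k / (of_nat k + 1))) \<le> (if k = 0 then 0 else 1)" for k
      proof -
        have "norm (of_nat k / (of_nat k + 1) :: complex) = real k / (real k + 1)"
          unfolding norm_divide by (metis norm_of_nat of_nat_Suc add.commute)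
        also have "\<dots> \<le> 1" by simp
        finally have "norm (gamma_quot k) * norm (of_nat k / (of_nat k + 1) :: complex) \<le> 1 * 1" by (intro mult_mono norm_gamma_quot_le) auto
        then have "norm (gamma_quot k * (of_nat k / (of_nat k + 1))) \<le> 1" by (simp only: norm_mult mult_1)
        then show ?thesis by (cases "k = 0") auto
      qed
      then have "norm (\<Prod>i\<in>?I. gamma_quot (l i) * (of_nat (l i) / (of_nat (l i) + 1))) \<le> (\<Prod>i\<in>?I. (if l i = 0 then 0 else 1))"
        unfolding prod_norm[symmetric] by (intro prod_mono) auto
      then show ?thesis unfolding norm_mult[of "of_real _"] norm_of_real abs_of_nonneg[OF vdm_nonneg] by (rule mult_left_mono[OF _ vdm_nonneg])
    qed
  qed
  then have nE: "norm E / norm (vconst (Suc m) a) \<le> norm (void_mass ?I a) / norm (vconst (Suc m) a)" by (rule divide_right_mono) simp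
  have nexp: "norm (exp (- (s * of_real a))) = 1" by (simp add: Re_s)
  have "norm (- s * (exp (- (s * of_real a)) * (E / vconst (Suc m) a))) \<le> norm s * norm (void_mass ?I a / vconst (Suc m) a)"
    unfolding norm_mult norm_minus_cancel nexp mult_1 norm_divide by (rule mult_left_mono[OF nE norm_ge_zero])
  then show ?thesis using d3 unfolding D by blast
qed

theorem det_mom_diagonal_approx:
  assumes a: "0 < a" "a \<le> real m"
  shows "norm (exp (- (s * of_real a)) * det_mom a m a - det_mom 0 m 0) \<le> norm s * (a ^ Suc m * exp (- a) / fact m) * a"
proof -
  let ?B = "norm s * (a ^ Suc m * exp (- a) / fact m)"
  let ?h = "\<lambda>a. exp (- (s * of_real a)) * det_mom a m a"
  have "\<forall>a. \<exists>D. a > 0 \<longrightarrow> (?h has_vector_derivative D) (at a) \<and> norm D \<le> norm s * norm (void_mass {..<Suc m} a / vconst (Suc m) a)"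
    using det_mom_exp_derivative[of _ m] by blast
  from choice[OF this] obtain D where D: "\<And>a. a > 0 \<Longrightarrow> (?h has_vector_derivative D a) (at a)" "\<And>a. a > 0 \<Longrightarrow> norm (D a) \<le> norm s * norm (void_mass {..<Suc m} a / vconst (Suc m) a)"
    by blast
  have le: "norm (?h a - ?h e) \<le> ?B * a" if e: "0 < e" "e < a" for e
  proof -
    have "norm (?h a - ?h e) \<le> ?B * (a - e)"
    proof (rule norm_mvt[OF e(2) D(1)])
      show "norm (D x) \<le> ?B" if "x \<in> {e..a}" for x
      proof -
        have x: "0 < x" "x \<le> a" using that e by auto
        show ?thesis
          using D(2)[OF x(1)] mult_left_mono[OF void_mass_bound[OF finite_lessThan card_lessThan x a(2)] norm_ge_zero[of s]] by linarith
      qed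
    qed (use e in auto)
    also have "\<dots> \<le> ?B * a" using e a by (intro mult_left_mono) auto
    finally show ?thesis .
  qed
  \<comment> \<open>The bound on the increment holds between positive rates; continuity of the
    diagonal moment extends it to the rate \<open>0\<close>, where the value is the product of Gamma
    quotients.\<close>
  define A where "A k = a / (real k + 2)" for k
  have A: "A \<longlonglongrightarrow> 0" unfolding A_def by real_asymp
  have "(\<lambda>k. norm (?h a - ?h (A k))) \<longlonglongrightarrow> norm (?h a - exp (- (s * of_real 0)) * det_mom 0 m 0)"
    by (intro tendsto_intros det_mom_tendsto A) (use a in \<open>auto simp: A_def\<close>)
  then have "norm (?h a - exp (- (s * of_real 0)) * det_mom 0 m 0) \<le> ?B * a"
  proof (rule LIMSEQ_le_const2, intro exI[of _ 0] allI impI)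
    fix k
    show "norm (?h a - ?h (A k)) \<le> ?B * a" by (rule le) (use a divide_strict_left_mono[of 1 "real k + 2" a] in \<open>auto simp: A_def\<close>)
  qed
  then show ?thesis by simp
qed

end

section \<open>Asymptotics of the product of Gamma quotients\<close>

lemma inverse_square_telescope:
  fixes x :: real
  assumes "x > 0"
  shows "(\<lambda>j. 1 / ((x + real j) * (x + real (Suc j)))) sums (1 / x)"
proof -
  have "(\<lambda>j. 1 / (x + real j)) \<longlonglongrightarrow> 0" by real_asymp
  from telescope_sums'[OF this] have "(\<lambda>j. 1 / (x + real j) - 1 / (x + real (Suc j))) sums (1 / x)" by simp
  moreover have "1 / (x + real j) - 1 / (x + real (Suc j)) = 1 / ((x + real j) * (x + real (Suc j)))" for j
    using assms by (simp add: divide_simps)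
  ultimately show ?thesis by simp
qed

text \<open>Each square is squeezed between products of neighbouring terms, whose reciprocals
  telescope to \<open>1 / x\<close>.\<close>

lemma inverse_square_sum_bounds:
  fixes x :: real
  assumes x: "x > 0"
  shows "1 / x \<le> (\<Sum>j. inverse ((x + real j) ^ 2))" "(\<Sum>j. inverse ((x + real j) ^ 2)) \<le> 1 / x + 1 / x\<^sup>2"
proof -
  have sm: "summable (\<lambda>j. inverse ((x + real j) ^ 2))" using Polygamma_converges'[of x 2] x by simp
  note t = inverse_square_telescope[OF x]
  have "(\<Sum>j. 1 / ((x + real j) * (x + real (Suc j)))) \<le> (\<Sum>j. inverse ((x + real j) ^ 2))"
  proof (rule suminf_le[OF _ sums_summable[OF t] sm])
    fix j
    have "(x + real j) ^ 2 \<le> (x + real j) * (x + real (Suc j))" unfolding power2_eq_square using x by (intro mult_left_mono) auto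
    then show "1 / ((x + real j) * (x + real (Suc j))) \<le> inverse ((x + real j) ^ 2)"
      unfolding inverse_eq_divide using x by (intro divide_left_mono) auto
  qed
  then show "1 / x \<le> (\<Sum>j. inverse ((x + real j) ^ 2))" using sums_unique[OF t] by simp
  have sm': "summable (\<lambda>j. inverse ((x + real (Suc j)) ^ 2))" using sm by (subst summable_Suc_iff)
  have "(\<Sum>j. inverse ((x + real (Suc j)) ^ 2)) \<le> (\<Sum>j. 1 / ((x + real j) * (x + real (Suc j))))"
  proof (rule suminf_le[OF _ sm' sums_summable[OF t]])
    fix j
    have "(x + real j) * (x + real (Suc j)) \<le> (x + real (Suc j)) ^ 2" unfolding power2_eq_square using x by (intro mult_right_mono) auto
    then show "inverse ((x + real (Suc j)) ^ 2) \<le> 1 / ((x + real j) * (x + real (Suc j)))"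
      unfolding inverse_eq_divide using x by (intro divide_left_mono) auto
  qed
  then have "(\<Sum>j. inverse ((x + real (Suc j)) ^ 2)) \<le> 1 / x" using sums_unique[OF t] by simp
  then show "(\<Sum>j. inverse ((x + real j) ^ 2)) \<le> 1 / x + 1 / x\<^sup>2"
    using suminf_split_head[OF sm] by (simp add: inverse_eq_divide)
qed

text \<open>In the series of inverse cubes one factor is estimated by \<open>r\<close>, and the
  remaining inverse squares add up to at most \<open>2 / r\<close>.\<close>

lemma norm_Polygamma_2_le:
  fixes z :: complex
  assumes r: "r \<ge> 1" and z: "Re z \<ge> r"
  shows "norm (Polygamma 2 z) \<le> 4 / r\<^sup>2"
proof -
  have sm: "summable (\<lambda>j. inverse ((r + real j) ^ 2))" using Polygamma_converges'[of r 2] r by simp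
  have term_le: "norm (inverse ((z + of_nat j) ^ 3)) \<le> (1 / r) * inverse ((r + real j) ^ 2)" for j
  proof -
    have n: "r + real j \<le> norm (z + of_nat j)" using z complex_Re_le_cmod[of "z + of_nat j"] by simp
    have "r * (r + real j) ^ 2 \<le> (r + real j) * (r + real j) ^ 2" using r by (intro mult_right_mono) auto
    also have "\<dots> = (r + real j) ^ 3" by (simp add: power3_eq_cube power2_eq_square)
    also have "\<dots> \<le> norm (z + of_nat j) ^ 3" using r n by (intro power_mono) auto
    finally have "inverse (norm (z + of_nat j) ^ 3) \<le> inverse (r * (r + real j) ^ 2)"
      using r by (intro le_imp_inverse_le) auto
    then show ?thesis by (simp add: norm_inverse norm_power norm_divide inverse_eq_divide)
  qed
  have "norm (\<Sum>j. inverse ((z + of_nat j) ^ 3)) \<le> (\<Sum>j. (1 / r) * inverse ((r + real j) ^ 2))"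
    by (rule norm_suminf_le[OF term_le summable_mult[OF sm]])
  also have "\<dots> = (1 / r) * (\<Sum>j. inverse ((r + real j) ^ 2))" by (rule suminf_mult[OF sm])
  also have "\<dots> \<le> (1 / r) * (1 / r + 1 / r\<^sup>2)" using r by (intro mult_left_mono inverse_square_sum_bounds(2)) auto
  also have "\<dots> \<le> (1 / r) * (1 / r + 1 / r)"
    using r by (intro mult_left_mono add_mono divide_left_mono) (auto simp: power2_eq_square)
  also have "\<dots> = 2 / r\<^sup>2" by (simp add: power2_eq_square)
  finally have "2 * norm (\<Sum>j. inverse ((z + of_nat j) ^ 3)) \<le> 4 / r\<^sup>2" by simp
  then show ?thesis by (simp add: Polygamma_def norm_mult numeral_3_eq_3)
qed

lemma nonpos_Reals_Re: "Re z > 0 \<Longrightarrow> z \<notin> \<real>\<^sub>\<le>\<^sub>0" by (auto simp: complex_nonpos_Reals_iff)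

text \<open>The remainder of the quadratic Taylor expansion of \<open>ln_Gamma\<close> at
  \<open>k + 1\<close>, where the Digamma function has the value
  \<open>harm k - euler_mascheroni\<close>.\<close>

definition gamma_err :: "nat \<Rightarrow> complex \<Rightarrow> complex" where
  "gamma_err k s = ln_Gamma (of_nat (Suc k) + s) - (ln_Gamma (of_nat (Suc k)) + s * of_real (harm k - euler_mascheroni) + s\<^sup>2 / 2 * of_real (Polygamma 1 (real (Suc k))))"

text \<open>An imaginary increment stays in the half-plane \<open>Re z \<ge> k + 1\<close>, which is
  convex and carries the bound on the third derivative. The form of Taylor's theorem applied divides
  by \<open>fact 2\<close>, whence the constant \<open>2\<close>.\<close>

lemma norm_gamma_err:
  assumes s: "Re s = 0"
  shows "norm (gamma_err k s) \<le> 2 * norm s ^ 3 / (real (Suc k))\<^sup>2"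
proof -
  define w where "w = (of_nat (Suc k) :: complex)"
  define f where "f i = (if i = 0 then ln_Gamma else Polygamma (i - 1) :: complex \<Rightarrow> complex)" for i :: nat
  let ?S = "{z. real (Suc k) \<le> Re z}"
  have pos: "Re x > 0" if "x \<in> ?S" for x using that by (simp add: less_le_trans[of 0 "real (Suc k)"] del: of_nat_Suc)
  have "cmod (f 0 (w + s) - (\<Sum>i\<le>2. f i w * ((w + s) - w) ^ i / fact i)) \<le> (4 / (real (Suc k))\<^sup>2) * cmod ((w + s) - w) ^ Suc 2 / fact 2"
  proof (rule complex_Taylor)
    show "convex ?S" by (rule convex_halfspace_Re_ge)
    show "(f i has_field_derivative f (Suc i) x) (at x within ?S)" if "x \<in> ?S" "i \<le> 2" for i x
    proof (cases "i = 0")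
      case True
      then show ?thesis using has_field_derivative_ln_Gamma_complex[OF nonpos_Reals_Re[OF pos[OF that(1)]]]
        by (simp add: f_def has_field_derivative_at_within)
    next
      case False
      then show ?thesis using has_field_derivative_Polygamma[OF not_nonpos_Int[OF pos[OF that(1)]], of "i - 1" ?S] by (simp add: f_def)
    qed
    show "cmod (f (Suc 2) x) \<le> 4 / (real (Suc k))\<^sup>2" if "x \<in> ?S" for x
      using norm_Polygamma_2_le[of "real (Suc k)" x] that by (simp add: f_def)
    show "w \<in> ?S" "w + s \<in> ?S" using s by (auto simp: w_def)
  qed
  moreover have "f 0 (w + s) - (\<Sum>i\<le>2. f i w * ((w + s) - w) ^ i / fact i) = gamma_err k s"
  proof -
    have D: "Digamma w = of_real (harm k - euler_mascheroni)" unfolding w_def by (subst Digamma_of_nat) (simp add: of_real_harm)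
    have P: "Polygamma 1 w = of_real (Polygamma 1 (real (Suc k)))" unfolding w_def
      using Polygamma_of_real[of "real (Suc k)" 1] by simp
    have "(\<Sum>i\<le>2. f i w * ((w + s) - w) ^ i / fact i) = ln_Gamma w + s * Digamma w + s\<^sup>2 / 2 * Polygamma 1 w"
      by (simp add: f_def numeral_2_eq_2 mult.commute)
    then show ?thesis unfolding D P by (simp add: f_def gamma_err_def w_def)
  qed
  ultimately show ?thesis by (simp add: numeral_3_eq_3 del: of_nat_Suc)
qed

lemma Gamma_ratio_exp:
  assumes s: "Re s = 0"
  shows "Gamma (of_nat (Suc k) + s) / fact k = exp (s * of_real (harm k - euler_mascheroni) + s\<^sup>2 / 2 * of_real (Polygamma 1 (real (Suc k))) + gamma_err k s)"
proof -
  have 1: "Gamma (of_nat (Suc k) + s) = exp (ln_Gamma (of_nat (Suc k) + s))"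
    using not_nonpos_Int[of "of_nat (Suc k) + s"] s by (simp add: Gamma_complex_altdef)
  have 2: "(fact k :: complex) = exp (ln_Gamma (of_nat (Suc k)))"
    using not_nonpos_Int[of "of_nat (Suc k)"] Gamma_fact[of k, where 'a = complex] by (simp add: Gamma_complex_altdef add.commute)
  show ?thesis unfolding 1 2 exp_diff[symmetric] gamma_err_def by (simp add: algebra_simps)
qed

lemma sum_harm: "(\<Sum>k<n. harm k :: real) = real n * harm n - real n"
proof (induction n)
  case (Suc n)
  have "real (Suc n) * harm (Suc n) = real (Suc n) * harm n + 1" by (simp add: harm_Suc field_simps)
  then show ?case using Suc by (simp add: algebra_simps)
qed (simp add: harm_def)

lemma harm_ln_bound:
  assumes "n \<ge> 1"
  shows "\<bar>harm n - ln (real n) - euler_mascheroni\<bar> \<le> 2 / real n"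
proof -
  have b: "euler_mascheroni \<in> {(harm n - ln (of_nat (Suc n))) + inverse (of_nat (2 * (n + 1)))..(harm n - ln (of_nat (Suc n))) + inverse (of_nat (2 * n)) :: real}"
    by (rule euler_mascheroni_bounds[OF assms])
  have "ln (real (Suc n)) - ln (real n) = ln (1 + 1 / real n)"
  proof -
    have "1 + 1 / real n = real (Suc n) / real n" using assms by (simp add: field_simps)
    then show ?thesis using assms by (simp add: ln_div)
  qed
  also have "\<dots> \<le> 1 / real n" by (rule ln_add_one_self_le_self) simp
  finally have l: "ln (real (Suc n)) - ln (real n) \<le> 1 / real n" .
  have l0: "ln (real n) \<le> ln (real (Suc n))" using assms by simp
  have i: "0 \<le> inverse (real (2 * (n + 1)))" "inverse (real (2 * n)) \<le> 1 / real n" using assms by (auto simp: field_simps)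
  have "2 / real n = 1 / real n + 1 / real n" by simp
  with b l l0 i show ?thesis unfolding atLeastAtMost_iff by linarith
qed

lemma sum_inverse_squares_le: "(\<Sum>k<n. 1 / (real (Suc k))\<^sup>2) \<le> 2"
proof -
  have "(\<Sum>k<n. 1 / (real (Suc k))\<^sup>2) = (\<Sum>k<n. inverse ((1 + real k) ^ 2))"
    by (intro sum.cong refl) (simp add: inverse_eq_divide)
  also have "\<dots> \<le> (\<Sum>k. inverse ((1 + real k) ^ 2))"
    using Polygamma_converges'[of "1 :: real" 2] by (intro sum_le_suminf) auto
  also have "\<dots> \<le> 2" using inverse_square_sum_bounds(2)[of 1] by simp
  finally show ?thesis .
qed

text \<open>The trigamma value at \<open>k + 1\<close> is \<open>1 / (k + 1)\<close> up to a
  summable error, so the variance is harmonic, that is \<open>ln N\<close> up to a constant.\<close>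

lemma sum_trigamma_bounds:
  "harm n \<le> (\<Sum>k<n. Polygamma 1 (real (Suc k)))" "(\<Sum>k<n. Polygamma 1 (real (Suc k))) \<le> harm n + 2"
proof -
  have p: "1 / real (Suc k) \<le> Polygamma 1 (real (Suc k))" "Polygamma 1 (real (Suc k)) \<le> 1 / real (Suc k) + 1 / (real (Suc k))\<^sup>2" for k
    using inverse_square_sum_bounds[of "real (Suc k)"] by (simp_all add: Polygamma_def numeral_2_eq_2)
  have h: "harm n = (\<Sum>k<n. 1 / real (Suc k))"
    unfolding harm_def by (rule sum.reindex_bij_witness[of _ Suc "\<lambda>k. k - 1"]) (auto simp: inverse_eq_divide)
  show "harm n \<le> (\<Sum>k<n. Polygamma 1 (real (Suc k)))" unfolding h by (rule sum_mono) (rule p)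
  have "(\<Sum>k<n. Polygamma 1 (real (Suc k))) \<le> (\<Sum>k<n. 1 / real (Suc k) + 1 / (real (Suc k))\<^sup>2)" by (rule sum_mono) (rule p)
  also have "\<dots> = harm n + (\<Sum>k<n. 1 / (real (Suc k))\<^sup>2)" unfolding h by (rule sum.distrib)
  also have "\<dots> \<le> harm n + 2" using sum_inverse_squares_le by simp
  finally show "(\<Sum>k<n. Polygamma 1 (real (Suc k))) \<le> harm n + 2" .
qed

text \<open>In the exponent the linear terms add up to \<open>s\<close> times
  \<open>N * (harm N - 1 - euler_mascheroni)\<close>; after compensation by
  \<open>N - N * ln N\<close> the factor of \<open>s\<close> is bounded. The quadratic terms give
  \<open>s\<^sup>2 / 2\<close> times a sum asymptotic to \<open>ln N\<close>, hence
  \<open>- t\<^sup>2 / 2\<close>, and the remainders are of order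
  \<open>\<bar>s\<bar> ^ 3\<close>.\<close>

lemma gamma_product_limit:
  fixes t :: real
  defines "s \<equiv> \<lambda>N::nat. \<i> * of_real (t / sqrt (ln (real N)))"
  shows "(\<lambda>N. (\<Prod>k<N. Gamma (of_nat (Suc k) + s N) / fact k) * exp (s N * of_real (real N - real N * ln (real N)))) \<longlonglongrightarrow> of_real (exp (- t\<^sup>2 / 2))"
proof -
  have Re: "Re (s N) = 0" for N by (simp add: s_def)
  have ns: "norm (s N) = \<bar>t\<bar> / \<bar>sqrt (ln (real N))\<bar>" for N by (simp add: s_def norm_mult norm_divide)
  have ns0: "(\<lambda>N. norm (s N)) \<longlonglongrightarrow> 0" unfolding ns by real_asymp
  define T where "T N = (\<Sum>k<N. Polygamma 1 (real (Suc k)))" for N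
  define A where "A N = s N * of_real (real N * (harm N - ln (real N) - euler_mascheroni))" for N
  define B where "B N = (s N)\<^sup>2 / 2 * of_real (T N)" for N
  define D where "D N = (\<Sum>k<N. gamma_err k (s N))" for N
  have eq: "(\<Prod>k<N. Gamma (of_nat (Suc k) + s N) / fact k) * exp (s N * of_real (real N - real N * ln (real N))) = exp (A N + B N + D N)" for N
  proof -
    have "(\<Prod>k<N. Gamma (of_nat (Suc k) + s N) / fact k) = exp (\<Sum>k<N. s N * of_real (harm k - euler_mascheroni) + (s N)\<^sup>2 / 2 * of_real (Polygamma 1 (real (Suc k))) + gamma_err k (s N))"
      unfolding Gamma_ratio_exp[OF Re] by (rule exp_sum[symmetric]) simp
    also have "(\<Sum>k<N. s N * of_real (harm k - euler_mascheroni) + (s N)\<^sup>2 / 2 * of_real (Polygamma 1 (real (Suc k))) + gamma_err k (s N))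
      = s N * of_real (\<Sum>k<N. harm k - euler_mascheroni) + B N + D N"
      by (simp only: sum.distrib sum_distrib_left[symmetric] of_real_sum[symmetric] B_def D_def T_def)
    also have "(\<Sum>k<N. harm k - euler_mascheroni :: real) = real N * harm N - real N - real N * euler_mascheroni"
      by (simp add: sum_subtractf sum_harm)
    finally have P: "(\<Prod>k<N. Gamma (of_nat (Suc k) + s N) / fact k) = exp (s N * of_real (real N * harm N - real N - real N * euler_mascheroni) + B N + D N)" .
    show ?thesis
      unfolding P exp_add[symmetric] A_def by (rule arg_cong[where f = exp]) (simp add: algebra_simps)
  qed
  have A0: "A \<longlonglongrightarrow> 0"
  proof (rule tendsto_norm_zero_cancel, rule tendsto_sandwich[OF _ _ tendsto_const])
    show "\<forall>\<^sub>F N in sequentially. 0 \<le> norm (A N)" by simp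
    show "\<forall>\<^sub>F N in sequentially. norm (A N) \<le> norm (s N) * 2"
    proof (rule eventually_sequentiallyI[of 1])
      fix N :: nat assume N: "N \<ge> 1"
      have "real N * \<bar>harm N - ln (real N) - euler_mascheroni\<bar> \<le> real N * (2 / real N)" by (rule mult_left_mono[OF harm_ln_bound[OF N]]) simp
      then have "\<bar>real N * (harm N - ln (real N) - euler_mascheroni)\<bar> \<le> 2" using N by (simp add: abs_mult)
      then show "norm (A N) \<le> norm (s N) * 2" unfolding A_def norm_mult norm_of_real by (rule mult_left_mono) simp
    qed
    show "(\<lambda>N. norm (s N) * 2) \<longlonglongrightarrow> 0" using tendsto_mult_left_zero[OF ns0] by simp
  qed
  have D0: "D \<longlonglongrightarrow> 0"
  proof (rule tendsto_norm_zero_cancel, rule tendsto_sandwich[OF _ _ tendsto_const])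
    show "\<forall>\<^sub>F N in sequentially. 0 \<le> norm (D N)" by simp
    show "\<forall>\<^sub>F N in sequentially. norm (D N) \<le> norm (s N) ^ 3 * 4"
    proof (rule always_eventually, rule allI)
      fix N
      have "norm (D N) \<le> (\<Sum>k<N. 2 * norm (s N) ^ 3 / (real (Suc k))\<^sup>2)"
        unfolding D_def by (rule order_trans[OF norm_sum sum_mono[OF norm_gamma_err[OF Re]]])
      also have "\<dots> = 2 * norm (s N) ^ 3 * (\<Sum>k<N. 1 / (real (Suc k))\<^sup>2)" by (simp add: sum_distrib_left)
      also have "\<dots> \<le> 2 * norm (s N) ^ 3 * 2" by (intro mult_left_mono sum_inverse_squares_le) simp
      finally show "norm (D N) \<le> norm (s N) ^ 3 * 4" by simp
    qed
    have "(\<lambda>N. norm (s N) ^ 3 * 4) \<longlonglongrightarrow> 0 ^ 3 * 4" by (intro tendsto_intros ns0)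
    then show "(\<lambda>N. norm (s N) ^ 3 * 4) \<longlonglongrightarrow> 0" by simp
  qed
  have T1: "(\<lambda>N. T N / ln (real N)) \<longlonglongrightarrow> 1"
  proof (rule tendsto_sandwich)
    have b: "ln (real N) + (euler_mascheroni - 2) \<le> T N \<and> T N \<le> ln (real N) + (euler_mascheroni + 4)" if "N \<ge> 1" for N
    proof -
      have "2 / real N \<le> 2" using that by (simp add: field_simps)
      then show ?thesis using harm_ln_bound[OF that] sum_trigamma_bounds[where n = N] unfolding T_def abs_le_iff by linarith
    qed
    show "\<forall>\<^sub>F N in sequentially. (ln (real N) + (euler_mascheroni - 2)) / ln (real N) \<le> T N / ln (real N)"
      by (rule eventually_sequentiallyI[of 2]) (use b in \<open>auto intro!: divide_right_mono\<close>)
    show "\<forall>\<^sub>F N in sequentially. T N / ln (real N) \<le> (ln (real N) + (euler_mascheroni + 4)) / ln (real N)"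
      by (rule eventually_sequentiallyI[of 2]) (use b in \<open>auto intro!: divide_right_mono\<close>)
    have "(\<lambda>N. (ln (real N) + c) / ln (real N)) \<longlonglongrightarrow> 1" for c by real_asymp
    then show "(\<lambda>N. (ln (real N) + (euler_mascheroni - 2)) / ln (real N)) \<longlonglongrightarrow> 1" "(\<lambda>N. (ln (real N) + (euler_mascheroni + 4)) / ln (real N)) \<longlonglongrightarrow> 1" by blast+
  qed
  have "(\<lambda>N. - of_real (t\<^sup>2) / 2 * of_real (T N / ln (real N))) \<longlonglongrightarrow> (- of_real (t\<^sup>2) / 2 * of_real 1 :: complex)"
    by (intro tendsto_mult tendsto_const tendsto_of_real T1)
  moreover have "\<forall>\<^sub>F N in sequentially. - of_real (t\<^sup>2) / 2 * of_real (T N / ln (real N)) = B N"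
  proof (rule eventually_sequentiallyI[of 2])
    fix N :: nat assume "N \<ge> 2"
    then have "sqrt (ln (real N)) ^ 2 = ln (real N)" by simp
    then have "(s N)\<^sup>2 = - of_real (t\<^sup>2 / ln (real N))" unfolding s_def power_mult_distrib
      by (simp add: power_divide flip: of_real_power)
    then show "- of_real (t\<^sup>2) / 2 * of_real (T N / ln (real N)) = B N" by (simp add: B_def)
  qed
  ultimately have B0: "B \<longlonglongrightarrow> - of_real (t\<^sup>2) / 2 * of_real 1" by (rule Lim_transform_eventually)
  have "(\<lambda>N. exp (A N + B N + D N)) \<longlonglongrightarrow> exp (0 + (- of_real (t\<^sup>2) / 2 * of_real 1) + 0)"
    by (intro tendsto_exp tendsto_add A0 B0 D0)
  then show ?thesis unfolding eq by (simp add: exp_of_real[symmetric])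
qed

section \<open>The central limit theorem\<close>

lemma ginibre_random_variables:
  assumes "complex_ginibre N M G" "N \<ge> 1" "ij \<in> {..<N} \<times> {..<N}"
  shows "(\<lambda>\<omega>. G \<omega> $$ ij) \<in> borel_measurable M"
  using assms prob_space.indep_vars_def unfolding complex_ginibre_def by (auto simp: prob_space.indep_vars_def)

lemma distr_ginibre_scaled:
  assumes G: "complex_ginibre N M G" and N: "N \<ge> 1"
  shows "distr M (PiM ({..<N} \<times> {..<N}) (\<lambda>_. borel)) (\<lambda>\<omega>. \<lambda>ij\<in>{..<N} \<times> {..<N}. of_real (sqrt (real N)) * (G \<omega> $$ ij)) = gauss_prod ({..<N} \<times> {..<N})"
proof -
  interpret prob_space M using G by (simp add: complex_ginibre_def)
  let ?I = "{..<N} \<times> {..<N}"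
  let ?c = "of_real (sqrt (real N)) :: complex"
  have ne: "?I \<noteq> {}" using N by (auto simp: lessThan_empty_iff)
  have m: "random_variable borel (\<lambda>\<omega>. G \<omega> $$ ij)" if "ij \<in> ?I" for ij
    by (rule ginibre_random_variables[OF G N that])
  have m': "random_variable borel (\<lambda>\<omega>. ?c * (G \<omega> $$ ij))" if "ij \<in> ?I" for ij
    using m[OF that] by measurable
  have "indep_vars (\<lambda>_. borel) (\<lambda>ij \<omega>. G \<omega> $$ ij) ?I" using G by (simp add: complex_ginibre_def)
  then have ind: "indep_vars (\<lambda>_. borel) (\<lambda>ij \<omega>. ?c * (G \<omega> $$ ij)) ?I"
    by (rule indep_vars_compose2[where Y = "\<lambda>_ w. ?c * w"]) simp
  have d: "distr M borel (\<lambda>\<omega>. ?c * (G \<omega> $$ ij)) = cgauss" if "ij \<in> ?I" for ij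
  proof -
    have dg: "distr M borel (\<lambda>\<omega>. G \<omega> $$ ij) = distr cgauss borel (\<lambda>w. w / ?c)"
      using G that by (cases ij) (auto simp: complex_ginibre_def)
    have "distr M borel (\<lambda>\<omega>. ?c * (G \<omega> $$ ij)) = distr (distr M borel (\<lambda>\<omega>. G \<omega> $$ ij)) borel (\<lambda>w. ?c * w)"
      by (subst distr_distr[OF _ m[OF that]]) (simp_all add: o_def)
    also have "\<dots> = distr cgauss borel (\<lambda>w. ?c * (w / ?c))"
      unfolding dg by (subst distr_distr) (simp_all add: o_def measurable_cgauss1)
    also have "\<dots> = distr cgauss borel (\<lambda>w. w)" using N by simp
    also have "\<dots> = cgauss" by (rule distr_id2) simp
    finally show ?thesis .
  qed
  have "distr M (PiM ?I (\<lambda>_. borel)) (\<lambda>\<omega>. \<lambda>ij\<in>?I. ?c * (G \<omega> $$ ij)) = PiM ?I (\<lambda>ij. distr M borel (\<lambda>\<omega>. ?c * (G \<omega> $$ ij)))"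
    using ind by (subst (asm) indep_vars_iff_distr_eq_PiM'[OF ne m'])
  also have "\<dots> = gauss_prod ?I" by (rule PiM_cong) (auto simp: d)
  finally show ?thesis .
qed

lemma cornerdet_scaled:
  assumes A: "A \<in> carrier_mat N N" and N: "N \<ge> 1"
  shows "cornerdet N 0 (of_real (sqrt (real N)) * z) (of_real (sqrt (real N)) * z) (\<lambda>ij\<in>{..<N} \<times> {..<N}. of_real (sqrt (real N)) * (A $$ ij))
    = of_real (sqrt (real N)) ^ N * Determinant.det (A - z \<cdot>\<^sub>m 1\<^sub>m N)"
proof -
  let ?c = "of_real (sqrt (real N)) :: complex"
  have "mat N N (\<lambda>(i, j). (\<lambda>ij\<in>{..<N} \<times> {..<N}. ?c * (A $$ ij)) (0 + i, 0 + j) - shiftm 0 (?c * z) (?c * z) (0 + i) (0 + j)) = ?c \<cdot>\<^sub>m (A - z \<cdot>\<^sub>m 1\<^sub>m N)"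
    using A by (intro eq_matI) (auto simp: shiftm_def right_diff_distrib)
  then show ?thesis unfolding cornerdet_def detf_def using A by (simp only: Determinant.det_smult) simp
qed

text \<open>Multiplying the matrix by \<open>sqrt N\<close> makes its entries standard Gaussian, the
  shift \<open>sqrt N * z\<close> and the squared determinant larger by \<open>N ^ N\<close>. All
  shifts agree, so the moment is a diagonal one with
  \<open>a = N * \<bar>z\<bar>\<^sup>2\<close>.\<close>

lemma ginibre_integral:
  assumes G: "complex_ginibre N M G" and N: "N \<ge> 1" and s: "Re s = 0"
  shows "(\<integral>\<omega>. pw s (real N ^ N * (cmod (Determinant.det (G \<omega> - z \<cdot>\<^sub>m 1\<^sub>m N)))\<^sup>2) \<partial>M) = imag_power.det_mom s (real N * (cmod z)\<^sup>2) (N - 1) (real N * (cmod z)\<^sup>2)"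
    and "(\<lambda>\<omega>. cmod (Determinant.det (G \<omega> - z \<cdot>\<^sub>m 1\<^sub>m N))) \<in> borel_measurable M"
proof -
  interpret prob_space M using G by (simp add: complex_ginibre_def)
  interpret imag_power s by unfold_locales (rule s)
  let ?I = "{..<N} \<times> {..<N}"
  let ?c = "of_real (sqrt (real N)) :: complex"
  let ?X = "\<lambda>\<omega>. \<lambda>ij\<in>?I. ?c * (G \<omega> $$ ij)"
  let ?d = "\<lambda>\<omega>. Determinant.det (G \<omega> - z \<cdot>\<^sub>m 1\<^sub>m N)"
  have I: "{0..<0 + N} \<times> {0..<0 + N} = ?I" by auto
  have sets: "sets (gauss_prod ?I) = sets (PiM ?I (\<lambda>_. borel))" by (rule sets_PiM_cong) auto
  have mc: "cornerdet N 0 (?c * z) (?c * z) \<in> borel_measurable (PiM ?I (\<lambda>_. borel))"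
    using measurable_cornerdet[of 0 N ?I "?c * z" "?c * z"] unfolding I measurable_cong_sets[OF sets refl] by simp
  have mX: "?X \<in> measurable M (PiM ?I (\<lambda>_. borel))"
    by (rule measurable_restrict) (use ginibre_random_variables[OF G N] in measurable)
  have car: "G \<omega> \<in> carrier_mat N N" if "\<omega> \<in> space M" for \<omega> using G that by (simp add: complex_ginibre_def)
  have e: "cornerdet N 0 (?c * z) (?c * z) (?X \<omega>) = ?c ^ N * ?d \<omega>" if "\<omega> \<in> space M" for \<omega>
    by (rule cornerdet_scaled[OF car[OF that] N])
  have m1: "(\<lambda>\<omega>. cornerdet N 0 (?c * z) (?c * z) (?X \<omega>)) \<in> borel_measurable M" by (rule measurable_compose[OF mX mc])
  have "(\<lambda>\<omega>. cmod (cornerdet N 0 (?c * z) (?c * z) (?X \<omega>) / ?c ^ N)) \<in> borel_measurable M" using m1 by measurable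
  also have "?this \<longleftrightarrow> (\<lambda>\<omega>. cmod (?d \<omega>)) \<in> borel_measurable M"
    by (rule measurable_cong) (use N in \<open>simp add: e\<close>)
  finally show "(\<lambda>\<omega>. cmod (?d \<omega>)) \<in> borel_measurable M" .
  have "(\<integral>\<omega>. pw s (real N ^ N * (cmod (?d \<omega>))\<^sup>2) \<partial>M) = (\<integral>\<omega>. pw s ((cmod (cornerdet N 0 (?c * z) (?c * z) (?X \<omega>)))\<^sup>2) \<partial>M)"
  proof (rule Bochner_Integration.integral_cong[OF refl])
    fix \<omega> assume "\<omega> \<in> space M"
    from e[OF this] have "(cmod (cornerdet N 0 (?c * z) (?c * z) (?X \<omega>)))\<^sup>2 = real N ^ N * (cmod (?d \<omega>))\<^sup>2"
      by (simp add: norm_mult norm_power power_mult_distrib flip: power_mult) (simp add: power_mult mult.commute[of N 2])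
    then show "pw s (real N ^ N * (cmod (?d \<omega>))\<^sup>2) = pw s ((cmod (cornerdet N 0 (?c * z) (?c * z) (?X \<omega>)))\<^sup>2)" by simp
  qed
  also have "\<dots> = (\<integral>x. pw s ((cmod (cornerdet N 0 (?c * z) (?c * z) x))\<^sup>2) \<partial>distr M (PiM ?I (\<lambda>_. borel)) ?X)"
    by (rule integral_distr[symmetric, OF mX]) (use mc in measurable)
  also have "\<dots> = (\<integral>x. pw s ((cmod (cornerdet (Suc (N - 1)) 0 (?c * z) (?c * z) x))\<^sup>2) \<partial>gauss_prod ({0..<0 + Suc (N - 1)} \<times> {0..<0 + Suc (N - 1)}))"
    unfolding distr_ginibre_scaled[OF G N] using N I by simp
  also have "\<dots> = det_mom ((cmod (?c * z))\<^sup>2) (N - 1) ((cmod (?c * z))\<^sup>2)" by (rule cornerdet_expectation)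
  also have "(cmod (?c * z))\<^sup>2 = real N * (cmod z)\<^sup>2" by (simp add: norm_mult power_mult_distrib)
  finally show "(\<integral>\<omega>. pw s (real N ^ N * (cmod (?d \<omega>))\<^sup>2) \<partial>M) = det_mom (real N * (cmod z)\<^sup>2) (N - 1) (real N * (cmod z)\<^sup>2)" .
qed

text \<open>\<open>pw 0\<close> is the indicator of nonzero numbers, so the moment with exponent
  zero is the probability in question.\<close>

lemma AE_det_nonzero:
  assumes G: "complex_ginibre N M G" and N: "N \<ge> 1"
  shows "AE \<omega> in M. Determinant.det (G \<omega> - z \<cdot>\<^sub>m 1\<^sub>m N) \<noteq> 0"
proof -
  interpret prob_space M using G by (simp add: complex_ginibre_def)
  let ?d = "\<lambda>\<omega>. cmod (Determinant.det (G \<omega> - z \<cdot>\<^sub>m 1\<^sub>m N))"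
  note [measurable] = ginibre_integral(2)[OF G N, of 0 z, simplified]
  define A where "A = {\<omega> \<in> space M. ?d \<omega> \<noteq> 0}"
  have A: "A \<in> events" unfolding A_def by measurable
  have "(\<integral>\<omega>. complex_of_real (indicator A \<omega>) \<partial>M) = (\<integral>\<omega>. pw 0 (real N ^ N * (?d \<omega>)\<^sup>2) \<partial>M)"
    by (rule Bochner_Integration.integral_cong[OF refl]) (use N in \<open>auto simp: A_def pw_def indicator_def\<close>)
  also have "\<dots> = 1" by (subst ginibre_integral(1)[OF G N]) (simp_all add: det_mom_zero)
  finally have "prob A = 1" using A by (simp add: sets.Int_space_eq2)
  then have "AE \<omega> in M. \<omega> \<in> A" using A by (simp add: prob_eq_1)
  then show ?thesis by eventually_elim (simp add: A_def)
qed

text \<open>The exponent acts on the squared modulus of the determinant, which absorbs the factor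
  \<open>1 / 2\<close> of the normalisation; so \<open>s\<close> contains \<open>sqrt (ln N)\<close>
  and not half of it. Singular matrices, where \<open>pw\<close> and \<open>ln\<close> take default
  values, form a null event.\<close>

lemma char_normalized_log_det:
  fixes t :: real
  assumes G: "complex_ginibre N M G" and N: "N \<ge> 2"
  defines "s \<equiv> \<i> * of_real (t / sqrt (ln (real N)))"
  shows "char (distr M borel (\<lambda>\<omega>. normalized_log_det N z (G \<omega>))) t
    = exp (s * of_real (real N - real N * ln (real N))) * (exp (- (s * of_real (real N * (cmod z)\<^sup>2))) * imag_power.det_mom s (real N * (cmod z)\<^sup>2) (N - 1) (real N * (cmod z)\<^sup>2))"
    and "(\<lambda>\<omega>. normalized_log_det N z (G \<omega>)) \<in> borel_measurable M"
proof -
  interpret prob_space M using G by (simp add: complex_ginibre_def)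
  have N1: "N \<ge> 1" using N by simp
  have s: "Re s = 0" by (simp add: s_def)
  let ?d = "\<lambda>\<omega>. cmod (Determinant.det (G \<omega> - z \<cdot>\<^sub>m 1\<^sub>m N))"
  note [measurable] = ginibre_integral(2)[OF G N1 s, of z]
  show m[measurable]: "(\<lambda>\<omega>. normalized_log_det N z (G \<omega>)) \<in> borel_measurable M"
    unfolding normalized_log_det_def by measurable
  \<comment> \<open>The deterministic part of the exponent: the logarithm of the rescaling factor
    \<open>N ^ N\<close> together with the centring.\<close>
  define K where "K = exp (- (s * of_real (real N * ln (real N) + real N * ((cmod z)\<^sup>2 - 1))))"
  have "char (distr M borel (\<lambda>\<omega>. normalized_log_det N z (G \<omega>))) t = (\<integral>\<omega>. iexp (t * normalized_log_det N z (G \<omega>)) \<partial>M)"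
    unfolding char_def by (rule integral_distr) simp_all
  also have "\<dots> = (\<integral>\<omega>. pw s (real N ^ N * (?d \<omega>)\<^sup>2) * K \<partial>M)"
  proof (rule integral_cong_AE)
    show "AE \<omega> in M. iexp (t * normalized_log_det N z (G \<omega>)) = pw s (real N ^ N * (?d \<omega>)\<^sup>2) * K"
      using AE_det_nonzero[OF G N1, of z]
    proof eventually_elim
      case (elim \<omega>)
      then have d: "?d \<omega> > 0" by simp
      have l: "ln (real N ^ N * (?d \<omega>)\<^sup>2) = real N * ln (real N) + 2 * ln (?d \<omega>)"
        using N d by (simp add: ln_mult ln_realpow)
      have "pw s (real N ^ N * (?d \<omega>)\<^sup>2) = exp (s * of_real (real N * ln (real N) + 2 * ln (?d \<omega>)))"
        using N d unfolding pw_def l[symmetric] by simp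
      then have "pw s (real N ^ N * (?d \<omega>)\<^sup>2) * K = exp (s * of_real (2 * ln (?d \<omega>) - real N * ((cmod z)\<^sup>2 - 1)))"
        unfolding K_def by (simp add: exp_add[symmetric] algebra_simps)
      also have "s * of_real (2 * ln (?d \<omega>) - real N * ((cmod z)\<^sup>2 - 1)) = \<i> * of_real (t / sqrt (ln (real N)) * (2 * ln (?d \<omega>) - real N * ((cmod z)\<^sup>2 - 1)))"
        unfolding s_def by (simp only: of_real_mult mult.assoc)
      also have "t / sqrt (ln (real N)) * (2 * ln (?d \<omega>) - real N * ((cmod z)\<^sup>2 - 1)) = t * normalized_log_det N z (G \<omega>)"
        proof -
        have "a / r * (2 * l - m * y) = a * (1 / (1 / 2 * r) * (l - 1 / 2 * m * y))" for a r l m y :: real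
          by (cases "r = 0") (simp_all add: field_simps)
        then show ?thesis unfolding normalized_log_det_def .
      qed
      finally show ?case by simp
    qed
  qed (use m in measurable)
  also have "\<dots> = imag_power.det_mom s (real N * (cmod z)\<^sup>2) (N - 1) (real N * (cmod z)\<^sup>2) * K"
    unfolding integral_mult_left_zero ginibre_integral(1)[OF G N1 s] ..
  also have "K = exp (s * of_real (real N - real N * ln (real N))) * exp (- (s * of_real (real N * (cmod z)\<^sup>2)))"
    unfolding K_def exp_add[symmetric] by (rule arg_cong[where f = exp]) (simp add: algebra_simps)
  finally show "char (distr M borel (\<lambda>\<omega>. normalized_log_det N z (G \<omega>))) t
    = exp (s * of_real (real N - real N * ln (real N))) * (exp (- (s * of_real (real N * (cmod z)\<^sup>2))) * imag_power.det_mom s (real N * (cmod z)\<^sup>2) (N - 1) (real N * (cmod z)\<^sup>2))"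
    by (subst mult.assoc[symmetric], subst mult.commute)
qed

text \<open>The estimate \<open>N ^ N / N! \<le> exp N\<close> reduces the void bound to an
  exponential with rate \<open>x - 1 - ln x\<close>, which is the large deviation rate of a Poisson
  variable of mean \<open>N * x\<close> at level \<open>N\<close>.\<close>

lemma diagonal_error_bound:
  assumes x: "0 < x" and N: "N \<ge> 1"
  shows "(real N * x) ^ Suc (N - 1) * exp (- (real N * x)) / fact (N - 1) * (real N * x) \<le> x * (real N)\<^sup>2 * exp (- ((x - 1 - ln x) * real N))"
proof -
  have f: "fact N = real N * fact (N - 1)" using N by (cases N) simp_all
  have xN: "x ^ N = exp (real N * ln x)" using x by (simp add: exp_of_nat_mult)
  have "(real N * x) ^ Suc (N - 1) * exp (- (real N * x)) / fact (N - 1) * (real N * x) = x * (real N)\<^sup>2 * (x ^ N * exp (- (real N * x))) * (real N ^ N / fact N)"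
    using N unfolding f by (simp add: power_mult_distrib power2_eq_square)
  also have "\<dots> \<le> x * (real N)\<^sup>2 * (x ^ N * exp (- (real N * x))) * exp (real N)"
    by (intro mult_left_mono power_div_fact_le_exp) (use x in auto)
  also have "\<dots> = x * (real N)\<^sup>2 * exp (- ((x - 1 - ln x) * real N))"
    unfolding xN by (simp add: exp_add[symmetric] algebra_simps)
  finally show ?thesis .
qed

lemma det_mom_diagonal_limit:
  fixes t x :: real
  assumes x: "0 \<le> x" "x < 1"
  defines "s \<equiv> \<lambda>N::nat. \<i> * of_real (t / sqrt (ln (real N)))"
  shows "(\<lambda>N. norm (exp (- (s N * of_real (real N * x))) * imag_power.det_mom (s N) (real N * x) (N - 1) (real N * x) - imag_power.det_mom (s N) 0 (N - 1) 0)) \<longlonglongrightarrow> 0"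
proof (cases "x = 0")
  case True
  then show ?thesis by simp
next
  case False
  then have x0: "x > 0" using x by simp
  have ip: "imag_power (s N)" for N by unfold_locales (simp add: s_def)
  have ns: "norm (s N) = \<bar>t\<bar> / \<bar>sqrt (ln (real N))\<bar>" for N by (simp add: s_def norm_mult norm_divide)
  define c where "c = x - 1 - ln x"
  have c: "c > 0" using ln_le_minus_one[OF x0] ln_eq_minus_one[OF x0] x(2) by (auto simp: c_def less_le)
  show ?thesis
  proof (rule tendsto_sandwich[OF _ _ tendsto_const])
    show "\<forall>\<^sub>F N in sequentially. norm (exp (- (s N * of_real (real N * x))) * imag_power.det_mom (s N) (real N * x) (N - 1) (real N * x) - imag_power.det_mom (s N) 0 (N - 1) 0) \<le> \<bar>t\<bar> / \<bar>sqrt (ln (real N))\<bar> * (x * (real N)\<^sup>2 * exp (- (c * real N)))"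
    \<comment> \<open>From this threshold on \<open>N * x \<le> N - 1\<close>, the range in which
      the void bound is available. This is where \<open>x < 1\<close> enters, besides making the
      rate \<open>c\<close> positive.\<close>
    proof (rule eventually_sequentiallyI[of "max 1 (nat \<lceil>1 / (1 - x)\<rceil>)"])
      fix N assume "max 1 (nat \<lceil>1 / (1 - x)\<rceil>) \<le> N"
      then have N: "N \<ge> 1" "1 / (1 - x) \<le> real N" by (auto simp: nat_le_iff ceiling_le_iff)
      then have "real N * x \<le> real N - 1" using x(2) by (simp add: field_simps)
      then have le: "real N * x \<le> real (N - 1)" using N by (simp add: of_nat_diff)
      have p: "0 < real N * x" using x0 N by simp
      have "norm (exp (- (s N * of_real (real N * x))) * imag_power.det_mom (s N) (real N * x) (N - 1) (real N * x) - imag_power.det_mom (s N) 0 (N - 1) 0)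
        \<le> norm (s N) * ((real N * x) ^ Suc (N - 1) * exp (- (real N * x)) / fact (N - 1)) * (real N * x)"
        by (rule imag_power.det_mom_diagonal_approx[OF ip p le])
      also have "\<dots> = norm (s N) * ((real N * x) ^ Suc (N - 1) * exp (- (real N * x)) / fact (N - 1) * (real N * x))" by (simp only: mult.assoc)
      also have "\<dots> \<le> norm (s N) * (x * (real N)\<^sup>2 * exp (- (c * real N)))"
        unfolding c_def by (rule mult_left_mono[OF diagonal_error_bound[OF x0 N(1)] norm_ge_zero])
      finally show "norm (exp (- (s N * of_real (real N * x))) * imag_power.det_mom (s N) (real N * x) (N - 1) (real N * x) - imag_power.det_mom (s N) 0 (N - 1) 0) \<le> \<bar>t\<bar> / \<bar>sqrt (ln (real N))\<bar> * (x * (real N)\<^sup>2 * exp (- (c * real N)))"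
        unfolding ns .
    qed
    show "(\<lambda>N. \<bar>t\<bar> / \<bar>sqrt (ln (real N))\<bar> * (x * (real N)\<^sup>2 * exp (- (c * real N)))) \<longlonglongrightarrow> 0"
      using c by real_asymp
  qed simp
qed

lemma char_limit:
  assumes G: "\<And>N. N \<ge> 1 \<Longrightarrow> complex_ginibre N (M N) (G N)" and z: "cmod z < 1"
  shows "(\<lambda>N. char (distr (M N) borel (\<lambda>\<omega>. normalized_log_det N z (G N \<omega>))) t) \<longlonglongrightarrow> of_real (exp (- t\<^sup>2 / 2))"
proof -
  define x where "x = (cmod z)\<^sup>2"
  have x: "0 \<le> x" "x < 1" using z by (auto simp: x_def power_less_one_iff abs_square_less_1)
  define s where "s N = \<i> * complex_of_real (t / sqrt (ln (real N)))" for N :: nat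
  have ip: "imag_power (s N)" for N by unfold_locales (simp add: s_def)
  define E where "E N = exp (s N * of_real (real N - real N * ln (real N)))" for N
  define J where "J N = exp (- (s N * of_real (real N * x))) * imag_power.det_mom (s N) (real N * x) (N - 1) (real N * x)" for N
  define P where "P N = (\<Prod>k<N. Gamma (of_nat (Suc k) + s N) / fact k)" for N
  \<comment> \<open>The compensating factor is a pure phase, so it does not magnify the error
    between the two moments.\<close>
  have nE: "norm (E N) = 1" for N by (simp add: E_def s_def)
  have "(\<lambda>N. norm (J N - imag_power.det_mom (s N) 0 (N - 1) 0)) \<longlonglongrightarrow> 0"
    unfolding J_def s_def by (rule det_mom_diagonal_limit[OF x])
  then have "(\<lambda>N. norm (E N * (J N - imag_power.det_mom (s N) 0 (N - 1) 0))) \<longlonglongrightarrow> 0"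
    by (simp only: norm_mult nE mult_1)
  then have "(\<lambda>N. E N * (J N - imag_power.det_mom (s N) 0 (N - 1) 0)) \<longlonglongrightarrow> 0"
    by (rule tendsto_norm_zero_cancel)
  moreover have "(\<lambda>N. P N * E N) \<longlonglongrightarrow> of_real (exp (- t\<^sup>2 / 2))"
    unfolding P_def E_def s_def by (rule gamma_product_limit)
  ultimately have "(\<lambda>N. E N * (J N - imag_power.det_mom (s N) 0 (N - 1) 0) + P N * E N) \<longlonglongrightarrow> 0 + of_real (exp (- t\<^sup>2 / 2))"
    by (rule tendsto_add)
  moreover have "\<forall>\<^sub>F N in sequentially. E N * (J N - imag_power.det_mom (s N) 0 (N - 1) 0) + P N * E N = char (distr (M N) borel (\<lambda>\<omega>. normalized_log_det N z (G N \<omega>))) t"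
  proof (rule eventually_sequentiallyI[of 2])
    fix N :: nat assume N: "N \<ge> 2"
    have "{..N - 1} = {..<N}" using N by auto
    then have "imag_power.det_mom (s N) 0 (N - 1) 0 = P N" unfolding P_def imag_power.det_mom_0_0[OF ip] by simp
    moreover have "char (distr (M N) borel (\<lambda>\<omega>. normalized_log_det N z (G N \<omega>))) t = E N * J N"
      unfolding E_def J_def x_def s_def using N by (intro char_normalized_log_det(1) G) auto
    ultimately show "E N * (J N - imag_power.det_mom (s N) 0 (N - 1) 0) + P N * E N = char (distr (M N) borel (\<lambda>\<omega>. normalized_log_det N z (G N \<omega>))) t"
      by (simp add: algebra_simps)
  qed
  ultimately show ?thesis by (simp add: Lim_transform_eventually)
qed

theorem corollary1p2:
  fixes M :: "nat \<Rightarrow> 'a measure"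
    and G :: "nat \<Rightarrow> 'a \<Rightarrow> complex mat"
    and z :: complex
  assumes "\<And>N. N \<ge> 1 \<Longrightarrow> complex_ginibre N (M N) (G N)"
    and "cmod z < 1"
  shows "weak_conv_m (\<lambda>N. distr (M N) borel (\<lambda>\<omega>. normalized_log_det N z (G N \<omega>)))
           std_normal_distribution"
proof -
  \<comment> \<open>Levy's theorem asks for a probability distribution at every index, while
    \<open>N = 0\<close> is unconstrained and the characteristic function is computed from
    \<open>N = 2\<close> on. The normal law fills the first two places without affecting the
    limit.\<close>
  define \<mu> where "\<mu> N = (if N < 2 then std_normal_distribution else distr (M N) borel (\<lambda>\<omega>. normalized_log_det N z (G N \<omega>)))" for N
  have "weak_conv_m \<mu> std_normal_distribution"
  proof (rule levy_continuity)
    show "real_distribution std_normal_distribution" by (rule real_dist_normal_dist)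
    show "real_distribution (\<mu> N)" for N
    proof (cases "N < 2")
      case True
      then show ?thesis by (simp add: \<mu>_def real_dist_normal_dist)
    next
      case False
      then have "complex_ginibre N (M N) (G N)" "N \<ge> 2" by (auto intro: assms(1))
      then show ?thesis using char_normalized_log_det(2)[of N "M N" "G N" z]
        by (simp add: \<mu>_def complex_ginibre_def prob_space.real_distribution_distr)
    qed
    fix t
    have "(\<lambda>N. char (distr (M N) borel (\<lambda>\<omega>. normalized_log_det N z (G N \<omega>))) t) \<longlonglongrightarrow> of_real (exp (- t\<^sup>2 / 2))"
      by (rule char_limit[OF assms])
    moreover have "\<forall>\<^sub>F N in sequentially. char (distr (M N) borel (\<lambda>\<omega>. normalized_log_det N z (G N \<omega>))) t = char (\<mu> N) t"
      by (rule eventually_sequentiallyI[of 2]) (simp add: \<mu>_def)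
    ultimately show "(\<lambda>N. char (\<mu> N) t) \<longlonglongrightarrow> char std_normal_distribution t"
      unfolding char_std_normal_distribution by (rule Lim_transform_eventually)
  qed
  then have "(\<lambda>N. cdf (\<mu> N) x) \<longlonglongrightarrow> cdf std_normal_distribution x" if "isCont (cdf std_normal_distribution) x" for x
    using that by (simp add: weak_conv_m_def weak_conv_def)
  moreover have "\<forall>\<^sub>F N in sequentially. cdf (\<mu> N) x = cdf (distr (M N) borel (\<lambda>\<omega>. normalized_log_det N z (G N \<omega>))) x" for x
    by (rule eventually_sequentiallyI[of 2]) (simp add: \<mu>_def)
  ultimately show ?thesis
    unfolding weak_conv_m_def weak_conv_def by (intro allI impI) (rule Lim_transform_eventually)
qed

end
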